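(* Let $\mathcal L$ be an $L_\infty$ algebroid on an affine manifold $U$. The normalized complex of closed $p$-forms $(\Omega^p_{\mathrm{cl}}([U/\mathcal L]),\delta_{\mathrm{Tw}})$ is, indeed, a complex, i.e. $\delta_{\mathrm{Tw}}^2=0$. Moreover, there is a canonical homotopy equivalence \[ \Omega^{\ge p}([U/\mathcal L])\cong\Omega^p_{\mathrm{cl}}([U/\mathcal L]) \] compatible with the projections to $\Omega^{\ge p}(U)$.
   Context: An affine manifold $U$ is a real $C^\infty$ manifold, a Stein manifold, or a smooth affine variety over a field of characteristic zero; $\mathbb K$ is the base field. Vector bundles on $U$ are identified with finite rank projective $\mathcal O(U)$-modules of sections; $\mathcal T_U$ is the tangent bundle. An $L_\infty$ algebroid on $U$ is a bounded complex of finite rank vector bundles $\mathcal L=(\cdots\to\mathcal L_1\to\mathcal L_0)$, $\mathcal L_i$ in degree $-i$, with an $L_\infty$ algebra structure over $\mathbb K$ (unary bracket the differential) whose binary bracket is $\mathbb K$-bilinear of degree $0$ and whose $n$-ary brackets for $n>2$ are $\mathcal O(U)$-multilinear of degree $2-n$, and an $\mathcal O(U)$-linear morphism of complexes $a\colon\mathcal L\to\mathcal T_U$ (the anchor) with $[x,fy]=(\mathscr L_{ax}f)y+f[x,y]$. Its Chevalley–Eilenberg algebra is the cdga $\mathcal O([U/\mathcal L])=(\mathrm{Sym}_{\mathcal O(U)}(\mathcal L^\vee[-1]),\delta)$, with $\delta$ the Chevalley–Eilenberg differential of $\mathcal L$ with coefficients in $\mathcal O(U)$, restricted to $\mathcal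 O(U)$-multilinear cochains. $\mathcal T_{[U/\mathcal L]}$ is the dg module of graded derivations of $\mathcal O([U/\mathcal L])$, $\mathcal T^\vee_{[U/\mathcal L]}$ its dual module of Kähler differentials, and $\Omega^{p,q}([U/\mathcal L])$ is the degree-$q$ part of $\wedge^p\mathcal T^\vee_{[U/\mathcal L]}$, so $\Omega^{p,0}([U/\mathcal L])=\Omega^p(U)$. It carries the internal differential $\delta$ of bidegree $(0,1)$ and the de Rham differential $\mathrm d$ of bidegree $(1,0)$, with signs such that $\mathrm d\delta=-\delta\mathrm d$. $\Omega^{\ge p}([U/\mathcal L])$ is the total complex of $\Omega^{p,\bullet}\xrightarrow{\mathrm d}\Omega^{p+1,\bullet}\xrightarrow{\mathrm d}\cdots$ with differential $\delta+\mathrm d$; $\Omega^{\ge p}(U)$ is the truncated de Rham complex of $U$. The projection $\Omega^{\ge p}([U/\mathcal L])\to\Omega^{\ge p}(U)$ is induced by $\Omega^{j,\bullet}([U/\mathcal L])\to\Omega^{j,0}([U/\mathcal L])=\Omega^j(U)$ (pullback of forms along $U\to[U/\mathcal L]$). Let $\xi$ be the Euler derivation, multiplying a homogeneous element of $\mathcal O([U/\mathcal L])$ by its degree, and let $h\colon\Omega^{\bullet,\bullet}([U/\mathcal L])\to\Omega^{\bullet-1,\bullet}([U/\mathcal L])$ be $h(\omega)=\tfrac1q\iota_\xi\omega$ for $\omega\in\Omega^{\bullet,q}$ with $q>0$, and $h=0$ on $\Omega^{\bullet,0}=\Omega^\bullet(U)$. The complex of potentials is $\mathrm{Pot}^{p-1,\bullet}([U/\mathcal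 L])=\mathrm{img}\,h\subset\Omega^{p-1,\bullet}([U/\mathcal L])$ with differential $\delta_{\mathrm{Pot}}=h\delta\mathrm d=-h\mathrm d\delta=(\mathrm dh-1)\delta$. The twisting map $\mathrm{Tw}\colon\Omega^{\ge p}(U)\to\mathrm{Pot}^{p-1}([U/\mathcal L])[1]$ sends $G\in\Omega^{p+q}(U)$ to its contraction $\mathrm{Tw}\,G=\iota_{\wedge^{q+1}a}G\in\wedge^{q+1}\mathcal L_0^\vee\otimes\Omega^{p-1}(U)$ with the exterior power $\wedge^{q+1}a$ of the anchor $a\in\mathcal L_0^\vee\otimes\mathcal T_U$ (Koszul sign conventions), viewed as a $(p-1)$-form on $[U/\mathcal L]$ with coefficients in $\wedge^{q+1}\mathcal L_0^\vee\subset\mathcal O([U/\mathcal L])$. The normalized complex is $\Omega^p_{\mathrm{cl}}([U/\mathcal L])=\mathrm{Pot}^{p-1}([U/\mathcal L])\oplus\Omega^{\ge p}(U)$, graded so that $\mathrm{Pot}^{p-1,q}$ and $\Omega^{p+q}(U)$ both have degree $p+q$, with \[ \delta_{\mathrm{Tw}}=\begin{pmatrix}\delta_{\mathrm{Pot}}&\mathrm{Tw}\\0&\mathrm d\end{pmatrix}, \] and its projection to $\Omega^{\ge p}(U)$ is onto the second summand. *)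

theory Defs
  imports
    "HOL-Analysis.Analysis"
    "HOL-Library.Function_Algebras"
    "HOL-Library.Product_Plus"
    "HOL-Library.Poly_Mapping"
begin

section \<open>Affine manifolds\<close>

subsection \<open>Manifolds over the reals and over the complex numbers\<close>

text \<open>The subspace of sequences supported on the first \<open>n\<close> entries is the model space of
  dimension \<open>n\<close>; this allows \<open>n\<close> to be a number, including 0.\<close>

definition coord_space :: "nat \<Rightarrow> (nat \<Rightarrow> 'f::real_normed_field) topology" where
  "coord_space n = top_of_set {x. \<forall>i\<ge>n. x i = 0}"

text \<open>Continuous functions all of whose iterated partial derivatives exist and are continuous.
  Over the reals these are the smooth functions; over the complex numbers they are the
  holomorphic functions (continuous and holomorphic in each variable).\<close>

coinductive smooth_on ::
  "nat \<Rightarrow> (nat \<Rightarrow> 'f::real_normed_field) set \<Rightarrow> ((nat \<Rightarrow> 'f) \<Rightarrow> 'f) \<Rightarrow> bool" for n W where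
  "continuous_on W f \<Longrightarrow>
   \<forall>i<n. \<exists>g. (\<forall>x\<in>W. ((\<lambda>t. f (x(i := t))) has_field_derivative g x) (at (x i))) \<and> smooth_on n W g
   \<Longrightarrow> smooth_on n W f"

definition manifold_atlas ::
  "nat \<Rightarrow> 'm topology \<Rightarrow> ('m set \<times> ('m \<Rightarrow> nat \<Rightarrow> 'f::real_normed_field)) set \<Rightarrow> bool" where
  "manifold_atlas n X \<A> \<longleftrightarrow>
     Hausdorff_space X \<and> second_countable X \<and> \<Union> (fst ` \<A>) = topspace X \<and>
     (\<forall>(V, u)\<in>\<A>. openin X V \<and> openin (coord_space n) (u ` V) \<and>
        homeomorphic_map (subtopology X V) (subtopology (coord_space n) (u ` V)) u) \<and>
     (\<forall>(V, u)\<in>\<A>. \<forall>(W, v)\<in>\<A>. \<forall>i<n. smooth_on n (u ` (V \<inter> W)) (\<lambda>z. v (inv_into V u z) i))"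

text \<open>Functions are extended by 0 outside the manifold.\<close>

definition manifold_functions ::
  "nat \<Rightarrow> 'm topology \<Rightarrow> ('m set \<times> ('m \<Rightarrow> nat \<Rightarrow> 'f::real_normed_field)) set \<Rightarrow> ('m \<Rightarrow> 'f) set" where
  "manifold_functions n X \<A> =
     {f. (\<forall>x. x \<notin> topspace X \<longrightarrow> f x = 0) \<and>
         (\<forall>(V, u)\<in>\<A>. smooth_on n (u ` V) (\<lambda>z. f (inv_into V u z)))}"

definition stein_atlas ::
  "nat \<Rightarrow> 'm topology \<Rightarrow> ('m set \<times> ('m \<Rightarrow> nat \<Rightarrow> complex)) set \<Rightarrow> bool" where
  "stein_atlas n X \<A> \<longleftrightarrow>
     manifold_atlas n X \<A> \<and>
     (\<forall>K. compactin X K \<longrightarrow>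
        compactin X {x \<in> topspace X. \<forall>f\<in>manifold_functions n X \<A>. \<exists>y\<in>K. norm (f x) \<le> norm (f y)}) \<and>
     (\<forall>x\<in>topspace X. \<forall>y\<in>topspace X. x \<noteq> y \<longrightarrow> (\<exists>f\<in>manifold_functions n X \<A>. f x \<noteq> f y))"

text \<open>The algebra \<open>'a\<close> over \<open>'k\<close> (with structure map \<open>\<eta>\<close>) is identified with
  the algebra \<open>F\<close> of functions on \<open>M\<close>, and \<open>'k\<close> with the field of constants \<open>'f\<close>.\<close>

definition is_function_algebra ::
  "('k::field_char_0 \<Rightarrow> 'a::comm_ring_1) \<Rightarrow> 'm set \<Rightarrow> ('m \<Rightarrow> 'f::real_normed_field) set \<Rightarrow> bool" where
  "is_function_algebra \<eta> M F \<longleftrightarrow>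
     (\<exists>\<rho> \<Phi>. bij \<rho> \<and> (\<forall>r s. \<rho> (r + s) = \<rho> r + \<rho> s \<and> \<rho> (r * s) = \<rho> r * \<rho> s) \<and>
        bij_betw \<Phi> UNIV F \<and>
        (\<forall>a b x. \<Phi> (a + b) x = \<Phi> a x + \<Phi> b x \<and> \<Phi> (a * b) x = \<Phi> a x * \<Phi> b x) \<and>
        (\<forall>r. \<Phi> (\<eta> r) = (\<lambda>x. if x \<in> M then \<rho> r else 0)))"

subsection \<open>Smooth affine varieties\<close>

type_synonym 'k mpoly = "(nat \<Rightarrow>\<^sub>0 nat) \<Rightarrow>\<^sub>0 'k"

definition polys :: "nat \<Rightarrow> 'k::field_char_0 mpoly set" where
  "polys N = {g. \<forall>m\<in>Poly_Mapping.keys g. Poly_Mapping.keys m \<subseteq> {..<N}}"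

definition poly_eval ::
  "('k::field_char_0 \<Rightarrow> 'a::comm_ring_1) \<Rightarrow> nat \<Rightarrow> (nat \<Rightarrow> 'a) \<Rightarrow> 'k mpoly \<Rightarrow> 'a" where
  "poly_eval \<eta> N x g =
     (\<Sum>m\<in>Poly_Mapping.keys g. \<eta> (Poly_Mapping.lookup g m) * (\<Prod>i<N. x i ^ Poly_Mapping.lookup m i))"

definition poly_partial :: "nat \<Rightarrow> 'k::field_char_0 mpoly \<Rightarrow> 'k mpoly" where
  "poly_partial j g =
     (\<Sum>m\<in>Poly_Mapping.keys g.
        Poly_Mapping.single (m - Poly_Mapping.single j 1)
          (of_nat (Poly_Mapping.lookup m j) * Poly_Mapping.lookup g m))"

definition prime_ideal :: "'a::comm_ring_1 set \<Rightarrow> bool" where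
  "prime_ideal P \<longleftrightarrow> 0 \<in> P \<and> 1 \<notin> P \<and> (\<forall>a\<in>P. \<forall>b\<in>P. a + b \<in> P) \<and> (\<forall>a b. b \<in> P \<longrightarrow> a * b \<in> P) \<and>
     (\<forall>a b. a * b \<in> P \<longrightarrow> a \<in> P \<or> b \<in> P)"

text \<open>Smoothness by the Jacobian condition: for a presentation \<open>'k[x\<^sub>0,\<dots>,x\<^sub>N\<^sub>-\<^sub>1]/I\<close> of the algebra,
  near every point \<open>P\<close> the ideal \<open>I\<close> is generated by equations whose differentials are linearly
  independent over the residue field of \<open>P\<close>.\<close>

definition smooth_affine_variety :: "('k::field_char_0 \<Rightarrow> 'a::comm_ring_1) \<Rightarrow> bool" where
  "smooth_affine_variety \<eta> \<longleftrightarrow>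
     (\<exists>N x. poly_eval \<eta> N x ` polys N = UNIV \<and>
       (let ev = poly_eval \<eta> N x; I = {f \<in> polys N. ev f = 0} in
        \<forall>P. prime_ideal P \<longrightarrow>
          (\<exists>c (g :: nat \<Rightarrow> 'k mpoly). (\<forall>i<c. g i \<in> I) \<and>
             (\<forall>f\<in>I. \<exists>s\<in>polys N. ev s \<notin> P \<and>
                (\<exists>u. (\<forall>i<c. u i \<in> polys N) \<and> s * f = (\<Sum>i<c. u i * g i))) \<and>
             (\<forall>u. (\<forall>j<N. (\<Sum>i<c. u i * ev (poly_partial j (g i))) \<in> P) \<longrightarrow> (\<forall>i<c. u i \<in> P)))))"

subsection \<open>The three cases\<close>

definition algebra_map :: "('k::field_char_0 \<Rightarrow> 'a::comm_ring_1) \<Rightarrow> bool" where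
  "algebra_map \<eta> \<longleftrightarrow>
     \<eta> 1 = 1 \<and> (\<forall>r s. \<eta> (r + s) = \<eta> r + \<eta> s) \<and> (\<forall>r s. \<eta> (r * s) = \<eta> r * \<eta> s)"

text \<open>An affine manifold \<open>U\<close> is given through its algebra of functions \<open>\<O>(U)\<close>, which is the
  type \<open>'a\<close>, and the structure map \<open>\<eta>\<close> from the base field \<open>'k\<close>; the type \<open>'m\<close> provides
  the points in the first two cases.\<close>

definition affine_manifold ::
  "'m itself \<Rightarrow> ('k::field_char_0 \<Rightarrow> 'a::comm_ring_1) \<Rightarrow> bool" where
  "affine_manifold _ \<eta> \<longleftrightarrow> algebra_map \<eta> \<and>
     ((\<exists>n (X :: 'm topology) (\<A> :: ('m set \<times> ('m \<Rightarrow> nat \<Rightarrow> real)) set).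
         manifold_atlas n X \<A> \<and> is_function_algebra \<eta> (topspace X) (manifold_functions n X \<A>)) \<or>
      (\<exists>n (X :: 'm topology) (\<A> :: ('m set \<times> ('m \<Rightarrow> nat \<Rightarrow> complex)) set).
         stein_atlas n X \<A> \<and> is_function_algebra \<eta> (topspace X) (manifold_functions n X \<A>)) \<or>
      smooth_affine_variety \<eta>)"


section \<open>Differential forms on a graded commutative algebra\<close>

definition sg :: "int \<Rightarrow> 'v::ab_group_add \<Rightarrow> 'v" where
  "sg k v = (if even k then v else - v)"

text \<open>A graded commutative algebra over \<open>'k\<close>; elements of all degrees live in one ambient
  type \<open>'c\<close>, and only the homogeneous parts in degrees \<open>\<ge> 0\<close> may be nonzero.\<close>

record ('k, 'c) galg =
  part :: "int \<Rightarrow> 'c set"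
  gmul :: "'c \<Rightarrow> 'c \<Rightarrow> 'c"
  gscale :: "'k \<Rightarrow> 'c \<Rightarrow> 'c"

definition all_parts :: "('k, 'c::ab_group_add) galg \<Rightarrow> 'c set" where
  "all_parts B = {x. \<exists>N c. (\<forall>i<N. c i \<in> part B (int i)) \<and> x = (\<Sum>i<N. c i)}"

text \<open>Graded derivations of degree \<open>k\<close>, set to 0 outside the algebra.\<close>

definition ders :: "('k, 'c::ab_group_add) galg \<Rightarrow> int \<Rightarrow> ('c \<Rightarrow> 'c) set" where
  "ders B k = {D.
     (\<forall>i. \<forall>c\<in>part B i. D c \<in> part B (i + k)) \<and>
     (\<forall>c\<in>all_parts B. \<forall>c'\<in>all_parts B. D (c + c') = D c + D c') \<and>
     (\<forall>r. \<forall>c\<in>all_parts B. D (gscale B r c) = gscale B r (D c)) \<and>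
     (\<forall>i. \<forall>c\<in>part B i. \<forall>c'\<in>all_parts B.
        D (gmul B c c') = gmul B (D c) c' + sg (k * i) (gmul B c (D c'))) \<and>
     (\<forall>c. c \<notin> all_parts B \<longrightarrow> D c = 0)}"

text \<open>Homogeneous derivations are tagged with their degree.\<close>

type_synonym 'c der = "int \<times> ('c \<Rightarrow> 'c)"

type_synonym 'c form = "'c der list \<Rightarrow> 'c"

definition der_lists :: "('k, 'c::ab_group_add) galg \<Rightarrow> 'c der list set" where
  "der_lists B = {Xs. \<forall>(k, D)\<in>set Xs. D \<in> ders B k}"

definition der_bracket :: "'c::ab_group_add der \<Rightarrow> 'c der \<Rightarrow> 'c der" where
  "der_bracket X Y =
     (fst X + fst Y, \<lambda>c. snd X (snd Y c) - sg (fst X * fst Y) (snd Y (snd X c)))"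

definition tot_deg :: "'c der list \<Rightarrow> int" where
  "tot_deg Xs = (\<Sum>X\<leftarrow>Xs. fst X)"

definition shifted_deg :: "(int \<times> 'd) list \<Rightarrow> int" where
  "shifted_deg Xs = (\<Sum>X\<leftarrow>Xs. fst X - 1)"

text \<open>The elements of the exterior power of the dual of the module of derivations, of form degree
  \<open>p\<close> and internal degree \<open>q\<close>, as graded alternating multilinear functions of \<open>p\<close> derivations.
  The sign conventions are those of the total degree: the contraction \<open>\<iota>\<^sub>X\<close> is a derivation of
  degree \<open>|X| - 1\<close>, \<open>\<omega> [X\<^sub>1,\<dots>,X\<^sub>p] = \<iota>\<^bsub>X\<^sub>p\<^esub> \<cdots> \<iota>\<^bsub>X\<^sub>1\<^esub> \<omega>\<close> and \<open>\<iota>\<^bsub>fX\<^esub> = f \<iota>\<^sub>X\<close>.\<close>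

definition forms :: "('k, 'c::ab_group_add) galg \<Rightarrow> nat \<Rightarrow> nat \<Rightarrow> 'c form set" where
  "forms B p q = {\<omega>.
     (\<forall>Xs. Xs \<notin> der_lists B \<or> length Xs \<noteq> p \<longrightarrow> \<omega> Xs = 0) \<and>
     (\<forall>Xs\<in>der_lists B. length Xs = p \<longrightarrow> \<omega> Xs \<in> part B (int q + tot_deg Xs)) \<and>
     (\<forall>Xs X Y Ys. Xs @ [X, Y] @ Ys \<in> der_lists B \<longrightarrow>
        \<omega> (Xs @ [X, Y] @ Ys) = sg ((fst X - 1) * (fst Y - 1)) (\<omega> (Xs @ [Y, X] @ Ys))) \<and>
     (\<forall>k D D' Xs. D \<in> ders B k \<longrightarrow> D' \<in> ders B k \<longrightarrow> Xs \<in> der_lists B \<longrightarrow>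
        \<omega> ((k, \<lambda>c. D c + D' c) # Xs) = \<omega> ((k, D) # Xs) + \<omega> ((k, D') # Xs)) \<and>
     (\<forall>i f k D Xs. f \<in> part B i \<longrightarrow> D \<in> ders B k \<longrightarrow> Xs \<in> der_lists B \<longrightarrow>
        \<omega> ((i + k, \<lambda>c. gmul B f (D c)) # Xs) = sg (i * shifted_deg Xs) (gmul B f (\<omega> ((k, D) # Xs))))}"

definition form_scale :: "('k, 'c) galg \<Rightarrow> 'k \<Rightarrow> 'c form \<Rightarrow> 'c form" where
  "form_scale B r \<omega> = (\<lambda>Xs. gscale B r (\<omega> Xs))"

definition contract :: "'c der \<Rightarrow> 'c form \<Rightarrow> 'c form" where
  "contract X \<omega> = (\<lambda>Xs. \<omega> (X # Xs))"

text \<open>The Lie derivative, determined by \<open>L\<^sub>X c = X c\<close> on functions and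
  \<open>[L\<^sub>X, \<iota>\<^sub>Y] = \<iota>\<^bsub>[X,Y]\<^esub>\<close>, and the de Rham differential, determined by
  \<open>L\<^sub>X = [\<iota>\<^sub>X, d]\<close>. All brackets are graded commutators.\<close>

fun lie_at :: "'c::ab_group_add der \<Rightarrow> 'c form \<Rightarrow> 'c der list \<Rightarrow> 'c" where
  "lie_at X \<omega> [] = snd X (\<omega> [])"
| "lie_at X \<omega> (Y # Ys) =
     sg (fst X * (fst Y - 1)) (lie_at X (contract Y \<omega>) Ys - \<omega> (der_bracket X Y # Ys))"

fun de_rham_at :: "'c::ab_group_add form \<Rightarrow> 'c der list \<Rightarrow> 'c" where
  "de_rham_at \<omega> [] = 0"
| "de_rham_at \<omega> (X # Xs) = lie_at X \<omega> Xs - sg (fst X) (de_rham_at (contract X \<omega>) Xs)"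

definition lie :: "('k, 'c::ab_group_add) galg \<Rightarrow> 'c der \<Rightarrow> 'c form \<Rightarrow> 'c form" where
  "lie B X \<omega> = (\<lambda>Xs. if Xs \<in> der_lists B then lie_at X \<omega> Xs else 0)"

definition de_rham :: "('k, 'c::ab_group_add) galg \<Rightarrow> 'c form \<Rightarrow> 'c form" where
  "de_rham B \<omega> = (\<lambda>Xs. if Xs \<in> der_lists B then de_rham_at \<omega> Xs else 0)"


section \<open>L-infinity algebroids\<close>

text \<open>\<open>sections E i\<close> is the module of sections of the vector bundle in degree \<open>- i\<close>. Homogeneous sections are
  tagged: the pair \<open>(i, x)\<close> stands for \<open>x \<in> sections E i\<close>. The n-ary bracket is \<open>brk E\<close>
  on lists of length \<open>n\<close>, and \<open>anchor E\<close> is the degree 0 component of the anchor.\<close>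

record ('k, 'a, 'l) linfty =
  base :: "'k \<Rightarrow> 'a"
  act :: "'a \<Rightarrow> 'l \<Rightarrow> 'l"
  sections :: "nat \<Rightarrow> 'l set"
  brk :: "(nat \<times> 'l) list \<Rightarrow> 'l"
  anchor :: "'l \<Rightarrow> 'a \<Rightarrow> 'a"

subsection \<open>The base, as a graded algebra concentrated in degree 0\<close>

definition base_alg :: "('k, 'a::comm_ring_1, 'l) linfty \<Rightarrow> ('k, 'a) galg" where
  "base_alg E = \<lparr>part = (\<lambda>i. if i = 0 then UNIV else {0}), gmul = (*), gscale = (\<lambda>r a. base E r * a)\<rparr>"

text \<open>Vector fields are the derivations of \<open>\<O>(U)\<close>, and differential forms on \<open>U\<close> are the
  alternating \<open>\<O>(U)\<close>-multilinear functions of vector fields.\<close>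

abbreviation vector_fields :: "('k, 'a::comm_ring_1, 'l) linfty \<Rightarrow> ('a \<Rightarrow> 'a) set" where
  "vector_fields E \<equiv> ders (base_alg E) 0"

abbreviation base_forms :: "('k, 'a::comm_ring_1, 'l) linfty \<Rightarrow> nat \<Rightarrow> 'a form set" where
  "base_forms E p \<equiv> forms (base_alg E) p 0"

subsection \<open>Signs of unshuffles\<close>

text \<open>A subset \<open>S\<close> of positions describes the unshuffle moving the entries at \<open>S\<close> to the front;
  \<open>koszul ds S\<close> is the exponent of its Koszul sign for entries of degrees \<open>ds\<close>, and the parity of the
  number of crossings is its signature.\<close>

definition crossings :: "nat \<Rightarrow> nat set \<Rightarrow> (nat \<times> nat) set" where
  "crossings n S = {(j, k). j < k \<and> k < n \<and> j \<notin> S \<and> k \<in> S}"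

definition koszul :: "nat list \<Rightarrow> nat set \<Rightarrow> nat" where
  "koszul ds S = (\<Sum>(j, k)\<in>crossings (length ds) S. ds ! j * ds ! k)"

definition sec_lists :: "('k, 'a, 'l) linfty \<Rightarrow> (nat \<times> 'l) list set" where
  "sec_lists E = {ys. \<forall>(i, x)\<in>set ys. x \<in> sections E i}"

text \<open>The n-ary bracket has degree \<open>2 - n\<close>. When the truncated subtraction is effective, the list
  consists of a single section of degree 0, whose bracket vanishes.\<close>

definition out_index :: "(nat \<times> 'l) list \<Rightarrow> nat" where
  "out_index ys = (\<Sum>y\<leftarrow>ys. fst y) + length ys - 2"

definition brk_tagged :: "('k, 'a, 'l) linfty \<Rightarrow> (nat \<times> 'l) list \<Rightarrow> nat \<times> 'l" where
  "brk_tagged E ys = (out_index ys, brk E ys)"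

definition anc :: "('k, 'a::zero, 'l) linfty \<Rightarrow> nat \<times> 'l \<Rightarrow> 'a \<Rightarrow> 'a" where
  "anc E y = (if fst y = 0 then anchor E (snd y) else (\<lambda>_. 0))"

subsection \<open>Definition of L-infinity algebroids\<close>

text \<open>Projective modules of finite rank: direct summands of a free module \<open>'a ^ n\<close>, the inclusion
  being \<open>x \<mapsto> (\<phi> j x)\<^sub>j\<close> and the projection sending the standard basis to \<open>e\<close>.\<close>

definition fg_projective :: "('a::comm_ring_1 \<Rightarrow> 'l::ab_group_add \<Rightarrow> 'l) \<Rightarrow> 'l set \<Rightarrow> bool" where
  "fg_projective s M \<longleftrightarrow> module.subspace s M \<and>
     (\<exists>(n::nat) e \<phi>. (\<forall>j<n. e j \<in> M) \<and>
        (\<forall>j<n. \<forall>f. \<forall>x\<in>M. \<forall>y\<in>M. \<phi> j (s f x + y) = f * \<phi> j x + \<phi> j y) \<and>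
        (\<forall>x\<in>M. x = (\<Sum>j<n. s (\<phi> j x) (e j))))"

text \<open>The generalized Jacobi identities are
  \<open>\<Sum> (-1)^(i (n - i)) \<chi> \<ell>(\<ell>(y\<^bsub>\<sigma> 1\<^esub>,\<dots>,y\<^bsub>\<sigma> i\<^esub>),y\<^bsub>\<sigma> (i+1)\<^esub>,\<dots>,y\<^bsub>\<sigma> n\<^esub>) = 0\<close>, where the sum is over all
  \<open>i \<ge> 1\<close> and all \<open>(i, n - i)\<close>-unshuffles, and \<open>\<chi>\<close> is the signature times the Koszul sign.\<close>

definition linfty_algebroid ::
  "('k::field_char_0, 'a::comm_ring_1, 'l::ab_group_add) linfty \<Rightarrow> bool" where
  "linfty_algebroid E \<longleftrightarrow>
     algebra_map (base E) \<and> module (act E) \<and>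
     (\<forall>i. fg_projective (act E) (sections E i)) \<and> (\<exists>N. \<forall>i>N. sections E i = {0}) \<and>
     (\<forall>ys\<in>sec_lists E. ys \<noteq> [] \<longrightarrow> brk E ys \<in> sections E (out_index ys)) \<and>
     (\<forall>x\<in>sections E 0. brk E [(0, x)] = 0) \<and>
     (\<forall>us y z vs. us @ [y, z] @ vs \<in> sec_lists E \<longrightarrow>
        brk E (us @ [y, z] @ vs) = - sg (int (fst y * fst z)) (brk E (us @ [z, y] @ vs))) \<and>
     (\<forall>i x x' vs. (i, x) # (i, x') # vs \<in> sec_lists E \<longrightarrow>
        brk E ((i, x + x') # vs) = brk E ((i, x) # vs) + brk E ((i, x') # vs)) \<and>
     (\<forall>r i x vs. (i, x) # vs \<in> sec_lists E \<longrightarrow>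
        brk E ((i, act E (base E r) x) # vs) = act E (base E r) (brk E ((i, x) # vs))) \<and>
     (\<forall>f i x vs. (i, x) # vs \<in> sec_lists E \<longrightarrow> length vs \<noteq> 1 \<longrightarrow>
        brk E ((i, act E f x) # vs) = act E f (brk E ((i, x) # vs))) \<and>
     (\<forall>ys\<in>sec_lists E. ys \<noteq> [] \<longrightarrow>
        (\<Sum>S\<in>Pow {..<length ys} - {{}}.
           sg (int (koszul (map fst ys) S + card (crossings (length ys) S) + card S * (length ys - card S)))
             (brk E (brk_tagged E (nths ys S) # nths ys (- S)))) = 0) \<and>
     (\<forall>x\<in>sections E 0. anchor E x \<in> vector_fields E) \<and>
     (\<forall>f g. \<forall>x\<in>sections E 0. \<forall>y\<in>sections E 0.
        anchor E (act E f x + y) g = f * anchor E x g + anchor E y g) \<and>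
     (\<forall>x\<in>sections E 1. \<forall>g. anchor E (brk E [(1, x)]) g = 0) \<and>
     (\<forall>f y i z. [y, (i, z)] \<in> sec_lists E \<longrightarrow>
        brk E [y, (i, act E f z)] = act E (anc E y f) z + act E f (brk E [y, (i, z)]))"


section \<open>The Chevalley--Eilenberg algebra\<close>

text \<open>A cochain is a graded symmetric \<open>\<O>(U)\<close>-multilinear function on the shift \<open>\<L>[1]\<close>, in which a
  section of \<open>sections E i\<close> has degree \<open>- (i + 1)\<close>; this is the symmetric algebra on \<open>\<L>\<^sup>\<or>[-1]\<close>. The
  product is dual to the unshuffle coproduct.\<close>

type_synonym ('a, 'l) cochain = "(nat \<times> 'l) list \<Rightarrow> 'a"

definition sec_degs :: "(nat \<times> 'l) list \<Rightarrow> nat list" where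
  "sec_degs ys = map (\<lambda>y. fst y + 1) ys"

definition cochains ::
  "('k, 'a::comm_ring_1, 'l::ab_group_add) linfty \<Rightarrow> int \<Rightarrow> ('a, 'l) cochain set" where
  "cochains E q = {c.
     (\<forall>ys. ys \<notin> sec_lists E \<or> int (sum_list (sec_degs ys)) \<noteq> q \<longrightarrow> c ys = 0) \<and>
     (\<forall>us y z vs. us @ [y, z] @ vs \<in> sec_lists E \<longrightarrow>
        c (us @ [y, z] @ vs) = sg (int ((fst y + 1) * (fst z + 1))) (c (us @ [z, y] @ vs))) \<and>
     (\<forall>f i x x' vs. (i, x) # (i, x') # vs \<in> sec_lists E \<longrightarrow>
        c ((i, act E f x + x') # vs) = f * c ((i, x) # vs) + c ((i, x') # vs))}"

definition cochain_mult :: "('a::comm_ring_1, 'l) cochain \<Rightarrow> ('a, 'l) cochain \<Rightarrow> ('a, 'l) cochain" where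
  "cochain_mult c c' = (\<lambda>ys. \<Sum>S\<in>Pow {..<length ys}.
     sg (int (koszul (sec_degs ys) S)) (c (nths ys S) * c' (nths ys (- S))))"

definition ce_alg ::
  "('k, 'a::comm_ring_1, 'l::ab_group_add) linfty \<Rightarrow> ('k, ('a, 'l) cochain) galg" where
  "ce_alg E = \<lparr>part = cochains E, gmul = cochain_mult, gscale = (\<lambda>r c ys. base E r * c ys)\<rparr>"

text \<open>The sign passing from the antisymmetric brackets on \<open>\<L>\<close> to symmetric brackets of degree 1
  on \<open>\<L>[1]\<close>.\<close>

definition decalage :: "(nat \<times> 'l) list \<Rightarrow> nat" where
  "decalage ys = (\<Sum>j<length ys. (length ys - 1 - j) * fst (ys ! j))"

definition ce_at ::
  "('k, 'a::comm_ring_1, 'l) linfty \<Rightarrow> ('a, 'l) cochain \<Rightarrow> (nat \<times> 'l) list \<Rightarrow> 'a" where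
  "ce_at E c ys =
     (\<Sum>j<length ys. sg (int (koszul (sec_degs ys) {j})) (anc E (ys ! j) (c (nths ys (- {j}))))) -
     (\<Sum>S\<in>Pow {..<length ys} - {{}}. sg (int (koszul (sec_degs ys) S + decalage (nths ys S)))
        (c (brk_tagged E (nths ys S) # nths ys (- S))))"

definition ce_diff ::
  "('k, 'a::comm_ring_1, 'l::ab_group_add) linfty \<Rightarrow> ('a, 'l) cochain \<Rightarrow> ('a, 'l) cochain" where
  "ce_diff E c = (if c \<in> all_parts (ce_alg E)
     then (\<lambda>ys. if ys \<in> sec_lists E then ce_at E c ys else 0) else 0)"

definition euler ::
  "('k, 'a::comm_ring_1, 'l::ab_group_add) linfty \<Rightarrow> ('a, 'l) cochain \<Rightarrow> ('a, 'l) cochain" where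
  "euler E c = (if c \<in> all_parts (ce_alg E)
     then (\<lambda>ys. of_nat (sum_list (sec_degs ys)) * c ys) else 0)"


section \<open>Forms on the quotient by an L-infinity algebroid\<close>

type_synonym ('a, 'l) ce_form = "('a, 'l) cochain form"

abbreviation ce_forms ::
  "('k, 'a::comm_ring_1, 'l::ab_group_add) linfty \<Rightarrow> nat \<Rightarrow> nat \<Rightarrow> ('a, 'l) ce_form set" where
  "ce_forms E p q \<equiv> forms (ce_alg E) p q"

definition d_ce ::
  "('k, 'a::comm_ring_1, 'l::ab_group_add) linfty \<Rightarrow> ('a, 'l) ce_form \<Rightarrow> ('a, 'l) ce_form" where
  "d_ce E = de_rham (ce_alg E)"

text \<open>The internal differential on forms is the Lie derivative along the Chevalley--Eilenberg
  differential.\<close>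

definition delta ::
  "('k, 'a::comm_ring_1, 'l::ab_group_add) linfty \<Rightarrow> ('a, 'l) ce_form \<Rightarrow> ('a, 'l) ce_form" where
  "delta E = lie (ce_alg E) (1, ce_diff E)"

definition d_base :: "('k, 'a::comm_ring_1, 'l) linfty \<Rightarrow> 'a form \<Rightarrow> 'a form" where
  "d_base E = de_rham (base_alg E)"

text \<open>The homotopy: for \<open>\<omega>\<close> of internal degree \<open>q\<close>, the value \<open>\<omega> Xs\<close> is a cochain of degree
  \<open>q + tot_deg Xs\<close>, so that the number \<open>q\<close> below is the internal degree of the component of
  \<open>\<omega>\<close> that contributes at \<open>ys\<close>.\<close>

definition hpty ::
  "('k::field_char_0, 'a::comm_ring_1, 'l::ab_group_add) linfty \<Rightarrow> ('a, 'l) ce_form \<Rightarrow> ('a, 'l) ce_form" where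
  "hpty E \<omega> = (\<lambda>Xs ys. let q = int (sum_list (sec_degs ys)) - tot_deg Xs in
     if q > 0 then base E (1 / of_int q) * contract (0, euler E) \<omega> Xs ys else 0)"

subsection \<open>The truncated de Rham complexes\<close>

text \<open>An element of the total complex is a function on lists of derivations of all lengths; its
  component of form degree \<open>r\<close> is the restriction to lists of length \<open>r\<close>.\<close>

definition form_part :: "nat \<Rightarrow> 'c::zero form \<Rightarrow> 'c form" where
  "form_part r \<omega> = (\<lambda>Xs. if length Xs = r then \<omega> Xs else 0)"

definition total_forms ::
  "('k, 'a::comm_ring_1, 'l::ab_group_add) linfty \<Rightarrow> nat \<Rightarrow> nat \<Rightarrow> ('a, 'l) ce_form set" where
  "total_forms E p m = {\<omega>. \<forall>r. form_part r \<omega> \<in> (if p \<le> r \<and> r \<le> m then ce_forms E r (m - r) else {0})}"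

definition total_diff ::
  "('k, 'a::comm_ring_1, 'l::ab_group_add) linfty \<Rightarrow> nat \<Rightarrow> ('a, 'l) ce_form \<Rightarrow> ('a, 'l) ce_form" where
  "total_diff E m \<omega> = delta E \<omega> + d_ce E \<omega>"

text \<open>Forms on \<open>U\<close> with coefficients in cochains: the extension of a form \<open>G\<close> on \<open>U\<close> to
  derivations \<open>Y\<close> of \<open>\<O>(U)\<close> with values in cochains (tagged with their degrees) by multilinearity
  over cochains. The sign is that of moving the coefficient \<open>c\<close> out of \<open>\<iota>\<^bsub>Y\<^sub>p\<^esub> \<cdots> \<iota>\<^bsub>Y\<^sub>2\<^esub> (c \<iota>\<^sub>v G)\<close>.\<close>

fun extend :: "'a::comm_ring_1 form \<Rightarrow> (int \<times> ('a \<Rightarrow> ('a, 'l) cochain)) list \<Rightarrow> ('a, 'l) cochain" where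
  "extend G [] ys = (if ys = [] then G [] else 0)"
| "extend G (Y # Ys) ys = (\<Sum>S\<in>Pow {..<length ys}.
     sg (int (koszul (sec_degs ys) S) + fst Y * shifted_deg Ys)
       (extend (contract (0, \<lambda>f. snd Y f (nths ys S)) G) Ys (nths ys (- S))))"

definition const_cochain :: "'a::zero \<Rightarrow> ('a, 'l) cochain" where
  "const_cochain f = (\<lambda>ys. if ys = [] then f else 0)"

definition restrict_der :: "('a::zero, 'l) cochain der \<Rightarrow> int \<times> ('a \<Rightarrow> ('a, 'l) cochain)" where
  "restrict_der X = (fst X, \<lambda>f. snd X (const_cochain f))"

text \<open>The contraction of a form \<open>G\<close> on \<open>U\<close> with the n-th exterior power of the anchor,
  \<open>(x\<^sub>1,\<dots>,x\<^sub>n) \<mapsto> G(a x\<^sub>1,\<dots>,a x\<^sub>n,\<dots>)\<close>, viewed as a form on \<open>[U/\<L>]\<close>. For \<open>n = 0\<close> this is the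
  identification of forms on \<open>U\<close> with the forms on \<open>[U/\<L>]\<close> of internal degree 0.\<close>

definition anchor_contraction ::
  "('k, 'a::comm_ring_1, 'l::ab_group_add) linfty \<Rightarrow> nat \<Rightarrow> 'a form \<Rightarrow> ('a, 'l) ce_form" where
  "anchor_contraction E n G = (\<lambda>Xs ys. if Xs \<in> der_lists (ce_alg E) \<and> ys \<in> sec_lists E then
     (\<Sum>S | S \<subseteq> {..<length ys} \<and> card S = n \<and> (\<forall>j\<in>S. fst (ys ! j) = 0).
        sg (int (koszul (sec_degs ys) S) + int n * shifted_deg Xs)
          (extend (\<lambda>Vs. G (map (\<lambda>y. (0, anchor E (snd y))) (nths ys S) @ Vs))
             (map restrict_der Xs) (nths ys (- S)))) else 0)"

definition pullback ::
  "('k, 'a::comm_ring_1, 'l::ab_group_add) linfty \<Rightarrow> 'a form \<Rightarrow> ('a, 'l) ce_form" where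
  "pullback E G = anchor_contraction E 0 G"

definition base_total :: "('k, 'a::comm_ring_1, 'l) linfty \<Rightarrow> nat \<Rightarrow> nat \<Rightarrow> 'a form set" where
  "base_total E p m = (if p \<le> m then base_forms E m else {0})"

text \<open>In total degree \<open>m\<close>, the component of internal degree 0 is the component of form degree \<open>m\<close>.\<close>

definition projection ::
  "('k, 'a::comm_ring_1, 'l::ab_group_add) linfty \<Rightarrow> nat \<Rightarrow> ('a, 'l) ce_form \<Rightarrow> 'a form" where
  "projection E m \<omega> = the_inv_into (base_forms E m) (pullback E) (form_part m \<omega>)"

subsection \<open>The normalized complex\<close>

definition potentials ::
  "('k::field_char_0, 'a::comm_ring_1, 'l::ab_group_add) linfty \<Rightarrow> nat \<Rightarrow> nat \<Rightarrow> ('a, 'l) ce_form set" where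
  "potentials E p q = hpty E ` ce_forms E p q"

definition delta_pot ::
  "('k::field_char_0, 'a::comm_ring_1, 'l::ab_group_add) linfty \<Rightarrow> ('a, 'l) ce_form \<Rightarrow> ('a, 'l) ce_form" where
  "delta_pot E P = hpty E (delta E (d_ce E P))"

definition twist ::
  "('k, 'a::comm_ring_1, 'l::ab_group_add) linfty \<Rightarrow> nat \<Rightarrow> nat \<Rightarrow> 'a form \<Rightarrow> ('a, 'l) ce_form" where
  "twist E p m G = anchor_contraction E (m + 1 - p) G"

text \<open>\<open>potentials E p q\<close> consists of \<open>(p - 1)\<close>-forms; it is zero for \<open>p = 0\<close>.\<close>

definition normalized ::
  "('k::field_char_0, 'a::comm_ring_1, 'l::ab_group_add) linfty \<Rightarrow> nat \<Rightarrow> nat \<Rightarrow> (('a, 'l) ce_form \<times> 'a form) set"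
  where "normalized E p m = (if p \<le> m then potentials E p (m - p) else {0}) \<times> base_total E p m"

definition delta_tw ::
  "('k::field_char_0, 'a::comm_ring_1, 'l::ab_group_add) linfty \<Rightarrow> nat \<Rightarrow> nat \<Rightarrow>
   ('a, 'l) ce_form \<times> 'a form \<Rightarrow> ('a, 'l) ce_form \<times> 'a form" where
  "delta_tw E p m z = (delta_pot E (fst z) + twist E p m (snd z), d_base E (snd z))"

definition total_scale ::
  "('k, 'a::comm_ring_1, 'l::ab_group_add) linfty \<Rightarrow> 'k \<Rightarrow> ('a, 'l) ce_form \<Rightarrow> ('a, 'l) ce_form" where
  "total_scale E = form_scale (ce_alg E)"

definition normalized_scale ::
  "('k, 'a::comm_ring_1, 'l::ab_group_add) linfty \<Rightarrow> 'k \<Rightarrow>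
   ('a, 'l) ce_form \<times> 'a form \<Rightarrow> ('a, 'l) ce_form \<times> 'a form" where
  "normalized_scale E r z = (form_scale (ce_alg E) r (fst z), form_scale (base_alg E) r (snd z))"


section \<open>Cochain complexes and homotopy equivalences\<close>

definition linear_between ::
  "('k \<Rightarrow> 'v \<Rightarrow> 'v) \<Rightarrow> ('k \<Rightarrow> 'w \<Rightarrow> 'w) \<Rightarrow> 'v::ab_group_add set \<Rightarrow> 'w::ab_group_add set \<Rightarrow> ('v \<Rightarrow> 'w) \<Rightarrow> bool"
  where "linear_between s t V W f \<longleftrightarrow>
     (\<forall>x\<in>V. f x \<in> W) \<and> (\<forall>x\<in>V. \<forall>y\<in>V. f (x + y) = f x + f y) \<and> (\<forall>r. \<forall>x\<in>V. f (s r x) = t r (f x))"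

definition cochain_complex ::
  "('k \<Rightarrow> 'v \<Rightarrow> 'v) \<Rightarrow> (nat \<Rightarrow> 'v::ab_group_add set) \<Rightarrow> (nat \<Rightarrow> 'v \<Rightarrow> 'v) \<Rightarrow> bool" where
  "cochain_complex s V D \<longleftrightarrow>
     (\<forall>m. 0 \<in> V m \<and> (\<forall>x\<in>V m. \<forall>y\<in>V m. x + y \<in> V m) \<and> (\<forall>r. \<forall>x\<in>V m. s r x \<in> V m)) \<and>
     (\<forall>m. linear_between s s (V m) (V (Suc m)) (D m)) \<and>
     (\<forall>m. \<forall>x\<in>V m. D (Suc m) (D m x) = 0)"

definition chain_map where
  "chain_map s V D t W D' f \<longleftrightarrow>
     (\<forall>m::nat. linear_between s t (V m) (W m) (f m)) \<and>
     (\<forall>m. \<forall>x\<in>V m. f (Suc m) (D m x) = D' m (f m x))"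

definition homotopic_to_id ::
  "('k \<Rightarrow> 'v \<Rightarrow> 'v) \<Rightarrow> (nat \<Rightarrow> 'v::ab_group_add set) \<Rightarrow> (nat \<Rightarrow> 'v \<Rightarrow> 'v) \<Rightarrow> (nat \<Rightarrow> 'v \<Rightarrow> 'v) \<Rightarrow> bool" where
  "homotopic_to_id s V D g \<longleftrightarrow>
     (\<exists>H. (\<forall>m. linear_between s s (V (Suc m)) (V m) (H m)) \<and>
       (\<forall>m. \<forall>x\<in>V m. g m x - x = (case m of 0 \<Rightarrow> 0 | Suc k \<Rightarrow> D k (H k x)) + H m (D m x)))"

definition homotopy_equivalence where
  "homotopy_equivalence s V D t W D' f g \<longleftrightarrow>
     cochain_complex s V D \<and> cochain_complex t W D' \<and>
     chain_map s V D t W D' f \<and> chain_map t W D' s V D g \<and>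
     homotopic_to_id s V D (\<lambda>m x. g m (f m x)) \<and> homotopic_to_id t W D' (\<lambda>m x. f m (g m x))"

text \<open>The canonical maps. For fixed internal degree \<open>q > 0\<close>, the homotopy \<open>h\<close> contracts the
  truncated de Rham complex onto its image \<open>d Pot\<close> of potentials; perturbing this retraction by
  \<open>\<delta>\<close> gives
  \<open>\<omega> \<mapsto> (- h \<Sum>\<^sub>n (- \<delta> h)^n \<omega>\<^bsub>p+n\<^esub>, \<omega>|\<^sub>U)\<close> and
  \<open>(P, G) \<mapsto> - d P + \<Sum>\<^sub>n \<iota>\<^bsub>\<Lambda>^n a\<^esub> G\<close>, where \<open>n \<le> deg G - p\<close>.\<close>

definition to_normalized ::
  "('k::field_char_0, 'a::comm_ring_1, 'l::ab_group_add) linfty \<Rightarrow> nat \<Rightarrow> nat \<Rightarrow>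
   ('a, 'l) ce_form \<Rightarrow> ('a, 'l) ce_form \<times> 'a form" where
  "to_normalized E p m \<omega> =
     (- hpty E (form_part p (\<Sum>n\<le>m. ((\<lambda>\<theta>. - delta E (hpty E \<theta>)) ^^ n) \<omega>)), projection E m \<omega>)"

definition from_normalized ::
  "('k::field_char_0, 'a::comm_ring_1, 'l::ab_group_add) linfty \<Rightarrow> nat \<Rightarrow> nat \<Rightarrow>
   ('a, 'l) ce_form \<times> 'a form \<Rightarrow> ('a, 'l) ce_form" where
  "from_normalized E p m z = - d_ce E (fst z) + (\<Sum>n\<le>m - p. anchor_contraction E n (snd z))"

end

theory Submission
  imports Defs
begin

text \<open>Write \<open>Q\<close> for the Chevalley--Eilenberg differential, a derivation of degree 1 and square 0 of
  \<open>\<O>([U/\<L>])\<close>, so that \<open>\<delta> = L\<^sub>Q = [\<iota>\<^sub>Q, d]\<close> up to sign and \<open>\<delta>\<^sup>2 = 0\<close>, \<open>\<delta> d = - d \<delta>\<close> are Cartan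
  calculus. On forms of internal degree \<open>q > 0\<close>, \<open>d h + h d = 1\<close> because \<open>L\<^sub>\<xi>\<close> is multiplication by
  \<open>q\<close>. Forms of internal degree 0 are pulled back from \<open>U\<close>: a Grassmann connection on \<open>\<L>\<close> lifts
  vector fields on \<open>U\<close> to derivations of cochains, and modulo these lifts every derivation is a
  combination of contractions with sections.

  Let \<open>\<alpha>\<^sub>n = \<iota>\<^bsub>\<Lambda>^n a\<^esub> G\<close>. On functions on \<open>U\<close>, \<open>Q\<close> is given by the anchor, so that
  \<open>\<iota>\<^sub>Q \<alpha>\<^sub>n = (n + 1) \<alpha>\<^bsub>n+1\<^esub>\<close>. Moving \<open>\<iota>\<^sub>\<xi>\<close> past \<open>L\<^sub>Q\<close> one obtains \<open>h \<delta> \<alpha>\<^sub>n = - \<alpha>\<^bsub>n+1\<^esub>\<close>. Hence the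
  \<open>\<alpha>\<^sub>n\<close> are the terms \<open>(- h \<delta>)^n \<alpha>\<^sub>0\<close> of the perturbation series, the twisting map is what
  perturbing \<open>d\<close> by \<open>\<delta>\<close> produces, and the perturbation lemma applies: the composite
  on the normalized complex is the identity, the one on the total complex is homotopic to the
  identity by the truncation of \<open>h \<Sum>\<^sub>n (- \<delta> h)^n\<close>. The square of the twisted differential vanishes
  since the inclusion of the normalized complex is an injective chain map.\<close>

text \<open>The truncation gives the normalized complex its shape. As h lowers the form degree, it
  does not act on the truncated complex. In the untruncated one, d h + h d = 1 contracts everything
  of positive internal degree; after truncation this fails exactly on p-forms, by the term d h, and
  the potentials h \<omega> record the failure. This is why they are (p - 1)-forms, and why the
  calculus runs in the untruncated complex, the cut at p being made last. The series are finite
  because \<delta> h lowers the form degree. Two obstacles shape the rest. Forms are functions on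
  lists of derivations, without coordinates, so identities are proved by contracting with an
  arbitrary derivation and inducting on the form degree; such contractions can make the internal
  degree negative. And the bundles are only projective modules: dual bases and the Euler derivation,
  together with the invertibility of nonzero integers in \<O>(U), take the place of free generators
  in the description of all derivations of cochains.\<close>

lemma sg_0 [simp]: "sg 0 v = v"
  and sg_zero [simp]: "sg k (0::'v::ab_group_add) = 0"
  and sg_add: "sg k (v + w) = sg k v + sg k (w::'v::ab_group_add)"
  and sg_diff: "sg k (v - w) = sg k v - sg k (w::'v::ab_group_add)"
  and sg_minus: "sg k (- v) = - sg k (v::'v::ab_group_add)"
  and sg_sg: "sg j (sg k v) = sg (j + k) (v::'v::ab_group_add)"
  and sg_double [simp]: "sg (k + k) v = v"
  by (auto simp: sg_def)

lemma sg_apply: "sg k f x = sg k (f x)"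
  by (simp add: sg_def)

lemma sg_cong_even: "even (j - k) \<Longrightarrow> sg j v = sg k v"
  by (auto simp: sg_def)

lemma sg_eq_0_iff [simp]: "sg k v = 0 \<longleftrightarrow> v = (0::'v::ab_group_add)"
  by (simp add: sg_def)

lemma contract_add: "contract X (\<omega> + \<omega>') = contract X \<omega> + contract X (\<omega>'::'c::ab_group_add form)"
  and contract_diff: "contract X (\<omega> - \<omega>') = contract X \<omega> - contract X (\<omega>'::'c::ab_group_add form)"
  and contract_sg: "contract X (sg k \<omega>) = sg k (contract X (\<omega>::'c::ab_group_add form))"
  and contract_zero [simp]: "contract X (0::'c::ab_group_add form) = 0"
  by (auto simp: contract_def fun_eq_iff sg_def)

lemma contract_apply: "contract X \<omega> Xs = \<omega> (X # Xs)"
  by (simp add: contract_def)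

lemma tot_deg_simps [simp]: "tot_deg [] = 0" "tot_deg (X # Xs) = fst X + tot_deg Xs"
  "tot_deg (Xs @ Ys) = tot_deg Xs + tot_deg Ys"
  by (simp_all add: tot_deg_def)

lemma shifted_deg_simps [simp]: "shifted_deg [] = 0" "shifted_deg (X # Xs) = fst X - 1 + shifted_deg Xs"
  "shifted_deg (Xs @ Ys) = shifted_deg Xs + shifted_deg Ys"
  by (simp_all add: shifted_deg_def)

section \<open>Graded commutative algebras and their derivations\<close>

text \<open>Both \<O>(U), concentrated in degree 0, and the cochains are instances, so that forms
  and Cartan calculus are developed once. Bilinearity and associativity are assumed on the whole
  ambient type, on which the shuffle product is defined as well; commutativity refers to homogeneous
  elements.\<close>

locale graded_comm_algebra =
  fixes B :: "('k, 'c::ab_group_add) galg"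
  assumes part_zero [simp]: "0 \<in> part B i"
    and part_diff: "x \<in> part B i \<Longrightarrow> y \<in> part B i \<Longrightarrow> x - y \<in> part B i"
    and part_neg: "i < 0 \<Longrightarrow> part B i = {0}"
    and part_mul: "x \<in> part B i \<Longrightarrow> y \<in> part B j \<Longrightarrow> gmul B x y \<in> part B (i + j)"
    and part_scale: "x \<in> part B i \<Longrightarrow> gscale B r x \<in> part B i"
    and mul_add_left: "gmul B (x + y) z = gmul B x z + gmul B y z"
    and mul_add_right: "gmul B x (y + z) = gmul B x y + gmul B x z"
    and mul_assoc: "gmul B (gmul B x y) z = gmul B x (gmul B y z)"
    and mul_comm: "x \<in> part B i \<Longrightarrow> y \<in> part B j \<Longrightarrow> gmul B x y = sg (i * j) (gmul B y x)"
    and scale_add: "gscale B r (x + y) = gscale B r x + gscale B r y"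
    and mul_scale_left: "gmul B (gscale B r x) y = gscale B r (gmul B x y)"
    and mul_scale_right: "gmul B x (gscale B r y) = gscale B r (gmul B x y)"
begin

abbreviation "AP \<equiv> all_parts B"

lemma part_minus: "x \<in> part B i \<Longrightarrow> - x \<in> part B i"
  using part_diff[of 0 i x] by simp

lemma part_add: "x \<in> part B i \<Longrightarrow> y \<in> part B i \<Longrightarrow> x + y \<in> part B i"
  using part_diff[of x i "- y"] part_minus by simp

lemma part_sg: "x \<in> part B i \<Longrightarrow> sg k x \<in> part B i"
  by (simp add: sg_def part_minus)

lemma mul_zero_right [simp]: "gmul B x 0 = 0"
  using mul_add_right[of x 0 0] by simp

lemma mul_zero_left [simp]: "gmul B 0 x = 0"
  using mul_add_left[of 0 0 x] by simp

lemma scale_zero [simp]: "gscale B r 0 = 0"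
  using scale_add[of r 0 0] by simp

lemma mul_minus_right: "gmul B x (- y) = - gmul B x y"
  using mul_add_right[of x y "- y"] by (simp add: eq_neg_iff_add_eq_0 add.commute)

lemma mul_minus_left: "gmul B (- x) y = - gmul B x y"
  using mul_add_left[of x "- x" y] by (simp add: eq_neg_iff_add_eq_0 add.commute)

lemma scale_minus: "gscale B r (- y) = - gscale B r y"
  using scale_add[of r y "- y"] by (simp add: eq_neg_iff_add_eq_0 add.commute)

lemma mul_sg_right: "gmul B x (sg k y) = sg k (gmul B x y)"
  by (simp add: sg_def mul_minus_right)

lemma mul_sg_left: "gmul B (sg k x) y = sg k (gmul B x y)"
  by (simp add: sg_def mul_minus_left)

lemma scale_sg: "gscale B r (sg k y) = sg k (gscale B r y)"
  by (simp add: sg_def scale_minus)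

lemma mul_diff_right: "gmul B x (y - z) = gmul B x y - gmul B x z"
  using mul_add_right[of x y "- z"] by (simp add: mul_minus_right)

lemma mul_diff_left: "gmul B (y - z) x = gmul B y x - gmul B z x"
  using mul_add_left[of y "- z" x] by (simp add: mul_minus_left)

lemma scale_diff: "gscale B r (y - z) = gscale B r y - gscale B r z"
  using scale_add[of r y "- z"] by (simp add: scale_minus)

text \<open>Padding with zeros makes every larger bound admissible, which gives two elements a
  common range of degrees.\<close>

lemma AP_sum_ge:
  assumes "x \<in> AP"
  shows "\<exists>N c. (\<forall>i. c i \<in> part B (int i)) \<and> (\<forall>M\<ge>N. x = (\<Sum>i<M. c i))"
proof -
  from assms obtain N c where c: "\<forall>i<N. c i \<in> part B (int i)" "x = (\<Sum>i<N. c i)"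
    by (auto simp: all_parts_def)
  define c' where "c' i = (if i < N then c i else 0)" for i
  have "x = (\<Sum>i<M. c' i)" if "N \<le> M" for M
  proof -
    have "(\<Sum>i<M. c' i) = (\<Sum>i<N. c' i)"
      by (rule sum.mono_neutral_right) (use that in \<open>auto simp: c'_def\<close>)
    also have "\<dots> = (\<Sum>i<N. c i)"
      by (rule sum.cong) (auto simp: c'_def)
    finally show ?thesis using c by simp
  qed
  moreover have "c' i \<in> part B (int i)" for i
    using c by (simp add: c'_def)
  ultimately show ?thesis by blast
qed

lemma AP_zero [simp]: "0 \<in> AP"
  by (auto simp: all_parts_def intro!: exI[of _ 0])

lemma AP_add:
  assumes "x \<in> AP" "y \<in> AP" shows "x + y \<in> AP"
proof -
  obtain N c where c: "\<And>i. c i \<in> part B (int i)" "\<And>M. N \<le> M \<Longrightarrow> x = (\<Sum>i<M. c i)"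
    using AP_sum_ge[OF assms(1)] by blast
  obtain N' c' where c': "\<And>i. c' i \<in> part B (int i)" "\<And>M. N' \<le> M \<Longrightarrow> y = (\<Sum>i<M. c' i)"
    using AP_sum_ge[OF assms(2)] by blast
  have "x = (\<Sum>i<max N N'. c i)" "y = (\<Sum>i<max N N'. c' i)"
    using c(2)[of "max N N'"] c'(2)[of "max N N'"] by auto
  then have "x + y = (\<Sum>i<max N N'. c i + c' i)"
    by (simp add: sum.distrib)
  then show ?thesis using c(1) c'(1) by (auto simp: all_parts_def intro!: exI[of _ "max N N'"] exI[of _ "\<lambda>i. c i + c' i"] part_add)
qed

lemma AP_minus: assumes "x \<in> AP" shows "- x \<in> AP"
proof -
  from assms obtain N c where c: "\<forall>i<N. c i \<in> part B (int i)" "x = (\<Sum>i<N. c i)"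
    by (auto simp: all_parts_def)
  have "\<forall>i<N. - c i \<in> part B (int i)"
    by (intro allI impI part_minus) (rule c(1)[rule_format])
  moreover have "- x = (\<Sum>i<N. - c i)"
    by (simp only: c(2) sum_negf)
  ultimately show ?thesis unfolding all_parts_def mem_Collect_eq
    by (intro exI[of _ N] exI[of _ "\<lambda>i. - c i"] conjI)
qed

lemma AP_diff: "x \<in> AP \<Longrightarrow> y \<in> AP \<Longrightarrow> x - y \<in> AP"
  using AP_add[of x "- y"] AP_minus by simp

lemma AP_sg: "x \<in> AP \<Longrightarrow> sg k x \<in> AP"
  by (simp add: sg_def AP_minus)

lemma AP_sum: "(\<And>j. j \<in> J \<Longrightarrow> f j \<in> AP) \<Longrightarrow> (\<Sum>j\<in>J. f j) \<in> AP"
  by (induction J rule: infinite_finite_induct) (auto intro: AP_add)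

lemma part_AP: "x \<in> part B i \<Longrightarrow> x \<in> AP"
proof (cases "i < 0")
  case False
  assume x: "x \<in> part B i"
  define c where "c j = (if j = nat i then x else 0)" for j
  have "x = (\<Sum>j<Suc (nat i). c j)"
    by (simp add: c_def)
  moreover have "\<forall>j<Suc (nat i). c j \<in> part B (int j)"
    using False x by (auto simp: c_def)
  ultimately show ?thesis unfolding all_parts_def by blast
qed (auto simp: part_neg)

lemma AP_induct [consumes 1, case_names part add]:
  assumes "x \<in> AP" and "\<And>i x. x \<in> part B i \<Longrightarrow> P x"
    and "\<And>x y. x \<in> AP \<Longrightarrow> y \<in> AP \<Longrightarrow> P x \<Longrightarrow> P y \<Longrightarrow> P (x + y)"
  shows "P x"
proof -
  from assms(1) obtain N c where c: "\<forall>i<N. c i \<in> part B (int i)" "x = (\<Sum>i<N. c i)"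
    by (auto simp: all_parts_def)
  have "M \<le> N \<Longrightarrow> P (\<Sum>i<M. c i) \<and> (\<Sum>i<M. c i) \<in> AP" for M
  proof (induction M)
    case 0
    then show ?case using assms(2)[OF part_zero] by simp
  next
    case (Suc M)
    then have "c M \<in> part B (int M)" using c(1) by simp
    with Suc show ?case using assms(2)[of "c M" "int M"] assms(3)[of "\<Sum>i<M. c i" "c M"] part_AP[of "c M" "int M"]
      by (simp add: AP_add)
  qed
  then show ?thesis using c(2) by blast
qed

lemma AP_mul: assumes "x \<in> AP" "y \<in> AP" shows "gmul B x y \<in> AP"
  using assms(1)
proof (induction rule: AP_induct)
  case (part i x)
  show ?case using assms(2)
    by (induction rule: AP_induct) (use part in \<open>auto simp: mul_add_right intro: AP_add part_AP part_mul\<close>)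
qed (auto simp: mul_add_left intro: AP_add)

lemma AP_scale: assumes "x \<in> AP" shows "gscale B r x \<in> AP"
  using assms by (induction rule: AP_induct) (auto simp: scale_add intro: AP_add part_AP part_scale)

lemma mul_comm_AP:
  assumes "x \<in> part B 0" "y \<in> AP" shows "gmul B x y = gmul B y x"
  using assms(2)
proof (induction rule: AP_induct)
  case (part i y)
  then show ?case using mul_comm[OF assms(1) part] by simp
qed (simp add: mul_add_left mul_add_right)

subsection \<open>Derivations\<close>

lemma der_part: "D \<in> ders B k \<Longrightarrow> c \<in> part B i \<Longrightarrow> D c \<in> part B (i + k)"
  and der_add: "D \<in> ders B k \<Longrightarrow> c \<in> AP \<Longrightarrow> c' \<in> AP \<Longrightarrow> D (c + c') = D c + D c'"
  and der_scale: "D \<in> ders B k \<Longrightarrow> c \<in> AP \<Longrightarrow> D (gscale B r c) = gscale B r (D c)"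
  and der_mul: "D \<in> ders B k \<Longrightarrow> c \<in> part B i \<Longrightarrow> c' \<in> AP \<Longrightarrow>
     D (gmul B c c') = gmul B (D c) c' + sg (k * i) (gmul B c (D c'))"
  and der_out: "D \<in> ders B k \<Longrightarrow> c \<notin> AP \<Longrightarrow> D c = 0"
  by (simp_all add: ders_def)

lemma der_AP: assumes "D \<in> ders B k" shows "D c \<in> AP"
proof (cases "c \<in> AP")
  case True
  then show ?thesis
    by (induction rule: AP_induct) (auto simp: der_add[OF assms] intro: AP_add part_AP der_part[OF assms])
qed (simp add: der_out[OF assms])

lemma der_zero [simp]: "D \<in> ders B k \<Longrightarrow> D 0 = 0"
  using der_add[of D k 0 0] by simp

lemma der_minus: "D \<in> ders B k \<Longrightarrow> c \<in> AP \<Longrightarrow> D (- c) = - D c"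
  using der_add[of D k c "- c"] by (simp add: AP_minus eq_neg_iff_add_eq_0 add.commute)

lemma der_diff: "D \<in> ders B k \<Longrightarrow> c \<in> AP \<Longrightarrow> c' \<in> AP \<Longrightarrow> D (c - c') = D c - D c'"
  using der_add[of D k c "- c'"] by (simp add: AP_minus der_minus)

lemma der_sg: "D \<in> ders B k \<Longrightarrow> c \<in> AP \<Longrightarrow> D (sg j c) = sg j (D c)"
  by (simp add: sg_def der_minus)

lemma der_sum: "D \<in> ders B k \<Longrightarrow> (\<And>j. j \<in> J \<Longrightarrow> f j \<in> AP) \<Longrightarrow> D (\<Sum>j\<in>J. f j) = (\<Sum>j\<in>J. D (f j))"
  by (induction J rule: infinite_finite_induct) (auto simp: der_add AP_sum)

text \<open>The Leibniz rule in \<open>ders\<close> admits an inhomogeneous second factor.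
  Additivity reduces it to two homogeneous factors, the form in which degree counts are
  available.\<close>

lemma dersI:
  assumes "\<And>i c. c \<in> part B i \<Longrightarrow> D c \<in> part B (i + k)"
    and "\<And>c c'. c \<in> AP \<Longrightarrow> c' \<in> AP \<Longrightarrow> D (c + c') = D c + D c'"
    and "\<And>r c. c \<in> AP \<Longrightarrow> D (gscale B r c) = gscale B r (D c)"
    and "\<And>i j c c'. c \<in> part B i \<Longrightarrow> c' \<in> part B j \<Longrightarrow>
     D (gmul B c c') = gmul B (D c) c' + sg (k * i) (gmul B c (D c'))"
    and "\<And>c. c \<notin> AP \<Longrightarrow> D c = 0"
  shows "D \<in> ders B k"
proof -
  have "D (gmul B c c') = gmul B (D c) c' + sg (k * i) (gmul B c (D c'))"
    if c: "c \<in> part B i" and c': "c' \<in> AP" for i c c'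
    using c'
  proof (induction rule: AP_induct)
    case (part j c')
    then show ?case using assms(4) c by blast
  next
    case (add x y)
    then show ?case
      by (simp add: mul_add_right assms(2) AP_mul part_AP[OF c] sg_add)
  qed
  then show ?thesis using assms unfolding ders_def by blast
qed

lemma ders_zero [simp]: "(\<lambda>c. 0) \<in> ders B k"
  by (auto simp: ders_def)

lemma ders_add: "D \<in> ders B k \<Longrightarrow> D' \<in> ders B k \<Longrightarrow> (\<lambda>c. D c + D' c) \<in> ders B k"
  by (rule dersI) (simp_all add: der_add der_scale der_mul der_out mul_add_left mul_add_right sg_add scale_add part_AP
      part_add der_part)

lemma ders_minus: "D \<in> ders B k \<Longrightarrow> (\<lambda>c. - D c) \<in> ders B k"
  by (rule dersI) (simp_all add: der_add der_scale der_mul der_out mul_minus_left mul_minus_right sg_minus scale_minus part_AP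
      part_minus der_part)

lemma ders_sg: "D \<in> ders B k \<Longrightarrow> (\<lambda>c. sg j (D c)) \<in> ders B k"
  by (cases "even j") (simp_all add: sg_def ders_minus)

lemma ders_sum: "(\<And>j. j \<in> J \<Longrightarrow> D j \<in> ders B k) \<Longrightarrow> (\<lambda>c. \<Sum>j\<in>J. D j c) \<in> ders B k"
  by (induction J rule: infinite_finite_induct) (auto intro: ders_add)

lemma ders_mul:
  assumes f: "f \<in> part B i" and D: "D \<in> ders B k"
  shows "(\<lambda>c. gmul B f (D c)) \<in> ders B (i + k)"
proof (rule dersI)
  fix j c assume "c \<in> part B j"
  then show "gmul B f (D c) \<in> part B (j + (i + k))"
    using part_mul[OF f der_part[OF D \<open>c \<in> part B j\<close>]] by (simp add: add.left_commute)
next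
  fix a b c c' assume c: "c \<in> part B a" "c' \<in> part B b"
  have "gmul B f (gmul B c (D c')) = sg (i * a) (gmul B c (gmul B f (D c')))"
    using mul_comm[OF f c(1)] by (metis mul_assoc mul_sg_left)
  then show "gmul B f (D (gmul B c c')) = gmul B (gmul B f (D c)) c' + sg ((i + k) * a) (gmul B c (gmul B f (D c')))"
    using c by (simp add: der_mul[OF D] part_AP mul_add_right mul_assoc mul_sg_right sg_sg algebra_simps)
qed (auto simp: der_add[OF D] der_scale[OF D] der_out[OF D] mul_add_right mul_scale_right)

definition is_der :: "'c der \<Rightarrow> bool" where
  "is_der X \<longleftrightarrow> snd X \<in> ders B (fst X)"

lemma is_der_pair [simp]: "is_der (k, D) \<longleftrightarrow> D \<in> ders B k"
  by (simp add: is_der_def)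

lemma der_lists_Nil [simp]: "[] \<in> der_lists B"
  by (simp add: der_lists_def)

lemma der_lists_Cons [simp]: "X # Xs \<in> der_lists B \<longleftrightarrow> is_der X \<and> Xs \<in> der_lists B"
  by (auto simp: der_lists_def is_der_def)

lemma der_lists_append [simp]: "Xs @ Ys \<in> der_lists B \<longleftrightarrow> Xs \<in> der_lists B \<and> Ys \<in> der_lists B"
  by (auto simp: der_lists_def)

lemma fst_bracket [simp]: "fst (der_bracket X Y) = fst X + fst Y"
  by (simp add: der_bracket_def)

lemma is_der_bracket [simp]:
  assumes "is_der X" "is_der Y" shows "is_der (der_bracket X Y)"
proof -
  obtain x D y D' where XY: "X = (x, D)" "Y = (y, D')" by (cases X, cases Y)
  with assms have D: "D \<in> ders B x" and D': "D' \<in> ders B y" by simp_all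
  have "(\<lambda>c. D (D' c) - sg (x * y) (D' (D c))) \<in> ders B (x + y)"
  proof (rule dersI)
    fix i c assume c: "c \<in> part B i"
    have "D (D' c) \<in> part B (i + (x + y))" "D' (D c) \<in> part B (i + (x + y))"
      using der_part[OF D der_part[OF D' c]] der_part[OF D' der_part[OF D c]] by (simp_all add: algebra_simps)
    then show "D (D' c) - sg (x * y) (D' (D c)) \<in> part B (i + (x + y))"
      by (auto intro!: part_diff part_sg)
  next
    fix i j c c' assume c: "c \<in> part B i" "c' \<in> part B j"
    have e1: "D (D' (gmul B c c')) = gmul B (D (D' c)) c' + sg (x * (i + y)) (gmul B (D' c) (D c'))
        + sg (y * i) (gmul B (D c) (D' c')) + sg (y * i + x * i) (gmul B c (D (D' c')))"
      using c by (simp add: der_mul[OF D'] der_mul[OF D] der_mul[OF D, OF der_part[OF D']] part_AP der_add[OF D] der_sg[OF D]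
          AP_mul AP_sg der_AP[OF D'] sg_add sg_sg)
    have e2: "D' (D (gmul B c c')) = gmul B (D' (D c)) c' + sg (y * (i + x)) (gmul B (D c) (D' c'))
        + sg (x * i) (gmul B (D' c) (D c')) + sg (x * i + y * i) (gmul B c (D' (D c')))"
      using c by (simp add: der_mul[OF D'] der_mul[OF D] der_mul[OF D', OF der_part[OF D]] part_AP der_add[OF D'] der_sg[OF D']
          AP_mul AP_sg der_AP[OF D] sg_add sg_sg)
    \<comment> \<open>The two mixed products, with one derivation on each factor, occur in both
      expansions and cancel by the sign in the commutator.\<close>
    show "D (D' (gmul B c c')) - sg (x * y) (D' (D (gmul B c c'))) =
      gmul B (D (D' c) - sg (x * y) (D' (D c))) c' + sg ((x + y) * i) (gmul B c (D (D' c') - sg (x * y) (D' (D c'))))"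
      unfolding e1 e2 by (cases "even x"; cases "even y"; cases "even i")
        (simp_all add: sg_def mul_diff_left mul_diff_right mul_add_left mul_add_right mul_minus_right mul_minus_left)
  qed (simp_all add: der_add[OF D] der_add[OF D'] der_AP[OF D] der_AP[OF D'] sg_add der_scale[OF D] der_scale[OF D']
      scale_diff scale_sg der_out[OF D] der_out[OF D'] der_zero[OF D] der_zero[OF D'] AP_scale)
  then show ?thesis unfolding XY by (simp add: der_bracket_def)
qed

end

lemmas form_apply = sg_apply plus_fun_apply zero_fun_apply minus_apply uminus_apply

section \<open>Alternating forms with integer internal degree\<close>

context graded_comm_algebra
begin

text \<open>These are \<open>forms\<close> with the internal degree in the integers: contracting
  with a derivation of degree k adds k, and contractions with sections of \<L> have negative degree,
  so inductions on contractions leave the natural numbers.\<close>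

definition iforms :: "nat \<Rightarrow> int \<Rightarrow> 'c form set" where
  "iforms p q = {\<omega>.
     (\<forall>Xs. Xs \<notin> der_lists B \<or> length Xs \<noteq> p \<longrightarrow> \<omega> Xs = 0) \<and>
     (\<forall>Xs\<in>der_lists B. length Xs = p \<longrightarrow> \<omega> Xs \<in> part B (q + tot_deg Xs)) \<and>
     (\<forall>Xs X Y Ys. Xs @ [X, Y] @ Ys \<in> der_lists B \<longrightarrow>
        \<omega> (Xs @ [X, Y] @ Ys) = sg ((fst X - 1) * (fst Y - 1)) (\<omega> (Xs @ [Y, X] @ Ys))) \<and>
     (\<forall>k D D' Xs. D \<in> ders B k \<longrightarrow> D' \<in> ders B k \<longrightarrow> Xs \<in> der_lists B \<longrightarrow>
        \<omega> ((k, \<lambda>c. D c + D' c) # Xs) = \<omega> ((k, D) # Xs) + \<omega> ((k, D') # Xs)) \<and>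
     (\<forall>i f k D Xs. f \<in> part B i \<longrightarrow> D \<in> ders B k \<longrightarrow> Xs \<in> der_lists B \<longrightarrow>
        \<omega> ((i + k, \<lambda>c. gmul B f (D c)) # Xs) = sg (i * shifted_deg Xs) (gmul B f (\<omega> ((k, D) # Xs))))}"

lemma forms_eq_iforms: "forms B p q = iforms p (int q)"
  by (simp add: forms_def iforms_def)

text \<open>Left multiplication by f of degree i. Evaluation at \<open>Xs\<close> applies the
  contractions after the multiplication, so f has to move out through operators of total degree
  \<open>shifted_deg Xs\<close>.\<close>

definition fmul :: "int \<Rightarrow> 'c \<Rightarrow> 'c form \<Rightarrow> 'c form" where
  "fmul i f \<omega> = (\<lambda>Xs. sg (i * shifted_deg Xs) (gmul B f (\<omega> Xs)))"

lemma iforms_0: "\<omega> \<in> iforms 0 q \<longleftrightarrow> \<omega> [] \<in> part B q \<and> (\<forall>Xs. Xs \<noteq> [] \<longrightarrow> \<omega> Xs = 0)"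
proof -
  have "Xs \<notin> der_lists B \<Longrightarrow> Xs \<noteq> []" for Xs by auto
  then show ?thesis by (auto simp: iforms_def)
qed

lemma iforms_0_contract: "\<omega> \<in> iforms 0 q \<Longrightarrow> contract X \<omega> = 0"
  by (simp add: iforms_0 contract_def fun_eq_iff)

lemma iforms_swap_at:
  assumes "\<omega> \<in> iforms p q" "Xs @ [X, Y] @ Ys \<in> der_lists B"
  shows "\<omega> (Xs @ [X, Y] @ Ys) = sg ((fst X - 1) * (fst Y - 1)) (\<omega> (Xs @ [Y, X] @ Ys))"
  using assms unfolding iforms_def by blast

lemma iforms_swap:
  "\<omega> \<in> iforms p q \<Longrightarrow> is_der X \<Longrightarrow> is_der Y \<Longrightarrow>
    contract Y (contract X \<omega>) = sg ((fst X - 1) * (fst Y - 1)) (contract X (contract Y \<omega>))"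
proof
  fix Xs assume w: "\<omega> \<in> iforms p q" and XY: "is_der X" "is_der Y"
  show "contract Y (contract X \<omega>) Xs = sg ((fst X - 1) * (fst Y - 1)) (contract X (contract Y \<omega>)) Xs"
  proof (cases "Xs \<in> der_lists B")
    case True
    then have "[] @ [X, Y] @ Xs \<in> der_lists B" using XY by simp
    then have "\<omega> ([] @ [X, Y] @ Xs) = sg ((fst X - 1) * (fst Y - 1)) (\<omega> ([] @ [Y, X] @ Xs))"
      using w unfolding iforms_def by blast
    then show ?thesis by (simp add: contract_def form_apply)
  next
    case False
    then have "\<omega> (X # Y # Xs) = 0" "\<omega> (Y # X # Xs) = 0"
      using w by (simp_all add: iforms_def)
    then show ?thesis by (simp add: contract_def form_apply)
  qed
qed

lemma iforms_add_der:
  "\<omega> \<in> iforms p q \<Longrightarrow> D \<in> ders B k \<Longrightarrow> D' \<in> ders B k \<Longrightarrow>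
    contract (k, \<lambda>c. D c + D' c) \<omega> = contract (k, D) \<omega> + contract (k, D') \<omega>"
proof
  fix Xs assume a: "\<omega> \<in> iforms p q" "D \<in> ders B k" "D' \<in> ders B k"
  show "contract (k, \<lambda>c. D c + D' c) \<omega> Xs = (contract (k, D) \<omega> + contract (k, D') \<omega>) Xs"
    using a by (cases "Xs \<in> der_lists B") (simp_all add: contract_def iforms_def)
qed

lemma iforms_mul_der:
  "\<omega> \<in> iforms p q \<Longrightarrow> f \<in> part B i \<Longrightarrow> D \<in> ders B k \<Longrightarrow>
    contract (i + k, \<lambda>c. gmul B f (D c)) \<omega> = fmul i f (contract (k, D) \<omega>)"
proof
  fix Xs assume a: "\<omega> \<in> iforms p q" "f \<in> part B i" "D \<in> ders B k"
  show "contract (i + k, \<lambda>c. gmul B f (D c)) \<omega> Xs = fmul i f (contract (k, D) \<omega>) Xs"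
    using a by (cases "Xs \<in> der_lists B") (simp_all add: contract_def fmul_def iforms_def)
qed

text \<open>A recursive criterion: conditions on the first one or two arguments, and contractions
  that are forms. Lie derivative and de Rham differential are defined by recursion over
  contractions, so their images can be tested in this shape.\<close>

lemma iforms_SucI:
  assumes "\<omega> [] = 0"
    and "\<And>X. \<not> is_der X \<Longrightarrow> contract X \<omega> = 0"
    and ct: "\<And>X. is_der X \<Longrightarrow> contract X \<omega> \<in> iforms p (q + fst X)"
    and sw: "\<And>X Y. is_der X \<Longrightarrow> is_der Y \<Longrightarrow>
      contract Y (contract X \<omega>) = sg ((fst X - 1) * (fst Y - 1)) (contract X (contract Y \<omega>))"
    and ad: "\<And>k D D'. D \<in> ders B k \<Longrightarrow> D' \<in> ders B k \<Longrightarrow>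
      contract (k, \<lambda>c. D c + D' c) \<omega> = contract (k, D) \<omega> + contract (k, D') \<omega>"
    and ml: "\<And>i f k D. f \<in> part B i \<Longrightarrow> D \<in> ders B k \<Longrightarrow>
      contract (i + k, \<lambda>c. gmul B f (D c)) \<omega> = fmul i f (contract (k, D) \<omega>)"
  shows "\<omega> \<in> iforms (Suc p) q"
proof -
  have z: "\<omega> Xs = 0" if "Xs \<notin> der_lists B \<or> length Xs \<noteq> Suc p" for Xs
  proof (cases Xs)
    case (Cons X Ys)
    show ?thesis
    proof (cases "is_der X")
      case True
      then have "contract X \<omega> Ys = 0"
        using ct[OF True] that Cons by (simp add: iforms_def)
      then show ?thesis using Cons by (simp add: contract_def)
    next
      case False
      then show ?thesis using assms(2)[OF False] Cons by (simp add: contract_def fun_eq_iff)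
    qed
  qed (use assms(1) in simp)
  moreover have "\<omega> Xs \<in> part B (q + tot_deg Xs)" if "Xs \<in> der_lists B" "length Xs = Suc p" for Xs
  proof (cases Xs)
    case (Cons X Ys)
    then have "contract X \<omega> Ys \<in> part B (q + fst X + tot_deg Ys)"
      using ct[of X] that by (simp add: iforms_def)
    then show ?thesis using Cons by (simp add: contract_def add.assoc)
  qed (use that in simp)
  moreover have "\<omega> (Xs @ [X, Y] @ Ys) = sg ((fst X - 1) * (fst Y - 1)) (\<omega> (Xs @ [Y, X] @ Ys))"
    if d: "Xs @ [X, Y] @ Ys \<in> der_lists B" for Xs X Y Ys
  proof (cases Xs)
    case Nil
    have "contract Y (contract X \<omega>) Ys = sg ((fst X - 1) * (fst Y - 1)) (contract X (contract Y \<omega>) Ys)"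
      using sw[of X Y] d by (simp add: form_apply)
    then show ?thesis using Nil by (simp add: contract_def)
  next
    case (Cons Z Zs)
    have "contract Z \<omega> (Zs @ [X, Y] @ Ys) = sg ((fst X - 1) * (fst Y - 1)) (contract Z \<omega> (Zs @ [Y, X] @ Ys))"
      by (rule iforms_swap_at[OF ct]) (use d Cons in simp_all)
    then show ?thesis using Cons by (simp add: contract_def)
  qed
  moreover have "\<omega> ((k, \<lambda>c. D c + D' c) # Xs) = \<omega> ((k, D) # Xs) + \<omega> ((k, D') # Xs)"
    if "D \<in> ders B k" "D' \<in> ders B k" for k D D' Xs
    using ad[OF that] by (simp add: contract_def fun_eq_iff)
  moreover have "\<omega> ((i + k, \<lambda>c. gmul B f (D c)) # Xs) = sg (i * shifted_deg Xs) (gmul B f (\<omega> ((k, D) # Xs)))"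
    if "f \<in> part B i" "D \<in> ders B k" for i k f D Xs
    using ml[OF that] by (simp add: contract_def fmul_def fun_eq_iff)
  ultimately show ?thesis
    unfolding iforms_def by blast
qed

text \<open>Linearity needs an argument: the first slot of \<open>contract Z \<omega>\<close> is the
  second slot of \<omega>, and graded symmetry brings it to the front.\<close>

lemma iforms_contract:
  assumes w: "\<omega> \<in> iforms (Suc p) q" and Z: "is_der Z"
  shows "contract Z \<omega> \<in> iforms p (q + fst Z)"
proof -
  have sw: "\<omega> (Z # X # Xs) = sg ((fst Z - 1) * (fst X - 1)) (\<omega> (X # Z # Xs))" if "is_der X" for X Xs
    using iforms_swap[OF w Z that] by (simp add: contract_def fun_eq_iff form_apply)
  have "contract Z \<omega> Xs = 0" if "Xs \<notin> der_lists B \<or> length Xs \<noteq> p" for Xs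
    using w that by (simp add: iforms_def contract_def)
  moreover have "contract Z \<omega> Xs \<in> part B (q + fst Z + tot_deg Xs)" if "Xs \<in> der_lists B" "length Xs = p" for Xs
  proof -
    have "Z # Xs \<in> der_lists B" "length (Z # Xs) = Suc p" using that Z by simp_all
    then have "\<omega> (Z # Xs) \<in> part B (q + tot_deg (Z # Xs))" using w unfolding iforms_def by blast
    then show ?thesis by (simp add: contract_def add.assoc)
  qed
  moreover have "contract Z \<omega> (Xs @ [X, Y] @ Ys) = sg ((fst X - 1) * (fst Y - 1)) (contract Z \<omega> (Xs @ [Y, X] @ Ys))"
    if "Xs @ [X, Y] @ Ys \<in> der_lists B" for Xs X Y Ys
  proof -
    have "(Z # Xs) @ [X, Y] @ Ys \<in> der_lists B" using that Z by simp
    then have "\<omega> ((Z # Xs) @ [X, Y] @ Ys) = sg ((fst X - 1) * (fst Y - 1)) (\<omega> ((Z # Xs) @ [Y, X] @ Ys))"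
      using w unfolding iforms_def by blast
    then show ?thesis by (simp add: contract_def)
  qed
  moreover have "contract Z \<omega> ((k, \<lambda>c. D c + D' c) # Xs) = contract Z \<omega> ((k, D) # Xs) + contract Z \<omega> ((k, D') # Xs)"
    if "D \<in> ders B k" "D' \<in> ders B k" for k D D' Xs
    using fun_cong[OF iforms_add_der[OF w that], of "Z # Xs"] that
    by (simp add: contract_def sw ders_add sg_add)
  moreover have "contract Z \<omega> ((i + k, \<lambda>c. gmul B f (D c)) # Xs) =
      sg (i * shifted_deg Xs) (gmul B f (contract Z \<omega> ((k, D) # Xs)))"
    if "f \<in> part B i" "D \<in> ders B k" for i k f D Xs
    using fun_cong[OF iforms_mul_der[OF w that], of "Z # Xs"] that
    by (simp add: contract_def sw ders_mul fmul_def sg_sg mul_sg_right)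
      (intro sg_cong_even, simp add: algebra_simps)
  ultimately show ?thesis
    unfolding iforms_def by blast
qed

lemma iforms_out: "\<omega> \<in> iforms p q \<Longrightarrow> Xs \<notin> der_lists B \<or> length Xs \<noteq> p \<Longrightarrow> \<omega> Xs = 0"
  by (simp add: iforms_def)

lemma iforms_Nil: "\<omega> \<in> iforms (Suc p) q \<Longrightarrow> \<omega> [] = 0"
  by (simp add: iforms_def)

lemma iforms_part: "\<omega> \<in> iforms p q \<Longrightarrow> \<omega> Xs \<in> part B (q + tot_deg Xs)"
  by (cases "Xs \<in> der_lists B \<and> length Xs = p") (auto simp: iforms_def)

lemma iforms_AP: "\<omega> \<in> iforms p q \<Longrightarrow> \<omega> Xs \<in> AP"
  by (rule part_AP[OF iforms_part])

lemma iforms_zero [simp]: "0 \<in> iforms p q"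
  by (auto simp: iforms_def)

lemma iforms_add:
  assumes w: "\<omega> \<in> iforms p q" and w': "\<omega>' \<in> iforms p q"
  shows "\<omega> + \<omega>' \<in> iforms p q"
proof -
  have "(\<omega> + \<omega>') (Xs @ [X, Y] @ Ys) = sg ((fst X - 1) * (fst Y - 1)) ((\<omega> + \<omega>') (Xs @ [Y, X] @ Ys))"
    if "Xs @ [X, Y] @ Ys \<in> der_lists B" for Xs X Y Ys
    by (simp only: plus_fun_apply iforms_swap_at[OF w that] iforms_swap_at[OF w' that] sg_add)
  moreover have "(\<omega> + \<omega>') ((k, \<lambda>c. D c + D' c) # Xs) = (\<omega> + \<omega>') ((k, D) # Xs) + (\<omega> + \<omega>') ((k, D') # Xs)"
    if "D \<in> ders B k" "D' \<in> ders B k" for k D D' Xs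
    using fun_cong[OF iforms_add_der[OF w that], of Xs] fun_cong[OF iforms_add_der[OF w' that], of Xs]
    by (simp add: contract_def)
  moreover have "(\<omega> + \<omega>') ((i + k, \<lambda>c. gmul B f (D c)) # Xs) =
      sg (i * shifted_deg Xs) (gmul B f ((\<omega> + \<omega>') ((k, D) # Xs)))"
    if "f \<in> part B i" "D \<in> ders B k" for i k f D Xs
    using fun_cong[OF iforms_mul_der[OF w that], of Xs] fun_cong[OF iforms_mul_der[OF w' that], of Xs]
    by (simp add: contract_def fmul_def mul_add_right sg_add)
  moreover have "(\<omega> + \<omega>') Xs = 0" if "Xs \<notin> der_lists B \<or> length Xs \<noteq> p" for Xs
    using w w' that by (simp add: iforms_out)
  moreover have "(\<omega> + \<omega>') Xs \<in> part B (q + tot_deg Xs)" for Xs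
    using w w' by (simp add: iforms_part part_add)
  ultimately show ?thesis unfolding iforms_def by blast
qed

lemma iforms_map:
  assumes w: "\<omega> \<in> iforms p q"
    and T: "\<And>x y. T (x + y) = T x + T y" "\<And>i x. x \<in> part B i \<Longrightarrow> T x \<in> part B i" "\<And>k x. T (sg k x) = sg k (T x)"
      "\<And>f x. T (gmul B f x) = gmul B f (T x)"
  shows "(\<lambda>Xs. T (\<omega> Xs)) \<in> iforms p q"
proof -
  have [simp]: "T 0 = 0" using T(1)[of 0 0] by simp
  have "T (\<omega> (Xs @ [X, Y] @ Ys)) = sg ((fst X - 1) * (fst Y - 1)) (T (\<omega> (Xs @ [Y, X] @ Ys)))"
    if "Xs @ [X, Y] @ Ys \<in> der_lists B" for Xs X Y Ys
    by (simp only: iforms_swap_at[OF w that] T)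
  moreover have "T (\<omega> ((k, \<lambda>c. D c + D' c) # Xs)) = T (\<omega> ((k, D) # Xs)) + T (\<omega> ((k, D') # Xs))"
    if "D \<in> ders B k" "D' \<in> ders B k" for k D D' Xs
    using fun_cong[OF iforms_add_der[OF w that], of Xs]
    by (simp add: contract_def T)
  moreover have "T (\<omega> ((i + k, \<lambda>c. gmul B f (D c)) # Xs)) =
      sg (i * shifted_deg Xs) (gmul B f (T (\<omega> ((k, D) # Xs))))"
    if "f \<in> part B i" "D \<in> ders B k" for i k f D Xs
    using fun_cong[OF iforms_mul_der[OF w that], of Xs]
    by (simp add: contract_def fmul_def T)
  moreover have "T (\<omega> Xs) = 0" if "Xs \<notin> der_lists B \<or> length Xs \<noteq> p" for Xs
    using w that by (simp add: iforms_out)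
  moreover have "T (\<omega> Xs) \<in> part B (q + tot_deg Xs)" for Xs
    using w by (simp add: iforms_part T)
  ultimately show ?thesis unfolding iforms_def by blast
qed

lemma iforms_minus: "\<omega> \<in> iforms p q \<Longrightarrow> - \<omega> \<in> iforms p q"
  using iforms_map[of \<omega> p q uminus] by (simp add: part_minus sg_minus mul_minus_right fun_Compl_def)

lemma iforms_diff: "\<omega> \<in> iforms p q \<Longrightarrow> \<omega>' \<in> iforms p q \<Longrightarrow> \<omega> - \<omega>' \<in> iforms p q"
  using iforms_add[of \<omega> p q "- \<omega>'"] iforms_minus by simp

lemma iforms_sg: "\<omega> \<in> iforms p q \<Longrightarrow> sg k \<omega> \<in> iforms p q"
  by (simp add: sg_def iforms_minus)

lemma iforms_scale: "\<omega> \<in> iforms p q \<Longrightarrow> form_scale B r \<omega> \<in> iforms p q"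
  unfolding form_scale_def by (rule iforms_map) (simp_all add: scale_add part_scale scale_sg mul_scale_right)

text \<open>A class on which the calculus is additive, derivations being additive only on
  \<open>all_parts\<close>. It admits sums of different bidegrees, and L, d and contractions
  preserve it without any check of symmetry or linearity.\<close>

definition sforms :: "'c form set" where
  "sforms = {\<omega>. (\<forall>Xs. \<omega> Xs \<in> AP) \<and> (\<forall>Xs. Xs \<notin> der_lists B \<longrightarrow> \<omega> Xs = 0)}"

definition gforms :: "'c form set" where
  "gforms = (\<Union>p q. iforms p q)"

lemma gforms_sforms [simp]: "\<omega> \<in> gforms \<Longrightarrow> \<omega> \<in> sforms"
  by (auto simp: gforms_def sforms_def iforms_AP iforms_out)

lemma iforms_gforms: "\<omega> \<in> iforms p q \<Longrightarrow> \<omega> \<in> gforms"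
  by (auto simp: gforms_def)

lemma iforms_sforms: "\<omega> \<in> iforms p q \<Longrightarrow> \<omega> \<in> sforms"
  by (rule gforms_sforms[OF iforms_gforms])

lemma sforms_AP: "\<omega> \<in> sforms \<Longrightarrow> \<omega> Xs \<in> AP"
  by (simp add: sforms_def)

lemma sforms_out: "\<omega> \<in> sforms \<Longrightarrow> Xs \<notin> der_lists B \<Longrightarrow> \<omega> Xs = 0"
  by (simp add: sforms_def)

lemma sforms_zero [simp]: "0 \<in> sforms"
  and sforms_add [simp]: "\<omega> \<in> sforms \<Longrightarrow> \<omega>' \<in> sforms \<Longrightarrow> \<omega> + \<omega>' \<in> sforms"
  and sforms_diff [simp]: "\<omega> \<in> sforms \<Longrightarrow> \<omega>' \<in> sforms \<Longrightarrow> \<omega> - \<omega>' \<in> sforms"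
  and sforms_minus [simp]: "\<omega> \<in> sforms \<Longrightarrow> - \<omega> \<in> sforms"
  and sforms_sg [simp]: "\<omega> \<in> sforms \<Longrightarrow> sg k \<omega> \<in> sforms"
  by (auto simp: sforms_def AP_add AP_diff AP_minus AP_sg form_apply)

lemma sforms_sum: "(\<And>j. j \<in> J \<Longrightarrow> f j \<in> sforms) \<Longrightarrow> (\<Sum>j\<in>J. f j) \<in> sforms"
  by (induction J rule: infinite_finite_induct) auto

lemma sforms_contract [simp]: "\<omega> \<in> sforms \<Longrightarrow> contract X \<omega> \<in> sforms"
  by (auto simp: sforms_def contract_def)

lemma sforms_fmul [simp]: "\<omega> \<in> sforms \<Longrightarrow> f \<in> part B i \<Longrightarrow> fmul j f \<omega> \<in> sforms"
  by (auto simp: sforms_def fmul_def AP_sg AP_mul part_AP)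

lemma sforms_scale [simp]: "\<omega> \<in> sforms \<Longrightarrow> form_scale B r \<omega> \<in> sforms"
  by (auto simp: sforms_def form_scale_def AP_scale)

lemma gforms_contract [simp]: "\<omega> \<in> gforms \<Longrightarrow> is_der X \<Longrightarrow> contract X \<omega> \<in> gforms"
proof -
  assume w: "\<omega> \<in> gforms" and X: "is_der X"
  from w obtain p q where w: "\<omega> \<in> iforms p q" by (auto simp: gforms_def)
  show "contract X \<omega> \<in> gforms"
  proof (cases p)
    case 0
    then have "contract X \<omega> = 0" using w iforms_0_contract by blast
    then show ?thesis using iforms_gforms[OF iforms_zero] by simp
  qed (use w iforms_contract[OF _ X] in \<open>blast intro: iforms_gforms\<close>)
qed

lemma gforms_swap: "\<omega> \<in> gforms \<Longrightarrow> is_der X \<Longrightarrow> is_der Y \<Longrightarrow>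
    contract Y (contract X \<omega>) = sg ((fst X - 1) * (fst Y - 1)) (contract X (contract Y \<omega>))"
  unfolding gforms_def UN_iff by (elim bexE) (rule iforms_swap)

lemma gforms_add_der: "\<omega> \<in> gforms \<Longrightarrow> D \<in> ders B k \<Longrightarrow> D' \<in> ders B k \<Longrightarrow>
    contract (k, \<lambda>c. D c + D' c) \<omega> = contract (k, D) \<omega> + contract (k, D') \<omega>"
  by (auto simp: gforms_def iforms_add_der)

lemma gforms_mul_der: "\<omega> \<in> gforms \<Longrightarrow> f \<in> part B i \<Longrightarrow> D \<in> ders B k \<Longrightarrow>
    contract (i + k, \<lambda>c. gmul B f (D c)) \<omega> = fmul i f (contract (k, D) \<omega>)"
  by (auto simp: gforms_def iforms_mul_der)

lemma gforms_zero_der: "\<omega> \<in> gforms \<Longrightarrow> contract (k, \<lambda>c. 0) \<omega> = 0"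
  using gforms_add_der[of \<omega> "\<lambda>c. 0" k "\<lambda>c. 0"] by simp

lemma gforms_minus_der: "\<omega> \<in> gforms \<Longrightarrow> D \<in> ders B k \<Longrightarrow> contract (k, \<lambda>c. - D c) \<omega> = - contract (k, D) \<omega>"
  using gforms_add_der[of \<omega> D k "\<lambda>c. - D c"]
  by (simp add: ders_minus gforms_zero_der eq_neg_iff_add_eq_0 add.commute)

lemma gforms_sg_der: "\<omega> \<in> gforms \<Longrightarrow> D \<in> ders B k \<Longrightarrow> contract (k, \<lambda>c. sg j (D c)) \<omega> = sg j (contract (k, D) \<omega>)"
  by (cases "even j") (simp_all add: sg_def gforms_minus_der)

lemma gforms_diff_der: "\<omega> \<in> gforms \<Longrightarrow> D \<in> ders B k \<Longrightarrow> D' \<in> ders B k \<Longrightarrow>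
    contract (k, \<lambda>c. D c - D' c) \<omega> = contract (k, D) \<omega> - contract (k, D') \<omega>"
  using gforms_add_der[of \<omega> D k "\<lambda>c. - D' c"] by (simp add: ders_minus gforms_minus_der)

lemma gforms_sum_der: "\<omega> \<in> gforms \<Longrightarrow> (\<And>j. j \<in> J \<Longrightarrow> D j \<in> ders B k) \<Longrightarrow>
    contract (k, \<lambda>c. \<Sum>j\<in>J. D j c) \<omega> = (\<Sum>j\<in>J. contract (k, D j) \<omega>)"
proof (induction J rule: infinite_finite_induct)
  case (insert j J)
  have "contract (k, \<lambda>c. D j c + (\<Sum>j\<in>J. D j c)) \<omega> = contract (k, D j) \<omega> + contract (k, \<lambda>c. \<Sum>j\<in>J. D j c) \<omega>"
    using insert.prems by (intro gforms_add_der ders_sum) simp_all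
  then show ?case using insert.hyps insert.IH[OF insert.prems(1)] insert.prems(2) by simp
qed (simp_all add: gforms_zero_der)

text \<open>Induction on the form degree without naming it. The premise \<open>P 0\<close> serves
  forms of degree 0, whose contractions are 0.\<close>

lemma gforms_induct [consumes 1, case_names zero step]:
  assumes "\<omega> \<in> gforms" and "P 0"
    and "\<And>\<omega>. \<omega> \<in> gforms \<Longrightarrow> (\<And>X. is_der X \<Longrightarrow> P (contract X \<omega>)) \<Longrightarrow> P \<omega>"
  shows "P \<omega>"
proof -
  have "\<omega> \<in> iforms p q \<Longrightarrow> P \<omega>" for p q
  proof (induction p arbitrary: \<omega> q)
    case 0
    show ?case
      by (rule assms(3)[OF iforms_gforms[OF 0]]) (simp add: iforms_0_contract[OF 0] assms(2))
  next
    case (Suc p)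
    show ?case
      by (rule assms(3)[OF iforms_gforms[OF Suc.prems]], rule Suc.IH, rule iforms_contract[OF Suc.prems])
  qed
  then show ?thesis using assms(1) by (auto simp: gforms_def)
qed

text \<open>Contractions are the coordinates of a form: with the value at the empty list they
  determine it. Combined with \<open>gforms_induct\<close>, this proves the identities of the
  calculus by commuting a contraction through both sides.\<close>

lemma sform_ext:
  assumes "\<omega> \<in> sforms" "\<omega>' \<in> sforms" "\<omega> [] = \<omega>' []"
    and "\<And>X. is_der X \<Longrightarrow> contract X \<omega> = contract X \<omega>'"
  shows "\<omega> = \<omega>'"
proof
  fix Xs
  show "\<omega> Xs = \<omega>' Xs"
  proof (cases Xs)
    case (Cons X Ys)
    show ?thesis
    proof (cases "is_der X")
      case True
      then show ?thesis using fun_cong[OF assms(4)[OF True], of Ys] Cons by (simp add: contract_def)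
    qed (use assms Cons in \<open>simp add: sforms_out\<close>)
  qed (use assms in simp)
qed

subsection \<open>Cartan calculus\<close>

end

declare plus_fun_apply [simp del] zero_fun_apply [simp del] minus_apply [simp del] uminus_apply [simp del]

context graded_comm_algebra
begin

abbreviation "L \<equiv> lie B"
abbreviation "d \<equiv> de_rham B"

lemma lie_Nil [simp]: "L X \<omega> [] = snd X (\<omega> [])"
  by (simp add: lie_def)

lemma d_Nil [simp]: "d \<omega> [] = 0"
  by (simp add: de_rham_def)

lemma is_der_snd: "is_der X \<Longrightarrow> snd X \<in> ders B (fst X)"
  by (simp add: is_der_def)

lemma lie_at_AP: "is_der X \<Longrightarrow> (\<And>Ys. \<omega> Ys \<in> AP) \<Longrightarrow> lie_at X \<omega> Xs \<in> AP"
  by (induction Xs arbitrary: \<omega>) (auto simp: der_AP[OF is_der_snd] contract_def intro!: AP_sg AP_diff)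

lemma lie_at_add: "is_der X \<Longrightarrow> (\<And>Ys. \<omega> Ys \<in> AP) \<Longrightarrow> (\<And>Ys. \<omega>' Ys \<in> AP) \<Longrightarrow>
    lie_at X (\<omega> + \<omega>') Xs = lie_at X \<omega> Xs + lie_at X \<omega>' Xs"
proof (induction Xs arbitrary: \<omega> \<omega>')
  case (Cons Y Ys)
  have "lie_at X (contract Y (\<omega> + \<omega>')) Ys = lie_at X (contract Y \<omega>) Ys + lie_at X (contract Y \<omega>') Ys"
    unfolding contract_add by (rule Cons.IH) (simp_all add: Cons.prems contract_apply)
  moreover have "(\<omega> + \<omega>') (der_bracket X Y # Ys) = \<omega> (der_bracket X Y # Ys) + \<omega>' (der_bracket X Y # Ys)"
    by (rule plus_fun_apply)
  ultimately show "lie_at X (\<omega> + \<omega>') (Y # Ys) = lie_at X \<omega> (Y # Ys) + lie_at X \<omega>' (Y # Ys)"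
    by (simp only: lie_at.simps sg_diff sg_add add_diff_add)
qed (simp add: der_add[OF is_der_snd] form_apply)

lemma lie_at_scale: "is_der X \<Longrightarrow> (\<And>Ys. \<omega> Ys \<in> AP) \<Longrightarrow>
    lie_at X (form_scale B r \<omega>) Xs = gscale B r (lie_at X \<omega> Xs)"
proof (induction Xs arbitrary: \<omega>)
  case (Cons Y Ys)
  have "contract Y (form_scale B r \<omega>) = form_scale B r (contract Y \<omega>)"
    by (simp add: fun_eq_iff contract_def form_scale_def)
  moreover have "lie_at X (form_scale B r (contract Y \<omega>)) Ys = gscale B r (lie_at X (contract Y \<omega>) Ys)"
    by (rule Cons.IH) (simp_all add: Cons.prems contract_apply)
  ultimately show ?case
    by (simp only: lie_at.simps scale_diff scale_sg) (simp add: form_scale_def)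
qed (simp add: der_scale[OF is_der_snd] form_scale_def)

lemma de_rham_at_AP: "Xs \<in> der_lists B \<Longrightarrow> (\<And>Ys. \<omega> Ys \<in> AP) \<Longrightarrow> de_rham_at \<omega> Xs \<in> AP"
  by (induction Xs arbitrary: \<omega>) (auto simp: contract_def intro!: AP_sg AP_diff lie_at_AP)

lemma de_rham_at_add: "Xs \<in> der_lists B \<Longrightarrow> (\<And>Ys. \<omega> Ys \<in> AP) \<Longrightarrow> (\<And>Ys. \<omega>' Ys \<in> AP) \<Longrightarrow>
    de_rham_at (\<omega> + \<omega>') Xs = de_rham_at \<omega> Xs + de_rham_at \<omega>' Xs"
proof (induction Xs arbitrary: \<omega> \<omega>')
  case (Cons Y Ys)
  have "de_rham_at (contract Y (\<omega> + \<omega>')) Ys = de_rham_at (contract Y \<omega>) Ys + de_rham_at (contract Y \<omega>') Ys"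
    unfolding contract_add by (rule Cons.IH) (use Cons.prems in \<open>simp_all add: contract_apply\<close>)
  moreover have "lie_at Y (\<omega> + \<omega>') Ys = lie_at Y \<omega> Ys + lie_at Y \<omega>' Ys"
    by (rule lie_at_add) (use Cons.prems in simp_all)
  ultimately show ?case by (simp only: de_rham_at.simps sg_add) (simp only: algebra_simps)
qed simp

lemma de_rham_at_scale: "Xs \<in> der_lists B \<Longrightarrow> (\<And>Ys. \<omega> Ys \<in> AP) \<Longrightarrow>
    de_rham_at (form_scale B r \<omega>) Xs = gscale B r (de_rham_at \<omega> Xs)"
proof (induction Xs arbitrary: \<omega>)
  case (Cons Y Ys)
  have "contract Y (form_scale B r \<omega>) = form_scale B r (contract Y \<omega>)"
    by (simp add: fun_eq_iff contract_def form_scale_def)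
  moreover have "de_rham_at (form_scale B r (contract Y \<omega>)) Ys = gscale B r (de_rham_at (contract Y \<omega>) Ys)"
    by (rule Cons.IH) (use Cons.prems in \<open>simp_all add: contract_apply\<close>)
  moreover have "lie_at Y (form_scale B r \<omega>) Ys = gscale B r (lie_at Y \<omega> Ys)"
    by (rule lie_at_scale) (use Cons.prems in simp_all)
  ultimately show ?case by (simp only: de_rham_at.simps scale_diff scale_sg)
qed simp

lemma sforms_lie [simp]: "is_der X \<Longrightarrow> \<omega> \<in> sforms \<Longrightarrow> L X \<omega> \<in> sforms"
  by (simp add: sforms_def lie_def lie_at_AP)

lemma sforms_d [simp]: "\<omega> \<in> sforms \<Longrightarrow> d \<omega> \<in> sforms"
  by (simp add: sforms_def de_rham_def de_rham_at_AP)

lemma lie_add: "is_der X \<Longrightarrow> \<omega> \<in> sforms \<Longrightarrow> \<omega>' \<in> sforms \<Longrightarrow> L X (\<omega> + \<omega>') = L X \<omega> + L X \<omega>'"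
  by (auto simp: lie_def fun_eq_iff lie_at_add sforms_AP form_apply)

lemma lie_scale: "is_der X \<Longrightarrow> \<omega> \<in> sforms \<Longrightarrow> L X (form_scale B r \<omega>) = form_scale B r (L X \<omega>)"
  by (auto simp: lie_def fun_eq_iff lie_at_scale sforms_AP form_scale_def[of _ _ "\<lambda>Xs. if _ Xs then _ Xs else _"])

lemma lie_zero [simp]: "is_der X \<Longrightarrow> L X 0 = 0"
  using lie_add[of X 0 0] by simp

lemma lie_minus: "is_der X \<Longrightarrow> \<omega> \<in> sforms \<Longrightarrow> L X (- \<omega>) = - L X \<omega>"
  using lie_add[of X \<omega> "- \<omega>"] by (simp add: eq_neg_iff_add_eq_0 add.commute)

lemma lie_diff: "is_der X \<Longrightarrow> \<omega> \<in> sforms \<Longrightarrow> \<omega>' \<in> sforms \<Longrightarrow> L X (\<omega> - \<omega>') = L X \<omega> - L X \<omega>'"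
  using lie_add[of X \<omega> "- \<omega>'"] by (simp add: lie_minus)

lemma lie_sg: "is_der X \<Longrightarrow> \<omega> \<in> sforms \<Longrightarrow> L X (sg k \<omega>) = sg k (L X \<omega>)"
  by (simp add: sg_def lie_minus)

lemma d_add: "\<omega> \<in> sforms \<Longrightarrow> \<omega>' \<in> sforms \<Longrightarrow> d (\<omega> + \<omega>') = d \<omega> + d \<omega>'"
  by (auto simp: de_rham_def fun_eq_iff de_rham_at_add sforms_AP form_apply)

lemma d_scale: "\<omega> \<in> sforms \<Longrightarrow> d (form_scale B r \<omega>) = form_scale B r (d \<omega>)"
  by (auto simp: de_rham_def fun_eq_iff de_rham_at_scale sforms_AP form_scale_def[of _ _ "\<lambda>Xs. if _ Xs then _ Xs else _"])

lemma d_zero [simp]: "d 0 = 0"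
  using d_add[of 0 0] by simp

lemma d_minus: "\<omega> \<in> sforms \<Longrightarrow> d (- \<omega>) = - d \<omega>"
  using d_add[of \<omega> "- \<omega>"] by (simp add: eq_neg_iff_add_eq_0 add.commute)

lemma d_diff: "\<omega> \<in> sforms \<Longrightarrow> \<omega>' \<in> sforms \<Longrightarrow> d (\<omega> - \<omega>') = d \<omega> - d \<omega>'"
  using d_add[of \<omega> "- \<omega>'"] by (simp add: d_minus)

lemma d_sg: "\<omega> \<in> sforms \<Longrightarrow> d (sg k \<omega>) = sg k (d \<omega>)"
  by (simp add: sg_def d_minus)

text \<open>The defining recursion read as [L_X, \<iota>_Y] = \<iota>_[X,Y]. The proofs of the
  Cartan identities use this and \<open>contract_d\<close>, which is [\<iota>_X, d] = L_X, instead
  of the recursive functions.\<close>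

lemma contract_lie:
  assumes "is_der X" "is_der Y" "\<omega> \<in> sforms"
  shows "contract Y (L X \<omega>) = sg (fst X * (fst Y - 1)) (L X (contract Y \<omega>) - contract (der_bracket X Y) \<omega>)"
proof
  fix Xs
  show "contract Y (L X \<omega>) Xs = sg (fst X * (fst Y - 1)) (L X (contract Y \<omega>) - contract (der_bracket X Y) \<omega>) Xs"
    using assms by (cases "Xs \<in> der_lists B") (simp_all add: contract_apply form_apply lie_def sforms_out)
qed

lemma contract_d:
  assumes "is_der X"
  shows "contract X (d \<omega>) = L X \<omega> - sg (fst X) (d (contract X \<omega>))"
proof
  fix Xs
  show "contract X (d \<omega>) Xs = (L X \<omega> - sg (fst X) (d (contract X \<omega>))) Xs"
    using assms by (cases "Xs \<in> der_lists B") (simp_all add: contract_apply form_apply lie_def de_rham_def)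
qed

lemma contract_fmul: "contract Y (fmul i f \<omega>) = sg (i * (fst Y - 1)) (fmul i f (contract Y \<omega>))"
  by (simp add: fun_eq_iff contract_apply form_apply fmul_def sg_sg algebra_simps)

lemma fmul_add: "fmul i f (\<omega> + \<omega>') = fmul i f \<omega> + fmul i f \<omega>'"
  and fmul_diff: "fmul i f (\<omega> - \<omega>') = fmul i f \<omega> - fmul i f \<omega>'"
  and fmul_minus: "fmul i f (- \<omega>) = - fmul i f \<omega>"
  and fmul_sg: "fmul i f (sg k \<omega>) = sg k (fmul i f \<omega>)"
  and fmul_zero [simp]: "fmul i f 0 = 0"
  by (simp_all add: fun_eq_iff fmul_def mul_add_right mul_diff_right mul_minus_right mul_sg_right sg_add sg_diff sg_minus
      form_apply sg_sg add.commute)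

text \<open>Tagged derivations have no sum, so the Jacobi identity is stated after contraction,
  where linearity of the form in its first slot supplies one. The other bracket rules below are
  stated in the same way.\<close>

lemma bracket_jacobi:
  assumes w: "\<omega> \<in> gforms" and X: "is_der X" and Y: "is_der Y" and Z: "is_der Z"
  shows "contract (der_bracket (der_bracket X Y) Z) \<omega> =
    contract (der_bracket X (der_bracket Y Z)) \<omega> - sg (fst X * fst Y) (contract (der_bracket Y (der_bracket X Z)) \<omega>)"
proof -
  note D = is_der_snd[OF X] is_der_snd[OF Y] is_der_snd[OF Z]
  let ?D = "snd (der_bracket X (der_bracket Y Z))" and ?D' = "snd (der_bracket Y (der_bracket X Z))"
  let ?k = "fst X + fst Y + fst Z"
  have "is_der (?k, ?D)" using is_der_bracket[OF X is_der_bracket[OF Y Z]] by (simp add: is_der_def add.assoc)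
  moreover have "is_der (?k, ?D')" using is_der_bracket[OF Y is_der_bracket[OF X Z]]
    by (simp add: is_der_def algebra_simps)
  moreover have e: "der_bracket (der_bracket X Y) Z = (?k, \<lambda>c. ?D c - sg (fst X * fst Y) (?D' c))"
    by (cases "even (fst X)"; cases "even (fst Y)"; cases "even (fst Z)")
      (simp_all add: der_bracket_def fun_eq_iff sg_def der_diff[OF D(1)] der_diff[OF D(2)] der_diff[OF D(3)]
        der_add[OF D(1)] der_add[OF D(2)] der_add[OF D(3)]
        der_AP[OF D(1)] der_AP[OF D(2)] der_AP[OF D(3)] )
  ultimately have "contract (der_bracket (der_bracket X Y) Z) \<omega> =
      contract (?k, ?D) \<omega> - sg (fst X * fst Y) (contract (?k, ?D') \<omega>)"
    unfolding e using gforms_diff_der[OF w, of ?D ?k "\<lambda>c. sg (fst X * fst Y) (?D' c)"]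
    by (simp add: gforms_sg_der[OF w] ders_sg)
  moreover have "(?k, ?D) = der_bracket X (der_bracket Y Z)" "(?k, ?D') = der_bracket Y (der_bracket X Z)"
    by (simp_all add: prod_eq_iff)
  ultimately show ?thesis by simp
qed

lemma bracket_swap:
  assumes w: "\<omega> \<in> gforms" and X: "is_der X" and Y: "is_der Y"
  shows "contract (der_bracket Y X) \<omega> = - sg (fst X * fst Y) (contract (der_bracket X Y) \<omega>)"
proof -
  let ?k = "fst X + fst Y"
  have e: "der_bracket Y X = (?k, \<lambda>c. sg (fst X * fst Y + 1) (snd (der_bracket X Y) c))"
    by (cases "even (fst X)"; cases "even (fst Y)") (simp_all add: der_bracket_def sg_def fun_eq_iff)
  have "snd (der_bracket X Y) \<in> ders B ?k" using is_der_snd[OF is_der_bracket[OF X Y]] by simp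
  then have "contract (der_bracket Y X) \<omega> = sg (fst X * fst Y + 1) (contract (?k, snd (der_bracket X Y)) \<omega>)"
    unfolding e by (simp add: gforms_sg_der[OF w])
  moreover have "(?k, snd (der_bracket X Y)) = der_bracket X Y" by (simp add: prod_eq_iff)
  ultimately show ?thesis by (simp add: sg_def)
qed

lemma bracket_add_right:
  assumes w: "\<omega> \<in> gforms" and X: "is_der X" and D: "D \<in> ders B k" "D' \<in> ders B k"
  shows "contract (der_bracket X (k, \<lambda>c. D c + D' c)) \<omega> =
    contract (der_bracket X (k, D)) \<omega> + contract (der_bracket X (k, D')) \<omega>"
proof -
  note X' = is_der_snd[OF X]
  have e: "der_bracket X (k, \<lambda>c. D c + D' c) =
      (fst X + k, \<lambda>c. snd (der_bracket X (k, D)) c + snd (der_bracket X (k, D')) c)"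
    by (simp add: der_bracket_def fun_eq_iff sg_add der_add[OF X'] der_AP[OF D(1)] der_AP[OF D(2)])
  have "snd (der_bracket X (k, D)) \<in> ders B (fst X + k)" "snd (der_bracket X (k, D')) \<in> ders B (fst X + k)"
    using is_der_snd[OF is_der_bracket[OF X, of "(k, D)"]] is_der_snd[OF is_der_bracket[OF X, of "(k, D')"]] D by simp_all
  then show ?thesis
    unfolding e by (simp add: gforms_add_der[OF w] prod_eq_iff flip: prod.collapse)
      (simp add: der_bracket_def)
qed

lemma bracket_mul_right:
  assumes w: "\<omega> \<in> gforms" and X: "is_der X" and f: "f \<in> part B i" and D: "D \<in> ders B k"
  shows "contract (der_bracket X (i + k, \<lambda>c. gmul B f (D c))) \<omega> =
    fmul (i + fst X) (snd X f) (contract (k, D) \<omega>) + sg (fst X * i) (fmul i f (contract (der_bracket X (k, D)) \<omega>))"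
proof -
  note X' = is_der_snd[OF X]
  let ?b = "snd (der_bracket X (k, D))"
  have Xf: "snd X f \<in> part B (i + fst X)" using der_part[OF X' f] .
  have b: "?b \<in> ders B (fst X + k)"
    using is_der_snd[OF is_der_bracket[OF X, of "(k, D)"]] D by simp
  let ?k = "i + (fst X + k)"
  have e: "der_bracket X (i + k, \<lambda>c. gmul B f (D c)) =
      (?k, \<lambda>c. gmul B (snd X f) (D c) + sg (fst X * i) (gmul B f (?b c)))"
    by (cases "even (fst X)"; cases "even i"; cases "even k")
     (simp_all add: der_bracket_def fun_eq_iff sg_def der_mul[OF X' f] der_AP[OF D] mul_diff_right mul_minus_right mul_add_right)
  have 1: "(\<lambda>c. gmul B (snd X f) (D c)) \<in> ders B ?k"
    using ders_mul[OF Xf D] by (simp add: add.assoc)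
  have 2: "(\<lambda>c. gmul B f (?b c)) \<in> ders B ?k"
    using ders_mul[OF f b] .
  have "contract (?k, \<lambda>c. gmul B (snd X f) (D c)) \<omega> = fmul (i + fst X) (snd X f) (contract (k, D) \<omega>)"
    using gforms_mul_der[OF w Xf D] by (simp add: add.assoc)
  moreover have "contract (?k, \<lambda>c. gmul B f (?b c)) \<omega> = fmul i f (contract (fst X + k, ?b) \<omega>)"
    using gforms_mul_der[OF w f b] .
  moreover have "(fst X + k, ?b) = der_bracket X (k, D)" by (simp add: prod_eq_iff)
  ultimately show ?thesis unfolding e
    by (simp add: gforms_add_der[OF w 1 ders_sg[OF 2]] gforms_sg_der[OF w 2])
qed

text \<open>Contracting with Z reduces the claim to the induction hypothesis and the Jacobi identity
  for X, Y, Z. What remains is a comparison of signs depending on three parities.\<close>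

lemma lie_lie:
  assumes "\<omega> \<in> gforms" and X: "is_der X" and Y: "is_der Y"
  shows "L (der_bracket X Y) \<omega> = L X (L Y \<omega>) - sg (fst X * fst Y) (L Y (L X \<omega>))"
  using assms(1)
proof (induction rule: gforms_induct)
  case zero
  then show ?case using X Y by simp
next
  case (step \<omega>)
  note [simp] = X Y step.hyps
  show ?case
  proof (rule sform_ext)
    show "L (der_bracket X Y) \<omega> [] = (L X (L Y \<omega>) - sg (fst X * fst Y) (L Y (L X \<omega>))) []"
      by (simp add: form_apply der_bracket_def)
  next
    fix Z assume Z [simp]: "is_der Z"
    show "contract Z (L (der_bracket X Y) \<omega>) = contract Z (L X (L Y \<omega>) - sg (fst X * fst Y) (L Y (L X \<omega>)))"
      by (simp add: contract_diff contract_sg contract_lie lie_diff lie_sg step.IH bracket_jacobi)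
        (cases "even (fst X)"; cases "even (fst Y)"; cases "even (fst Z)"; simp add: sg_def)
  qed simp_all
qed

lemma lie_d:
  assumes "\<omega> \<in> gforms" and X: "is_der X"
  shows "L X (d \<omega>) = sg (fst X) (d (L X \<omega>))"
  using assms(1)
proof (induction rule: gforms_induct)
  case zero
  then show ?case using X by simp
next
  case (step \<omega>)
  note [simp] = X step.hyps
  show ?case
  proof (rule sform_ext)
    show "L X (d \<omega>) [] = sg (fst X) (d (L X \<omega>)) []"
      by (simp add: form_apply der_zero[OF is_der_snd[OF X]])
  next
    fix Z assume Z [simp]: "is_der Z"
    show "contract Z (L X (d \<omega>)) = contract Z (sg (fst X) (d (L X \<omega>)))"
      by (simp add: contract_diff contract_sg contract_lie contract_d lie_diff lie_sg d_diff d_sg step.IH lie_lie)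
        (cases "even (fst X)"; cases "even (fst Z)"; simp add: sg_def)
  qed simp_all
qed

text \<open>\<iota>_Z d d = L_Z d - (-1)^|Z| d L_Z + d d \<iota>_Z, where the first two terms cancel
  by \<open>lie_d\<close> and the third vanishes by induction.\<close>

lemma d_d:
  assumes "\<omega> \<in> gforms"
  shows "d (d \<omega>) = 0"
  using assms(1)
proof (induction rule: gforms_induct)
  case (step \<omega>)
  note [simp] = step.hyps
  show ?case
  proof (rule sform_ext)
    fix Z assume Z [simp]: "is_der Z"
    show "contract Z (d (d \<omega>)) = contract Z 0"
      by (simp add: contract_d d_diff d_sg step.IH lie_d)
  qed (simp, simp, simp add: form_apply)
qed simp

lemma lie_fmul:
  assumes "\<omega> \<in> gforms" and X: "is_der X" and f: "f \<in> part B i"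
  shows "L X (fmul i f \<omega>) = fmul (i + fst X) (snd X f) \<omega> + sg (fst X * i) (fmul i f (L X \<omega>))"
  using assms(1)
proof (induction rule: gforms_induct)
  case zero
  then show ?case using X by simp
next
  case (step \<omega>)
  note X' = is_der_snd[OF X]
  note [simp] = X step.hyps sforms_fmul[OF _ f] sforms_fmul[OF _ der_part[OF X' f]]
  show ?case
  proof (rule sform_ext)
    show "L X (fmul i f \<omega>) [] = (fmul (i + fst X) (snd X f) \<omega> + sg (fst X * i) (fmul i f (L X \<omega>))) []"
      by (simp add: form_apply fmul_def der_mul[OF X' f] sforms_AP)
  next
    fix Z assume Z [simp]: "is_der Z"
    show "contract Z (L X (fmul i f \<omega>)) = contract Z (fmul (i + fst X) (snd X f) \<omega> + sg (fst X * i) (fmul i f (L X \<omega>)))"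
      by (simp add: contract_add contract_diff contract_sg contract_lie contract_fmul lie_sg fmul_sg fmul_diff step.IH)
        (cases "even (fst X)"; cases "even (fst Z)"; cases "even i"; simp add: sg_def)
  qed simp_all
qed

lemma lie_der_add:
  assumes "\<omega> \<in> gforms" and D: "D \<in> ders B k" "D' \<in> ders B k"
  shows "L (k, \<lambda>c. D c + D' c) \<omega> = L (k, D) \<omega> + L (k, D') \<omega>"
  using assms(1)
proof (induction rule: gforms_induct)
  case zero
  then show ?case using D by (simp add: ders_add)
next
  case (step \<omega>)
  note [simp] = D step.hyps ders_add
  show ?case
  proof (rule sform_ext)
    fix Z assume Z [simp]: "is_der Z"
    have "contract (der_bracket (k, \<lambda>c. D c + D' c) Z) \<omega> =
        contract (der_bracket (k, D) Z) \<omega> + contract (der_bracket (k, D') Z) \<omega>"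
      by (subst (1 2 3) bracket_swap) (simp_all add: bracket_add_right sg_add)
    then show "contract Z (L (k, \<lambda>c. D c + D' c) \<omega>) = contract Z (L (k, D) \<omega> + L (k, D') \<omega>)"
      by (simp add: contract_add contract_diff contract_sg contract_lie step.IH sg_add[symmetric] algebra_simps)
  qed (simp, simp, simp add: form_apply)
qed

text \<open>In other words L_fX = f \<iota>_X d + (-1)^|fX| d f \<iota>_X, with f \<iota>_X d
  rewritten through L_X and d \<iota>_X. No product with df occurs, and this is exactly what makes d
  \<omega> linear over functions in \<open>d_formI\<close>.\<close>

lemma lie_der_mul:
  assumes "\<omega> \<in> gforms" and f: "f \<in> part B i" and D: "D \<in> ders B k"
  shows "L (i + k, \<lambda>c. gmul B f (D c)) \<omega> =
    sg (i + k) (d (fmul i f (contract (k, D) \<omega>))) + fmul i f (L (k, D) \<omega>) - sg k (fmul i f (d (contract (k, D) \<omega>)))"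
  using assms(1)
proof (induction rule: gforms_induct)
  case zero
  then show ?case using D f by (simp add: ders_mul)
next
  case (step \<omega>)
  let ?X = "(k, D)" and ?fX = "(i + k, \<lambda>c. gmul B f (D c))"
  note [simp] = D step.hyps ders_mul[OF f D] sforms_fmul[OF _ f]
  show ?case
  proof (rule sform_ext)
    show "L ?fX \<omega> [] = (sg (i + k) (d (fmul i f (contract ?X \<omega>))) + fmul i f (L ?X \<omega>)
        - sg k (fmul i f (d (contract ?X \<omega>)))) []"
      by (simp add: form_apply fmul_def)
  next
    fix Z assume Z [simp]: "is_der Z"
    have 1: "contract (der_bracket ?fX Z) \<omega> =
        fmul i f (contract (der_bracket ?X Z) \<omega>) - sg ((i + k) * fst Z) (fmul (i + fst Z) (snd Z f) (contract ?X \<omega>))"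
    proof -
      have a: "contract (der_bracket ?fX Z) \<omega> = - sg (fst Z * fst ?fX) (contract (der_bracket Z ?fX) \<omega>)"
        by (rule bracket_swap) simp_all
      have b: "contract (der_bracket ?X Z) \<omega> = - sg (fst Z * fst ?X) (contract (der_bracket Z ?X) \<omega>)"
        by (rule bracket_swap) simp_all
      show ?thesis unfolding a b
        by (simp add: bracket_mul_right[OF _ _ f D] fmul_minus fmul_sg)
          (cases "even k"; cases "even (fst Z)"; cases "even i"; simp add: sg_def)
    qed
    have 2: "contract Z (contract ?X \<omega>) = sg ((k - 1) * (fst Z - 1)) (contract ?X (contract Z \<omega>))"
      by (subst gforms_swap) simp_all
    show "contract Z (L ?fX \<omega>) = contract Z (sg (i + k) (d (fmul i f (contract ?X \<omega>))) + fmul i f (L ?X \<omega>)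
        - sg k (fmul i f (d (contract ?X \<omega>))))"
      by (simp add: contract_add contract_diff contract_sg contract_lie contract_fmul contract_d lie_sg fmul_sg fmul_diff
          fmul_add d_sg step.IH 1 2 lie_fmul[OF _ _ f])
        (cases "even k"; cases "even (fst Z)"; cases "even i"; simp add: sg_def)
  qed simp_all
qed

lemma lie_form:
  assumes X: "is_der X" and "\<omega> \<in> iforms p q"
  shows "L X \<omega> \<in> iforms p (q + fst X)"
  using assms(2)
proof (induction p arbitrary: \<omega> q)
  case 0
  note w = iforms_gforms[OF 0]
  have "contract Y (L X \<omega>) = 0" if "is_der Y" for Y
    using X that w 0 by (simp add: contract_lie iforms_0_contract)
  moreover have "contract Y (L X \<omega>) = 0" if "\<not> is_der Y" for Y
    using that by (simp add: contract_def lie_def fun_eq_iff form_apply)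
  ultimately have "contract Y (L X \<omega>) = 0" for Y by blast
  then have "L X \<omega> (Y # Ys) = 0" for Y Ys by (metis contract_apply zero_fun_apply)
  then have "\<forall>Xs. Xs \<noteq> [] \<longrightarrow> L X \<omega> Xs = 0" by (metis neq_Nil_conv)
  then show ?case using 0 der_part[OF is_der_snd[OF X]] by (simp add: iforms_0)
next
  case (Suc p)
  note w [simp] = iforms_gforms[OF Suc.prems]
  note [simp] = X
  show ?case
  proof (rule iforms_SucI)
    show "L X \<omega> [] = 0" using Suc.prems der_zero[OF is_der_snd[OF X]] by (simp add: iforms_Nil)
  next
    fix Y assume "\<not> is_der Y"
    then show "contract Y (L X \<omega>) = 0" by (simp add: contract_def lie_def fun_eq_iff form_apply)
  next
    fix Y assume Y: "is_der Y"
    have "L X (contract Y \<omega>) \<in> iforms p (q + fst X + fst Y)"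
      using Suc.IH[OF iforms_contract[OF Suc.prems Y]] by (simp add: algebra_simps)
    moreover have "contract (der_bracket X Y) \<omega> \<in> iforms p (q + fst X + fst Y)"
      using iforms_contract[OF Suc.prems is_der_bracket[OF X Y]] by (simp add: algebra_simps)
    ultimately show "contract Y (L X \<omega>) \<in> iforms p (q + fst X + fst Y)"
      using Y by (simp add: contract_lie iforms_sg iforms_diff)
  next
    fix Y Z assume [simp]: "is_der Y" "is_der Z"
    have 1: "contract Z (contract Y \<omega>) = sg ((fst Y - 1) * (fst Z - 1)) (contract Y (contract Z \<omega>))"
      by (subst gforms_swap) simp_all
    have 2: "contract (der_bracket X Z) (contract Y \<omega>) = sg ((fst Y - 1) * (fst X + fst Z - 1)) (contract Y (contract (der_bracket X Z) \<omega>))"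
      by (subst gforms_swap) simp_all
    have 3: "contract (der_bracket X Y) (contract Z \<omega>) = sg ((fst Z - 1) * (fst X + fst Y - 1)) (contract Z (contract (der_bracket X Y) \<omega>))"
      by (subst gforms_swap) simp_all
    show "contract Z (contract Y (L X \<omega>)) = sg ((fst Y - 1) * (fst Z - 1)) (contract Y (contract Z (L X \<omega>)))"
      by (simp add: contract_lie contract_sg contract_diff 1 2 3 lie_sg)
       (cases "even (fst X)"; cases "even (fst Y)"; cases "even (fst Z)"; simp add: sg_def)
  next
    fix k D D' assume D [simp]: "D \<in> ders B k" "D' \<in> ders B k"
    show "contract (k, \<lambda>c. D c + D' c) (L X \<omega>) = contract (k, D) (L X \<omega>) + contract (k, D') (L X \<omega>)"
      by (simp add: contract_lie ders_add gforms_add_der bracket_add_right lie_add sg_add[symmetric] algebra_simps)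
  next
    fix i f k D assume f: "f \<in> part B i" and D [simp]: "D \<in> ders B k"
    show "contract (i + k, \<lambda>c. gmul B f (D c)) (L X \<omega>) = fmul i f (contract (k, D) (L X \<omega>))"
      by (simp add: contract_lie ders_mul[OF f D] gforms_mul_der[OF w f D] bracket_mul_right[OF w X f D] lie_fmul[OF _ X f]
           fmul_sg fmul_diff)
        (cases "even (fst X)"; cases "even k"; cases "even i"; simp add: sg_def)
  qed
qed

lemma d_formI:
  assumes w: "\<omega> \<in> iforms p q"
    and ct: "\<And>X. is_der X \<Longrightarrow> d (contract X \<omega>) \<in> iforms p (q + fst X)"
  shows "d \<omega> \<in> iforms (Suc p) q"
proof (rule iforms_SucI)
  note [simp] = iforms_gforms[OF w]
  {
    fix Y assume "\<not> is_der Y"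
    then show "contract Y (d \<omega>) = 0" by (simp add: contract_def de_rham_def fun_eq_iff form_apply)
  next
    fix X assume X: "is_der X"
    show "contract X (d \<omega>) \<in> iforms p (q + fst X)"
      using X ct[OF X] lie_form[OF X w] by (simp add: contract_d iforms_sg iforms_diff)
  next
    fix Y Z assume [simp]: "is_der Y" "is_der Z"
    have 1: "contract Z (contract Y \<omega>) = sg ((fst Y - 1) * (fst Z - 1)) (contract Y (contract Z \<omega>))"
      by (subst gforms_swap) simp_all
    have 2: "contract (der_bracket Z Y) \<omega> = - sg (fst Y * fst Z) (contract (der_bracket Y Z) \<omega>)"
      by (subst bracket_swap) simp_all
    show "contract Z (contract Y (d \<omega>)) = sg ((fst Y - 1) * (fst Z - 1)) (contract Y (contract Z (d \<omega>)))"
      by (simp add: contract_lie contract_d contract_sg contract_diff 1 2 d_sg)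
       (cases "even (fst Y)"; cases "even (fst Z)"; simp add: sg_def)
  next
    fix k D D' assume D [simp]: "D \<in> ders B k" "D' \<in> ders B k"
    show "contract (k, \<lambda>c. D c + D' c) (d \<omega>) = contract (k, D) (d \<omega>) + contract (k, D') (d \<omega>)"
      by (simp add: contract_d ders_add gforms_add_der lie_der_add d_add sg_add)
  next
    fix i f k D assume f: "f \<in> part B i" and D [simp]: "D \<in> ders B k"
    show "contract (i + k, \<lambda>c. gmul B f (D c)) (d \<omega>) = fmul i f (contract (k, D) (d \<omega>))"
      by (simp add: contract_d ders_mul[OF f D] gforms_mul_der[OF _ f D] lie_der_mul[OF _ f D] fmul_sg fmul_diff)
  }
qed simp

lemma d_form:
  assumes "\<omega> \<in> iforms p q"
  shows "d \<omega> \<in> iforms (Suc p) q"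
  using assms
proof (induction p arbitrary: \<omega> q)
  case (0 \<omega> q)
  then show ?case by (intro d_formI) (simp_all add: iforms_0_contract)
next
  case (Suc p)
  show ?case by (rule d_formI[OF Suc.prems]) (rule Suc.IH[OF iforms_contract[OF Suc.prems]])
qed

text \<open>\<open>lie_lie\<close> with X = Y yields only 2 L_D^2 = 0, and a general graded algebra
  has no division by 2. The induction uses [D, [D, Z]] = 0 instead.\<close>

lemma lie_square_zero:
  assumes "\<omega> \<in> gforms" and D: "D \<in> ders B 1" and sq: "\<And>c. D (D c) = 0"
  shows "L (1, D) (L (1, D) \<omega>) = 0"
  using assms(1)
proof (induction rule: gforms_induct)
  case zero
  then show ?case using D by simp
next
  case (step \<omega>)
  note [simp] = D step.hyps sq
  show ?case
  proof (rule sform_ext)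
    fix Z assume Z [simp]: "is_der Z"
    have "der_bracket (1, D) (der_bracket (1, D) Z) = (1 + (1 + fst Z), \<lambda>c. 0)"
      by (simp add: der_bracket_def fun_eq_iff der_diff[OF D] der_diff[OF is_der_snd[OF Z]] der_sg[OF D] der_AP[OF D]
          der_AP[OF is_der_snd[OF Z]] AP_sg der_zero[OF is_der_snd[OF Z]]) (simp add: sg_def)
    then show "contract Z (L (1, D) (L (1, D) \<omega>)) = contract Z 0"
      by (simp add: contract_lie contract_sg contract_diff lie_diff lie_sg step.IH gforms_zero_der)
        (simp add: sg_def)
  qed (simp, simp, simp add: form_apply)
qed

end

declare plus_fun_apply [simp] zero_fun_apply [simp] minus_apply [simp] uminus_apply [simp]

subsection \<open>Signed sums over unshuffles\<close>

abbreviation dy :: "nat \<times> 'l \<Rightarrow> int" where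
  "dy y \<equiv> int (fst y) + 1"

definition dg :: "(nat \<times> 'l) list \<Rightarrow> int" where
  "dg ys = (\<Sum>y\<leftarrow>ys. dy y)"

lemma dg_simps [simp]: "dg [] = 0" "dg (y # ys) = dy y + dg ys" "dg (us @ vs) = dg us + dg vs"
  by (simp_all add: dg_def)

lemma dg_sec_degs: "int (sum_list (sec_degs ys)) = dg ys"
  by (induction ys) (simp_all add: sec_degs_def)

lemma dg_nonneg: "0 \<le> dg ys"
  by (induction ys) auto

lemma dg_pos: "ys \<noteq> [] \<Longrightarrow> 0 < dg ys"
  using dg_nonneg[of "tl ys"] by (cases ys) auto

lemma dg_eq_0_iff [simp]: "dg ys = 0 \<longleftrightarrow> ys = []"
  using dg_pos[of ys] by (cases "ys = []") auto

text \<open>The sum over unshuffles is computed by deciding, from left to right, which block an entry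
  joins; an entry that joins the second block is moved past the current first block. Products of
  cochains, the differential and derivations of cochains are all of this shape, so that their
  algebra reduces to inductions on lists.\<close>

fun shsum :: "((nat \<times> 'l) list \<Rightarrow> (nat \<times> 'l) list \<Rightarrow> 'b::ab_group_add) \<Rightarrow> (nat \<times> 'l) list \<Rightarrow> 'b" where
  "shsum F [] = F [] []"
| "shsum F (y # ys) = shsum (\<lambda>u v. F (y # u) v) ys + shsum (\<lambda>u v. sg (dy y * dg u) (F u (y # v))) ys"

lemma nths_shift: "nths (y # ys) (insert 0 (Suc ` S)) = y # nths ys S" "nths (y # ys) (Suc ` S) = nths ys S"
    "nths (y # ys) (- insert 0 (Suc ` S)) = nths ys (- S)" "nths (y # ys) (- Suc ` S) = y # nths ys (- S)"
proof -
  have "{j. Suc j \<in> insert 0 (Suc ` S)} = S" "{j. Suc j \<in> Suc ` S} = S"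
    "{j. Suc j \<in> - insert 0 (Suc ` S)} = - S" "{j. Suc j \<in> - Suc ` S} = - S"
    by auto
  then show "nths (y # ys) (insert 0 (Suc ` S)) = y # nths ys S" "nths (y # ys) (Suc ` S) = nths ys S"
    "nths (y # ys) (- insert 0 (Suc ` S)) = nths ys (- S)" "nths (y # ys) (- Suc ` S) = y # nths ys (- S)"
    by (simp_all add: nths_Cons)
qed

text \<open>Splits the subsets according to whether they contain position 0, to match the two
  branches of \<open>shsum\<close>.\<close>

lemma sum_Pow_Suc:
  fixes n :: nat
  shows "(\<Sum>S\<in>Pow {..<Suc n}. g S) = (\<Sum>S\<in>Pow {..<n}. g (insert 0 (Suc ` S)) + (g (Suc ` S) :: 'b::ab_group_add))"
proof -
  let ?a = "\<lambda>S. insert 0 (Suc ` S)" and ?b = "\<lambda>S. Suc ` S"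
  have inj: "inj_on ?a (Pow {..<n})" "inj_on ?b (Pow {..<n})"
    by (auto simp: inj_on_def)
  have "Pow {..<Suc n} = ?a ` Pow {..<n} \<union> ?b ` Pow {..<n}"
  proof (rule set_eqI)
    fix S :: "nat set"
    show "S \<in> Pow {..<Suc n} \<longleftrightarrow> S \<in> ?a ` Pow {..<n} \<union> ?b ` Pow {..<n}"
    proof
      assume S: "S \<in> Pow {..<Suc n}"
      let ?T = "{k. Suc k \<in> S}"
      have "?T \<in> Pow {..<n}" using S by auto
      moreover have "S = (if 0 \<in> S then ?a ?T else ?b ?T)"
        by (auto simp: image_iff) (metis not0_implies_Suc)+
      ultimately show "S \<in> ?a ` Pow {..<n} \<union> ?b ` Pow {..<n}"
        by (auto split: if_splits)
    qed auto
  qed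
  moreover have "?a ` Pow {..<n} \<inter> ?b ` Pow {..<n} = {}" by auto
  ultimately have "(\<Sum>S\<in>Pow {..<Suc n}. g S) = sum g (?a ` Pow {..<n}) + sum g (?b ` Pow {..<n})"
    by (simp add: sum.union_disjoint)
  then show ?thesis using inj by (simp add: sum.reindex sum.distrib)
qed

lemma crossings_shift:
  "crossings (Suc n) (insert 0 (Suc ` S)) = map_prod Suc Suc ` crossings n S"
  "crossings (Suc n) (Suc ` S) = map_prod Suc Suc ` crossings n S \<union> (\<lambda>k. (0, Suc k)) ` (S \<inter> {..<n})"
proof -
  show "crossings (Suc n) (insert 0 (Suc ` S)) = map_prod Suc Suc ` crossings n S"
  proof (rule set_eqI, clarify)
    fix a b show "(a, b) \<in> crossings (Suc n) (insert 0 (Suc ` S)) \<longleftrightarrow> (a, b) \<in> map_prod Suc Suc ` crossings n S"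
      by (cases a; cases b) (auto simp: crossings_def map_prod_def image_iff)
  qed
  show "crossings (Suc n) (Suc ` S) = map_prod Suc Suc ` crossings n S \<union> (\<lambda>k. (0, Suc k)) ` (S \<inter> {..<n})"
  proof (rule set_eqI, clarify)
    fix a b show "(a, b) \<in> crossings (Suc n) (Suc ` S) \<longleftrightarrow>
        (a, b) \<in> map_prod Suc Suc ` crossings n S \<union> (\<lambda>k. (0, Suc k)) ` (S \<inter> {..<n})"
      by (cases a; cases b) (auto simp: crossings_def map_prod_def image_iff)
  qed
qed

lemma finite_crossings [simp]: "finite (crossings n S)"
  by (rule finite_subset[of _ "{..<n} \<times> {..<n}"]) (auto simp: crossings_def)

text \<open>An entry at position 0 outside S is crossed by every entry of S; inside S it takes part
  in no crossing.\<close>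

lemma koszul_shift:
  "koszul (d # ds) (insert 0 (Suc ` S)) = koszul ds S"
  "koszul (d # ds) (Suc ` S) = koszul ds S + (\<Sum>k\<in>S \<inter> {..<length ds}. d * ds ! k)"
proof -
  have inj: "inj_on (map_prod Suc Suc) A" "inj_on (\<lambda>k. (0::nat, Suc k)) B" for A B
    by (auto simp: inj_on_def)
  show "koszul (d # ds) (insert 0 (Suc ` S)) = koszul ds S"
    by (simp add: koszul_def crossings_shift sum.reindex[OF inj(1)] case_prod_beta)
  have "map_prod Suc Suc ` crossings (length ds) S \<inter> (\<lambda>k. (0, Suc k)) ` (S \<inter> {..<length ds}) = {}"
    by (auto simp: map_prod_def)
  then show "koszul (d # ds) (Suc ` S) = koszul ds S + (\<Sum>k\<in>S \<inter> {..<length ds}. d * ds ! k)"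
    by (simp add: koszul_def crossings_shift sum.union_disjoint sum.reindex[OF inj(1)] sum.reindex[OF inj(2)] case_prod_beta)
qed

lemma sum_list_nths: "sum_list (map f (nths ys S)) = (\<Sum>k\<in>S \<inter> {..<length ys}. f (ys ! k) :: 'b::comm_monoid_add)"
proof (induction ys arbitrary: S)
  case (Cons y ys)
  let ?T = "{k. Suc k \<in> S}"
  have "S \<inter> {..<length (y # ys)} = (if 0 \<in> S then {0} else {}) \<union> Suc ` (?T \<inter> {..<length ys})"
    by (auto simp: image_iff less_Suc_eq_0_disj)
  moreover have "(if 0 \<in> S then {0} else {}) \<inter> Suc ` (?T \<inter> {..<length ys}) = {}"
    by auto
  ultimately have "(\<Sum>k\<in>S \<inter> {..<length (y # ys)}. f ((y # ys) ! k)) =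
      (\<Sum>k\<in>(if 0 \<in> S then {0} else {}). f ((y # ys) ! k)) + (\<Sum>k\<in>?T \<inter> {..<length ys}. f (ys ! k))"
    by (simp add: sum.union_disjoint sum.reindex)
  then show ?case by (simp add: nths_Cons Cons.IH)
qed simp

lemma sum_unshuffles:
  "(\<Sum>S\<in>Pow {..<length ys}. sg (int (koszul (sec_degs ys) S)) (F (nths ys S) (nths ys (- S)))) = shsum F ys"
proof (induction ys arbitrary: F)
  case Nil
  then show ?case by (simp add: koszul_def crossings_def)
next
  case (Cons y ys)
  have "int (koszul (sec_degs (y # ys)) (Suc ` S)) = int (koszul (sec_degs ys) S) + dy y * dg (nths ys S)" for S
    by (simp add: sec_degs_def koszul_shift dg_def sum_list_nths sum_distrib_left)
      (simp add: algebra_simps)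
  moreover have "koszul (sec_degs (y # ys)) (insert 0 (Suc ` S)) = koszul (sec_degs ys) S" for S
    by (simp add: sec_degs_def koszul_shift)
  ultimately show ?case
    by (simp add: sum_Pow_Suc nths_shift sum.distrib Cons.IH[symmetric] sg_sg)
qed

lemma shsum_cong:
  assumes "\<And>u v. set u \<union> set v = set ys \<Longrightarrow> dg u + dg v = dg ys \<Longrightarrow> length u + length v = length ys \<Longrightarrow> F u v = G u v"
  shows "shsum F ys = shsum G ys"
  using assms
proof (induction ys arbitrary: F G)
  case (Cons y ys)
  have "shsum (\<lambda>u v. F (y # u) v) ys = shsum (\<lambda>u v. G (y # u) v) ys"
    by (rule Cons.IH, rule Cons.prems) auto
  moreover have "shsum (\<lambda>u v. sg (dy y * dg u) (F u (y # v))) ys = shsum (\<lambda>u v. sg (dy y * dg u) (G u (y # v))) ys"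
    by (rule Cons.IH, rule arg_cong[where f = "sg _"], rule Cons.prems) auto
  ultimately show ?case by simp
qed simp

lemma shsum_hom:
  assumes T: "\<And>x y. T (x + y) = T x + T (y::'b::ab_group_add)"
  shows "T (shsum F ys) = shsum (\<lambda>u v. T (F u v) :: 'c::ab_group_add) ys"
proof -
  have T0: "T 0 = 0" using T[of 0 0] by simp
  have "T (- x) = - T x" for x using T[of x "- x"] T0 by (simp add: eq_neg_iff_add_eq_0 add.commute)
  then have sg: "T (sg k x) = sg k (T x)" for k x by (simp add: sg_def)
  show ?thesis by (induction ys arbitrary: F) (simp_all add: T sg)
qed

lemma shsum_add: "shsum (\<lambda>u v. F u v + G u v) ys = shsum F ys + shsum G ys"
  by (induction ys arbitrary: F G) (simp_all add: sg_add algebra_simps)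

lemma shsum_minus: "shsum (\<lambda>u v. - F u v) ys = - shsum F ys"
  by (rule shsum_hom[symmetric]) simp

lemma shsum_diff: "shsum (\<lambda>u v. F u v - G u v) ys = shsum F ys - shsum G ys"
  using shsum_add[of F "\<lambda>u v. - G u v" ys] by (simp add: shsum_minus)

lemma shsum_sg: "shsum (\<lambda>u v. sg k (F u v)) ys = sg k (shsum F ys)"
  by (rule shsum_hom[symmetric]) (rule sg_add)

lemma shsum_zero [simp]: "shsum (\<lambda>u v. 0) ys = 0"
  by (induction ys) simp_all

lemma shsum_mult_left: "shsum (\<lambda>u v. f * F u v) ys = f * (shsum F ys :: 'a::ring)"
  by (rule shsum_hom[symmetric]) (rule distrib_left)

lemma shsum_mult_right: "shsum (\<lambda>u v. F u v * f) ys = (shsum F ys :: 'a::ring) * f"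
  by (rule shsum_hom[symmetric]) (rule distrib_right)

lemma shsum_sum: "shsum (\<lambda>u v. \<Sum>j\<in>J. F j u v) ys = (\<Sum>j\<in>J. shsum (F j) ys)"
  by (induction J rule: infinite_finite_induct) (simp_all add: shsum_add)

text \<open>Both sides run over the unshuffles into three blocks. An entry joining the third block
  passes the first two, with the same sign whether they are counted together or one after the
  other.\<close>

lemma shsum_coassoc: "shsum (\<lambda>w t. shsum (\<lambda>u s. F u s t) w) ys = shsum (\<lambda>u w. shsum (\<lambda>s t. F u s t) w) ys"
proof (induction ys arbitrary: F)
  case (Cons y ys)
  have "shsum (\<lambda>w t. sg (dy y * dg w) (shsum (\<lambda>u s. F u s (y # t)) w)) ys =
      shsum (\<lambda>w t. shsum (\<lambda>u s. sg (dy y * dg u) (sg (dy y * dg s) (F u s (y # t)))) w) ys"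
  proof (rule shsum_cong)
    fix w t
    show "sg (dy y * dg w) (shsum (\<lambda>u s. F u s (y # t)) w) =
      shsum (\<lambda>u s. sg (dy y * dg u) (sg (dy y * dg s) (F u s (y # t)))) w"
      unfolding shsum_sg[symmetric]
      by (rule shsum_cong) (simp add: sg_sg flip: distrib_left)
  qed
  then show ?case
    by (simp add: shsum_add sg_add Cons.IH shsum_sg add.assoc)
qed simp

lemma shsum_cocomm: "shsum F ys = shsum (\<lambda>u v. sg (dg u * dg v) (F v u)) ys"
proof (induction ys arbitrary: F)
  case (Cons y ys)
  have 1: "shsum (\<lambda>u v. F (y # u) v) ys = shsum (\<lambda>u v. sg (dy y * dg u) (sg (dg u * dg (y # v)) (F (y # v) u))) ys"
    unfolding Cons.IH[of "\<lambda>u v. F (y # u) v"]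
    by (rule shsum_cong) (auto simp: sg_sg intro!: sg_cong_even)
  have 2: "shsum (\<lambda>u v. sg (dy y * dg u) (F u (y # v))) ys = shsum (\<lambda>u v. sg (dg (y # u) * dg v) (F v (y # u))) ys"
    unfolding Cons.IH[of "\<lambda>u v. sg (dy y * dg u) (F u (y # v))"]
    by (rule shsum_cong) (auto simp: sg_sg algebra_simps)
  show ?case unfolding shsum.simps 1 2 by (rule add.commute)
qed simp

lemma shsum_Nil_left: "shsum (\<lambda>u v. if u = [] then G v else 0) ys = G ys"
proof (induction ys arbitrary: G)
  case (Cons y ys)
  have "shsum (\<lambda>u v. sg (dy y * dg u) (if u = [] then G (y # v) else 0)) ys = shsum (\<lambda>u v. if u = [] then G (y # v) else 0) ys"
    by (rule shsum_cong) simp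
  then show ?case by (simp add: Cons.IH)
qed simp

lemma shsum_Nil_right: "shsum (\<lambda>u v. if v = [] then G u else 0) ys = G ys"
  by (induction ys arbitrary: G) simp_all

lemma sum_fun_apply: "(\<Sum>j\<in>J. f j) x = (\<Sum>j\<in>J. f j x)"
  by (induction J rule: infinite_finite_induct) simp_all

lemma ce_alg_simps [simp]: "part (ce_alg E) = cochains E" "gmul (ce_alg E) = cochain_mult"
    "gscale (ce_alg E) r c = (\<lambda>ys. base E r * c ys)"
  by (simp_all add: ce_alg_def)

lemma base_alg_simps [simp]: "part (base_alg E) i = (if i = 0 then UNIV else {0})" "gmul (base_alg E) = (*)"
    "gscale (base_alg E) r f = base E r * f"
  by (simp_all add: base_alg_def)

lemma cochain_mult_shsum: "cochain_mult c c' ys = shsum (\<lambda>u v. c u * c' v) ys"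
  unfolding cochain_mult_def by (rule sum_unshuffles)

lemma sg_mult_left: "sg k (x::'b::ring) * y = sg k (x * y)"
  and sg_mult_right: "x * sg k (y::'b::ring) = sg k (x * y)"
  by (simp_all add: sg_def)

section \<open>The base algebra and the modules of sections\<close>

locale linfty_alg =
  fixes E :: "('k::field_char_0, 'a::comm_ring_1, 'l::ab_group_add) linfty"
  assumes algebroid: "linfty_algebroid E"
begin

lemma algebra_map_base: "algebra_map (base E)"
  and module_act: "module (act E)"
  and sec_proj_all: "\<forall>i. fg_projective (act E) (sections E i)"
  using algebroid[unfolded linfty_algebroid_def, THEN conjunct1]
    algebroid[unfolded linfty_algebroid_def, THEN conjunct2, THEN conjunct1]
    algebroid[unfolded linfty_algebroid_def, THEN conjunct2, THEN conjunct2, THEN conjunct1]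
  by auto

lemma base_one [simp]: "base E 1 = 1"
  and base_add: "base E (r + s) = base E r + base E s"
  and base_mult: "base E (r * s) = base E r * base E s"
  using algebra_map_base by (simp_all add: algebra_map_def)

lemma base_zero [simp]: "base E 0 = 0"
  using base_add[of 0 0] by simp

lemma base_of_nat: "base E (of_nat n) = of_nat n"
  by (induction n) (simp_all add: base_add)

lemma base_minus: "base E (- r) = - base E r"
  using base_add[of r "- r"] by (simp add: eq_neg_iff_add_eq_0 add.commute)

lemma base_of_int: "base E (of_int n) = of_int n"
  by (cases n rule: int_cases2) (simp_all add: base_of_nat base_minus)

lemma base_inverse: "n \<noteq> 0 \<Longrightarrow> base E (1 / of_int n) * of_int n = 1"
  unfolding base_of_int[symmetric] base_mult[symmetric] by simp

text \<open>\<O>(U) may have zero divisors, but nonzero integers are units in it, as images of units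
  of a field of characteristic zero.\<close>

lemma of_int_cancel: "n \<noteq> 0 \<Longrightarrow> of_int n * (x::'a) = of_int n * y \<Longrightarrow> x = y"
  by (metis base_inverse mult.assoc mult_1)

lemma double_zero: "(x::'a) = - x \<Longrightarrow> x = 0"
proof (rule of_int_cancel[of 2])
  assume *: "x = - x"
  have "x + x = - x + x" using arg_cong[OF *, of "\<lambda>z. z + x"] .
  also have "\<dots> = 0" by simp
  finally show "of_int 2 * x = of_int 2 * 0" by (simp only: of_int_numeral mult_2 mult_zero_right)
qed simp

interpretation module "act E"
  by (rule module_act)

lemmas act_add_right = scale_right_distrib
  and act_add_left = scale_left_distrib
  and act_act = scale_scale
  and act_one [simp] = scale_one
  and act_zero_left [simp] = scale_zero_left
  and act_zero_right [simp] = scale_zero_right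
  and act_minus_left = scale_minus_left
  and act_minus_right = scale_minus_right
  and act_sum_right = scale_sum_right

lemma sec_proj: "fg_projective (act E) (sections E i)"
  using sec_proj_all by blast

lemma sec_zero [simp]: "0 \<in> sections E i"
  and sec_add: "x \<in> sections E i \<Longrightarrow> y \<in> sections E i \<Longrightarrow> x + y \<in> sections E i"
  and sec_act: "x \<in> sections E i \<Longrightarrow> act E f x \<in> sections E i"
  using sec_proj[of i] by (auto simp: fg_projective_def subspace_def)

lemma sec_minus: "x \<in> sections E i \<Longrightarrow> - x \<in> sections E i"
  using sec_act[of x i "-1"] by (simp add: act_minus_left)

lemma sec_sg: "x \<in> sections E i \<Longrightarrow> sg k x \<in> sections E i"
  by (simp add: sg_def sec_minus)

lemma sec_sum: "(\<And>j. j \<in> J \<Longrightarrow> g j \<in> sections E i) \<Longrightarrow> (\<Sum>j\<in>J. g j) \<in> sections E i"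
  by (induction J rule: infinite_finite_induct) (auto intro: sec_add)

lemma act_sg: "act E f (sg k x) = sg k (act E f x)"
  by (simp add: sg_def act_minus_right)

abbreviation "SL \<equiv> sec_lists E"

lemma SL_simps [simp]: "[] \<in> SL" "y # ys \<in> SL \<longleftrightarrow> snd y \<in> sections E (fst y) \<and> ys \<in> SL"
    "us @ vs \<in> SL \<longleftrightarrow> us \<in> SL \<and> vs \<in> SL"
  by (auto simp: sec_lists_def)

lemma SL_split:
  assumes "set u \<union> set v = set ys" shows "ys \<in> SL \<longleftrightarrow> u \<in> SL \<and> v \<in> SL"
  unfolding sec_lists_def mem_Collect_eq assms[symmetric] ball_Un ..

subsection \<open>Graded symmetric multilinear functions\<close>

definition gsym :: "((nat \<times> 'l) list \<Rightarrow> 'b::ab_group_add) \<Rightarrow> bool" where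
  "gsym \<Phi> \<longleftrightarrow> (\<forall>us y z vs. us @ [y, z] @ vs \<in> SL \<longrightarrow>
     \<Phi> (us @ [y, z] @ vs) = sg (dy y * dy z) (\<Phi> (us @ [z, y] @ vs)))"

definition glin :: "((nat \<times> 'l) list \<Rightarrow> 'a) \<Rightarrow> bool" where
  "glin \<Phi> \<longleftrightarrow> (\<forall>f i x x' vs. (i, x) # (i, x') # vs \<in> SL \<longrightarrow>
        \<Phi> ((i, act E f x + x') # vs) = f * \<Phi> ((i, x) # vs) + \<Phi> ((i, x') # vs))"

lemma gsymD: "gsym \<Phi> \<Longrightarrow> us @ [y, z] @ vs \<in> SL \<Longrightarrow>
    \<Phi> (us @ [y, z] @ vs) = sg (dy y * dy z) (\<Phi> (us @ [z, y] @ vs))"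
  by (simp only: gsym_def)

lemma gsym_Cons: "gsym \<Phi> \<Longrightarrow> snd x \<in> sections E (fst x) \<Longrightarrow> gsym (\<lambda>u. \<Phi> (x # u))"
  unfolding gsym_def by (metis append_Cons SL_simps(2))

lemma gsym_front:
  assumes "gsym \<Phi>"
  shows "us @ y # vs \<in> SL \<Longrightarrow> \<Phi> (us @ y # vs) = sg (dy y * dg us) (\<Phi> (y # us @ vs))"
proof (induction us arbitrary: vs rule: rev_induct)
  case (snoc z us)
  have "\<Phi> (us @ [z, y] @ vs) = sg (dy z * dy y) (\<Phi> (us @ [y, z] @ vs))"
    by (rule gsymD[OF assms]) (use snoc.prems in simp)
  also have "\<Phi> (us @ [y, z] @ vs) = sg (dy y * dg us) (\<Phi> (y # us @ z # vs))"
    using snoc.IH[of "z # vs"] snoc.prems by simp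
  finally show ?case
    by (simp add: sg_sg algebra_simps)
qed simp

text \<open>The adjacent entries y and z can be distributed over the two blocks in four ways. If
  they stay together, the symmetry of F in that block applies; if they part, the two mixed terms
  trade places and their insertion signs differ by that of the swap.\<close>

lemma shsum_swap:
  assumes "\<And>v. v \<in> SL \<Longrightarrow> gsym (\<lambda>u. F u v)" "\<And>u. u \<in> SL \<Longrightarrow> gsym (F u)"
  shows "us @ [y, z] @ vs \<in> SL \<Longrightarrow> shsum F (us @ [y, z] @ vs) = sg (dy y * dy z) (shsum F (us @ [z, y] @ vs))"
  using assms
proof (induction us arbitrary: F)
  case Nil
  then have yz: "snd y \<in> sections E (fst y)" "snd z \<in> sections E (fst z)" "vs \<in> SL" by simp_all
  have 1: "shsum (\<lambda>u v. F (y # z # u) v) vs = sg (dy y * dy z) (shsum (\<lambda>u v. F (z # y # u) v) vs)"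
    unfolding shsum_sg[symmetric]
  proof (rule shsum_cong)
    fix u v assume "set u \<union> set v = set vs"
    then have "u \<in> SL" "v \<in> SL" using yz SL_split by auto
    then show "F (y # z # u) v = sg (dy y * dy z) (F (z # y # u) v)"
      using gsymD[OF Nil.prems(2), of v "[]" y z u] yz by simp
  qed
  have 2: "shsum (\<lambda>u v. sg (dy z * dg u) (sg (dy y * dg u) (F u (y # z # v)))) vs =
      sg (dy y * dy z) (shsum (\<lambda>u v. sg (dy y * dg u) (sg (dy z * dg u) (F u (z # y # v)))) vs)"
    unfolding shsum_sg[symmetric]
  proof (rule shsum_cong)
    fix u v assume "set u \<union> set v = set vs"
    then have "u \<in> SL" "v \<in> SL" using yz SL_split by auto
    then have "F u (y # z # v) = sg (dy y * dy z) (F u (z # y # v))"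
      using gsymD[OF Nil.prems(3), of u "[]" y z v] yz by simp
    then show "sg (dy z * dg u) (sg (dy y * dg u) (F u (y # z # v))) =
        sg (dy y * dy z) (sg (dy y * dg u) (sg (dy z * dg u) (F u (z # y # v))))"
      by (simp add: sg_sg algebra_simps)
  qed
  have 3: "shsum (\<lambda>u v. sg (dy z * dg u) (F (y # u) (z # v))) vs =
      sg (dy y * dy z) (shsum (\<lambda>u v. sg (dy z * dg (y # u)) (F (y # u) (z # v))) vs)"
    unfolding shsum_sg[symmetric] by (rule shsum_cong) (auto simp: sg_sg algebra_simps intro!: sg_cong_even)
  have 4: "shsum (\<lambda>u v. sg (dy y * dg (z # u)) (F (z # u) (y # v))) vs =
      sg (dy y * dy z) (shsum (\<lambda>u v. sg (dy y * dg u) (F (z # u) (y # v))) vs)"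
    unfolding shsum_sg[symmetric] by (rule shsum_cong) (auto simp: sg_sg algebra_simps)
  show ?case
    by (simp only: append.simps shsum.simps shsum_add sg_add 1 2 3 4) (simp only: add_ac)
next
  case (Cons x us)
  have x: "snd x \<in> sections E (fst x)" and l: "us @ [y, z] @ vs \<in> SL" using Cons.prems by simp_all
  have "shsum (\<lambda>u v. F (x # u) v) (us @ [y, z] @ vs) = sg (dy y * dy z) (shsum (\<lambda>u v. F (x # u) v) (us @ [z, y] @ vs))"
    by (rule Cons.IH[OF l]) (use Cons.prems(2,3) x in \<open>auto intro: gsym_Cons\<close>)
  moreover have "shsum (\<lambda>u v. sg (dy x * dg u) (F u (x # v))) (us @ [y, z] @ vs) =
      sg (dy y * dy z) (shsum (\<lambda>u v. sg (dy x * dg u) (F u (x # v))) (us @ [z, y] @ vs))"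
  proof (rule Cons.IH[OF l])
    fix v assume "v \<in> SL"
    then have g: "gsym (\<lambda>u. F u (x # v))" using Cons.prems(2) x by simp
    show "gsym (\<lambda>u. sg (dy x * dg u) (F u (x # v)))"
      unfolding gsym_def
    proof (intro allI impI)
      fix us y z vs assume "us @ [y, z] @ vs \<in> SL"
      from gsymD[OF g this] show "sg (dy x * dg (us @ [y, z] @ vs)) (F (us @ [y, z] @ vs) (x # v)) =
          sg (dy y * dy z) (sg (dy x * dg (us @ [z, y] @ vs)) (F (us @ [z, y] @ vs) (x # v)))"
        by (simp add: sg_sg algebra_simps)
    qed
  next
    fix u assume "u \<in> SL"
    then have g: "gsym (\<lambda>v. F u (x # v))" using Cons.prems(3) x gsym_Cons by blast
    show "gsym (\<lambda>v. sg (dy x * dg u) (F u (x # v)))"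
      unfolding gsym_def
    proof (intro allI impI)
      fix us y z vs assume "us @ [y, z] @ vs \<in> SL"
      from gsymD[OF g this] show "sg (dy x * dg u) (F u (x # us @ [y, z] @ vs)) =
          sg (dy y * dy z) (sg (dy x * dg u) (F u (x # us @ [z, y] @ vs)))"
        by (simp add: sg_sg algebra_simps)
    qed
  qed
  ultimately show ?case by (simp add: sg_add)
qed

text \<open>Selecting one entry and writing it in front costs the sign of moving it there, which the
  symmetry of \<Phi> undoes; so every choice contributes \<Phi> w with its weight. This yields the
  eigenvalue of the Euler derivation and the factor n + 1 for anchors.\<close>

lemma shsum_single:
  fixes \<Phi> :: "(nat \<times> 'l) list \<Rightarrow> 'b::ring"
  assumes "gsym \<Phi>" "w \<in> SL"
  shows "shsum (\<lambda>s u. if length s = 1 then wt (hd s) * \<Phi> (s @ u) else 0) w = (\<Sum>y\<leftarrow>w. wt y) * \<Phi> w"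
  using assms
proof (induction w arbitrary: \<Phi>)
  case (Cons y w)
  have "shsum (\<lambda>s u. sg (dy y * dg s) (if length s = 1 then wt (hd s) * \<Phi> (s @ y # u) else 0)) w =
      shsum (\<lambda>s u. if length s = 1 then wt (hd s) * \<Phi> (y # s @ u) else 0) w"
  proof (rule shsum_cong)
    fix s u assume "set s \<union> set u = set w"
    then have "s @ y # u \<in> SL" using Cons.prems SL_split[of s u w] by simp
    from gsym_front[OF Cons.prems(1) this]
    show "sg (dy y * dg s) (if length s = 1 then wt (hd s) * \<Phi> (s @ y # u) else 0) =
        (if length s = 1 then wt (hd s) * \<Phi> (y # s @ u) else 0)"
      by (simp only: sg_mult_right sg_sg sg_double sg_zero split: if_split) simp
  qed
  also have "\<dots> = (\<Sum>y\<leftarrow>w. wt y) * \<Phi> (y # w)"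
    using Cons.prems by (intro Cons.IH gsym_Cons) simp_all
  finally have 2: "shsum (\<lambda>s u. sg (dy y * dg s) (if length s = 1 then wt (hd s) * \<Phi> (s @ y # u) else 0)) w =
      (\<Sum>y\<leftarrow>w. wt y) * \<Phi> (y # w)" .
  have "shsum (\<lambda>s u. if length (y # s) = 1 then wt (hd (y # s)) * \<Phi> ((y # s) @ u) else 0) w =
      shsum (\<lambda>s u. if s = [] then wt y * \<Phi> (y # u) else 0) w"
    by (rule shsum_cong) simp
  then have 1: "shsum (\<lambda>s u. if length (y # s) = 1 then wt (hd (y # s)) * \<Phi> ((y # s) @ u) else 0) w = wt y * \<Phi> (y # w)"
    by (simp only: shsum_Nil_left)
  show ?case
    unfolding shsum.simps 1 2 by (simp add: distrib_right)
qed simp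

subsection \<open>The algebra of cochains\<close>

lemma cochains_iff: "c \<in> cochains E q \<longleftrightarrow>
    (\<forall>ys. ys \<notin> SL \<or> dg ys \<noteq> q \<longrightarrow> c ys = 0) \<and> gsym c \<and> glin c"
  unfolding cochains_def gsym_def glin_def dg_sec_degs mem_Collect_eq
  by (simp only: of_nat_mult of_nat_add of_nat_1)

lemma cochain_out: "c \<in> cochains E q \<Longrightarrow> ys \<notin> SL \<or> dg ys \<noteq> q \<Longrightarrow> c ys = 0"
  by (simp add: cochains_iff)

lemma gsym_diff:
  assumes "gsym \<Phi>" "gsym \<Psi>" shows "gsym (\<lambda>u. \<Phi> u - \<Psi> u)"
  unfolding gsym_def by (intro allI impI) (simp only: sg_diff gsymD[OF assms(1)] gsymD[OF assms(2)])

lemma gsym_add: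
  assumes "gsym \<Phi>" "gsym \<Psi>" shows "gsym (\<lambda>u. \<Phi> u + \<Psi> u)"
  unfolding gsym_def by (intro allI impI) (simp only: sg_add gsymD[OF assms(1)] gsymD[OF assms(2)])

lemma gsym_mult_right:
  assumes "gsym \<Phi>" shows "gsym (\<lambda>u. \<Phi> u * (x::'b::ring))"
  unfolding gsym_def by (intro allI impI) (simp only: sg_mult_left gsymD[OF assms])

lemma gsym_mult_left:
  assumes "gsym \<Phi>" shows "gsym (\<lambda>u. (x::'b::ring) * \<Phi> u)"
  unfolding gsym_def by (intro allI impI) (simp only: sg_mult_right gsymD[OF assms])

text \<open>The linearity premise concerns the sum of the two terms in which a new entry joins
  either block. For the differential neither term is linear over \<O>(U) alone: the Leibniz term of
  the bracket cancels against the derivative of the coefficient.\<close>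

lemma shsum_in_cochains:
  assumes sup: "\<And>u v. u \<in> SL \<Longrightarrow> v \<in> SL \<Longrightarrow> dg u + dg v \<noteq> q \<Longrightarrow> F u v = 0"
    and "\<And>v. v \<in> SL \<Longrightarrow> gsym (\<lambda>u. F u v)" "\<And>u. u \<in> SL \<Longrightarrow> gsym (F u)"
    and lin: "\<And>f i x x' u v. x \<in> sections E i \<Longrightarrow> x' \<in> sections E i \<Longrightarrow> u \<in> SL \<Longrightarrow> v \<in> SL \<Longrightarrow>
      F ((i, act E f x + x') # u) v + sg ((int i + 1) * dg u) (F u ((i, act E f x + x') # v)) =
      f * (F ((i, x) # u) v + sg ((int i + 1) * dg u) (F u ((i, x) # v))) +
      (F ((i, x') # u) v + sg ((int i + 1) * dg u) (F u ((i, x') # v)))"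
  shows "(\<lambda>ys. if ys \<in> SL then shsum F ys else 0) \<in> cochains E q"
proof -
  have "shsum F ys = 0" if "ys \<in> SL" "dg ys \<noteq> q" for ys
  proof -
    have "shsum F ys = shsum (\<lambda>u v. 0) ys"
    proof (rule shsum_cong)
      fix u v assume "set u \<union> set v = set ys" "dg u + dg v = dg ys"
      then show "F u v = 0" using that SL_split[of u v ys] sup by simp
    qed
    then show ?thesis by simp
  qed
  moreover have "gsym (\<lambda>ys. if ys \<in> SL then shsum F ys else 0)"
    unfolding gsym_def
  proof (intro allI impI)
    fix us y z vs assume l: "us @ [y, z] @ vs \<in> SL"
    then have "us @ [z, y] @ vs \<in> SL" by simp
    with l shsum_swap[of F, OF assms(2,3) l]
    show "(if us @ [y, z] @ vs \<in> SL then shsum F (us @ [y, z] @ vs) else 0) =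
        sg (dy y * dy z) (if us @ [z, y] @ vs \<in> SL then shsum F (us @ [z, y] @ vs) else 0)"
      by (simp only: if_True)
  qed
  moreover have "glin (\<lambda>ys. if ys \<in> SL then shsum F ys else 0)"
    unfolding glin_def
  proof (intro allI impI)
    fix f i x x' vs assume a: "(i, x) # (i, x') # vs \<in> SL"
    have "shsum F ((i, act E f x + x') # vs) = shsum (\<lambda>u v. f * (F ((i, x) # u) v + sg ((int i + 1) * dg u) (F u ((i, x) # v))) +
      (F ((i, x') # u) v + sg ((int i + 1) * dg u) (F u ((i, x') # v)))) vs"
      unfolding shsum.simps shsum_add[symmetric] fst_conv
    proof (rule shsum_cong)
      fix u v assume "set u \<union> set v = set vs"
      then show "F ((i, act E f x + x') # u) v + sg ((int i + 1) * dg u) (F u ((i, act E f x + x') # v)) =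
      f * (F ((i, x) # u) v + sg ((int i + 1) * dg u) (F u ((i, x) # v))) +
      (F ((i, x') # u) v + sg ((int i + 1) * dg u) (F u ((i, x') # v)))"
        using a SL_split[of u v vs] lin by simp
    qed
    also have "\<dots> = f * shsum F ((i, x) # vs) + shsum F ((i, x') # vs)"
      by (simp add: shsum_add shsum_mult_left)
    finally show "(if (i, act E f x + x') # vs \<in> SL then shsum F ((i, act E f x + x') # vs) else 0) =
        f * (if (i, x) # vs \<in> SL then shsum F ((i, x) # vs) else 0) +
        (if (i, x') # vs \<in> SL then shsum F ((i, x') # vs) else 0)"
      using a by (simp add: sec_add sec_act)
  qed
  ultimately show ?thesis by (simp add: cochains_iff)
qed

lemma cochain_mult_cochains:
  assumes c: "c \<in> cochains E i" and c': "c' \<in> cochains E j"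
  shows "cochain_mult c c' \<in> cochains E (i + j)"
proof -
  have g: "gsym c" "gsym c'" "glin c" "glin c'" using c c' by (simp_all add: cochains_iff)
  have "(\<lambda>ys. if ys \<in> SL then shsum (\<lambda>u v. c u * c' v) ys else 0) \<in> cochains E (i + j)"
  proof (rule shsum_in_cochains)
    fix u v :: "(nat \<times> 'l) list" assume "dg u + dg v \<noteq> i + j"
    then have "dg u \<noteq> i \<or> dg v \<noteq> j" by auto
    then show "c u * c' v = 0" using cochain_out[OF c] cochain_out[OF c'] by auto
  next
    fix f i x x' u v assume a: "x \<in> sections E i" "x' \<in> sections E i" "u \<in> SL" "v \<in> SL"
    have "c ((i, act E f x + x') # u) = f * c ((i, x) # u) + c ((i, x') # u)"
      "c' ((i, act E f x + x') # v) = f * c' ((i, x) # v) + c' ((i, x') # v)"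
      using a g(3,4) by (simp_all add: glin_def)
    then show "c ((i, act E f x + x') # u) * c' v + sg ((int i + 1) * dg u) (c u * c' ((i, act E f x + x') # v)) =
       f * (c ((i, x) # u) * c' v + sg ((int i + 1) * dg u) (c u * c' ((i, x) # v))) +
       (c ((i, x') # u) * c' v + sg ((int i + 1) * dg u) (c u * c' ((i, x') # v)))"
      by (simp add: sg_add sg_mult_right algebra_simps)
  qed (use g gsym_mult_left gsym_mult_right in auto)
  moreover have "cochain_mult c c' = (\<lambda>ys. if ys \<in> SL then shsum (\<lambda>u v. c u * c' v) ys else 0)"
  proof
    fix ys
    show "cochain_mult c c' ys = (if ys \<in> SL then shsum (\<lambda>u v. c u * c' v) ys else 0)"
    proof (cases "ys \<in> SL")
      case False
      have "shsum (\<lambda>u v. c u * c' v) ys = shsum (\<lambda>u v. 0) ys"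
      proof (rule shsum_cong)
        fix u v assume "set u \<union> set v = set ys"
        then have "u \<notin> SL \<or> v \<notin> SL" using False SL_split by blast
        then show "c u * c' v = 0" using cochain_out[OF c] cochain_out[OF c'] by auto
      qed
      then show ?thesis using False by (simp add: cochain_mult_shsum)
    qed (simp add: cochain_mult_shsum)
  qed
  ultimately show ?thesis by simp
qed

sublocale C: graded_comm_algebra "ce_alg E"
proof
  fix x y z :: "('a, 'l) cochain" and i j :: int and r
  show "0 \<in> part (ce_alg E) i"
    by (simp add: cochains_iff gsym_def glin_def)
  show "x \<in> part (ce_alg E) i \<Longrightarrow> y \<in> part (ce_alg E) i \<Longrightarrow> x - y \<in> part (ce_alg E) i"
    using gsym_diff[of x y] by (simp add: cochains_iff fun_diff_def glin_def algebra_simps)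
  show "i < 0 \<Longrightarrow> part (ce_alg E) i = {0}"
  proof -
    assume "i < 0"
    then have "dg ys \<noteq> i" for ys :: "(nat \<times> 'l) list" using dg_nonneg[of ys] by linarith
    then have "x = 0" if "x \<in> cochains E i" for x using cochain_out[OF that] by (auto simp: fun_eq_iff)
    moreover have "0 \<in> cochains E i" by (simp add: cochains_iff gsym_def glin_def)
    ultimately show ?thesis by auto
  qed
  show "x \<in> part (ce_alg E) i \<Longrightarrow> y \<in> part (ce_alg E) j \<Longrightarrow> gmul (ce_alg E) x y \<in> part (ce_alg E) (i + j)"
    by (simp add: cochain_mult_cochains)
  show "x \<in> part (ce_alg E) i \<Longrightarrow> gscale (ce_alg E) r x \<in> part (ce_alg E) i"
    using gsym_mult_left[of x "base E r"] by (simp add: cochains_iff glin_def algebra_simps)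
  show "gmul (ce_alg E) (x + y) z = gmul (ce_alg E) x z + gmul (ce_alg E) y z"
    "gmul (ce_alg E) x (y + z) = gmul (ce_alg E) x y + gmul (ce_alg E) x z"
    by (simp_all add: fun_eq_iff cochain_mult_shsum distrib_left distrib_right shsum_add)
  show "gmul (ce_alg E) (gmul (ce_alg E) x y) z = gmul (ce_alg E) x (gmul (ce_alg E) y z)"
    using shsum_coassoc[of "\<lambda>u s t. x u * y s * z t"]
    by (simp add: fun_eq_iff cochain_mult_shsum shsum_mult_left[symmetric] shsum_mult_right[symmetric] mult.assoc)
  show "gmul (ce_alg E) x y = sg (i * j) (gmul (ce_alg E) y x)"
    if x: "x \<in> part (ce_alg E) i" and y: "y \<in> part (ce_alg E) j"
  proof
    fix ys
    have "shsum (\<lambda>u v. x u * y v) ys = shsum (\<lambda>u v. sg (i * j) (y u * x v)) ys"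
      unfolding shsum_cocomm[of "\<lambda>u v. x u * y v"]
    proof (rule shsum_cong)
      fix u v :: "(nat \<times> 'l) list"
      show "sg (dg u * dg v) (x v * y u) = sg (i * j) (y u * x v)"
        using cochain_out[of x i v] cochain_out[of y j u] x y
        by (cases "dg u = j \<and> dg v = i") (auto simp: mult.commute)
    qed
    then show "gmul (ce_alg E) x y ys = sg (i * j) (gmul (ce_alg E) y x) ys"
      by (simp add: cochain_mult_shsum sg_apply shsum_sg)
  qed
  show "gscale (ce_alg E) r (x + y) = gscale (ce_alg E) r x + gscale (ce_alg E) r y"
    by (simp add: fun_eq_iff distrib_left)
  show "gmul (ce_alg E) (gscale (ce_alg E) r x) y = gscale (ce_alg E) r (gmul (ce_alg E) x y)"
    "gmul (ce_alg E) x (gscale (ce_alg E) r y) = gscale (ce_alg E) r (gmul (ce_alg E) x y)"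
    by (simp_all add: fun_eq_iff cochain_mult_shsum shsum_mult_left[symmetric] ac_simps)
qed

sublocale A: graded_comm_algebra "base_alg E"
  by unfold_locales (auto simp: algebra_simps split: if_splits)

abbreviation "CE \<equiv> all_parts (ce_alg E)"

lemma assumes "c \<in> CE" shows CE_gsym: "gsym c" and CE_glin: "glin c" and CE_out: "ys \<notin> SL \<Longrightarrow> c ys = 0"
proof -
  have "gsym c \<and> glin c \<and> (\<forall>ys. ys \<notin> SL \<longrightarrow> c ys = 0)"
    using assms
  proof (induction rule: C.AP_induct)
    case (part i x)
    then show ?case by (simp add: cochains_iff)
  next
    case (add x y)
    then show ?case
      using gsym_add[of x y] by (simp add: plus_fun_def glin_def algebra_simps)
  qed
  then show "gsym c" "glin c" "ys \<notin> SL \<Longrightarrow> c ys = 0" by blast+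
qed

lemma cochain_CE: "c \<in> cochains E i \<Longrightarrow> c \<in> CE"
  using C.part_AP by simp

lemma CE_lin:
  assumes "c \<in> CE" "x \<in> sections E i" "x' \<in> sections E i" "w \<in> SL"
  shows "c ((i, act E f x + x') # w) = f * c ((i, x) # w) + c ((i, x') # w)"
  using CE_glin[OF assms(1)] assms by (simp add: glin_def)

lemma CE_sec_zero: "c \<in> CE \<Longrightarrow> c ((i, 0) # w) = 0"
  using CE_lin[of c 0 i 0 w 1] by (cases "w \<in> SL") (simp_all add: CE_out)

lemma CE_sec_add: "c \<in> CE \<Longrightarrow> x \<in> sections E i \<Longrightarrow> x' \<in> sections E i \<Longrightarrow> w \<in> SL \<Longrightarrow>
    c ((i, x + x') # w) = c ((i, x) # w) + c ((i, x') # w)"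
  using CE_lin[of c x i x' w 1] by simp

lemma CE_sec_act: "c \<in> CE \<Longrightarrow> x \<in> sections E i \<Longrightarrow> w \<in> SL \<Longrightarrow> c ((i, act E f x) # w) = f * c ((i, x) # w)"
  using CE_lin[of c x i 0 w f] by (simp add: CE_sec_zero)

lemma CE_sec_minus: "c \<in> CE \<Longrightarrow> x \<in> sections E i \<Longrightarrow> w \<in> SL \<Longrightarrow> c ((i, - x) # w) = - c ((i, x) # w)"
  using CE_sec_act[of c x i w "- 1"] by (simp add: act_minus_left)

lemma CE_sec_sg: "c \<in> CE \<Longrightarrow> x \<in> sections E i \<Longrightarrow> w \<in> SL \<Longrightarrow> c ((i, sg k x) # w) = sg k (c ((i, x) # w))"
  by (simp add: sg_def CE_sec_minus)

lemma CE_sec_sum: "c \<in> CE \<Longrightarrow> (\<And>j. j \<in> J \<Longrightarrow> g j \<in> sections E i) \<Longrightarrow> w \<in> SL \<Longrightarrow>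
    c ((i, \<Sum>j\<in>J. g j) # w) = (\<Sum>j\<in>J. c ((i, g j) # w))"
  by (induction J rule: infinite_finite_induct) (auto simp: CE_sec_zero CE_sec_add sec_sum)

lemma CE_swap:
  assumes "c \<in> CE" "snd y \<in> sections E (fst y)" "snd z \<in> sections E (fst z)" "w \<in> SL"
  shows "c (y # z # w) = sg (dy y * dy z) (c (z # y # w))"
  using gsymD[OF CE_gsym[OF assms(1)], of "[]" y z w] assms by simp

subsection \<open>Derivations from anchors and brackets\<close>

text \<open>Derivations of cochains are dual to coderivations of the symmetric coalgebra of \<open>\<L>[1]\<close>. They are
  given by Taylor coefficients: anchors \<open>A u\<close>, acting on functions, and brackets \<open>\<beta> u\<close>, which fail
  to be multilinear over functions by the Leibniz rule. The differential, contractions with sections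
  and connections are instances.\<close>

definition coder_op :: "int \<Rightarrow> ((nat \<times> 'l) list \<Rightarrow> 'a \<Rightarrow> 'a) \<Rightarrow> ((nat \<times> 'l) list \<Rightarrow> 'l) \<Rightarrow> ('a, 'l) cochain \<Rightarrow> ('a, 'l) cochain" where
  "coder_op k A \<beta> c = (if c \<in> CE then (\<lambda>ys. if ys \<in> SL then
     shsum (\<lambda>u w. A u (c w) - c ((nat (dg u - k - 1), \<beta> u) # w)) ys else 0) else 0)"

text \<open>A derivation of degree k turns a block of weight \<open>dg u\<close> into one entry of
  weight \<open>dg u - k\<close>, that is, of index \<open>dg u - k - 1\<close>. Where this is
  negative, \<open>nat\<close> would wrongly point to index 0, so the bracket is required to be 0.
  The last clause is the Leibniz rule.\<close>

definition coder :: "int \<Rightarrow> ((nat \<times> 'l) list \<Rightarrow> 'a \<Rightarrow> 'a) \<Rightarrow> ((nat \<times> 'l) list \<Rightarrow> 'l) \<Rightarrow> bool" where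
  "coder k A \<beta> \<longleftrightarrow>
     (\<forall>u\<in>SL. \<beta> u \<in> sections E (nat (dg u - k - 1)) \<and> (dg u - k < 1 \<longrightarrow> \<beta> u = 0)) \<and>
     (\<forall>u\<in>SL. dg u \<noteq> k \<longrightarrow> A u = (\<lambda>_. 0)) \<and>
     (\<forall>u\<in>SL. \<forall>f g. A u (f + g) = A u f + A u g \<and> A u (f * g) = A u f * g + f * A u g) \<and>
     (\<forall>u\<in>SL. \<forall>r f. A u (base E r * f) = base E r * A u f) \<and>
     (\<forall>f. gsym (\<lambda>u. A u f)) \<and> gsym \<beta> \<and> (\<forall>g. glin (\<lambda>u. A u g)) \<and>
     (\<forall>f i x x' u. (i, x) # (i, x') # u \<in> SL \<longrightarrow>
        \<beta> ((i, act E f x + x') # u) = act E f (\<beta> ((i, x) # u)) + \<beta> ((i, x') # u) +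
          sg ((int i + 1) * dg u) (act E (A u f) x))"

context
  fixes k A \<beta>
  assumes cod: "coder k A \<beta>"
begin

private abbreviation (input) "tg u \<equiv> nat (dg u - k - 1)"

lemma coder_sec: "u \<in> SL \<Longrightarrow> \<beta> u \<in> sections E (tg u)"
  and coder_small: "u \<in> SL \<Longrightarrow> dg u - k < 1 \<Longrightarrow> \<beta> u = 0"
  and coder_A_deg: "u \<in> SL \<Longrightarrow> dg u \<noteq> k \<Longrightarrow> A u f = 0"
  and coder_A_add: "u \<in> SL \<Longrightarrow> A u (f + g) = A u f + A u g"
  and coder_A_mult: "u \<in> SL \<Longrightarrow> A u (f * g) = A u f * g + f * A u g"
  and coder_A_gsym: "gsym (\<lambda>u. A u f)"
  and coder_gsym: "gsym \<beta>"
  and coder_A_glin: "glin (\<lambda>u. A u g)"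
  and coder_lin: "x \<in> sections E i \<Longrightarrow> x' \<in> sections E i \<Longrightarrow> u \<in> SL \<Longrightarrow>
        \<beta> ((i, act E f x + x') # u) = act E f (\<beta> ((i, x) # u)) + \<beta> ((i, x') # u) +
          sg ((int i + 1) * dg u) (act E (A u f) x)"
  using cod by (simp_all add: coder_def)

lemma coder_A_base: "u \<in> SL \<Longrightarrow> A u (base E r * f) = base E r * A u f"
  using cod unfolding coder_def by blast

lemma coder_A_zero: "u \<in> SL \<Longrightarrow> A u 0 = 0"
  using coder_A_add[of u 0 0] by simp

lemma coder_A_minus: "u \<in> SL \<Longrightarrow> A u (- f) = - A u f"
  using coder_A_add[of u f "- f"] by (simp add: coder_A_zero eq_neg_iff_add_eq_0 add.commute)

lemma coder_A_sg: "u \<in> SL \<Longrightarrow> A u (sg j f) = sg j (A u f)"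
  by (simp add: sg_def coder_A_minus)

text \<open>Where the index is truncated, the bracket is 0 and so is the value of the cochain; the
  sign computations may therefore take the bracket entry to have weight
  \<open>dg u - k\<close>.\<close>

lemma coder_dy: "u \<in> SL \<Longrightarrow> c \<in> CE \<Longrightarrow> \<not> (int (tg u) + 1 = dg u - k) \<Longrightarrow> c ((tg u, \<beta> u) # w) = 0"
  using coder_small[of u] by (cases "dg u - k < 1") (simp_all add: CE_sec_zero)

lemma coder_op_cochain:
  assumes c: "c \<in> cochains E i"
  shows "coder_op k A \<beta> c \<in> cochains E (i + k)"
proof -
  note cCE = cochain_CE[OF c]
  let ?F = "\<lambda>u w. A u (c w) - c ((tg u, \<beta> u) # w)"
  have "(\<lambda>ys. if ys \<in> SL then shsum ?F ys else 0) \<in> cochains E (i + k)"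
  proof (rule shsum_in_cochains)
    fix u v assume uv: "u \<in> SL" "v \<in> SL" "dg u + dg v \<noteq> i + k"
    have "A u (c v) = 0"
      using uv coder_A_deg[of u] cochain_out[OF c, of v] by (cases "dg u = k") (auto simp: coder_A_zero)
    moreover have "c ((tg u, \<beta> u) # v) = 0"
    proof (cases "int (tg u) + 1 = dg u - k")
      case True
      then have "dg ((tg u, \<beta> u) # v) \<noteq> i" unfolding dg_simps fst_conv True using uv by simp
      then show ?thesis using cochain_out[OF c] by blast
    qed (rule coder_dy[OF uv(1) cCE])
    ultimately show "?F u v = 0" by simp
  next
    fix v assume v: "v \<in> SL"
    show "gsym (\<lambda>u. ?F u v)" unfolding gsym_def
    proof (intro allI impI)
      fix us y z vs assume u: "us @ [y, z] @ vs \<in> SL"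
      then have u': "us @ [z, y] @ vs \<in> SL" by simp
      have "tg (us @ [y, z] @ vs) = tg (us @ [z, y] @ vs)" by (simp add: algebra_simps)
      moreover have "c ((tg (us @ [z, y] @ vs), sg (dy y * dy z) (\<beta> (us @ [z, y] @ vs))) # v) =
          sg (dy y * dy z) (c ((tg (us @ [z, y] @ vs), \<beta> (us @ [z, y] @ vs)) # v))"
        by (rule CE_sec_sg[OF cCE coder_sec[OF u'] v])
      ultimately show "?F (us @ [y, z] @ vs) v = sg (dy y * dy z) (?F (us @ [z, y] @ vs) v)"
        unfolding gsymD[OF coder_gsym u] gsymD[OF coder_A_gsym u] by (simp only: sg_diff)
    qed
  next
    fix u assume u: "u \<in> SL"
    show "gsym (?F u)" unfolding gsym_def
    proof (intro allI impI)
      fix us y z vs assume l: "us @ [y, z] @ vs \<in> SL"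
      have "c (((tg u, \<beta> u) # us) @ [y, z] @ vs) = sg (dy y * dy z) (c (((tg u, \<beta> u) # us) @ [z, y] @ vs))"
        by (rule gsymD[OF CE_gsym[OF cCE]]) (use l coder_sec[OF u] in simp)
      then show "?F u (us @ [y, z] @ vs) = sg (dy y * dy z) (?F u (us @ [z, y] @ vs))"
        unfolding gsymD[OF CE_gsym[OF cCE] l] by (simp add: sg_diff coder_A_sg[OF u])
    qed
  next
    fix f i x x' u v assume a: "x \<in> sections E i" "x' \<in> sections E i" "u \<in> SL" "v \<in> SL"
    let ?s = "sg ((int i + 1) * dg u) :: 'a \<Rightarrow> 'a"
    have s: "act E f x + x' \<in> sections E i" using a by (simp add: sec_add sec_act)
    let ?t = "tg ((i, x) # u)"
    have t: "\<beta> ((i, x) # u) \<in> sections E ?t" "\<beta> ((i, x') # u) \<in> sections E ?t"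
      using coder_sec[of "(i, x) # u"] coder_sec[of "(i, x') # u"] a by simp_all
    \<comment> \<open>The anchor at u is nonzero only for \<open>dg u = k\<close>, and then the
      bracket of \<open>(i, x) # u\<close> lies in the bundle of x itself; otherwise the Leibniz
      term is 0.\<close>
    have Auf: "act E (A u f) x \<in> sections E ?t \<and> c ((?t, act E (A u f) x) # v) = A u f * c ((i, x) # v)"
    proof (cases "dg u = k")
      case True
      then have "?t = i" by simp
      then show ?thesis using a by (simp add: sec_act CE_sec_act[OF cCE])
    qed (use a in \<open>simp add: coder_A_deg CE_sec_zero[OF cCE]\<close>)
    have 1: "c ((?t, \<beta> ((i, act E f x + x') # u)) # v) =
        f * c ((?t, \<beta> ((i, x) # u)) # v) + c ((?t, \<beta> ((i, x') # u)) # v) + ?s (A u f * c ((i, x) # v))"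
      unfolding coder_lin[OF a(1-3)] using Auf t a(4)
      by (simp add: CE_sec_add[OF cCE] sec_add sec_act sec_sg CE_sec_act[OF cCE] CE_sec_sg[OF cCE])
    have 2: "A ((i, act E f x + x') # u) (c v) = f * A ((i, x) # u) (c v) + A ((i, x') # u) (c v)"
      using coder_A_glin a by (simp add: glin_def)
    have 3: "A u (c ((i, act E f x + x') # v)) = A u f * c ((i, x) # v) + f * A u (c ((i, x) # v)) + A u (c ((i, x') # v))"
      using a by (simp add: CE_lin[OF cCE] coder_A_add coder_A_mult)
    have sw: "c ((tg u, \<beta> u) # (i, z) # v) = sg ((int (tg u) + 1) * (int i + 1)) (c ((i, z) # (tg u, \<beta> u) # v))"
      if "z \<in> sections E i" for z
      using CE_swap[OF cCE, of "(tg u, \<beta> u)" "(i, z)" v] that a coder_sec[of u] by simp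
    have 4: "c ((tg u, \<beta> u) # (i, act E f x + x') # v) = f * c ((tg u, \<beta> u) # (i, x) # v) + c ((tg u, \<beta> u) # (i, x') # v)"
      unfolding sw[OF s] sw[OF a(1)] sw[OF a(2)] using a coder_sec[of u]
      by (simp add: CE_lin[OF cCE] sg_add sg_mult_right)
    \<comment> \<open>The terms in \<open>A u f\<close>, from fact 1 with a minus sign and from fact
      3, cancel.\<close>
    show "?F ((i, act E f x + x') # u) v + ?s (?F u ((i, act E f x + x') # v)) =
      f * (?F ((i, x) # u) v + ?s (?F u ((i, x) # v))) + (?F ((i, x') # u) v + ?s (?F u ((i, x') # v)))"
      using 1 unfolding 2 3 4 by (simp add: sg_add sg_diff sg_mult_right algebra_simps)
  qed
  then show ?thesis using cCE by (simp add: coder_op_def)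
qed

text \<open>The Leibniz rule for anchors, together with the choice of the factor that takes the
  bracket, gives two triple sums. In the first, u sits next to the argument s of c; in the second it
  moves past s. As \<open>dg s = i\<close>, the sign of this move, corrected by that of the bracket
  entry, is (-1)^(k i).\<close>

lemma coder_op_mult:
  assumes c: "c \<in> cochains E i" and c': "c' \<in> cochains E j" and ys: "ys \<in> SL"
  shows "coder_op k A \<beta> (cochain_mult c c') ys =
    cochain_mult (coder_op k A \<beta> c) c' ys + sg (k * i) (cochain_mult c (coder_op k A \<beta> c') ys)"
proof -
  note CE = cochain_CE[OF c] cochain_CE[OF c'] C.AP_mul[OF cochain_CE[OF c] cochain_CE[OF c'], simplified]
  let ?b = "\<lambda>u. (tg u, \<beta> u)"
  let ?G = "\<lambda>u s t. A u (c s) * c' t - c (?b u # s) * c' t"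
  let ?H = "\<lambda>u s t. c s * A u (c' t) - sg (dy (?b u) * dg s) (c s * c' (?b u # t))"
  have "coder_op k A \<beta> (cochain_mult c c') ys = shsum (\<lambda>u w. shsum (\<lambda>s t. ?G u s t + ?H u s t) w) ys"
  proof -
    have "A u (cochain_mult c c' w) - cochain_mult c c' (?b u # w) = shsum (\<lambda>s t. ?G u s t + ?H u s t) w"
      if "set u \<union> set w = set ys" for u w
    proof -
      have u: "u \<in> SL" using that ys SL_split by blast
      show ?thesis
        by (simp add: cochain_mult_shsum shsum_hom[of "A u", OF coder_A_add[OF u]] coder_A_mult[OF u] shsum_add shsum_diff)
    qed
    then show ?thesis using CE ys by (simp add: coder_op_def cong: shsum_cong)
  qed
  also have "\<dots> = shsum (\<lambda>u w. shsum (\<lambda>s t. ?G u s t) w) ys + shsum (\<lambda>u w. shsum (\<lambda>s t. ?H u s t) w) ys"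
    by (simp only: shsum_add)
  also have "shsum (\<lambda>u w. shsum (\<lambda>s t. ?G u s t) w) ys = cochain_mult (coder_op k A \<beta> c) c' ys"
    unfolding shsum_coassoc[symmetric] cochain_mult_shsum
  proof (rule shsum_cong)
    fix w t assume "set w \<union> set t = set ys"
    then have "w \<in> SL" using ys SL_split by blast
    then show "shsum (\<lambda>u s. ?G u s t) w = coder_op k A \<beta> c w * c' t"
      using CE by (simp add: coder_op_def left_diff_distrib[symmetric] shsum_mult_right)
  qed
  also have "shsum (\<lambda>u w. shsum (\<lambda>s t. ?H u s t) w) ys = shsum (\<lambda>w t. shsum (\<lambda>s u. sg (dg s * dg u) (?H u s t)) w) ys"
    unfolding shsum_coassoc[symmetric] by (subst shsum_cocomm) (rule refl)
  also have "\<dots> = shsum (\<lambda>s w. shsum (\<lambda>u t. sg (dg s * dg u) (?H u s t)) w) ys"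
    by (rule shsum_coassoc)
  also have "\<dots> = sg (k * i) (cochain_mult c (coder_op k A \<beta> c') ys)"
    unfolding cochain_mult_shsum shsum_sg[symmetric]
  proof (rule shsum_cong)
    fix s w assume "set s \<union> set w = set ys"
    then have s: "s \<in> SL" and w: "w \<in> SL" using ys SL_split by blast+
    have "coder_op k A \<beta> c' w = shsum (\<lambda>u t. A u (c' t) - c' (?b u # t)) w"
      using CE w by (simp add: coder_op_def)
    then have "sg (k * i) (c s * coder_op k A \<beta> c' w) =
        shsum (\<lambda>u t. sg (k * i) (c s * (A u (c' t) - c' (?b u # t)))) w"
      by (simp add: shsum_mult_left shsum_sg)
    moreover have "shsum (\<lambda>u t. sg (dg s * dg u) (?H u s t)) w =
        shsum (\<lambda>u t. sg (k * i) (c s * (A u (c' t) - c' (?b u # t)))) w"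
    proof (rule shsum_cong)
      fix u t assume "set u \<union> set t = set w"
      then have u: "u \<in> SL" using w SL_split by blast
      show "sg (dg s * dg u) (?H u s t) = sg (k * i) (c s * (A u (c' t) - c' (?b u # t)))"
      proof (cases "dg s = i")
        case True
        have "sg (dg s * dg u) (c s * A u (c' t)) = sg (k * i) (c s * A u (c' t))"
          using True coder_A_deg[OF u] by (cases "dg u = k") (simp_all add: mult.commute)
        moreover have "sg (dg s * dg u) (sg (dy (?b u) * dg s) (c s * c' (?b u # t))) = sg (k * i) (c s * c' (?b u # t))"
        proof (cases "int (tg u) + 1 = dg u - k")
          case b: True
          show ?thesis unfolding sg_sg fst_conv b True
            by (rule sg_cong_even) (simp add: algebra_simps)
        qed (simp add: coder_dy[OF u CE(2)])
        ultimately show ?thesis by (simp only: sg_diff right_diff_distrib)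
      next
        case False
        then show ?thesis using cochain_out[OF c, of s] by simp
      qed
    qed
    ultimately show "shsum (\<lambda>u t. sg (dg s * dg u) (?H u s t)) w = sg (k * i) (c s * coder_op k A \<beta> c' w)"
      by simp
  qed
  finally show ?thesis .
qed

lemma coder_op_der: "coder_op k A \<beta> \<in> ders (ce_alg E) k"
proof (rule C.dersI)
  fix i c assume "c \<in> part (ce_alg E) i"
  then show "coder_op k A \<beta> c \<in> part (ce_alg E) (i + k)" using coder_op_cochain by simp
next
  fix c c' assume c: "c \<in> CE" "c' \<in> CE"
  show "coder_op k A \<beta> (c + c') = coder_op k A \<beta> c + coder_op k A \<beta> c'"
  proof
    fix ys
    show "coder_op k A \<beta> (c + c') ys = (coder_op k A \<beta> c + coder_op k A \<beta> c') ys"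
    proof (cases "ys \<in> SL")
      case True
      have "shsum (\<lambda>u w. A u (c w + c' w) - (c ((tg u, \<beta> u) # w) + c' ((tg u, \<beta> u) # w))) ys =
          shsum (\<lambda>u w. (A u (c w) - c ((tg u, \<beta> u) # w)) + (A u (c' w) - c' ((tg u, \<beta> u) # w))) ys"
      proof (rule shsum_cong)
        fix u w assume "set u \<union> set w = set ys"
        then have "u \<in> SL" using True SL_split by blast
        then show "A u (c w + c' w) - (c ((tg u, \<beta> u) # w) + c' ((tg u, \<beta> u) # w)) =
          (A u (c w) - c ((tg u, \<beta> u) # w)) + (A u (c' w) - c' ((tg u, \<beta> u) # w))"
          by (simp add: coder_A_add)
      qed
      then show ?thesis using c True by (simp add: coder_op_def C.AP_add shsum_add)
    qed (simp add: coder_op_def c C.AP_add)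
  qed
next
  fix r c assume c: "c \<in> CE"
  show "coder_op k A \<beta> (gscale (ce_alg E) r c) = gscale (ce_alg E) r (coder_op k A \<beta> c)"
  proof
    fix ys
    show "coder_op k A \<beta> (gscale (ce_alg E) r c) ys = gscale (ce_alg E) r (coder_op k A \<beta> c) ys"
    proof (cases "ys \<in> SL")
      case True
      have "shsum (\<lambda>u w. A u (base E r * c w) - base E r * c ((tg u, \<beta> u) # w)) ys =
          shsum (\<lambda>u w. base E r * (A u (c w) - c ((tg u, \<beta> u) # w))) ys"
      proof (rule shsum_cong)
        fix u w assume "set u \<union> set w = set ys"
        then have "u \<in> SL" using True SL_split by blast
        then show "A u (base E r * c w) - base E r * c ((tg u, \<beta> u) # w) = base E r * (A u (c w) - c ((tg u, \<beta> u) # w))"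
          by (simp add: coder_A_base right_diff_distrib)
      qed
      then show ?thesis using c True C.AP_scale[OF c] by (simp add: coder_op_def shsum_mult_left)
    qed (use c C.AP_scale[OF c] in \<open>simp add: coder_op_def\<close>)
  qed
next
  fix i j c c' assume c: "c \<in> part (ce_alg E) i" "c' \<in> part (ce_alg E) j"
  show "coder_op k A \<beta> (gmul (ce_alg E) c c') = gmul (ce_alg E) (coder_op k A \<beta> c) c' +
      sg (k * i) (gmul (ce_alg E) c (coder_op k A \<beta> c'))"
  proof
    fix ys
    show "coder_op k A \<beta> (gmul (ce_alg E) c c') ys = (gmul (ce_alg E) (coder_op k A \<beta> c) c' +
      sg (k * i) (gmul (ce_alg E) c (coder_op k A \<beta> c'))) ys"
    proof (cases "ys \<in> SL")
      case True
      then show ?thesis using coder_op_mult[of c i c' j ys] c by (simp add: sg_apply)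
    next
      case False
      have m: "coder_op k A \<beta> c \<in> cochains E (i + k)" "coder_op k A \<beta> c' \<in> cochains E (j + k)"
        using coder_op_cochain c by simp_all
      have "coder_op k A \<beta> (gmul (ce_alg E) c c') ys = 0"
        using False by (simp add: coder_op_def)
      moreover have "cochain_mult (coder_op k A \<beta> c) c' ys = 0" "cochain_mult c (coder_op k A \<beta> c') ys = 0"
        using False cochain_out[OF cochain_mult_cochains[OF m(1), of c' j]] cochain_out[OF cochain_mult_cochains[OF _ m(2), of c i]] c
        by simp_all
      ultimately show ?thesis by (simp add: sg_apply)
    qed
  qed
qed (simp add: coder_op_def)

end

end

section \<open>Partially additive maps on shuffle sums, and the decalage sign\<close>

text \<open>Meant for maps sending x to \<open>c ((n, x) # t)\<close>: a cochain is additive in an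
  entry only on sections of the bundle, so T is additive only where P holds.\<close>

lemma shsum_hom_on:
  assumes P: "\<And>x y. P x \<Longrightarrow> P y \<Longrightarrow> P (x + y)" "\<And>k x. P x \<Longrightarrow> P (sg k x)"
    and T: "\<And>x y. P x \<Longrightarrow> P y \<Longrightarrow> T (x + y) = T x + T (y::'b::ab_group_add)"
      "\<And>k x. P x \<Longrightarrow> T (sg k x) = sg k (T x :: 'c::ab_group_add)"
  shows "(\<And>u v. set u \<union> set v = set ys \<Longrightarrow> P (F u v)) \<Longrightarrow>
    P (shsum F ys) \<and> T (shsum F ys) = shsum (\<lambda>u v. T (F u v)) ys"
proof (induction ys arbitrary: F)
  case (Cons y ys)
  have "P (shsum (\<lambda>u v. F (y # u) v) ys) \<and> T (shsum (\<lambda>u v. F (y # u) v) ys) = shsum (\<lambda>u v. T (F (y # u) v)) ys"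
    by (rule Cons.IH, rule Cons.prems) auto
  moreover have "P (shsum (\<lambda>u v. sg (dy y * dg u) (F u (y # v))) ys) \<and>
      T (shsum (\<lambda>u v. sg (dy y * dg u) (F u (y # v))) ys) = shsum (\<lambda>u v. T (sg (dy y * dg u) (F u (y # v)))) ys"
    by (rule Cons.IH, rule P(2), rule Cons.prems) auto
  moreover have "shsum (\<lambda>u v. T (sg (dy y * dg u) (F u (y # v)))) ys = shsum (\<lambda>u v. sg (dy y * dg u) (T (F u (y # v)))) ys"
    by (rule shsum_cong, rule T(2), rule Cons.prems) auto
  ultimately show ?case by (simp add: P(1) T(1))
qed simp

lemma decalage_Cons: "decalage (y # ys) = length ys * fst y + decalage ys"
  unfolding decalage_def length_Cons sum.lessThan_Suc_shift by simp

lemma decalage_Nil [simp]: "decalage [] = 0"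
  by (simp add: decalage_def)

lemma decalage_swap: "decalage (us @ [y, z] @ vs) + fst z = decalage (us @ [z, y] @ vs) + fst y"
  by (induction us) (simp_all add: decalage_Cons)

lemma dg_length: "dg ys = int (\<Sum>y\<leftarrow>ys. fst y) + int (length ys)"
  by (induction ys) simp_all

lemma out_index_dg: "out_index u = nat (dg u - 2)"
  unfolding out_index_def dg_length by simp

lemma card_nths: assumes "S \<subseteq> {..<length ys}" shows "length (nths ys S) = card S"
proof -
  have "{i. i < length ys \<and> i \<in> S} = S" using assms by auto
  then show ?thesis by (simp add: length_nths)
qed

lemma length_nths_Compl: "length (nths ys S) + length (nths ys (- S)) = length ys"
proof (induction ys arbitrary: S)
  case (Cons y ys)
  have "{j. Suc j \<in> - S} = - {j. Suc j \<in> S}" by auto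
  then show ?case using Cons.IH[of "{j. Suc j \<in> S}"] by (simp add: nths_Cons)
qed simp

lemma positions_induct [case_names Nil ins shift]:
  assumes "P [] {}"
    and "\<And>y ys S. S \<subseteq> {..<length ys} \<Longrightarrow> P ys S \<Longrightarrow> P (y # ys) (insert 0 (Suc ` S))"
    and "\<And>y ys S. S \<subseteq> {..<length ys} \<Longrightarrow> P ys S \<Longrightarrow> P (y # ys) (Suc ` S)"
  shows "S \<subseteq> {..<length ys} \<Longrightarrow> P ys S"
proof (induction ys arbitrary: S)
  case Nil
  then show ?case using assms(1) by simp
next
  case (Cons y ys)
  let ?T = "{k. Suc k \<in> S}"
  have T: "?T \<subseteq> {..<length ys}" using Cons.prems by auto
  have "S = (if 0 \<in> S then insert 0 (Suc ` ?T) else Suc ` ?T)"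
    by (auto simp: image_iff) (metis not0_implies_Suc)+
  then show ?case using assms(2,3)[OF T Cons.IH[OF T], of y] by presburger
qed

lemma crossings_card:
  "card (crossings (Suc n) (insert 0 (Suc ` S))) = card (crossings n S)"
  "S \<subseteq> {..<n} \<Longrightarrow> card (crossings (Suc n) (Suc ` S)) = card (crossings n S) + card S"
proof -
  have inj: "inj_on (map_prod Suc Suc) A" "inj_on (\<lambda>k. (0::nat, Suc k)) B" for A B
    by (auto simp: inj_on_def)
  show "card (crossings (Suc n) (insert 0 (Suc ` S))) = card (crossings n S)"
    by (simp add: crossings_shift card_image inj)
  assume S: "S \<subseteq> {..<n}"
  have "map_prod Suc Suc ` crossings n S \<inter> (\<lambda>k. (0, Suc k)) ` (S \<inter> {..<n}) = {}"
    by (auto simp: map_prod_def)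
  moreover have "S \<inter> {..<n} = S" using S by auto
  ultimately show "card (crossings (Suc n) (Suc ` S)) = card (crossings n S) + card S"
    using finite_subset[OF S] by (simp add: crossings_shift card_Un_disjoint card_image inj)
qed

lemma even_transfer: "a = b + 2 * c \<Longrightarrow> even b \<Longrightarrow> even (a::nat)"
  by simp

text \<open>The bookkeeping for an entry of degree \<open>fy\<close> that joins the second block: a
  and u are the degree sum and the length of the first block, v is the length of the second.
  Everything new is even.\<close>

lemma decalage_arith:
  "K + (fy + 1) * (a + u) + Suc v * a + (v * fy + dv) + du + ((u + v) * fy + e) + (k + fy * a) + (c + u) =
    K + v * a + dv + du + e + k + c + 2 * (fy * a + fy * u + a + u + fy * (v::nat))"
  by (simp add: algebra_simps)

text \<open>The parity by which the Koszul sign on \<L>[1] differs from Koszul sign times signature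
  on \<L>. The bracket of the first block heads the outer list and is weighted by the length of the
  second block; its degree appears here as the degree sum of the block, and the remaining shift is
  accounted for in \<open>sym_jacobi\<close>.\<close>

lemma decalage_unshuffle:
  assumes "S \<subseteq> {..<length ys}"
  shows "even (koszul (sec_degs ys) S + length (nths ys (- S)) * (\<Sum>y\<leftarrow>nths ys S. fst y) + decalage (nths ys (- S)) + decalage (nths ys S)
      + decalage ys + koszul (map fst ys) S + card (crossings (length ys) S))"
    (is "even (?P ys S)")
proof (induction ys S rule: positions_induct)
  case Nil
  then show ?case by (simp add: koszul_def crossings_def)
next
  case (ins y ys S)
  have 1: "length ys = length (nths ys S) + length (nths ys (- S))" by (rule length_nths_Compl[symmetric])
  have "?P (y # ys) (insert 0 (Suc ` S)) = ?P ys S + 2 * (fst y * length ys)"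
    by (simp add: nths_shift decalage_Cons sec_degs_def koszul_shift crossings_card)
      (simp add: 1 algebra_simps)
  then show ?case by (rule even_transfer) (rule ins(2))
next
  case (shift y ys S)
  let ?a = "\<Sum>y\<leftarrow>nths ys S. fst y" and ?u = "length (nths ys S)" and ?v = "length (nths ys (- S))"
  have 1: "length ys = ?u + ?v" by (rule length_nths_Compl[symmetric])
  have i: "S \<inter> {..<length ys} = S" using shift(1) by auto
  have a: "?a = (\<Sum>k\<in>S. fst (ys ! k))"
    using shift(1) by (simp add: sum_list_nths i)
  have b: "(\<Sum>k\<in>S. Suc (fst (ys ! k))) = ?a + ?u"
    unfolding a card_nths[OF shift(1)] by (simp add: sum_Suc)
  have k1: "koszul (sec_degs (y # ys)) (Suc ` S) = koszul (sec_degs ys) S + (fst y + 1) * (?a + ?u)"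
    unfolding b[symmetric] sec_degs_def list.map koszul_shift sum_distrib_left length_map i
    by (intro arg_cong2[of _ _ _ _ "(+)"] sum.cong refl) (use shift(1) in auto)
  have k2: "koszul (map fst (y # ys)) (Suc ` S) = koszul (map fst ys) S + fst y * ?a"
    unfolding a list.map koszul_shift sum_distrib_left length_map i
    by (intro arg_cong2[of _ _ _ _ "(+)"] sum.cong refl) (use shift(1) in auto)
  have c: "card (crossings (Suc (length ys)) (Suc ` S)) = card (crossings (length ys) S) + ?u"
    using crossings_card(2)[OF shift(1)] card_nths[OF shift(1)] by simp
  have "?P (y # ys) (Suc ` S) = ?P ys S + 2 * (fst y * ?a + fst y * ?u + ?a + ?u + fst y * ?v)"
    unfolding k1 k2 nths_shift decalage_Cons length_Cons c decalage_arith[symmetric]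
    unfolding 1 by (rule refl)
  then show ?case by (rule even_transfer) (rule shift(2))
qed (rule assms)

section \<open>The axioms of an algebroid, one by one\<close>

context linfty_alg
begin

lemmas algebroid_conds = algebroid[unfolded linfty_algebroid_def]

lemma brk_sec: "ys \<in> SL \<Longrightarrow> ys \<noteq> [] \<Longrightarrow> brk E ys \<in> sections E (out_index ys)"
  by (rule algebroid_conds[THEN conjunct2, THEN conjunct2, THEN conjunct2, THEN conjunct2, THEN conjunct1, rule_format])

lemma brk_0: "x \<in> sections E 0 \<Longrightarrow> brk E [(0, x)] = 0"
  by (rule algebroid_conds[THEN conjunct2, THEN conjunct2, THEN conjunct2, THEN conjunct2, THEN conjunct2, THEN conjunct1, rule_format])

lemma brk_swap: "us @ [y, z] @ vs \<in> SL \<Longrightarrow>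
        brk E (us @ [y, z] @ vs) = - sg (int (fst y * fst z)) (brk E (us @ [z, y] @ vs))"
  by (rule algebroid_conds[THEN conjunct2, THEN conjunct2, THEN conjunct2, THEN conjunct2, THEN conjunct2, THEN conjunct2, THEN conjunct1, rule_format])

lemma brk_add: "(i, x) # (i, x') # vs \<in> SL \<Longrightarrow>
        brk E ((i, x + x') # vs) = brk E ((i, x) # vs) + brk E ((i, x') # vs)"
  by (rule algebroid_conds[THEN conjunct2, THEN conjunct2, THEN conjunct2, THEN conjunct2, THEN conjunct2, THEN conjunct2, THEN conjunct2, THEN conjunct1, rule_format])

lemma brk_act: "(i, x) # vs \<in> SL \<Longrightarrow> length vs \<noteq> 1 \<Longrightarrow>
        brk E ((i, act E f x) # vs) = act E f (brk E ((i, x) # vs))"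
  by (rule algebroid_conds[THEN conjunct2, THEN conjunct2, THEN conjunct2, THEN conjunct2, THEN conjunct2, THEN conjunct2, THEN conjunct2, THEN conjunct2, THEN conjunct2, THEN conjunct1, rule_format])

lemma jacobi: "ys \<in> SL \<Longrightarrow> ys \<noteq> [] \<Longrightarrow>
        (\<Sum>S\<in>Pow {..<length ys} - {{}}.
           sg (int (koszul (map fst ys) S + card (crossings (length ys) S) + card S * (length ys - card S)))
             (brk E (brk_tagged E (nths ys S) # nths ys (- S)))) = 0"
  by (rule algebroid_conds[THEN conjunct2, THEN conjunct2, THEN conjunct2, THEN conjunct2, THEN conjunct2, THEN conjunct2, THEN conjunct2, THEN conjunct2, THEN conjunct2, THEN conjunct2, THEN conjunct1, rule_format])

lemma anchor_vf: "x \<in> sections E 0 \<Longrightarrow> anchor E x \<in> vector_fields E"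
  by (rule algebroid_conds[THEN conjunct2, THEN conjunct2, THEN conjunct2, THEN conjunct2, THEN conjunct2, THEN conjunct2, THEN conjunct2, THEN conjunct2, THEN conjunct2, THEN conjunct2, THEN conjunct2, THEN conjunct1, rule_format])

lemma anchor_lin: "x \<in> sections E 0 \<Longrightarrow> x' \<in> sections E 0 \<Longrightarrow>
        anchor E (act E f x + x') g = f * anchor E x g + anchor E x' g"
  by (rule algebroid_conds[THEN conjunct2, THEN conjunct2, THEN conjunct2, THEN conjunct2, THEN conjunct2, THEN conjunct2, THEN conjunct2, THEN conjunct2, THEN conjunct2, THEN conjunct2, THEN conjunct2, THEN conjunct2, THEN conjunct1, rule_format])

lemma anchor_differential: "x \<in> sections E 1 \<Longrightarrow> anchor E (brk E [(1, x)]) g = 0"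
  by (rule algebroid_conds[THEN conjunct2, THEN conjunct2, THEN conjunct2, THEN conjunct2, THEN conjunct2, THEN conjunct2, THEN conjunct2, THEN conjunct2, THEN conjunct2, THEN conjunct2, THEN conjunct2, THEN conjunct2, THEN conjunct2, THEN conjunct1, rule_format])

lemma leibniz: "[y, (i, x)] \<in> SL \<Longrightarrow>
        brk E [y, (i, act E f x)] = act E (anc E y f) x + act E f (brk E [y, (i, x)])"
  by (rule algebroid_conds[THEN conjunct2, THEN conjunct2, THEN conjunct2, THEN conjunct2, THEN conjunct2, THEN conjunct2, THEN conjunct2, THEN conjunct2, THEN conjunct2, THEN conjunct2, THEN conjunct2, THEN conjunct2, THEN conjunct2, THEN conjunct2, rule_format])

lemma brk_zero: "vs \<in> SL \<Longrightarrow> brk E ((i, 0) # vs) = 0"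
  using brk_add[of i 0 0 vs] by simp

lemma brk_minus: "(i, x) # vs \<in> SL \<Longrightarrow> brk E ((i, - x) # vs) = - brk E ((i, x) # vs)"
  using brk_add[of i x "- x" vs] brk_zero[of vs i] by (simp add: sec_minus eq_neg_iff_add_eq_0 add.commute)

lemma brk_sg: "(i, x) # vs \<in> SL \<Longrightarrow> brk E ((i, sg k x) # vs) = sg k (brk E ((i, x) # vs))"
  by (simp add: sg_def brk_minus)

lemma AP_base [simp]: "all_parts (base_alg E) = UNIV"
  using A.part_AP[of _ 0] by auto

lemma vf_add: "v \<in> vector_fields E \<Longrightarrow> v (f + g) = v f + v g"
  and vf_mult: "v \<in> vector_fields E \<Longrightarrow> v (f * g) = v f * g + f * v g"
  and vf_base: "v \<in> vector_fields E \<Longrightarrow> v (base E r * f) = base E r * v f"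
  using A.der_add[of v 0 f g] A.der_mul[of v 0 f 0 g] A.der_scale[of v 0 f r] by simp_all

lemma vfI:
  assumes "\<And>f g. v (f + g) = v f + v g" "\<And>f g. v (f * g) = v f * g + f * v g" "\<And>r f. v (base E r * f) = base E r * v f"
  shows "v \<in> vector_fields E"
proof -
  have "v 0 = 0" using assms(1)[of 0 0] by simp
  then show ?thesis
    by (intro A.dersI) (auto simp: assms(1,2) simp del: base_alg_simps(3) split: if_splits, simp add: assms(3))
qed

lemma anchor_act: "x \<in> sections E 0 \<Longrightarrow> anchor E (act E f x) g = f * anchor E x g"
  and anchor_zero: "anchor E 0 g = 0"
  and anchor_add: "x \<in> sections E 0 \<Longrightarrow> y \<in> sections E 0 \<Longrightarrow> anchor E (x + y) g = anchor E x g + anchor E y g"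
proof -
  show z: "anchor E 0 g = 0" using anchor_lin[of 0 0 1 g] by simp
  show "x \<in> sections E 0 \<Longrightarrow> anchor E (act E f x) g = f * anchor E x g"
    using anchor_lin[of x 0 f g] z by simp
  show "x \<in> sections E 0 \<Longrightarrow> y \<in> sections E 0 \<Longrightarrow> anchor E (x + y) g = anchor E x g + anchor E y g"
    using anchor_lin[of x y 1 g] by simp
qed

lemma anchor_minus: "x \<in> sections E 0 \<Longrightarrow> anchor E (- x) g = - anchor E x g"
  using anchor_act[of x "- 1" g] by (simp add: act_minus_left)

subsection \<open>The Chevalley--Eilenberg differential\<close>

text \<open>The symmetric brackets of degree 1 on \<L>[1]. The empty bracket, a curvature, is set to
  0.\<close>

definition sym_brk :: "(nat \<times> 'l) list \<Rightarrow> 'l" where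
  "sym_brk u = (if u = [] then 0 else sg (int (decalage u)) (brk E u))"

definition sym_anc :: "(nat \<times> 'l) list \<Rightarrow> 'a \<Rightarrow> 'a" where
  "sym_anc u f = (case u of [y] \<Rightarrow> anc E y f | _ \<Rightarrow> 0)"

lemma sym_anc_simps [simp]: "sym_anc [] f = 0" "sym_anc [y] f = anc E y f" "sym_anc (y # z # vs) f = 0"
  by (simp_all add: sym_anc_def)

lemma sym_anc_long: "length u \<noteq> 1 \<Longrightarrow> sym_anc u f = 0"
  by (auto simp: sym_anc_def split: list.splits)

lemma sym_brk_sec: "u \<in> SL \<Longrightarrow> sym_brk u \<in> sections E (nat (dg u - 1 - 1))"
  using brk_sec[of u] by (simp add: sym_brk_def out_index_dg sec_sg)

lemma sym_brk_small: assumes "u \<in> SL" "dg u - 1 < 1" shows "sym_brk u = 0"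
proof (cases u)
  case (Cons y v)
  have "dg v = 0" "fst y = 0" using assms(2) Cons dg_nonneg[of v] by (simp_all del: dg_eq_0_iff)
  then have "u = [(0, snd y)]" using Cons by (simp add: prod_eq_iff)
  then show ?thesis using assms(1) brk_0 by (simp add: sym_brk_def)
qed (simp add: sym_brk_def)

lemma gsym_sym_brk: "gsym sym_brk"
  unfolding gsym_def
proof (intro allI impI)
  fix us y z vs assume l: "us @ [y, z] @ vs \<in> SL"
  have "even (decalage (us @ [y, z] @ vs) + decalage (us @ [z, y] @ vs) + fst y + fst z)"
    using decalage_swap[of us y z vs] by presburger
  then have "sg (int (decalage (us @ [y, z] @ vs))) (- sg (int (fst y * fst z)) (brk E (us @ [z, y] @ vs))) =
      sg (dy y * dy z) (sg (int (decalage (us @ [z, y] @ vs))) (brk E (us @ [z, y] @ vs)))"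
    by (cases "even (fst y)"; cases "even (fst z)") (simp_all add: sg_def)
  then show "sym_brk (us @ [y, z] @ vs) = sg (dy y * dy z) (sym_brk (us @ [z, y] @ vs))"
    unfolding sym_brk_def brk_swap[OF l] by simp
qed

text \<open>Only the binary bracket fails to be linear. Its Leibniz rule is given for the second
  entry, so the entries are exchanged before it is applied and exchanged back afterwards.\<close>

lemma sym_brk_lin:
  assumes a: "x \<in> sections E i" "x' \<in> sections E i" "u \<in> SL"
  shows "sym_brk ((i, act E f x + x') # u) = act E f (sym_brk ((i, x) # u)) + sym_brk ((i, x') # u) +
          sg ((int i + 1) * dg u) (act E (sym_anc u f) x)"
proof -
  have 1: "brk E ((i, act E f x + x') # u) = brk E ((i, act E f x) # u) + brk E ((i, x') # u)"
    using brk_add[of i "act E f x" x' u] a by (simp add: sec_act)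
  have d: "decalage ((i, z) # u) = length u * i + decalage u" for z :: 'l
    by (simp add: decalage_Cons)
  show ?thesis
  proof (cases "length u = 1")
    case False
    then show ?thesis using brk_act[of i x u f] a
      by (simp add: sym_brk_def 1 d sym_anc_long sg_add act_sg)
  next
    case True
    then obtain z where u: "u = [z]" by (cases u) auto
    have z: "snd z \<in> sections E (fst z)" using a(3) u by simp
    have sw: "brk E [(i, x''), z] = - sg (int (i * fst z)) (brk E [z, (i, x'')])" if "x'' \<in> sections E i" for x''
      using brk_swap[of "[]" "(i, x'')" z "[]"] that z by simp
    have "brk E [(i, act E f x), z] = - sg (int (i * fst z)) (act E (anc E z f) x + act E f (brk E [z, (i, x)]))"
      using sw[of "act E f x"] leibniz[of z i x f] a z by (simp add: sec_act)
    then have "brk E [(i, act E f x), z] = act E f (brk E [(i, x), z]) - sg (int (i * fst z)) (act E (anc E z f) x)"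
      using sw[OF a(1)] by (simp add: sg_add act_minus_right act_sg)
    \<comment> \<open>The anchor of z vanishes unless z has degree 0; then \<open>dg u = 1\<close>
      and both signs are (-1)^(i + 1).\<close>
    moreover have "sg (int i) (- sg (int (i * fst z)) (act E (anc E z f) x)) = sg ((int i + 1) * dg u) (act E (anc E z f) x)"
    proof (cases "fst z = 0")
      case False
      then show ?thesis by (simp add: anc_def)
    qed (simp add: u sg_def)
    ultimately show ?thesis
      by (simp add: sym_brk_def 1[unfolded u] d u decalage_Cons sg_add sg_diff act_sg sg_minus)
  qed
qed

lemma coder_Q: "coder 1 sym_anc sym_brk"
  unfolding coder_def
proof (intro conjI ballI allI impI)
  fix u assume u: "u \<in> SL"
  show "sym_brk u \<in> sections E (nat (dg u - 1 - 1))" by (rule sym_brk_sec[OF u])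
  show "dg u - 1 < 1 \<Longrightarrow> sym_brk u = 0" by (rule sym_brk_small[OF u])
  show "sym_anc u = (\<lambda>_. 0)" if "dg u \<noteq> 1"
  proof
    fix f show "sym_anc u f = 0"
      using that by (cases u) (auto simp: sym_anc_def anc_def split: list.splits)
  qed
  have vf: "sym_anc u \<in> vector_fields E"
  proof (cases "\<exists>y. u = [y] \<and> fst y = 0")
    case True
    then obtain y where "u = [y]" "fst y = 0" by blast
    moreover have "sym_anc [y] = anchor E (snd y)" using \<open>fst y = 0\<close> by (simp add: fun_eq_iff anc_def)
    ultimately show ?thesis using anchor_vf u by simp
  next
    case False
    then have "sym_anc u = (\<lambda>f. 0)"
      by (auto simp: sym_anc_def anc_def fun_eq_iff split: list.splits)
    then show ?thesis using A.ders_zero by simp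
  qed
  fix f g
  show "sym_anc u (f + g) = sym_anc u f + sym_anc u g"
    "sym_anc u (f * g) = sym_anc u f * g + f * sym_anc u g"
    using vf by (simp_all add: vf_add vf_mult)
  fix r show "sym_anc u (base E r * f) = base E r * sym_anc u f"
    using vf by (simp add: vf_base)
next
  fix f show "gsym (\<lambda>u. sym_anc u f)" by (simp add: gsym_def sym_anc_long)
next
  show "gsym sym_brk" by (rule gsym_sym_brk)
next
  fix g show "glin (\<lambda>u. sym_anc u g)"
    unfolding glin_def
  proof (intro allI impI)
    fix f i x x' vs assume "(i, x) # (i, x') # vs \<in> SL"
    then show "sym_anc ((i, act E f x + x') # vs) g = f * sym_anc ((i, x) # vs) g + sym_anc ((i, x') # vs) g"
      by (cases vs) (auto simp: anc_def anchor_lin)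
  qed
next
  fix f i x x' u assume "(i, x) # (i, x') # u \<in> SL"
  then show "sym_brk ((i, act E f x + x') # u) = act E f (sym_brk ((i, x) # u)) + sym_brk ((i, x') # u) +
          sg ((int i + 1) * dg u) (act E (sym_anc u f) x)"
    using sym_brk_lin by simp
qed

lemma nths_singleton: "j < length ys \<Longrightarrow> nths ys {j} = [ys ! j]"
proof (induction ys arbitrary: j)
  case (Cons y ys)
  have "{i. Suc i \<in> {j}} = (if j = 0 then {} else {j - 1})" by auto
  then show ?case using Cons.IH[of "j - 1"] Cons.prems by (auto simp: nths_Cons nth_Cons')
qed simp

text \<open>Both sums in \<open>ce_at\<close> are completed to sums over all subsets: the symbol
  \<open>sym_anc\<close> vanishes off lists of length 1, and \<open>sym_brk\<close> vanishes on the
  empty list.\<close>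

lemma ce_diff_coder: "ce_diff E = coder_op 1 sym_anc sym_brk"
proof
  fix c
  show "ce_diff E c = coder_op 1 sym_anc sym_brk c"
  proof (cases "c \<in> CE")
    case c: True
    have "ce_at E c ys = shsum (\<lambda>u w. sym_anc u (c w) - c ((nat (dg u - 1 - 1), sym_brk u) # w)) ys" if ys: "ys \<in> SL" for ys
    proof -
      let ?k = "\<lambda>S. int (koszul (sec_degs ys) S)" and ?I = "Pow {..<length ys}"
      have "(\<Sum>j<length ys. sg (?k {j}) (anc E (ys ! j) (c (nths ys (- {j}))))) =
          (\<Sum>j<length ys. sg (?k {j}) (sym_anc (nths ys {j}) (c (nths ys (- {j})))))"
        by (intro sum.cong refl) (simp add: nths_singleton)
      also have "\<dots> = (\<Sum>S\<in>(\<lambda>j. {j}) ` {..<length ys}. sg (?k S) (sym_anc (nths ys S) (c (nths ys (- S)))))"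
        by (subst sum.reindex) (simp_all add: inj_on_def)
      also have "\<dots> = (\<Sum>S\<in>?I. sg (?k S) (sym_anc (nths ys S) (c (nths ys (- S)))))"
      proof (rule sum.mono_neutral_left)
        show "\<forall>S\<in>?I - (\<lambda>j. {j}) ` {..<length ys}. sg (?k S) (sym_anc (nths ys S) (c (nths ys (- S)))) = 0"
        proof
          fix S assume S: "S \<in> ?I - (\<lambda>j. {j}) ` {..<length ys}"
          have "card S \<noteq> 1"
          proof
            assume "card S = 1"
            then obtain j where "S = {j}" by (auto simp: card_1_singleton_iff)
            then show False using S by auto
          qed
          then have "length (nths ys S) \<noteq> 1" using S card_nths[of S ys] by simp
          then show "sg (?k S) (sym_anc (nths ys S) (c (nths ys (- S)))) = 0" by (simp add: sym_anc_long)
        qed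
      qed auto
      finally have 1: "(\<Sum>j<length ys. sg (?k {j}) (anc E (ys ! j) (c (nths ys (- {j}))))) =
        (\<Sum>S\<in>?I. sg (?k S) (sym_anc (nths ys S) (c (nths ys (- S)))))" .
      have "(\<Sum>S\<in>?I - {{}}. sg (int (koszul (sec_degs ys) S + decalage (nths ys S))) (c (brk_tagged E (nths ys S) # nths ys (- S)))) =
         (\<Sum>S\<in>?I - {{}}. sg (?k S) (c ((nat (dg (nths ys S) - 1 - 1), sym_brk (nths ys S)) # nths ys (- S))))"
      proof (rule sum.cong[OF refl])
        fix S assume S: "S \<in> ?I - {{}}"
        have sl: "nths ys S \<in> SL" "nths ys (- S) \<in> SL"
          using ys by (auto simp: sec_lists_def dest: in_set_nthsD)
        have ne: "nths ys S \<noteq> []"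
        proof
          assume "nths ys S = []"
          then have "card S = 0" using S card_nths[of S ys] by simp
          then show False using S finite_subset[of S "{..<length ys}"] by auto
        qed
        have "brk E (nths ys S) \<in> sections E (nat (dg (nths ys S) - 2))"
          using brk_sec[OF sl(1) ne] by (simp add: out_index_dg)
        then show "sg (int (koszul (sec_degs ys) S + decalage (nths ys S))) (c (brk_tagged E (nths ys S) # nths ys (- S))) =
           sg (?k S) (c ((nat (dg (nths ys S) - 1 - 1), sym_brk (nths ys S)) # nths ys (- S)))"
          using ne sl(2) by (simp add: sym_brk_def brk_tagged_def out_index_dg CE_sec_sg[OF c] sg_sg)
      qed
      also have "\<dots> = (\<Sum>S\<in>?I. sg (?k S) (c ((nat (dg (nths ys S) - 1 - 1), sym_brk (nths ys S)) # nths ys (- S))))"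
        by (rule sum.mono_neutral_left) (auto simp: sym_brk_def CE_sec_zero[OF c])
      finally have 2: "(\<Sum>S\<in>?I - {{}}. sg (int (koszul (sec_degs ys) S + decalage (nths ys S))) (c (brk_tagged E (nths ys S) # nths ys (- S)))) =
         (\<Sum>S\<in>?I. sg (?k S) (c ((nat (dg (nths ys S) - 1 - 1), sym_brk (nths ys S)) # nths ys (- S))))" .
      show ?thesis
        unfolding ce_at_def 1 2 sum_unshuffles[symmetric] by (simp add: sum_subtractf sg_diff)
    qed
    then show ?thesis using c by (auto simp: ce_diff_def coder_op_def fun_eq_iff)
  qed (simp add: ce_diff_def coder_op_def)
qed

lemma Q_der: "ce_diff E \<in> ders (ce_alg E) 1"
  unfolding ce_diff_coder by (rule coder_op_der[OF coder_Q])

end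

section \<open>The Jacobi identity for symmetric brackets\<close>

lemma sg_nat_cong: "even (j + k) \<Longrightarrow> sg (int j) v = sg (int k) v"
  by (auto simp: sg_def)

context linfty_alg
begin

text \<open>The counterpart of \<open>brk_tagged\<close> for symmetric brackets, with the index that
  \<open>coder_op\<close> uses for k = 1.\<close>

definition tagged_brk :: "(nat \<times> 'l) list \<Rightarrow> nat \<times> 'l" where
  "tagged_brk u = (nat (dg u - 1 - 1), sym_brk u)"

lemma tagged_brk_sec: "u \<in> SL \<Longrightarrow> snd (tagged_brk u) \<in> sections E (fst (tagged_brk u))"
  using sym_brk_sec by (simp add: tagged_brk_def)

lemma sym_brk_zero: "s \<in> SL \<Longrightarrow> snd y = 0 \<Longrightarrow> sym_brk (y # s) = 0"
  using brk_zero[of s "fst y"] by (cases y) (simp add: sym_brk_def)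

lemma tagged_brk_deg: "u \<in> SL \<Longrightarrow> sym_brk u \<noteq> 0 \<Longrightarrow> dy (tagged_brk u) = dg u - 1"
  using sym_brk_small[of u] by (force simp: tagged_brk_def)

text \<open>Each term of the Jacobi identity, rewritten with symmetric brackets, acquires the same
  factor, the decalage sign of w; by \<open>decalage_unshuffle\<close> all other exponents add up to
  an even number.\<close>

lemma sym_jacobi:
  assumes w: "w \<in> SL"
  shows "shsum (\<lambda>u s. sym_brk (tagged_brk u # s)) w = 0"
proof (cases "w = []")
  case True
  then show ?thesis by (simp add: sym_brk_zero tagged_brk_def sym_brk_def[of "[]"])
next
  case False
  let ?I = "Pow {..<length w}"
  let ?J = "\<lambda>S. koszul (map fst w) S + card (crossings (length w) S) + card S * (length w - card S)"
  have "shsum (\<lambda>u s. sym_brk (tagged_brk u # s)) w =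
      (\<Sum>S\<in>?I. sg (int (koszul (sec_degs w) S)) (sym_brk (tagged_brk (nths w S) # nths w (- S))))"
    by (rule sum_unshuffles[symmetric])
  also have "\<dots> = (\<Sum>S\<in>?I - {{}}. sg (int (koszul (sec_degs w) S)) (sym_brk (tagged_brk (nths w S) # nths w (- S))))"
  proof (rule sum.mono_neutral_right)
    have "sym_brk (tagged_brk [] # w) = 0" by (rule sym_brk_zero[OF w]) (simp add: tagged_brk_def sym_brk_def)
    then show "\<forall>S\<in>?I - (?I - {{}}). sg (int (koszul (sec_degs w) S)) (sym_brk (tagged_brk (nths w S) # nths w (- S))) = 0"
      by (auto simp: nths_all)
  qed auto
  also have "\<dots> = (\<Sum>S\<in>?I - {{}}. sg (int (decalage w)) (sg (int (?J S)) (brk E (brk_tagged E (nths w S) # nths w (- S)))))"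
  proof (rule sum.cong[OF refl])
    fix S assume S: "S \<in> ?I - {{}}"
    define u s where us: "u = nths w S" "s = nths w (- S)"
    have sl: "u \<in> SL" "s \<in> SL"
      using w by (auto simp: us sec_lists_def dest: in_set_nthsD)
    have lu: "length u = card S" using S card_nths[of S w] by (simp add: us)
    then have ls: "length w - card S = length s" using length_nths_Compl[of w S] by (simp add: us)
    have ne: "u \<noteq> []" using lu S finite_subset[of S "{..<length w}"] by auto
    show "sg (int (koszul (sec_degs w) S)) (sym_brk (tagged_brk (nths w S) # nths w (- S))) =
       sg (int (decalage w)) (sg (int (?J S)) (brk E (brk_tagged E (nths w S) # nths w (- S))))"
      unfolding us[symmetric]
    proof (cases "dg u < 2")
      \<comment> \<open>Here u is a single section of degree 0, the case in which
        \<open>out_index\<close> is a truncated difference and the count of signs does not apply;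
        both sides are 0.\<close>
      case True
      then have z: "sym_brk u = 0" using sym_brk_small[OF sl(1)] by simp
      then have "brk E u = 0" using ne by (simp add: sym_brk_def)
      then have "brk E (brk_tagged E u # s) = 0" using brk_zero[OF sl(2)] by (simp add: brk_tagged_def)
      moreover have "sym_brk (tagged_brk u # s) = 0" by (rule sym_brk_zero[OF sl(2)]) (simp add: tagged_brk_def z)
      ultimately show "sg (int (koszul (sec_degs w) S)) (sym_brk (tagged_brk u # s)) =
       sg (int (decalage w)) (sg (int (?J S)) (brk E (brk_tagged E u # s)))" by simp
    next
      case False
      let ?a = "\<Sum>y\<leftarrow>u. fst y"
      have out: "out_index u + 2 = ?a + length u"
        using False dg_length[of u] unfolding out_index_def by linarith
      have bs: "(out_index u, brk E u) # s \<in> SL" using brk_sec[OF sl(1) ne] sl by simp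
      have "sym_brk (tagged_brk u # s) = sg (int (length s * out_index u + decalage s)) (sg (int (decalage u)) (brk E (brk_tagged E u # s)))"
        using ne brk_sg[OF bs] by (simp add: sym_brk_def tagged_brk_def decalage_Cons brk_tagged_def out_index_dg)
      then have 1: "sg (int (koszul (sec_degs w) S)) (sym_brk (tagged_brk u # s)) =
          sg (int (koszul (sec_degs w) S + length s * out_index u + decalage s + decalage u)) (brk E (brk_tagged E u # s))"
        by (simp add: sg_sg add.assoc)
      have 2: "sg (int (decalage w)) (sg (int (?J S)) (brk E (brk_tagged E u # s))) =
          sg (int (decalage w + ?J S)) (brk E (brk_tagged E u # s))"
        by (simp add: sg_sg)
      have "even (koszul (sec_degs w) S + length s * ?a + decalage s + decalage u
          + decalage w + koszul (map fst w) S + card (crossings (length w) S))"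
        using decalage_unshuffle[of S w] S unfolding us by blast
      moreover have "koszul (sec_degs w) S + length s * out_index u + decalage s + decalage u + (decalage w + ?J S) + 2 * length s =
          (koszul (sec_degs w) S + length s * ?a + decalage s + decalage u
          + decalage w + koszul (map fst w) S + card (crossings (length w) S)) + 2 * (length s * length u)"
      proof -
        have "length s * out_index u + 2 * length s = length s * ?a + length s * length u"
          using arg_cong[OF out, of "\<lambda>n. length s * n"] by (simp only: add_mult_distrib2 mult.commute)
        then show ?thesis unfolding ls unfolding lu[symmetric] by (simp add: mult.commute)
      qed
      ultimately have "even (koszul (sec_degs w) S + length s * out_index u + decalage s + decalage u + (decalage w + ?J S) + 2 * length s)"
        by (simp only: even_add dvd_triv_left simp_thms)
      then have "even (koszul (sec_degs w) S + length s * out_index u + decalage s + decalage u + (decalage w + ?J S))"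
        by (simp only: even_add dvd_triv_left simp_thms)
      then show "sg (int (koszul (sec_degs w) S)) (sym_brk (tagged_brk u # s)) =
       sg (int (decalage w)) (sg (int (?J S)) (brk E (brk_tagged E u # s)))"
        unfolding 1 2 by (rule sg_nat_cong)
    qed
  qed
  also have "\<dots> = sg (int (decalage w)) (\<Sum>S\<in>?I - {{}}. sg (int (?J S)) (brk E (brk_tagged E (nths w S) # nths w (- S))))"
    by (induction rule: infinite_finite_induct) (auto simp: sg_add)
  finally show ?thesis using jacobi[OF w False] by simp
qed

subsection \<open>Dual bases\<close>

lemma dual_basis_exists:
  "\<exists>(b :: nat \<Rightarrow> nat \<times> (nat \<Rightarrow> 'l) \<times> (nat \<Rightarrow> 'l \<Rightarrow> 'a)). \<forall>i.
     (\<forall>j<fst (b i). fst (snd (b i)) j \<in> sections E i) \<and>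
     (\<forall>j<fst (b i). \<forall>f. \<forall>x\<in>sections E i. \<forall>y\<in>sections E i.
        snd (snd (b i)) j (act E f x + y) = f * snd (snd (b i)) j x + snd (snd (b i)) j y) \<and>
     (\<forall>x\<in>sections E i. x = (\<Sum>j<fst (b i). act E (snd (snd (b i)) j x) (fst (snd (b i)) j)))"
proof (rule choice, rule allI)
  fix i
  obtain n e \<phi> where b: "\<forall>j<n. e j \<in> sections E i"
    "\<forall>j<n. \<forall>f. \<forall>x\<in>sections E i. \<forall>y\<in>sections E i. \<phi> j (act E f x + y) = f * \<phi> j x + \<phi> j y"
    "\<forall>x\<in>sections E i. x = (\<Sum>j<(n::nat). act E (\<phi> j x) (e j))"
    using sec_proj[of i] unfolding fg_projective_def by blast
  show "\<exists>b :: nat \<times> (nat \<Rightarrow> 'l) \<times> (nat \<Rightarrow> 'l \<Rightarrow> 'a). (\<forall>j<fst b. fst (snd b) j \<in> sections E i) \<and>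
     (\<forall>j<fst b. \<forall>f. \<forall>x\<in>sections E i. \<forall>y\<in>sections E i.
        snd (snd b) j (act E f x + y) = f * snd (snd b) j x + snd (snd b) j y) \<and>
     (\<forall>x\<in>sections E i. x = (\<Sum>j<fst b. act E (snd (snd b) j x) (fst (snd b) j)))"
    by (rule exI[of _ "(n, e, \<phi>)"]) (unfold fst_conv snd_conv, intro conjI b)
qed

definition "dual_bases = (SOME (b :: nat \<Rightarrow> nat \<times> (nat \<Rightarrow> 'l) \<times> (nat \<Rightarrow> 'l \<Rightarrow> 'a)). \<forall>i.
     (\<forall>j<fst (b i). fst (snd (b i)) j \<in> sections E i) \<and>
     (\<forall>j<fst (b i). \<forall>f. \<forall>x\<in>sections E i. \<forall>y\<in>sections E i.
        snd (snd (b i)) j (act E f x + y) = f * snd (snd (b i)) j x + snd (snd (b i)) j y) \<and>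
     (\<forall>x\<in>sections E i. x = (\<Sum>j<fst (b i). act E (snd (snd (b i)) j x) (fst (snd (b i)) j))))"

text \<open>A number of generators, not the rank of the bundle: \<open>eb\<close> and
  \<open>coord\<close> come from a direct summand of a free module, and the coordinates of the
  generators form a projection matrix, in general not the identity.\<close>

definition rk :: "nat \<Rightarrow> nat" where "rk i = fst (dual_bases i)"
definition eb :: "nat \<Rightarrow> nat \<Rightarrow> 'l" where "eb i = fst (snd (dual_bases i))"
definition coord :: "nat \<Rightarrow> nat \<Rightarrow> 'l \<Rightarrow> 'a" where "coord i = snd (snd (dual_bases i))"

lemmas dual_bases_props = someI_ex[OF dual_basis_exists, folded dual_bases_def, folded rk_def eb_def coord_def, THEN spec]

lemma eb_sec: "j < rk i \<Longrightarrow> eb i j \<in> sections E i"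
  by (rule dual_bases_props[THEN conjunct1, rule_format])

lemma coord_lin: "j < rk i \<Longrightarrow> x \<in> sections E i \<Longrightarrow> y \<in> sections E i \<Longrightarrow>
      coord i j (act E f x + y) = f * coord i j x + coord i j y"
  by (rule dual_bases_props[THEN conjunct2, THEN conjunct1, rule_format])

lemma coord_sum: "x \<in> sections E i \<Longrightarrow> (\<Sum>j<rk i. act E (coord i j x) (eb i j)) = x"
  by (rule dual_bases_props[THEN conjunct2, THEN conjunct2, rule_format, symmetric])

lemma coord_zero: "j < rk i \<Longrightarrow> coord i j 0 = 0"
  using coord_lin[of j i 0 0 1] by simp

lemma coord_act: "j < rk i \<Longrightarrow> x \<in> sections E i \<Longrightarrow> coord i j (act E f x) = f * coord i j x"
  using coord_lin[of j i x 0 f] by (simp add: coord_zero)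

subsection \<open>The anchor preserves brackets\<close>

abbreviation (input) "br x y \<equiv> brk E [(0, x), (0, y)]"

lemma br_sec: "x \<in> sections E 0 \<Longrightarrow> y \<in> sections E 0 \<Longrightarrow> br x y \<in> sections E 0"
  using brk_sec[of "[(0, x), (0, y)]"] by (simp add: out_index_def)

lemma br_antisym: "x \<in> sections E 0 \<Longrightarrow> y \<in> sections E 0 \<Longrightarrow> br x y = - br y x"
  using brk_swap[of "[]" "(0, x)" "(0, y)" "[]"] by simp

lemma br_act_right: "x \<in> sections E 0 \<Longrightarrow> y \<in> sections E 0 \<Longrightarrow>
    br x (act E f y) = act E (anchor E x f) y + act E f (br x y)"
  using leibniz[of "(0, x)" 0 y f] by (simp add: anc_def)

lemma br_add_left: "x \<in> sections E 0 \<Longrightarrow> y \<in> sections E 0 \<Longrightarrow> z \<in> sections E 0 \<Longrightarrow> br (x + y) z = br x z + br y z"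
  using brk_add[of 0 x y "[(0, z)]"] by simp

lemma br_act_left: "x \<in> sections E 0 \<Longrightarrow> y \<in> sections E 0 \<Longrightarrow>
    br (act E f x) y = act E f (br x y) - act E (anchor E y f) x"
  using br_antisym[of "act E f x" y] br_antisym[of x y] br_act_right[of y x f] by (simp add: sec_act act_minus_right)

lemma brk3_sec: "x \<in> sections E 0 \<Longrightarrow> y \<in> sections E 0 \<Longrightarrow> z \<in> sections E 0 \<Longrightarrow>
    brk E [(0, x), (0, y), (0, z)] \<in> sections E 1"
  using brk_sec[of "[(0, x), (0, y), (0, z)]"] by (simp add: out_index_def)

lemma brk3_act: assumes "x \<in> sections E 0" "y \<in> sections E 0" "z \<in> sections E 0"
  shows "brk E [(0, x), (0, y), (0, act E f z)] = act E f (brk E [(0, x), (0, y), (0, z)])"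
proof -
  have "brk E [(0, x), (0, y), (0, z')] = brk E [(0, z'), (0, x), (0, y)]" if "z' \<in> sections E 0" for z'
    using brk_swap[of "[(0, x)]" "(0, y)" "(0, z')" "[]"] brk_swap[of "[]" "(0, x)" "(0, z')" "[(0, y)]"] that assms by simp
  then show ?thesis
    using assms brk_act[of 0 z "[(0, x), (0, y)]" f] by (simp add: sec_act)
qed

text \<open>The unshuffle sum evaluated on three sections of degree 0. Terms with an inner unary
  bracket vanish, and the ternary bracket enters through its differential.\<close>

lemma jacobi3:
  assumes "x \<in> sections E 0" "y \<in> sections E 0" "z \<in> sections E 0"
  shows "br (br x y) z - br (br x z) y + br (br y z) x + brk E [(1, brk E [(0, x), (0, y), (0, z)])] = 0"
proof -
  have e: "shsum (\<lambda>u s. sym_brk (tagged_brk u # s)) [(0, x), (0, y), (0, z)] =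
      brk E [(1, brk E [(0, x), (0, y), (0, z)])] + br (br x y) z - br (br x z) y + br (br y z) x"
    using assms by (simp add: tagged_brk_def sym_brk_def decalage_Cons sg_def brk_0 brk_zero)
  have "brk E [(1, brk E [(0, x), (0, y), (0, z)])] + br (br x y) z - br (br x z) y + br (br y z) x = 0"
    unfolding e[symmetric] by (rule sym_jacobi) (use assms in simp)
  then show ?thesis by (simp add: algebra_simps)
qed

lemma act_diff_left: "act E (f - g) x = act E f x - act E g x"
  using act_add_left[of f "- g" x] by (simp add: act_minus_left)

lemma act_diff_right: "act E f (x - y) = act E f x - act E f y"
  using act_add_right[of f x "- y"] by (simp add: act_minus_right)

text \<open>Not part of the definition of an algebroid, but needed for \<open>Q\<^sup>2 = 0\<close>. Replacing \<open>z\<close> by \<open>f z\<close> in the Jacobi identity of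
  \<open>x\<close>, \<open>y\<close>, \<open>z\<close> shows that the defect \<open>T x\<close> annihilates all sections of degree 0; as it is linear in \<open>x\<close>,
  expanding \<open>x\<close> in a dual basis gives \<open>T x = 0\<close>.\<close>

lemma anchor_bracket:
  assumes x: "x \<in> sections E 0" and y: "y \<in> sections E 0"
  shows "anchor E (br x y) f = anchor E x (anchor E y f) - anchor E y (anchor E x f)"
proof -
  define T where "T x = anchor E (br x y) f - (anchor E x (anchor E y f) - anchor E y (anchor E x f))" for x
  have kills: "act E (T x) z = 0" if x: "x \<in> sections E 0" and z: "z \<in> sections E 0" for x z
  proof -
    note s = x y z br_sec[OF x y] br_sec[OF x z] br_sec[OF y z]
    let ?J = "br (br x y) z - br (br x z) y + br (br y z) x + brk E [(1, brk E [(0, x), (0, y), (0, z)])]"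
    have 1: "br (br x y) (act E f z) = act E (anchor E (br x y) f) z + act E f (br (br x y) z)"
      using s by (simp add: br_act_right)
    have 2: "br (br x (act E f z)) y = act E (anchor E x f) (br z y) - act E (anchor E y (anchor E x f)) z
        + act E f (br (br x z) y) - act E (anchor E y f) (br x z)"
      using s by (simp add: br_act_right br_add_left br_act_left sec_act)
    have 3: "br (br y (act E f z)) x = act E (anchor E y f) (br z x) - act E (anchor E x (anchor E y f)) z
        + act E f (br (br y z) x) - act E (anchor E x f) (br y z)"
      using s by (simp add: br_act_right br_add_left br_act_left sec_act)
    have 4: "brk E [(1, brk E [(0, x), (0, y), (0, act E f z)])] = act E f (brk E [(1, brk E [(0, x), (0, y), (0, z)])])"
      using s brk3_sec[OF x y z] brk_act[of 1 _ "[]" f] by (simp add: brk3_act)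
    have "0 = br (br x y) (act E f z) - br (br x (act E f z)) y + br (br y (act E f z)) x
        + brk E [(1, brk E [(0, x), (0, y), (0, act E f z)])]"
      using jacobi3[OF x y, of "act E f z"] z by (simp add: sec_act)
    also have "\<dots> = act E (T x) z + act E f ?J"
      unfolding 1 2 3 4 T_def using br_antisym[OF z y] br_antisym[OF z x]
      by (simp add: act_add_left act_add_right act_diff_left act_diff_right act_minus_right)
    finally show ?thesis using jacobi3[OF x y z] by simp
  qed
  have vf: "anchor E x \<in> vector_fields E" "anchor E y \<in> vector_fields E" if "x \<in> sections E 0" for x
    using anchor_vf that y by auto
  have Tadd: "T (x + x') = T x + T x'" if "x \<in> sections E 0" "x' \<in> sections E 0" for x x'
    using that y by (simp add: T_def br_add_left anchor_add br_sec vf_add vf)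
  have Tact: "T (act E h x) = h * T x" if x: "x \<in> sections E 0" for h x
  proof -
    have "anchor E (br (act E h x) y) f = h * anchor E (br x y) f - anchor E y h * anchor E x f"
      using x y anchor_add[of "act E h (br x y)" "- act E (anchor E y h) x" f]
      by (simp add: br_act_left sec_act br_sec sec_minus anchor_act anchor_minus)
    then show ?thesis
      using x y vf[OF x] by (simp add: T_def anchor_act vf_mult algebra_simps)
  qed
  have T0: "T 0 = 0" using Tadd[of 0 0] by simp
  have Tsum: "T (\<Sum>j\<in>J. g j) = (\<Sum>j\<in>J. T (g j))" if "\<And>j. j \<in> J \<Longrightarrow> g j \<in> sections E 0" for J and g :: "nat \<Rightarrow> 'l"
    using that by (induction J rule: infinite_finite_induct) (auto simp: T0 Tadd sec_sum)
  have "T x = T (\<Sum>j<rk 0. act E (coord 0 j x) (eb 0 j))"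
    using coord_sum[OF x] by simp
  also have "\<dots> = (\<Sum>j<rk 0. coord 0 j x * T (eb 0 j))"
    using eb_sec by (subst Tsum) (auto simp: sec_act Tact)
  \<comment> \<open>The scalar \<open>T (eb 0 j)\<close> is moved inside the coordinate, where it
    acts on x itself and annihilates it.\<close>
  also have "\<dots> = (\<Sum>j<rk 0. coord 0 j (act E (T (eb 0 j)) x))"
    by (rule sum.cong) (auto simp: coord_act x mult.commute)
  also have "\<dots> = 0"
    by (rule sum.neutral) (auto simp: kills eb_sec x coord_zero)
  finally show ?thesis by (simp add: T_def)
qed

subsection \<open>The square of the Chevalley--Eilenberg differential\<close>

lemma Q_apply: "c \<in> CE \<Longrightarrow> ys \<in> SL \<Longrightarrow> ce_diff E c ys = shsum (\<lambda>u w. sym_anc u (c w) - c (tagged_brk u # w)) ys"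
  by (simp add: ce_diff_coder coder_op_def tagged_brk_def)

lemma sym_anc_add: "u \<in> SL \<Longrightarrow> sym_anc u (f + g) = sym_anc u f + sym_anc u g"
  and sym_anc_mult: "u \<in> SL \<Longrightarrow> sym_anc u (f * g) = sym_anc u f * g + f * sym_anc u g"
  and sym_anc_deg: "u \<in> SL \<Longrightarrow> dg u \<noteq> 1 \<Longrightarrow> sym_anc u f = 0"
  using coder_A_add[OF coder_Q] coder_A_mult[OF coder_Q] coder_A_deg[OF coder_Q] by auto

lemma sym_anc_zero [simp]: "u \<in> SL \<Longrightarrow> sym_anc u 0 = 0"
  using sym_anc_add[of u 0 0] by simp

lemma sym_anc_minus: "u \<in> SL \<Longrightarrow> sym_anc u (- f) = - sym_anc u f"
  using sym_anc_add[of u f "- f"] by (simp add: eq_neg_iff_add_eq_0 add.commute)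

lemma sym_anc_diff: "u \<in> SL \<Longrightarrow> sym_anc u (f - g) = sym_anc u f - sym_anc u g"
  using sym_anc_add[of u f "- g"] by (simp add: sym_anc_minus)

text \<open>Both sides vanish unless \<open>dg w = 2\<close>. If w is one section of degree 1, the
  claim is that the anchor kills the image of the differential; if w consists of two sections of
  degree 0, it is \<open>anchor_bracket\<close>.\<close>

lemma Q_Q_anchor:
  assumes w: "w \<in> SL"
  shows "shsum (\<lambda>u s. sym_anc u (sym_anc s g)) w = shsum (\<lambda>u s. sym_anc (tagged_brk u # s) g) w"
proof -
  have "shsum (\<lambda>u s. sym_anc (tagged_brk u # s) g) w = shsum (\<lambda>u s. if s = [] then sym_anc [tagged_brk u] g else 0) w"
    by (rule shsum_cong) (auto simp: neq_Nil_conv)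
  then have r: "shsum (\<lambda>u s. sym_anc (tagged_brk u # s) g) w = sym_anc [tagged_brk w] g"
    by (simp only: shsum_Nil_right)
  show ?thesis
  proof (cases "dg w = 2")
    case False
    have "shsum (\<lambda>u s. sym_anc u (sym_anc s g)) w = shsum (\<lambda>u s. 0) w"
    proof (rule shsum_cong)
      fix u s assume "set u \<union> set s = set w" "dg u + dg s = dg w"
      then have "u \<in> SL" "s \<in> SL" "dg u \<noteq> 1 \<or> dg s \<noteq> 1" using w SL_split[of u s w] False by auto
      then show "sym_anc u (sym_anc s g) = 0" using sym_anc_deg by auto
    qed
    moreover have "sym_anc [tagged_brk w] g = 0"
    proof (cases "dg w < 2")
      case True
      then have "sym_brk w = 0" using sym_brk_small[OF w] by simp
      then show ?thesis by (simp add: tagged_brk_def anc_def anchor_zero)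
    next
      case f: False
      then have "fst (tagged_brk w) \<noteq> 0" using False by (simp add: tagged_brk_def)
      then show ?thesis by (simp add: anc_def)
    qed
    ultimately show ?thesis using r by simp
  next
    case True
    obtain y v where wy: "w = y # v" using True by (cases w) auto
    show ?thesis
    proof (cases v)
      case Nil
      then have "y = (1, snd y)" using True wy by (simp add: prod_eq_iff)
      then obtain x where y: "y = (1, x)" by blast
      then have "x \<in> sections E 1" using w wy by simp
      then show ?thesis
        unfolding r by (simp add: wy Nil y tagged_brk_def sym_brk_def anc_def anchor_differential[unfolded One_nat_def] decalage_Cons)
    next
      case (Cons z v')
      have "dg v' = 0" "fst y = 0" "fst z = 0" using True wy Cons dg_nonneg[of v'] by (simp_all del: dg_eq_0_iff)
      then have "w = [(0, snd y), (0, snd z)]" using wy Cons by (simp add: prod_eq_iff)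
      then obtain x x' where wx: "w = [(0, x), (0, x')]" by blast
      then have s: "x \<in> sections E 0" "x' \<in> sections E 0" using w by simp_all
      show ?thesis
        unfolding r using anchor_bracket[OF s, of g] sym_anc_zero[of "[(0, x)]"] s
        by (simp add: wx tagged_brk_def sym_brk_def anc_def decalage_Cons sg_def)
    qed
  qed
qed

text \<open>Coassociativity collects the terms of the double application by the block w of entries
  that the two copies of Q consume. For fixed w they fall into four groups that vanish separately:
  two anchors, an anchor and a bracket on disjoint blocks, two brackets on disjoint blocks, and
  nested brackets.\<close>

lemma Q_Q: "ce_diff E (ce_diff E c) = 0"
proof (cases "c \<in> CE")
  case False
  then show ?thesis using C.der_zero[OF Q_der] C.der_out[OF Q_der False] by simp
next
  case c: True
  let ?A = sym_anc and ?b = tagged_brk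
  have Qc: "ce_diff E c \<in> CE" by (rule C.der_AP[OF Q_der])
  show ?thesis
  proof
    fix ys
    show "ce_diff E (ce_diff E c) ys = 0 ys"
    proof (cases "ys \<in> SL")
      case False
      then show ?thesis using CE_out[OF C.der_AP[OF Q_der]] by simp
    next
      case ys: True
      let ?K = "\<lambda>u s t. ?A u (?A s (c t)) - ?A u (c (?b s # t)) - ?A (?b u # s) (c t) + c (?b (?b u # s) # t)
          - sg (dy (?b u) * dg s) (?A s (c (?b u # t))) + sg (dy (?b u) * dg s) (c (?b s # ?b u # t))"
      have "ce_diff E (ce_diff E c) ys = shsum (\<lambda>u w. shsum (\<lambda>s t. ?K u s t) w) ys"
        unfolding Q_apply[OF Qc ys]
      proof (rule shsum_cong)
        fix u w assume "set u \<union> set w = set ys"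
        then have u: "u \<in> SL" and w: "w \<in> SL" using ys SL_split by blast+
        have bw: "?b u # w \<in> SL" using tagged_brk_sec[OF u] w by simp
        show "?A u (ce_diff E c w) - ce_diff E c (?b u # w) = shsum (\<lambda>s t. ?K u s t) w"
          unfolding Q_apply[OF c w] Q_apply[OF c bw] shsum.simps shsum_hom[of "?A u", OF sym_anc_add[OF u]]
            shsum_add[symmetric] shsum_diff[symmetric]
          by (rule shsum_cong) (simp add: sym_anc_diff[OF u] sg_diff)
      qed
      also have "\<dots> = shsum (\<lambda>w t. shsum (\<lambda>u s. ?K u s t) w) ys"
        by (rule shsum_coassoc[symmetric])
      also have "\<dots> = shsum (\<lambda>w t. 0) ys"
      proof (rule shsum_cong)
        fix w t assume "set w \<union> set t = set ys"
        then have w: "w \<in> SL" and t: "t \<in> SL" using ys SL_split by blast+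
        have sl: "u \<in> SL \<and> s \<in> SL" if "set u \<union> set s = set w" for u s using that w SL_split by blast
        have Z: "shsum (\<lambda>u s. ?A u (?A s (c t)) - ?A (?b u # s) (c t)) w = 0"
          unfolding shsum_diff using Q_Q_anchor[OF w] by simp
        \<comment> \<open>An anchor and a bracket on disjoint blocks occur in both orders;
          exchanging the blocks turns one sum into the negative of the other.\<close>
        have Y: "shsum (\<lambda>u s. ?A u (c (?b s # t)) + sg (dy (?b u) * dg s) (?A s (c (?b u # t)))) w = 0"
        proof -
          have "shsum (\<lambda>u s. sg (dy (?b u) * dg s) (?A s (c (?b u # t)))) w =
              shsum (\<lambda>u s. - ?A u (c (?b s # t))) w"
            unfolding shsum_cocomm[of "\<lambda>u s. sg (dy (?b u) * dg s) (?A s (c (?b u # t)))"]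
          proof (rule shsum_cong)
            fix u s assume "set u \<union> set s = set w"
            then have u: "u \<in> SL" and s: "s \<in> SL" using sl by blast+
            show "sg (dg u * dg s) (sg (dy (?b s) * dg u) (?A u (c (?b s # t)))) = - ?A u (c (?b s # t))"
            proof (cases "sym_brk s = 0 \<or> dg u \<noteq> 1")
              case True
              then have "?A u (c (?b s # t)) = 0"
                using sym_anc_deg[OF u] CE_sec_zero[OF c] u by (auto simp: tagged_brk_def)
              then show ?thesis by simp
            next
              case False
              then have "dg u * dg s + dy (?b s) * dg u = 2 * dg s - 1"
                unfolding tagged_brk_deg[OF s False[unfolded de_Morgan_disj, THEN conjunct1]] by simp
              then show ?thesis by (simp only: sg_sg) (simp add: sg_def)
            qed
          qed
          then show ?thesis by (simp add: shsum_add shsum_minus)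
        qed
        \<comment> \<open>Exchanging the blocks of the two brackets reverses the sign because both
          operations are odd, so the sum equals its own negative.\<close>
        have X: "shsum (\<lambda>u s. sg (dy (?b u) * dg s) (c (?b s # ?b u # t))) w = 0" (is "?X = 0")
        proof (rule double_zero)
          have "?X = shsum (\<lambda>u s. - sg (dy (?b u) * dg s) (c (?b s # ?b u # t))) w"
            unfolding shsum_cocomm[of "\<lambda>u s. sg (dy (?b u) * dg s) (c (?b s # ?b u # t))"]
          proof (rule shsum_cong)
            fix u s assume "set u \<union> set s = set w"
            then have u: "u \<in> SL" and s: "s \<in> SL" using sl by blast+
            have sw: "c (?b u # ?b s # t) = sg (dy (?b u) * dy (?b s)) (c (?b s # ?b u # t))"
              by (rule CE_swap[OF c tagged_brk_sec[OF u] tagged_brk_sec[OF s] t])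
            show "sg (dg u * dg s) (sg (dy (?b s) * dg u) (c (?b u # ?b s # t))) =
                - sg (dy (?b u) * dg s) (c (?b s # ?b u # t))"
            proof (cases "sym_brk s = 0 \<or> sym_brk u = 0")
              case True
              have "c (?b s # ?b u # t) = 0"
              proof (cases "sym_brk s = 0")
                case False
                then have "sym_brk u = 0" using True by simp
                then have "c (?b u # ?b s # t) = 0" by (simp add: tagged_brk_def CE_sec_zero[OF c])
                then show ?thesis using sw by simp
              qed (simp add: tagged_brk_def CE_sec_zero[OF c])
              then show ?thesis unfolding sw by simp
            next
              case False
              then have d: "dy (?b s) = dg s - 1" "dy (?b u) = dg u - 1"
                using tagged_brk_deg[OF s] tagged_brk_deg[OF u] by simp_all
              show ?thesis unfolding sw d
                by (cases "even (dg s)"; cases "even (dg u)") (simp_all add: sg_def)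
            qed
          qed
          then show "?X = - ?X" by (simp only: shsum_minus)
        qed
        have J: "shsum (\<lambda>u s. c (?b (?b u # s) # t)) w = 0"
        proof -
          let ?n = "nat (dg w - 3)" and ?F = "\<lambda>u s. sym_brk (?b u # s)"
          have F: "?F u s \<in> sections E ?n \<and> c (?b (?b u # s) # t) = c ((?n, ?F u s) # t)"
            if "set u \<union> set s = set w" "dg u + dg s = dg w" for u s
          proof -
            have u: "u \<in> SL" and s: "s \<in> SL" using sl that by blast+
            have bs: "?b u # s \<in> SL" using tagged_brk_sec[OF u] s by simp
            show ?thesis
            proof (cases "sym_brk u = 0")
              case True
              then have "?F u s = 0" by (intro sym_brk_zero[OF s]) (simp add: tagged_brk_def)
              then show ?thesis by (simp add: tagged_brk_def[of "?b u # s"] CE_sec_zero[OF c])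
            next
              case False
              then have "nat (dg (?b u # s) - 1 - 1) = ?n"
                using tagged_brk_deg[OF u] that(2) by simp
              then show ?thesis using sym_brk_sec[OF bs] by (simp only: tagged_brk_def[of "?b u # s"])
            qed
          qed
          \<comment> \<open>\<open>shsum_hom_on\<close> knows which entries the blocks contain, but
            not that their degrees add up. The guard restores this information, which puts all
            nested brackets into the one bundle of index \<open>?n\<close>.\<close>
          let ?F' = "\<lambda>u s. if dg u + dg s = dg w then ?F u s else 0"
          have "shsum (\<lambda>u s. c (?b (?b u # s) # t)) w = shsum (\<lambda>u s. c ((?n, ?F' u s) # t)) w"
            by (rule shsum_cong) (use F in auto)
          also have "\<dots> = c ((?n, shsum ?F' w) # t)"
          proof -
            have "shsum ?F' w \<in> sections E ?n \<and> c ((?n, shsum ?F' w) # t) = shsum (\<lambda>u s. c ((?n, ?F' u s) # t)) w"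
              by (rule shsum_hom_on[where P = "\<lambda>x. x \<in> sections E ?n" and T = "\<lambda>x. c ((?n, x) # t)"])
                (use F c t in \<open>auto simp: sec_add sec_sg CE_sec_add CE_sec_sg\<close>)
            then show ?thesis by simp
          qed
          also have "shsum ?F' w = shsum ?F w"
            by (rule shsum_cong) simp
          finally show ?thesis using sym_jacobi[OF w] CE_sec_zero[OF c] by simp
        qed
        have "shsum (\<lambda>u s. ?K u s t) w = shsum (\<lambda>u s. (?A u (?A s (c t)) - ?A (?b u # s) (c t))
           - (?A u (c (?b s # t)) + sg (dy (?b u) * dg s) (?A s (c (?b u # t))))
           + c (?b (?b u # s) # t) + sg (dy (?b u) * dg s) (c (?b s # ?b u # t))) w"
          by (rule shsum_cong) simp
        also have "\<dots> = 0"
          unfolding shsum_add shsum_diff using X J Y Z by (simp add: shsum_add shsum_diff)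
        finally show "shsum (\<lambda>u s. ?K u s t) w = 0" .
      qed
      finally show ?thesis by simp
    qed
  qed
qed

subsection \<open>The Euler derivation\<close>

lemma euler_apply: "c \<in> CE \<Longrightarrow> euler E c ys = of_int (dg ys) * c ys"
  by (simp add: euler_def flip: dg_sec_degs)

lemma euler_cochain: "c \<in> cochains E i \<Longrightarrow> euler E c = gscale (ce_alg E) (of_int i) c"
proof
  fix ys assume c: "c \<in> cochains E i"
  show "euler E c ys = gscale (ce_alg E) (of_int i) c ys"
    using cochain_CE[OF c] cochain_out[OF c, of ys] by (cases "dg ys = i") (simp_all add: euler_apply base_of_int)
qed

lemma euler_der: "euler E \<in> ders (ce_alg E) 0"
proof (rule C.dersI)
  fix i c assume c: "c \<in> part (ce_alg E) i"
  then show "euler E c \<in> part (ce_alg E) (i + 0)" using C.part_scale[OF c, of "of_int i"] by (simp add: euler_cochain)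
next
  fix i j c c' assume c: "c \<in> part (ce_alg E) i" "c' \<in> part (ce_alg E) j"
  have m: "cochain_mult c c' \<in> cochains E (i + j)" using cochain_mult_cochains c by simp
  have "gscale (ce_alg E) (of_int (i + j)) (cochain_mult c c') =
      cochain_mult (gscale (ce_alg E) (of_int i) c) c' + cochain_mult c (gscale (ce_alg E) (of_int j) c')"
    using C.mul_scale_left[of "of_int i" c c'] C.mul_scale_right[of c "of_int j" c']
    by (simp add: fun_eq_iff base_add distrib_right)
  then show "euler E (gmul (ce_alg E) c c') = gmul (ce_alg E) (euler E c) c' + sg (0 * i) (gmul (ce_alg E) c (euler E c'))"
    using c m by (simp add: euler_cochain)
next
  fix c c' assume "c \<in> CE" "c' \<in> CE"
  then show "euler E (c + c') = euler E c + euler E c'"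
    by (simp add: fun_eq_iff euler_apply C.AP_add distrib_left)
next
  fix r c assume c: "c \<in> CE"
  show "euler E (gscale (ce_alg E) r c) = gscale (ce_alg E) r (euler E c)"
    using euler_apply[OF C.AP_scale[OF c, of r]] euler_apply[OF c] by (simp add: fun_eq_iff mult.left_commute)
qed (simp add: euler_def)

subsection \<open>Constant cochains\<close>

lemma const_cochain: "const_cochain f \<in> cochains E 0"
  by (auto simp: cochains_iff const_cochain_def gsym_def glin_def)

lemma cochain_0: "c \<in> cochains E 0 \<Longrightarrow> c = const_cochain (c [])"
  using cochain_out[of c 0] by (auto simp: const_cochain_def fun_eq_iff)

lemma const_cochain_Nil [simp]: "const_cochain f [] = f"
  and const_cochain_Cons [simp]: "const_cochain f (y # ys) = 0"
  by (simp_all add: const_cochain_def)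

lemma const_mult: "cochain_mult (const_cochain f) c ys = f * c ys"
proof -
  have "shsum (\<lambda>u v. const_cochain f u * c v) ys = shsum (\<lambda>u v. if u = [] then f * c v else 0) ys"
    by (rule shsum_cong) (simp add: const_cochain_def)
  then show ?thesis by (simp only: cochain_mult_shsum shsum_Nil_left)
qed

lemma const_cochain_mult: "const_cochain (f * g) = cochain_mult (const_cochain f) (const_cochain g)"
  by (simp add: fun_eq_iff const_mult) (simp add: const_cochain_def)

lemma const_cochain_add: "const_cochain (f + g :: 'a) = const_cochain f + const_cochain g"
  by (simp add: const_cochain_def fun_eq_iff)

lemma const_cochain_base: "const_cochain (base E r * f) = gscale (ce_alg E) r (const_cochain f)"
  by (simp add: const_cochain_def fun_eq_iff)

text \<open>A constant cochain vanishes on nonempty lists, so the bracket terms drop out: on \<O>(U)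
  the derivation consists of its anchors.\<close>

lemma coder_op_const:
  assumes cod: "coder k A \<beta>" and ys: "ys \<in> SL"
  shows "coder_op k A \<beta> (const_cochain f) ys = A ys f"
proof -
  have "shsum (\<lambda>u w. A u (const_cochain f w) - const_cochain f ((nat (dg u - k - 1), \<beta> u) # w)) ys =
      shsum (\<lambda>u w. if w = [] then A u f else 0) ys"
  proof (rule shsum_cong)
    fix u w assume "set u \<union> set w = set ys"
    then have "u \<in> SL" using ys SL_split by blast
    then show "A u (const_cochain f w) - const_cochain f ((nat (dg u - k - 1), \<beta> u) # w) = (if w = [] then A u f else 0)"
      using coder_A_zero[OF cod] by (simp add: const_cochain_def)
  qed
  then show ?thesis
    using ys cochain_CE[OF const_cochain] by (simp add: coder_op_def shsum_Nil_right)
qed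

subsection \<open>Contractions with sections\<close>

text \<open>Contraction with a section is the derivation whose only Taylor coefficient is the one at
  the empty list. The sign in \<open>- x\<close> offsets the minus in
  \<open>coder_op\<close>.\<close>

definition iot :: "nat \<Rightarrow> 'l \<Rightarrow> ('a, 'l) cochain \<Rightarrow> ('a, 'l) cochain" where
  "iot i x = coder_op (- (int i + 1)) (\<lambda>_ _. 0) (\<lambda>u. if u = [] then - x else 0)"

lemma coder_iot:
  assumes "x \<in> sections E i" shows "coder (- (int i + 1)) (\<lambda>_ _. 0) (\<lambda>u. if u = [] then - x else 0)"
proof -
  have "\<not> dg u + (int i + 1) < 1" for u :: "(nat \<times> 'l) list" using dg_nonneg[of u] by simp
  then show ?thesis using assms by (simp add: coder_def gsym_def glin_def sec_minus del: dg_eq_0_iff)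
qed

lemma iot_der: "x \<in> sections E i \<Longrightarrow> iot i x \<in> ders (ce_alg E) (- (int i + 1))"
  unfolding iot_def by (rule coder_op_der[OF coder_iot])

lemma iot_apply:
  assumes c: "c \<in> CE" and x: "x \<in> sections E i" and ys: "ys \<in> SL"
  shows "iot i x c ys = c ((i, x) # ys)"
proof -
  have "shsum (\<lambda>u w. 0 - c ((nat (dg u - (- (int i + 1)) - 1), if u = [] then - x else 0) # w)) ys =
      shsum (\<lambda>u w. if u = [] then c ((i, x) # w) else 0) ys"
  proof (rule shsum_cong)
    fix u w assume "set u \<union> set w = set ys"
    then have "w \<in> SL" using ys SL_split by blast
    then show "0 - c ((nat (dg u - (- (int i + 1)) - 1), if u = [] then - x else 0) # w) = (if u = [] then c ((i, x) # w) else 0)"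
      using c x by (simp add: CE_sec_minus CE_sec_zero)
  qed
  then show ?thesis using c ys by (simp add: iot_def coder_op_def shsum_Nil_left)
qed

lemma iot_const: "x \<in> sections E i \<Longrightarrow> iot i x (const_cochain f) = 0"
proof
  fix ys assume x: "x \<in> sections E i"
  show "iot i x (const_cochain f) ys = 0 ys"
    using iot_apply[OF cochain_CE[OF const_cochain] x, of ys] CE_out[OF C.der_AP[OF iot_der[OF x]], of ys]
    by (cases "ys \<in> SL") simp_all
qed

subsection \<open>The Grassmann connection\<close>

text \<open>The coordinates of a section are differentiated in the free module, and the result is
  projected back to the direct summand.\<close>

definition conn :: "('a \<Rightarrow> 'a) \<Rightarrow> nat \<times> 'l \<Rightarrow> 'l" where
  "conn v y = (\<Sum>j<rk (fst y). act E (v (coord (fst y) j (snd y))) (eb (fst y) j))"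

definition nab_anc :: "('a \<Rightarrow> 'a) \<Rightarrow> (nat \<times> 'l) list \<Rightarrow> 'a \<Rightarrow> 'a" where
  "nab_anc v u f = (if u = [] then v f else 0)"

definition nab_sec :: "('a \<Rightarrow> 'a) \<Rightarrow> (nat \<times> 'l) list \<Rightarrow> 'l" where
  "nab_sec v u = (case u of [y] \<Rightarrow> conn v y | _ \<Rightarrow> 0)"

definition nab :: "('a \<Rightarrow> 'a) \<Rightarrow> ('a, 'l) cochain \<Rightarrow> ('a, 'l) cochain" where
  "nab v = coder_op 0 (nab_anc v) (nab_sec v)"

lemma nab_sec_simps [simp]: "nab_sec v [] = 0" "nab_sec v [y] = conn v y" "nab_sec v (y # z # u) = 0"
  by (simp_all add: nab_sec_def)

lemma nab_sec_long: "length u \<noteq> 1 \<Longrightarrow> nab_sec v u = 0"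
  by (auto simp: nab_sec_def split: list.splits)

lemma conn_sec: "conn v (i, x) \<in> sections E i"
  by (auto simp: conn_def intro!: sec_sum sec_act eb_sec)

lemma nab_sec_sec: "nab_sec v u \<in> sections E (nat (dg u - 1))"
proof (cases "length u = 1")
  case True
  then obtain y where "u = [y]" by (cases u) auto
  then show ?thesis using conn_sec[of v "fst y" "snd y"] by simp
qed (simp add: nab_sec_long)

lemma conn_lin:
  assumes v: "v \<in> vector_fields E" and x: "x \<in> sections E i" "x' \<in> sections E i"
  shows "conn v (i, act E f x + x') = act E f (conn v (i, x)) + conn v (i, x') + act E (v f) x"
proof -
  have "conn v (i, act E f x + x') =
      (\<Sum>j<rk i. act E f (act E (v (coord i j x)) (eb i j)) + act E (v (coord i j x')) (eb i j) + act E (v f) (act E (coord i j x) (eb i j)))"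
    unfolding conn_def fst_conv snd_conv
  proof (rule sum.cong[OF refl])
    fix j assume "j \<in> {..<rk i}"
    then have e: "coord i j (act E f x + x') = f * coord i j x + coord i j x'" by (simp add: coord_lin x)
    show "act E (v (coord i j (act E f x + x'))) (eb i j) = act E f (act E (v (coord i j x)) (eb i j)) +
        act E (v (coord i j x')) (eb i j) + act E (v f) (act E (coord i j x) (eb i j))"
      unfolding e vf_add[OF v] vf_mult[OF v] act_add_left act_act by (simp only: add_ac)
  qed
  also have "\<dots> = act E f (conn v (i, x)) + conn v (i, x') + act E (v f) (\<Sum>j<rk i. act E (coord i j x) (eb i j))"
    by (simp add: conn_def sum.distrib act_sum_right)
  finally show ?thesis using coord_sum[OF x(1)] by simp
qed

lemma coder_nab:
  assumes v: "v \<in> vector_fields E" shows "coder 0 (nab_anc v) (nab_sec v)"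
  unfolding coder_def
proof (intro conjI ballI allI impI)
  fix f i x x' u assume a: "(i, x) # (i, x') # u \<in> SL"
  show "nab_sec v ((i, act E f x + x') # u) = act E f (nab_sec v ((i, x) # u)) + nab_sec v ((i, x') # u) +
       sg ((int i + 1) * dg u) (act E (nab_anc v u f) x)"
    using a by (cases u) (simp_all add: conn_lin[OF v] nab_anc_def)
next
  fix u assume u: "u \<in> SL" "dg u - 0 < 1"
  then have "u = []" using dg_pos[of u] by force
  then show "nab_sec v u = 0" by simp
next
  fix u r f show "nab_anc v u (base E r * f) = base E r * nab_anc v u f"
    by (simp add: nab_anc_def vf_base[OF v])
qed (auto simp: nab_anc_def vf_add[OF v] vf_mult[OF v] gsym_def glin_def nab_sec_long nab_sec_sec)

lemma nab_der: "v \<in> vector_fields E \<Longrightarrow> nab v \<in> ders (ce_alg E) 0"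
  unfolding nab_def by (rule coder_op_der[OF coder_nab])

lemma nab_const: "v \<in> vector_fields E \<Longrightarrow> nab v (const_cochain f) = const_cochain (v f)"
proof
  fix ys assume v: "v \<in> vector_fields E"
  show "nab v (const_cochain f) ys = const_cochain (v f) ys"
  proof (cases "ys \<in> SL")
    case True
    then show ?thesis using coder_op_const[OF coder_nab[OF v] True, of f]
      by (simp add: nab_def nab_anc_def const_cochain_def)
  next
    case False
    then have "ys \<noteq> []" by auto
    then show ?thesis using CE_out[OF C.der_AP[OF nab_der[OF v]] False] by (simp add: const_cochain_def)
  qed
qed

text \<open>Linearity of the lift over \<O>(U) makes the restriction of a form along lifts
  multilinear, see \<open>base_form_exists\<close>.\<close>

lemma nab_lin: "nab (\<lambda>f. h * v f + v' f) c = cochain_mult (const_cochain h) (nab v c) + nab v' c"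
proof
  fix ys
  show "nab (\<lambda>f. h * v f + v' f) c ys = (cochain_mult (const_cochain h) (nab v c) + nab v' c) ys"
  proof (cases "c \<in> CE \<and> ys \<in> SL")
    case True
    then have c: "c \<in> CE" and ys: "ys \<in> SL" by auto
    have "conn (\<lambda>f. h * v f + v' f) y = act E h (conn v y) + conn v' y" for y
      by (simp add: conn_def act_add_left act_act sum.distrib act_sum_right)
    then have s: "nab_sec (\<lambda>f. h * v f + v' f) u = act E h (nab_sec v u) + nab_sec v' u" for u
      by (cases "length u = 1") (auto simp: nab_sec_long length_Suc_conv)
    have "shsum (\<lambda>u w. nab_anc (\<lambda>f. h * v f + v' f) u (c w) - c ((nat (dg u - 1), nab_sec (\<lambda>f. h * v f + v' f) u) # w)) ys =
        shsum (\<lambda>u w. h * (nab_anc v u (c w) - c ((nat (dg u - 1), nab_sec v u) # w)) +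
          (nab_anc v' u (c w) - c ((nat (dg u - 1), nab_sec v' u) # w))) ys"
    proof (rule shsum_cong)
      fix u w assume "set u \<union> set w = set ys"
      then have "w \<in> SL" using ys SL_split by blast
      then show "nab_anc (\<lambda>f. h * v f + v' f) u (c w) - c ((nat (dg u - 1), nab_sec (\<lambda>f. h * v f + v' f) u) # w) =
        h * (nab_anc v u (c w) - c ((nat (dg u - 1), nab_sec v u) # w)) +
          (nab_anc v' u (c w) - c ((nat (dg u - 1), nab_sec v' u) # w))"
        unfolding s CE_lin[OF c nab_sec_sec nab_sec_sec \<open>w \<in> SL\<close>] by (simp add: nab_anc_def algebra_simps)
    qed
    then show ?thesis
      using c ys by (simp add: nab_def coder_op_def const_mult shsum_add shsum_mult_left)
  qed (auto simp: nab_def coder_op_def const_mult)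
qed

lemma nab_zero: "nab (\<lambda>f. 0) c = 0"
  using nab_lin[of 1 "\<lambda>f. 0" "\<lambda>f. 0" c] by (simp add: fun_eq_iff const_mult)

lemma nab_add: "nab (\<lambda>f. v f + v' f) c = nab v c + nab v' c"
  using nab_lin[of 1 v v' c] by (simp add: fun_eq_iff const_mult)

lemma nab_mult: "nab (\<lambda>f. h * v f) c = cochain_mult (const_cochain h) (nab v c)"
  using nab_lin[of h v "\<lambda>f. 0" c] by (simp add: nab_zero)

subsection \<open>Derivations vanishing on the base\<close>

text \<open>The coordinates as cochains of degree i + 1; with the functions on U they serve as
  generators in the sense of \<open>der_unique\<close>. The membership test is there because a
  cochain is 0 on lists of non-sections.\<close>

definition coord_cochain :: "nat \<Rightarrow> nat \<Rightarrow> ('a, 'l) cochain" where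
  "coord_cochain i j = (\<lambda>ys. case ys of [y] \<Rightarrow> if fst y = i \<and> snd y \<in> sections E i then coord i j (snd y) else 0 | _ \<Rightarrow> 0)"

lemma coord_cochain_simps [simp]: "coord_cochain i j [] = 0" "coord_cochain i j (y # z # ys) = 0"
    "coord_cochain i j [y] = (if fst y = i \<and> snd y \<in> sections E i then coord i j (snd y) else 0)"
  by (simp_all add: coord_cochain_def)

lemma coord_cochain_long: "length u \<noteq> 1 \<Longrightarrow> coord_cochain i j u = 0"
  by (auto simp: coord_cochain_def split: list.splits)

lemma coord_cochain_cochain: assumes "j < rk i" shows "coord_cochain i j \<in> cochains E (int i + 1)"
proof -
  have "coord_cochain i j ys = 0" if "ys \<notin> SL \<or> dg ys \<noteq> int i + 1" for ys
    using that by (cases "length ys = 1") (auto simp: coord_cochain_long length_Suc_conv)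
  moreover have "gsym (coord_cochain i j)" by (simp add: gsym_def coord_cochain_long)
  moreover have "glin (coord_cochain i j)"
    unfolding glin_def
  proof (intro allI impI)
    fix f i' x x' vs assume "(i', x) # (i', x') # vs \<in> SL"
    then show "coord_cochain i j ((i', act E f x + x') # vs) = f * coord_cochain i j ((i', x) # vs) + coord_cochain i j ((i', x') # vs)"
      using assms by (cases vs; cases "i' = i") (simp_all add: coord_lin sec_add sec_act)
  qed
  ultimately show ?thesis by (simp add: cochains_iff)
qed

lemma bounded_ex: "\<exists>N. \<forall>i>N. sections E i = {0}"
  by (rule algebroid_conds[THEN conjunct2, THEN conjunct2, THEN conjunct2, THEN conjunct1])

definition top_index :: nat where "top_index = (SOME N. \<forall>i>N. sections E i = {0})"

lemma sections_above: "i > top_index \<Longrightarrow> sections E i = {0}"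
  using someI_ex[OF bounded_ex] unfolding top_index_def by blast

text \<open>Finite because \<L> is bounded, so that expansions over all generators are finite
  sums.\<close>

definition idx :: "(nat \<times> nat) set" where "idx = Sigma {..top_index} (\<lambda>i. {..<rk i})"

lemma sum_idx: "(\<Sum>(i, j)\<in>idx. g i j) = (\<Sum>i\<le>top_index. \<Sum>j<rk i. g i j)"
  unfolding idx_def by (simp add: sum.Sigma)

lemma coord_expand: "c \<in> CE \<Longrightarrow> x \<in> sections E i \<Longrightarrow> w \<in> SL \<Longrightarrow>
    (\<Sum>j<rk i. coord i j x * c ((i, eb i j) # w)) = c ((i, x) # w)"
  using arg_cong[OF coord_sum[of x i], of "\<lambda>x. c ((i, x) # w)"]
  by (subst (asm) CE_sec_sum) (auto simp: eb_sec sec_act CE_sec_act)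

lemma idx_expand:
  assumes c: "c \<in> CE" and u: "u \<in> SL" and w: "w \<in> SL"
  shows "(\<Sum>(i, j)\<in>idx. of_nat (i + 1) * (coord_cochain i j u * c ((i, eb i j) # w))) =
    (if length u = 1 then of_int (dy (hd u)) * c (u @ w) else 0)"
proof (cases "length u = 1")
  case True
  then obtain i' x where uy: "u = [(i', x)]" by (cases u) auto
  then have x: "x \<in> sections E i'" using u by simp
  have "(\<Sum>(i, j)\<in>idx. of_nat (i + 1) * (coord_cochain i j u * c ((i, eb i j) # w))) =
      (\<Sum>i\<le>top_index. if i' = i then of_nat (i' + 1) * c ((i', x) # w) else 0)"
    unfolding sum_idx
  proof (rule sum.cong[OF refl])
    fix i
    show "(\<Sum>j<rk i. of_nat (i + 1) * (coord_cochain i j u * c ((i, eb i j) # w))) =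
        (if i' = i then of_nat (i' + 1) * c ((i', x) # w) else 0)"
      using coord_expand[OF c x w] x by (cases "i' = i") (simp_all add: uy flip: sum_distrib_left)
  qed
  also have "\<dots> = of_nat (i' + 1) * c ((i', x) # w)"
  proof (cases "i' \<le> top_index")
    case False
    then have "x = 0" using sections_above[of i'] x by simp
    then show ?thesis by (simp add: CE_sec_zero[OF c])
  qed simp
  finally show ?thesis by (simp add: uy add.commute)
qed (simp add: coord_cochain_long case_prod_beta)

text \<open>The Euler field in coordinates: the sum of (i + 1) times a coordinate times the
  contraction with its generator. The dual basis reassembles the extracted entry at the front, and
  \<open>shsum_single\<close> adds the weights up to \<open>dg ys\<close>.\<close>

lemma euler_expand:
  assumes c: "c \<in> CE" and ys: "ys \<in> SL"
  shows "(\<Sum>(i, j)\<in>idx. of_nat (i + 1) * cochain_mult (coord_cochain i j) (iot i (eb i j) c) ys) = of_int (dg ys) * c ys"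
proof -
  have "(\<Sum>(i, j)\<in>idx. of_nat (i + 1) * cochain_mult (coord_cochain i j) (iot i (eb i j) c) ys) =
      shsum (\<lambda>u w. \<Sum>(i, j)\<in>idx. of_nat (i + 1) * (coord_cochain i j u * iot i (eb i j) c w)) ys"
    by (simp add: cochain_mult_shsum shsum_sum case_prod_beta flip: shsum_mult_left)
  also have "\<dots> = shsum (\<lambda>u w. if length u = 1 then of_int (dy (hd u)) * c (u @ w) else 0) ys"
  proof (rule shsum_cong)
    fix u w assume "set u \<union> set w = set ys"
    then have u: "u \<in> SL" and w: "w \<in> SL" using ys SL_split by blast+
    have "(\<Sum>(i, j)\<in>idx. of_nat (i + 1) * (coord_cochain i j u * iot i (eb i j) c w)) =
        (\<Sum>(i, j)\<in>idx. of_nat (i + 1) * (coord_cochain i j u * c ((i, eb i j) # w)))"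
      by (rule sum.cong) (auto simp: idx_def iot_apply[OF c eb_sec w])
    then show "(\<Sum>(i, j)\<in>idx. of_nat (i + 1) * (coord_cochain i j u * iot i (eb i j) c w)) =
        (if length u = 1 then of_int (dy (hd u)) * c (u @ w) else 0)"
      using idx_expand[OF c u w] by simp
  qed
  also have "\<dots> = (\<Sum>y\<leftarrow>ys. of_int (dy y)) * c ys"
    by (rule shsum_single[OF CE_gsym[OF c] ys])
  also have "(\<Sum>y\<leftarrow>ys. of_int (dy y)) = of_int (dg ys)"
    by (induction ys) simp_all
  finally show ?thesis .
qed

definition weighted_coord :: "nat \<Rightarrow> nat \<Rightarrow> ('a, 'l) cochain" where
  "weighted_coord i j = cochain_mult (const_cochain (of_nat (i + 1))) (coord_cochain i j)"

lemma weighted_coord_cochain: "j < rk i \<Longrightarrow> weighted_coord i j \<in> cochains E (int i + 1)"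
  unfolding weighted_coord_def using cochain_mult_cochains[OF const_cochain coord_cochain_cochain[of j i], of "of_nat (i + 1)"] by simp

lemma euler_expand':
  assumes c: "c \<in> cochains E q"
  shows "cochain_mult (const_cochain (of_int q)) c = (\<Sum>(i, j)\<in>idx. cochain_mult (weighted_coord i j) (iot i (eb i j) c))"
proof
  fix ys
  note cCE = cochain_CE[OF c]
  have e: "(\<Sum>(i, j)\<in>idx. cochain_mult (weighted_coord i j) (iot i (eb i j) c)) ys =
      (\<Sum>(i, j)\<in>idx. of_nat (i + 1) * cochain_mult (coord_cochain i j) (iot i (eb i j) c) ys)"
    unfolding sum_fun_apply
    by (rule sum.cong) (auto simp: weighted_coord_def C.mul_assoc[simplified] const_mult)
  show "cochain_mult (const_cochain (of_int q)) c ys = (\<Sum>(i, j)\<in>idx. cochain_mult (weighted_coord i j) (iot i (eb i j) c)) ys"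
  proof (cases "ys \<in> SL")
    case True
    then show ?thesis unfolding e using euler_expand[OF cCE True] cochain_out[OF c, of ys]
      by (cases "dg ys = q") (simp_all add: const_mult)
  next
    case False
    have "cochain_mult (coord_cochain i j) (iot i (eb i j) c) ys = 0" if "(i, j) \<in> idx" for i j
    proof -
      have j: "j < rk i" using that by (simp add: idx_def)
      have "iot i (eb i j) c \<in> cochains E (q + - (int i + 1))"
        using C.der_part[OF iot_der[OF eb_sec[OF j]], of c q] c by simp
      then show ?thesis using cochain_out[OF cochain_mult_cochains[OF coord_cochain_cochain[OF j]]] False by blast
    qed
    then have "(\<Sum>(i, j)\<in>idx. of_nat (i + 1) * cochain_mult (coord_cochain i j) (iot i (eb i j) c) ys) = 0"
      by (intro sum.neutral) auto
    then show ?thesis unfolding e using cochain_out[OF c, of ys] False by (simp add: const_mult)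
  qed
qed

lemma const_cancel:
  fixes c :: "('a, 'l) cochain"
  shows "q \<noteq> 0 \<Longrightarrow> cochain_mult (const_cochain (of_int q)) c = 0 \<Longrightarrow> c = 0"
proof
  fix x assume q: "q \<noteq> 0" and c: "cochain_mult (const_cochain (of_int q)) c = 0"
  have "of_int q * c x = of_int q * 0" using fun_cong[OF c, of x] by (simp add: const_mult)
  then have "c x = 0" by (rule of_int_cancel[OF q])
  then show "c x = 0 x" by simp
qed

text \<open>As q is invertible, \<open>euler_expand'\<close> writes a cochain of degree q > 0
  through products of generators with cochains of lower degree. Strong induction on q then needs the
  derivation only on generators, although the modules need not be free.\<close>

lemma der_unique:
  assumes Y: "Y \<in> ders (ce_alg E) k" and const: "\<And>f. Y (const_cochain f) = 0"
    and gen: "\<And>i j. j < rk i \<Longrightarrow> Y (coord_cochain i j) = 0"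
  shows "Y c = 0"
proof -
  have hom: "\<forall>c\<in>cochains E (int q). Y c = 0" for q
  proof (induction q rule: less_induct)
    case (less q)
    show ?case
    proof
      fix c assume c: "c \<in> cochains E (int q)"
      show "Y c = 0"
      proof (cases "q = 0")
        case True
        then show ?thesis using cochain_0[of c] c const by simp metis
      next
        case False
        have low: "Y c' = 0" if "c' \<in> cochains E (int q + - (int i + 1))" for c' i
        proof (cases "i + 1 \<le> q")
          case True
          then have e: "int q + - (int i + 1) = int (q - (i + 1))" by simp
          have "\<forall>c\<in>cochains E (int (q - (i + 1))). Y c = 0"
            by (rule less) (use True in simp)
          then show ?thesis using that unfolding e by blast
        next
          case f: False
          then have "c' = 0" using C.part_neg[of "int q + - (int i + 1)"] that by simp
          then show ?thesis using C.der_zero[OF Y] by simp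
        qed
        have t: "Y (cochain_mult (weighted_coord i j) (iot i (eb i j) c)) = 0" if "(i, j) \<in> idx" for i j
        proof -
          have j: "j < rk i" using that by (simp add: idx_def)
          have ic: "iot i (eb i j) c \<in> cochains E (int q + - (int i + 1))"
            using C.der_part[OF iot_der[OF eb_sec[OF j]], of c "int q"] c by simp
          have w0: "Y (weighted_coord i j) = 0"
            unfolding weighted_coord_def using C.der_mul[OF Y, of "const_cochain (of_nat (i + 1))" 0 "coord_cochain i j"]
              const_cochain cochain_CE[OF coord_cochain_cochain[OF j]] const gen[OF j]
              C.mul_zero_left C.mul_zero_right by simp
          show ?thesis
            using C.der_mul[OF Y, of "weighted_coord i j" "int i + 1" "iot i (eb i j) c"] weighted_coord_cochain[OF j] cochain_CE[OF ic]
              w0 low[OF ic] C.mul_zero_left C.mul_zero_right by simp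
        qed
        have "cochain_mult (const_cochain (of_int (int q))) (Y c) = Y (cochain_mult (const_cochain (of_int (int q))) c)"
          using C.der_mul[OF Y, of "const_cochain (of_int (int q))" 0 c] const_cochain cochain_CE[OF c] const
            C.mul_zero_left by simp
        also have "\<dots> = (\<Sum>(i, j)\<in>idx. Y (cochain_mult (weighted_coord i j) (iot i (eb i j) c)))"
          unfolding euler_expand'[OF c] case_prod_beta
          by (rule C.der_sum[OF Y]) (auto simp: idx_def intro!: C.AP_mul[simplified] cochain_CE[OF weighted_coord_cochain] C.der_AP[OF iot_der[OF eb_sec]])
        also have "\<dots> = 0" by (rule sum.neutral) (use t in auto)
        finally show ?thesis using const_cancel[of "int q" "Y c"] False by simp
      qed
    qed
  qed
  show ?thesis
  proof (cases "c \<in> CE")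
    case True
    then show ?thesis
    proof (induction rule: C.AP_induct)
      case (part i x)
      show ?case
      proof (cases "i < 0")
        case True
        then have "x = 0" using part C.part_neg[of i] by simp
        then show "Y x = 0" using C.der_zero[OF Y] by simp
      next
        case False
        then show ?thesis using part hom[of "nat i"] by simp
      qed
    next
      case (add x y)
      show "Y (x + y) = 0" by (simp only: C.der_add[OF Y add(1,2)] add(3,4) add_0)
    qed
  qed (rule C.der_out[OF Y])
qed

lemma iot_cc:
  assumes j': "j' < rk i'" and x: "x \<in> sections E i"
  shows "iot i x (coord_cochain i' j') = const_cochain (if i = i' then coord i' j' x else 0)"
proof
  fix ys
  show "iot i x (coord_cochain i' j') ys = const_cochain (if i = i' then coord i' j' x else 0) ys"
  proof (cases "ys \<in> SL")
    case True
    then show ?thesis using iot_apply[OF cochain_CE[OF coord_cochain_cochain[OF j']] x True] x by (cases ys) auto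
  next
    case False
    then have "ys \<noteq> []" by auto
    then show ?thesis using CE_out[OF C.der_AP[OF iot_der[OF x]] False] by (simp add: const_cochain_def)
  qed
qed

text \<open>The relations between coordinates in a projective module. They let
  \<open>der_killing_base\<close> be checked on generators, although contracting a coordinate with a
  generator gives an entry of the projection matrix rather than 0 or 1.\<close>

lemma coord_cochain_expand:
  assumes j': "j' < rk i"
  shows "coord_cochain i j' = (\<Sum>j<rk i. cochain_mult (const_cochain (coord i j' (eb i j))) (coord_cochain i j))"
proof
  fix ys
  have lin: "coord i j' (\<Sum>j\<in>J. act E (g j) (eb i j)) = (\<Sum>j\<in>J. g j * coord i j' (eb i j))"
    if "J \<subseteq> {..<rk i}" for J and g :: "nat \<Rightarrow> 'a"
    using that
  proof (induction J rule: infinite_finite_induct)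
    case (insert j J)
    then show ?case using coord_lin[OF j', of "eb i j" "\<Sum>j\<in>J. act E (g j) (eb i j)" "g j"]
      by (simp add: eb_sec sec_sum sec_act subset_eq)
  qed (simp_all add: coord_zero[OF j'])
  show "coord_cochain i j' ys = (\<Sum>j<rk i. cochain_mult (const_cochain (coord i j' (eb i j))) (coord_cochain i j)) ys"
  proof (cases "length ys = 1 \<and> fst (hd ys) = i \<and> snd (hd ys) \<in> sections E i")
    case True
    then obtain x where ys: "ys = [(i, x)]" and x: "x \<in> sections E i" by (cases ys) auto
    have "coord i j' x = (\<Sum>j<rk i. coord i j x * coord i j' (eb i j))"
      using arg_cong[OF coord_sum[OF x], of "coord i j'"] lin[of "{..<rk i}" "\<lambda>j. coord i j x"] by simp
    then show ?thesis by (simp add: sum_fun_apply const_mult ys x mult.commute)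
  next
    case False
    then have "coord_cochain i j ys = 0" for j by (cases ys rule: list.exhaust; cases "tl ys") auto
    then show ?thesis by (simp add: sum_fun_apply const_mult)
  qed
qed

text \<open>The coefficients are the values of X on the coordinates. Both sides are derivations;
  they agree on functions and, by the relations between the coordinates, on generators, so
  \<open>der_unique\<close> applies to the difference.\<close>

lemma der_killing_base:
  assumes X: "X \<in> ders (ce_alg E) k" and const: "\<And>f. X (const_cochain f) = 0"
  shows "X = (\<lambda>c. \<Sum>(i, j)\<in>idx. cochain_mult (X (coord_cochain i j)) (iot i (eb i j) c))"
proof -
  let ?S = "\<lambda>c. \<Sum>(i, j)\<in>idx. cochain_mult (X (coord_cochain i j)) (iot i (eb i j) c)"
  have Xcc: "X (coord_cochain i j) \<in> part (ce_alg E) (int i + 1 + k)" if "j < rk i" for i j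
    using C.der_part[OF X, of "coord_cochain i j"] coord_cochain_cochain[OF that] by simp
  have t: "(\<lambda>c. cochain_mult (X (coord_cochain i j)) (iot i (eb i j) c)) \<in> ders (ce_alg E) k" if "j < rk i" for i j
    using C.ders_mul[OF Xcc[OF that] iot_der[OF eb_sec[OF that]]] by simp
  have S: "?S \<in> ders (ce_alg E) k"
    unfolding case_prod_beta by (rule C.ders_sum) (auto simp: idx_def t)
  have Y: "(\<lambda>c. X c + - ?S c) \<in> ders (ce_alg E) k"
    by (rule C.ders_add[OF X C.ders_minus[OF S]])
  have "X c + - ?S c = 0" for c
  proof (rule der_unique[OF Y])
    fix f
    have "?S (const_cochain f) = 0"
      by (rule sum.neutral) (auto simp: idx_def iot_const eb_sec C.mul_zero_right[simplified])
    then show "X (const_cochain f) + - ?S (const_cochain f) = 0" using const by simp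
  next
    fix i' j' assume j': "j' < rk i'"
    have "?S (coord_cochain i' j') = (\<Sum>i\<le>top_index. if i' = i then \<Sum>j<rk i'. cochain_mult (X (coord_cochain i' j)) (const_cochain (coord i' j' (eb i' j))) else 0)"
      unfolding sum_idx
    proof (rule sum.cong[OF refl])
      fix i
      have "const_cochain 0 = (0 :: ('a, 'l) cochain)" by (simp add: fun_eq_iff const_cochain_def)
      then have "cochain_mult (X (coord_cochain i j)) (iot i (eb i j) (coord_cochain i' j')) =
         (if i' = i then cochain_mult (X (coord_cochain i' j)) (const_cochain (coord i' j' (eb i' j))) else 0)" if "j < rk i" for j
        using that by (auto simp: iot_cc[OF j' eb_sec] C.mul_zero_right[simplified])
      then show "(\<Sum>j<rk i. cochain_mult (X (coord_cochain i j)) (iot i (eb i j) (coord_cochain i' j'))) =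
         (if i' = i then \<Sum>j<rk i'. cochain_mult (X (coord_cochain i' j)) (const_cochain (coord i' j' (eb i' j))) else 0)"
        by simp
    qed
    also have "\<dots> = (if i' \<le> top_index then \<Sum>j<rk i'. cochain_mult (X (coord_cochain i' j)) (const_cochain (coord i' j' (eb i' j))) else 0)"
      by simp
    also have "\<dots> = (if i' \<le> top_index then X (coord_cochain i' j') else 0)"
    proof -
      have "X (coord_cochain i' j') = (\<Sum>j<rk i'. X (cochain_mult (const_cochain (coord i' j' (eb i' j))) (coord_cochain i' j)))"
        by (subst coord_cochain_expand[OF j'], rule C.der_sum[OF X])
          (auto intro!: C.AP_mul[simplified] cochain_CE[OF const_cochain] cochain_CE[OF coord_cochain_cochain])
      also have "\<dots> = (\<Sum>j<rk i'. cochain_mult (X (coord_cochain i' j)) (const_cochain (coord i' j' (eb i' j))))"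
      proof (rule sum.cong[OF refl])
        fix j assume "j \<in> {..<rk i'}"
        then have j: "j < rk i'" by simp
        have "X (cochain_mult (const_cochain (coord i' j' (eb i' j))) (coord_cochain i' j)) =
            cochain_mult (const_cochain (coord i' j' (eb i' j))) (X (coord_cochain i' j))"
          using C.der_mul[OF X, of "const_cochain (coord i' j' (eb i' j))" 0 "coord_cochain i' j"] const_cochain
            cochain_CE[OF coord_cochain_cochain[OF j]] const C.mul_zero_left by simp
        also have "\<dots> = cochain_mult (X (coord_cochain i' j)) (const_cochain (coord i' j' (eb i' j)))"
          using C.mul_comm_AP[of "const_cochain (coord i' j' (eb i' j))" "X (coord_cochain i' j)"] const_cochain C.der_AP[OF X] by simp
        finally show "X (cochain_mult (const_cochain (coord i' j' (eb i' j))) (coord_cochain i' j)) =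
            cochain_mult (X (coord_cochain i' j)) (const_cochain (coord i' j' (eb i' j)))" .
      qed
      finally show ?thesis by simp
    qed
    \<comment> \<open>Beyond the bound the bundles are 0, and so are their coordinates.\<close>
    also have "\<dots> = X (coord_cochain i' j')"
    proof (cases "i' \<le> top_index")
      case False
      have "coord_cochain i' j' ys = 0" for ys
      proof (cases "length ys = 1")
        case True
        then obtain y where "ys = [y]" by (cases ys) auto
        then show ?thesis using sections_above[of i'] False coord_zero[OF j'] by auto
      qed (simp add: coord_cochain_long)
      then have "coord_cochain i' j' = 0" by (simp add: fun_eq_iff)
      then show ?thesis using C.der_zero[OF X] False by simp
    qed simp
    finally show "X (coord_cochain i' j') + - ?S (coord_cochain i' j') = 0" by simp
  qed
  then show ?thesis by (simp add: fun_eq_iff)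
qed

subsection \<open>Forms of internal degree zero\<close>

text \<open>Contraction with a section of \<L> makes the internal degree negative, where the values
  on lifts vanish for degree reasons; so by induction these contractions are 0. Hence every
  derivation that kills \<O>(U) contracts to 0, which covers negative degrees, and degree 0 up to a
  lift. For k > 0, k X agrees on \<O>(U) with the sum of weighted coordinates times commutators of
  contractions with X, and these commutators have smaller degree.\<close>

lemma form_vanishes:
  assumes "\<eta> \<in> C.iforms m q" "q \<le> 0"
    and "\<And>vs. set vs \<subseteq> vector_fields E \<Longrightarrow> length vs = m \<Longrightarrow> \<eta> (map (\<lambda>v. (0, nab v)) vs) [] = 0"
  shows "\<eta> = 0"
  using assms
proof (induction m arbitrary: \<eta> q)
  case 0
  have n: "\<eta> [] \<in> cochains E q" using C.iforms_part[OF "0.prems"(1), of "[]"] by simp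
  have "\<eta> [] = 0"
  proof (cases "q = 0")
    case True
    have z: "\<eta> [] [] = 0" using "0.prems"(3)[of "[]"] by simp
    have "\<eta> [] = const_cochain (\<eta> [] [])" by (rule cochain_0) (use n True in simp)
    also have "\<dots> = 0" unfolding z by (simp add: fun_eq_iff const_cochain_def)
    finally show ?thesis .
  next
    case False
    then show ?thesis using n C.part_neg[of q] "0.prems"(2) by simp
  qed
  then have "\<eta> Xs = 0" for Xs using "0.prems"(1) by (cases "Xs = []") (auto simp: C.iforms_0)
  then show ?case by (simp add: fun_eq_iff)
next
  case (Suc m)
  note eta = Suc.prems(1)
  note g [simp] = C.iforms_gforms[OF eta]
  have nb: "contract (0, nab v) \<eta> = 0" if v: "v \<in> vector_fields E" for v
  proof (rule Suc.IH)
    show "contract (0, nab v) \<eta> \<in> C.iforms m q"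
      using C.iforms_contract[OF eta, of "(0, nab v)"] nab_der[OF v] by simp
    fix vs assume "set vs \<subseteq> vector_fields E" "length vs = m"
    then show "contract (0, nab v) \<eta> (map (\<lambda>v. (0, nab v)) vs) [] = 0"
      using Suc.prems(3)[of "v # vs"] v by (simp add: contract_def)
  qed (rule Suc.prems(2))
  have io: "contract (- (int i + 1), iot i x) \<eta> = 0" if x: "x \<in> sections E i" for i x
  proof (rule Suc.IH)
    show i: "contract (- (int i + 1), iot i x) \<eta> \<in> C.iforms m (q + - (int i + 1))"
      using C.iforms_contract[OF eta, of "(- (int i + 1), iot i x)"] iot_der[OF x] by simp
    show "q + - (int i + 1) \<le> 0" using Suc.prems(2) by simp
    fix vs :: "('a \<Rightarrow> 'a) list"
    have "tot_deg (map (\<lambda>v. (0, nab v)) vs) = 0" by (induction vs) simp_all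
    then have "contract (- (int i + 1), iot i x) \<eta> (map (\<lambda>v. (0, nab v)) vs) \<in> cochains E (q + - (int i + 1))"
      using C.iforms_part[OF i, of "map (\<lambda>v. (0, nab v)) vs"] by simp
    then show "contract (- (int i + 1), iot i x) \<eta> (map (\<lambda>v. (0, nab v)) vs) [] = 0"
      using C.part_neg[of "q + - (int i + 1)"] Suc.prems(2) by simp
  qed
  have kill: "contract (k, X) \<eta> = 0" if X: "X \<in> ders (ce_alg E) k" and const: "\<And>f. X (const_cochain f) = 0" for k X
  proof -
    have Xcc: "X (coord_cochain i j) \<in> part (ce_alg E) (int i + 1 + k)" if "j < rk i" for i j
      using C.der_part[OF X, of "coord_cochain i j"] coord_cochain_cochain[OF that] by simp
    have t: "(\<lambda>c. cochain_mult (X (coord_cochain i j)) (iot i (eb i j) c)) \<in> ders (ce_alg E) k" if "j < rk i" for i j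
      using C.ders_mul[OF Xcc[OF that] iot_der[OF eb_sec[OF that]]] by simp
    have "contract (k, X) \<eta> = contract (k, \<lambda>c. \<Sum>p\<in>idx. cochain_mult (X (coord_cochain (fst p) (snd p))) (iot (fst p) (eb (fst p) (snd p)) c)) \<eta>"
      by (subst der_killing_base[OF X const]) (simp add: case_prod_beta)
    also have "\<dots> = (\<Sum>p\<in>idx. contract (k, \<lambda>c. cochain_mult (X (coord_cochain (fst p) (snd p))) (iot (fst p) (eb (fst p) (snd p)) c)) \<eta>)"
      by (rule C.gforms_sum_der[OF g]) (auto simp: idx_def t)
    also have "\<dots> = 0"
    proof (rule sum.neutral, rule ballI)
      fix p assume "p \<in> idx"
      then obtain i j where p: "p = (i, j)" and j: "j < rk i" by (auto simp: idx_def)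
      show "contract (k, \<lambda>c. cochain_mult (X (coord_cochain (fst p) (snd p))) (iot (fst p) (eb (fst p) (snd p)) c)) \<eta> = 0"
        using C.gforms_mul_der[OF g Xcc[OF j] iot_der[OF eb_sec[OF j]]] io[OF eb_sec[OF j]] by (simp add: p)
    qed
    finally show ?thesis .
  qed
  have deg0: "contract (0, X) \<eta> = 0" if X: "X \<in> ders (ce_alg E) 0" for X
  proof -
    define v where "v f = X (const_cochain f) []" for f
    have Xc: "X (const_cochain f) = const_cochain (v f)" for f
      unfolding v_def using cochain_0[of "X (const_cochain f)"] C.der_part[OF X, of "const_cochain f" 0] const_cochain by simp
    have v: "v \<in> vector_fields E"
    proof (rule vfI)
      fix f g r
      have "X (const_cochain (f + g)) [] = X (const_cochain f) [] + X (const_cochain g) []"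
        unfolding const_cochain_add C.der_add[OF X cochain_CE[OF const_cochain] cochain_CE[OF const_cochain]] by simp
      then show "v (f + g) = v f + v g" by (simp only: v_def)
      have "X (const_cochain (f * g)) = cochain_mult (X (const_cochain f)) (const_cochain g) + cochain_mult (const_cochain f) (X (const_cochain g))"
        using C.der_mul[OF X, of "const_cochain f" 0 "const_cochain g"] const_cochain cochain_CE[OF const_cochain]
        by (simp add: const_cochain_mult)
      then have "X (const_cochain (f * g)) [] = v f * g + f * v g"
        unfolding Xc[of f] Xc[of g] by (simp add: const_mult)
      then show "v (f * g) = v f * g + f * v g" by (simp only: v_def)
      have "X (const_cochain (base E r * f)) [] = base E r * X (const_cochain f) []"
        unfolding const_cochain_base C.der_scale[OF X cochain_CE[OF const_cochain]] by simp
      then show "v (base E r * f) = base E r * v f" by (simp only: v_def)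
    qed
    have "contract (0, \<lambda>c. X c - nab v c) \<eta> = contract (0, X) \<eta> - contract (0, nab v) \<eta>"
      by (rule C.gforms_diff_der[OF g X nab_der[OF v]])
    moreover have "contract (0, \<lambda>c. X c - nab v c) \<eta> = 0"
      using C.ders_add[OF X C.ders_minus[OF nab_der[OF v]]]
      by (intro kill) (simp_all add: Xc nab_const[OF v])
    ultimately show ?thesis using nb[OF v] by simp
  qed
  have pos: "\<forall>X\<in>ders (ce_alg E) (int k). contract (int k, X) \<eta> = 0" for k
  proof (induction k rule: less_induct)
    case (less k)
    show ?case
    proof
      fix X assume X: "X \<in> ders (ce_alg E) (int k)"
      show "contract (int k, X) \<eta> = 0"
      proof (cases "k = 0")
        case True
        then show ?thesis using deg0 X by simp
      next
        case False
        let ?b = "\<lambda>i j. der_bracket (- (int i + 1), iot i (eb i j)) (int k, X)"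
        let ?t = "\<lambda>i j c. cochain_mult (weighted_coord i j) (snd (?b i j) c)"
        have b: "snd (?b i j) \<in> ders (ce_alg E) (- (int i + 1) + int k)" if "j < rk i" for i j
          using C.is_der_snd[OF C.is_der_bracket[of "(- (int i + 1), iot i (eb i j))" "(int k, X)"]] X iot_der[OF eb_sec[OF that]]
          by simp
        have w: "weighted_coord i j \<in> part (ce_alg E) (int i + 1)" if "j < rk i" for i j using weighted_coord_cochain[OF that] by simp
        have t: "?t i j \<in> ders (ce_alg E) (int k)" if "j < rk i" for i j
          using C.ders_mul[OF w[OF that] b[OF that]] by simp
        have cb: "contract (- (int i + 1) + int k, snd (?b i j)) \<eta> = 0" if j: "j < rk i" for i j
        proof (cases "i + 1 \<le> k")
          case True
          then have e: "- (int i + 1) + int k = int (k - (i + 1))" by simp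
          have "\<forall>X\<in>ders (ce_alg E) (int (k - (i + 1))). contract (int (k - (i + 1)), X) \<eta> = 0"
            by (rule less) (use True in simp)
          then show ?thesis using b[OF j] unfolding e by blast
        next
          case f: False
          show ?thesis
          proof (rule kill[OF b[OF j]])
            fix f
            have "snd (?b i j) (const_cochain f) \<in> part (ce_alg E) (0 + (- (int i + 1) + int k))"
              by (rule C.der_part[OF b[OF j]]) (use const_cochain in simp)
            then show "snd (?b i j) (const_cochain f) = 0" using C.part_neg[of "- (int i + 1) + int k"] f by simp
          qed
        qed
        have ct: "contract (int k, ?t i j) \<eta> = 0" if "j < rk i" for i j
          using C.gforms_mul_der[OF g w[OF that] b[OF that]] cb[OF that] by simp
        let ?T = "\<lambda>c. \<Sum>p\<in>idx. ?t (fst p) (snd p) c" and ?kX = "\<lambda>c. cochain_mult (const_cochain (of_int (int k))) (X c)"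
        have ti: "?t (fst p) (snd p) \<in> ders (ce_alg E) (int k)" if "p \<in> idx" for p
          by (rule t) (use that in \<open>auto simp: idx_def\<close>)
        have T: "?T \<in> ders (ce_alg E) (int k)" by (rule C.ders_sum) (rule ti)
        have kX: "?kX \<in> ders (ce_alg E) (int k)"
          using C.ders_mul[of "const_cochain (of_int (int k))" 0 X "int k"] const_cochain X by simp
        \<comment> \<open>On a function f the commutator is the contraction of X f, because
          contractions kill f. As X f is a cochain of degree k, its Euler expansion sums to k X
          f.\<close>
        have "contract (int k, \<lambda>c. ?kX c - ?T c) \<eta> = 0"
        proof (rule kill)
          show "(\<lambda>c. ?kX c - ?T c) \<in> ders (ce_alg E) (int k)"
            using C.ders_add[OF kX C.ders_minus[OF T]] by simp
          fix f
          have Xf: "X (const_cochain f) \<in> cochains E (int k)"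
            using C.der_part[OF X, of "const_cochain f" 0] const_cochain by simp
          have "snd (?b i j) (const_cochain f) = iot i (eb i j) (X (const_cochain f))" if "j < rk i" for i j
            using iot_const[OF eb_sec[OF that]] C.der_zero[OF X] by (simp add: der_bracket_def)
          then have "?T (const_cochain f) = (\<Sum>p\<in>idx. cochain_mult (weighted_coord (fst p) (snd p)) (iot (fst p) (eb (fst p) (snd p)) (X (const_cochain f))))"
            by (intro sum.cong refl) (auto simp: idx_def)
          then show "?kX (const_cochain f) - ?T (const_cochain f) = 0"
            using euler_expand'[OF Xf] by (simp add: case_prod_beta)
        qed
        moreover have "contract (int k, \<lambda>c. ?kX c - ?T c) \<eta> = contract (int k, ?kX) \<eta> - contract (int k, ?T) \<eta>"
          by (rule C.gforms_diff_der[OF g kX T])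
        moreover have "contract (int k, ?T) \<eta> = (\<Sum>p\<in>idx. contract (int k, ?t (fst p) (snd p)) \<eta>)"
          by (rule C.gforms_sum_der[OF g]) (rule ti)
        moreover have "\<dots> = 0"
          by (intro sum.neutral ballI ct) (auto simp: idx_def)
        moreover have "contract (int k, ?kX) \<eta> = C.fmul 0 (const_cochain (of_int (int k))) (contract (int k, X) \<eta>)"
          using C.gforms_mul_der[OF g _ X, of "const_cochain (of_int (int k))" 0] const_cochain by simp
        ultimately have z: "C.fmul 0 (const_cochain (of_int (int k))) (contract (int k, X) \<eta>) = 0" by simp
        have "contract (int k, X) \<eta> Xs = 0" for Xs
          using const_cancel[of "int k" "contract (int k, X) \<eta> Xs"] fun_cong[OF z, of Xs] False by (simp add: C.fmul_def)
        then show ?thesis by (simp add: fun_eq_iff)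
      qed
    qed
  qed
  show ?case
  proof (rule C.sform_ext)
    fix X :: "('a, 'l) cochain der" assume X: "C.is_der X"
    obtain k D where XD: "X = (k, D)" by (cases X)
    have D: "D \<in> ders (ce_alg E) k" using X XD by simp
    have "contract (k, D) \<eta> = 0"
    proof (cases "k < 0")
      case True
      show ?thesis
      proof (rule kill[OF D])
        fix f
        have "D (const_cochain f) \<in> part (ce_alg E) (0 + k)"
          by (rule C.der_part[OF D]) (use const_cochain in simp)
        then show "D (const_cochain f) = 0" using C.part_neg[of k] True by simp
      qed
    next
      case False
      then show ?thesis using pos[of "nat k"] D by simp
    qed
    then show "contract X \<eta> = contract X 0" by (simp add: XD)
  qed (use C.iforms_Nil[OF eta] C.iforms_sforms[OF eta] C.sforms_zero in \<open>simp_all del: zero_fun_apply\<close>, simp)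
qed

end

section \<open>Forms on U with cochain coefficients, and the pullback\<close>

lemma extend_Cons: "extend G (Y # Ys) ys =
    shsum (\<lambda>u w. sg (fst Y * shifted_deg Ys) (extend (contract (0, \<lambda>f. snd Y f u) G) Ys w)) ys"
  unfolding sum_unshuffles[symmetric] by (simp add: sg_sg)

declare extend.simps(2) [simp del]

lemma extend_add: "extend (G + G') Ys ys = extend G Ys ys + extend G' Ys ys"
  by (induction Ys arbitrary: G G' ys) (simp_all add: extend_Cons contract_add sg_add shsum_add)

lemma extend_zero: "extend 0 Ys ys = 0"
  using extend_add[of 0 0 Ys ys] by simp

lemma extend_minus: "extend (- G) Ys ys = - extend G Ys ys"
  using extend_add[of G "- G" Ys ys] by (simp add: extend_zero eq_neg_iff_add_eq_0 add.commute)

lemma extend_diff: "extend (G - G') Ys ys = extend G Ys ys - extend G' Ys ys"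
  using extend_add[of G "- G'" Ys ys] by (simp add: extend_minus)

lemma extend_sg: "extend (sg k G) Ys ys = sg k (extend G Ys ys)"
  by (simp add: sg_def extend_minus)

lemma extend_scale: "extend (\<lambda>Vs. f * G Vs) Ys ys = f * extend G Ys ys"
proof (induction Ys arbitrary: G ys)
  case (Cons Y Ys)
  have "contract V (\<lambda>Vs. f * G Vs) = (\<lambda>Vs. f * contract V G Vs)" for V
    by (simp add: contract_def)
  then show ?case by (simp add: extend_Cons Cons.IH sg_mult_right[symmetric] shsum_mult_left)
qed simp

lemma shifted_deg_restrict [simp]: "shifted_deg (map restrict_der Xs) = shifted_deg Xs"
  by (induction Xs) (simp_all add: restrict_der_def)

text \<open>Restricted to \<O>(U), a derivation of cochains takes values in cochains; its component
  at u is a vector field on U. The extension of a form on U sees the derivation only through these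
  components.\<close>

definition res :: "('a::zero, 'l) cochain der \<Rightarrow> (nat \<times> 'l) list \<Rightarrow> 'a \<Rightarrow> 'a" where
  "res X u f = snd X (const_cochain f) u"

lemma extend_restrict_Cons: "extend G (map restrict_der (X # Xs)) ys =
    shsum (\<lambda>u w. sg (fst X * shifted_deg Xs) (extend (contract (0, res X u) G) (map restrict_der Xs) w)) ys"
proof -
  have "(\<lambda>f. snd (restrict_der X) f u) = res X u" for u
    by (simp add: fun_eq_iff res_def restrict_der_def)
  moreover have "fst (restrict_der X) = fst X" by (simp add: restrict_der_def)
  ultimately show ?thesis by (simp add: extend_Cons)
qed

lemma pullback_eq:
  fixes E :: "('a, 'b::comm_ring_1, 'c::ab_group_add) linfty"
  shows "pullback E G = (\<lambda>Xs ys. if Xs \<in> der_lists (ce_alg E) \<and> ys \<in> sec_lists E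
    then extend G (map restrict_der Xs) ys else 0)"
proof (intro ext)
  fix Xs :: "('b, 'c) cochain der list" and ys :: "(nat \<times> 'c) list"
  have "{S. S \<subseteq> {..<length ys} \<and> card S = 0 \<and> (\<forall>j\<in>S. fst (ys ! j) = 0)} = {{}}"
    by (auto dest: finite_subset)
  moreover have "koszul (sec_degs ys) {} = 0" by (simp add: koszul_def crossings_def)
  ultimately show "pullback E G Xs ys = (if Xs \<in> der_lists (ce_alg E) \<and> ys \<in> sec_lists E
    then extend G (map restrict_der Xs) ys else 0)"
    by (simp add: pullback_def anchor_contraction_def nths_all)
qed

context linfty_alg
begin

abbreviation (input) "ext G Xs \<equiv> extend G (map restrict_der Xs)"

lemma const_mult_right: "c \<in> CE \<Longrightarrow> cochain_mult c (const_cochain f) ys = c ys * f"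
  using C.mul_comm_AP[of "const_cochain f" c] const_cochain[of f] const_mult[of f c ys] by (simp add: mult.commute)

lemma res_vf:
  assumes X: "C.is_der X" shows "res X u \<in> vector_fields E"
proof -
  note D = C.is_der_snd[OF X]
  note k = cochain_CE[OF const_cochain]
  show ?thesis
  proof (rule vfI)
    fix f g r
    show "res X u (f + g) = res X u f + res X u g"
      unfolding res_def const_cochain_add C.der_add[OF D k k] by simp
    have "snd X (cochain_mult (const_cochain f) (const_cochain g)) =
        cochain_mult (snd X (const_cochain f)) (const_cochain g) + cochain_mult (const_cochain f) (snd X (const_cochain g))"
      using C.der_mul[OF D, of "const_cochain f" 0 "const_cochain g"] const_cochain k by simp
    then show "res X u (f * g) = res X u f * g + f * res X u g"
      unfolding res_def const_cochain_mult by (simp add: const_mult const_mult_right[OF C.der_AP[OF D]])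
    show "res X u (base E r * f) = base E r * res X u f"
      unfolding res_def const_cochain_base C.der_scale[OF D k] by simp
  qed
qed

lemma res_cochain: "C.is_der X \<Longrightarrow> snd X (const_cochain f) \<in> cochains E (fst X)"
  using C.der_part[OF C.is_der_snd, of X "const_cochain f" 0] const_cochain by simp

lemma res_out: "C.is_der X \<Longrightarrow> u \<notin> SL \<or> dg u \<noteq> fst X \<Longrightarrow> res X u = (\<lambda>f. 0)"
  by (rule HOL.ext) (simp only: res_def cochain_out[OF res_cochain])

lemma base_contract:
  assumes "G \<in> A.iforms m 0" "v \<in> vector_fields E"
  shows "\<exists>m'. contract (0, v) G \<in> A.iforms m' 0 \<and> (m = Suc m' \<or> contract (0, v) G = 0)"
proof (cases m)
  case 0
  then show ?thesis using A.iforms_0_contract assms(1) A.iforms_zero by metis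
next
  case (Suc m')
  then show ?thesis using A.iforms_contract[of G m' 0 "(0, v)"] assms by auto
qed

lemma contract_res_out:
  "G \<in> A.gforms \<Longrightarrow> C.is_der X \<Longrightarrow> u \<notin> SL \<or> dg u \<noteq> fst X \<Longrightarrow> contract (0, res X u) G = 0"
  by (simp only: res_out A.gforms_zero_der)

lemma ext_length:
  "G \<in> A.iforms m 0 \<Longrightarrow> Xs \<in> der_lists (ce_alg E) \<Longrightarrow> length Xs \<noteq> m \<Longrightarrow> ext G Xs ys = 0"
proof (induction Xs arbitrary: G m ys)
  case Nil
  then show ?case using A.iforms_out[of G m 0 "[]"] by simp
next
  case (Cons X Xs)
  have X: "C.is_der X" and Xs: "Xs \<in> der_lists (ce_alg E)" using Cons.prems by simp_all
  have "ext (contract (0, res X u) G) Xs w = 0" for u w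
  proof -
    obtain m' where m': "contract (0, res X u) G \<in> A.iforms m' 0" "m = Suc m' \<or> contract (0, res X u) G = 0"
      using base_contract[OF Cons.prems(1) res_vf[OF X, of u]] by blast
    show ?thesis
    proof (cases "contract (0, res X u) G = 0")
      case True
      then show ?thesis by (simp only: extend_zero)
    next
      case False
      then have "length Xs \<noteq> m'" using m'(2) Cons.prems(3) by simp
      then show ?thesis by (rule Cons.IH[OF m'(1) Xs])
    qed
  qed
  then show ?case unfolding extend_restrict_Cons by simp
qed

lemma ext_cochain:
  "G \<in> A.iforms m 0 \<Longrightarrow> Xs \<in> der_lists (ce_alg E) \<Longrightarrow>
    (\<lambda>ys. if ys \<in> SL then ext G Xs ys else 0) \<in> cochains E (tot_deg Xs)"
proof (induction Xs arbitrary: G m)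
  case Nil
  have "(\<lambda>ys. if ys \<in> SL then ext G [] ys else 0) = const_cochain (G [])"
    by (auto simp: const_cochain_def fun_eq_iff)
  then show ?case using const_cochain by simp
next
  case (Cons X Xs)
  have X: "C.is_der X" and Xs: "Xs \<in> der_lists (ce_alg E)" using Cons.prems by simp_all
  note g = A.iforms_gforms[OF Cons.prems(1)]
  let ?G = "\<lambda>u. contract (0, res X u) G"
  have IH: "(\<lambda>ys. if ys \<in> SL then ext (?G u) Xs ys else 0) \<in> cochains E (tot_deg Xs)" for u
    using base_contract[OF Cons.prems(1) res_vf[OF X, of u]] Cons.IH[OF _ Xs] by blast
  let ?s = "sg (fst X * shifted_deg Xs) :: 'a \<Rightarrow> 'a"
  let ?F = "\<lambda>u w. ?s (ext (?G u) Xs w)"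
  have Xc: "snd X (const_cochain f) \<in> CE" for f by (rule cochain_CE[OF res_cochain[OF X]])
  have "(\<lambda>ys. if ys \<in> SL then shsum ?F ys else 0) \<in> cochains E (tot_deg (X # Xs))"
  proof (rule shsum_in_cochains)
    fix u w assume uw: "u \<in> SL" "w \<in> SL" "dg u + dg w \<noteq> tot_deg (X # Xs)"
    show "?F u w = 0"
    proof (cases "dg u = fst X")
      case True
      then have "dg w \<noteq> tot_deg Xs" using uw by simp
      then show ?thesis using cochain_out[OF IH, of w u] uw by simp
    next
      case False
      then have "?G u = 0" using contract_res_out[OF g X] by blast
      then show ?thesis by (simp only: extend_zero sg_zero)
    qed
  next
    fix w
    show "gsym (\<lambda>u. ?F u w)" unfolding gsym_def
    proof (intro allI impI)
      fix us y z vs assume l: "us @ [y, z] @ vs \<in> SL"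
      have "res X (us @ [y, z] @ vs) = (\<lambda>f. sg (dy y * dy z) (res X (us @ [z, y] @ vs) f))"
        unfolding res_def by (rule HOL.ext, rule gsymD[OF CE_gsym[OF Xc] l])
      then have "?G (us @ [y, z] @ vs) = sg (dy y * dy z) (?G (us @ [z, y] @ vs))"
        by (simp only: A.gforms_sg_der[OF g res_vf[OF X]])
      then show "?F (us @ [y, z] @ vs) w = sg (dy y * dy z) (?F (us @ [z, y] @ vs) w)"
        by (simp only: extend_sg sg_sg) (simp only: add.commute)
    qed
  next
    fix u
    have g': "gsym (\<lambda>ys. if ys \<in> SL then ext (?G u) Xs ys else 0)" using IH[of u] by (simp add: cochains_iff)
    show "gsym (?F u)" unfolding gsym_def
    proof (intro allI impI)
      fix us y z vs assume l: "us @ [y, z] @ vs \<in> SL"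
      then have l': "us @ [z, y] @ vs \<in> SL" by simp
      have "ext (?G u) Xs (us @ [y, z] @ vs) = sg (dy y * dy z) (ext (?G u) Xs (us @ [z, y] @ vs))"
        using gsymD[OF g' l] unfolding if_P[OF l] if_P[OF l'] .
      then show "?F u (us @ [y, z] @ vs) = sg (dy y * dy z) (?F u (us @ [z, y] @ vs))"
        by (simp only: sg_sg) (simp only: add.commute)
    qed
  next
    fix f i x x' u w assume a: "x \<in> sections E i" "x' \<in> sections E i" "u \<in> SL" "w \<in> SL"
    have gl: "glin (\<lambda>ys. if ys \<in> SL then ext (?G u) Xs ys else 0)" using IH[of u] by (simp add: cochains_iff)
    have 1: "ext (?G u) Xs ((i, act E f x + x') # w) = f * ext (?G u) Xs ((i, x) # w) + ext (?G u) Xs ((i, x') # w)"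
      using gl[unfolded glin_def, rule_format, of i x x' w f] a by (simp add: sec_add sec_act)
    have r: "res X ((i, act E f x + x') # u) = (\<lambda>h. f * res X ((i, x) # u) h + res X ((i, x') # u) h)"
      by (simp add: fun_eq_iff res_def CE_lin[OF Xc] a)
    have "?G ((i, act E f x + x') # u) = contract (0, \<lambda>h. f * res X ((i, x) # u) h) G + ?G ((i, x') # u)"
      unfolding r
      by (rule A.gforms_add_der[OF g _ res_vf[OF X]]) (use A.ders_mul[of f 0 _ 0] res_vf[OF X] in simp)
    also have "contract (0, \<lambda>h. f * res X ((i, x) # u) h) G = A.fmul 0 f (?G ((i, x) # u))"
      using A.gforms_mul_der[OF g _ res_vf[OF X], of f 0] by simp
    also have "\<dots> = (\<lambda>Vs. f * ?G ((i, x) # u) Vs)" by (simp add: A.fmul_def)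
    finally have 2: "ext (?G ((i, act E f x + x') # u)) Xs w = f * ext (?G ((i, x) # u)) Xs w + ext (?G ((i, x') # u)) Xs w"
      by (simp only: extend_add extend_scale)
    show "?F ((i, act E f x + x') # u) w + sg ((int i + 1) * dg u) (?F u ((i, act E f x + x') # w)) =
      f * (?F ((i, x) # u) w + sg ((int i + 1) * dg u) (?F u ((i, x) # w))) +
      (?F ((i, x') # u) w + sg ((int i + 1) * dg u) (?F u ((i, x') # w)))"
      unfolding 1 2 by (simp only: sg_add distrib_left sg_mult_right add_ac)
  qed
  then show ?case unfolding extend_restrict_Cons .
qed

text \<open>Contractions with vector fields on U anticommute. A component of X at u is nonzero only
  for \<open>dg u = fst X\<close>, so exchanging the blocks of X and Y costs (-1)^(|X| |Y|); the
  signs of moving the two coefficients out supply the rest.\<close>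

lemma ext_swap:
  "G \<in> A.gforms \<Longrightarrow> Xs @ [X, Y] @ Ys \<in> der_lists (ce_alg E) \<Longrightarrow>
    ext G (Xs @ [X, Y] @ Ys) ys = sg ((fst X - 1) * (fst Y - 1)) (ext G (Xs @ [Y, X] @ Ys) ys)"
proof (induction Xs arbitrary: G ys)
  case Nil
  then have X: "C.is_der X" and Y: "C.is_der Y" and Ys: "Ys \<in> der_lists (ce_alg E)" by simp_all
  note g = Nil.prems(1)
  let ?s = "shifted_deg Ys"
  have exp: "ext G (X # Y # Ys) ys = shsum (\<lambda>w t. shsum (\<lambda>u s. sg (fst X * (fst Y - 1 + ?s) + fst Y * ?s)
      (ext (contract (0, res Y s) (contract (0, res X u) G)) Ys t)) w) ys" for X Y
    unfolding shsum_coassoc extend_restrict_Cons shsum_sg[symmetric] sg_sg shifted_deg_simps by (rule refl)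
  have "shsum (\<lambda>u s. sg (fst X * (fst Y - 1 + ?s) + fst Y * ?s)
      (ext (contract (0, res Y s) (contract (0, res X u) G)) Ys t)) w =
    shsum (\<lambda>u s. sg ((fst X - 1) * (fst Y - 1)) (sg (fst Y * (fst X - 1 + ?s) + fst X * ?s)
      (ext (contract (0, res X s) (contract (0, res Y u) G)) Ys t))) w" for w t
    unfolding shsum_cocomm[of "\<lambda>u s. sg _ (ext (contract (0, res Y s) (contract (0, res X u) G)) Ys t)"]
  proof (rule shsum_cong)
    fix u s
    have sw: "contract (0, res Y u) (contract (0, res X s) G) = - contract (0, res X s) (contract (0, res Y u) G)"
      using A.gforms_swap[OF g, of "(0, res X s)" "(0, res Y u)"] res_vf[OF X] res_vf[OF Y] by (simp add: sg_def)
    show "sg (dg u * dg s) (sg (fst X * (fst Y - 1 + ?s) + fst Y * ?s) (ext (contract (0, res Y u) (contract (0, res X s) G)) Ys t)) =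
        sg ((fst X - 1) * (fst Y - 1)) (sg (fst Y * (fst X - 1 + ?s) + fst X * ?s) (ext (contract (0, res X s) (contract (0, res Y u) G)) Ys t))"
    proof (cases "dg u = fst Y \<and> dg s = fst X")
      case True
      then show ?thesis unfolding sw extend_minus
        by (cases "even (fst X)"; cases "even (fst Y)"; cases "even ?s") (simp_all add: sg_def)
    next
      case False
      then have "contract (0, res Y u) G = 0 \<or> contract (0, res X s) G = 0"
        using contract_res_out[OF g X] contract_res_out[OF g Y] by blast
      then have "contract (0, res Y u) (contract (0, res X s) G) = 0 \<and> contract (0, res X s) (contract (0, res Y u) G) = 0"
        unfolding sw by (metis contract_zero neg_equal_0_iff_equal sw)
      then show ?thesis by (simp only: extend_zero sg_zero)
    qed
  qed
  then show ?case unfolding append.simps exp shsum_sg[symmetric] by simp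
next
  case (Cons Z Zs)
  have Z: "C.is_der Z" and l: "Zs @ [X, Y] @ Ys \<in> der_lists (ce_alg E)" using Cons.prems by simp_all
  have s: "shifted_deg (Zs @ [X, Y] @ Ys) = shifted_deg (Zs @ [Y, X] @ Ys)" by simp
  have IH: "ext (contract (0, res Z u) G) (Zs @ [X, Y] @ Ys) w =
      sg ((fst X - 1) * (fst Y - 1)) (ext (contract (0, res Z u) G) (Zs @ [Y, X] @ Ys) w)" for u w
    by (rule Cons.IH[OF _ l]) (use A.gforms_contract[OF Cons.prems(1)] res_vf[OF Z] in simp)
  show ?case
    unfolding append_Cons[of Z Zs] extend_restrict_Cons s IH sg_sg shsum_sg[symmetric] by (simp only: add.commute)
qed

lemma contract_shsum:
  assumes g: "G \<in> A.gforms" and D: "\<And>s t. D s t \<in> vector_fields E"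
  shows "(\<lambda>h. shsum (\<lambda>s t. D s t h) u) \<in> vector_fields E \<and>
    contract (0, \<lambda>h. shsum (\<lambda>s t. D s t h) u) G = shsum (\<lambda>s t. contract (0, D s t) G) u"
  using D
proof (induction u arbitrary: D)
  case (Cons y u)
  have "(\<lambda>h. shsum (\<lambda>s t. D (y # s) t h) u) \<in> vector_fields E \<and>
    contract (0, \<lambda>h. shsum (\<lambda>s t. D (y # s) t h) u) G = shsum (\<lambda>s t. contract (0, D (y # s) t) G) u"
    by (rule Cons.IH) (rule Cons.prems)
  moreover have "(\<lambda>h. shsum (\<lambda>s t. sg (dy y * dg s) (D s (y # t) h)) u) \<in> vector_fields E \<and>
    contract (0, \<lambda>h. shsum (\<lambda>s t. sg (dy y * dg s) (D s (y # t) h)) u) G =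
      shsum (\<lambda>s t. contract (0, \<lambda>h. sg (dy y * dg s) (D s (y # t) h)) G) u"
    by (rule Cons.IH) (rule A.ders_sg[OF Cons.prems])
  ultimately show ?case
    unfolding shsum.simps
    by (simp only: A.gforms_add_der[OF g] A.ders_add A.gforms_sg_der[OF g Cons.prems] simp_thms)
qed simp

lemma ext_mul:
  assumes g: "G \<in> A.gforms" and f: "f \<in> cochains E i" and D: "D \<in> ders (ce_alg E) k" and ys: "ys \<in> SL"
  shows "ext G ((i + k, \<lambda>c. cochain_mult f (D c)) # Xs) ys =
    sg (i * shifted_deg Xs) (shsum (\<lambda>s w. f s * ext G ((k, D) # Xs) w) ys)"
proof -
  let ?X = "(k, D)" and ?s = "shifted_deg Xs"
  have vf: "res ?X t \<in> vector_fields E" for t by (rule res_vf) (simp add: D)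
  have r: "res (i + k, \<lambda>c. cochain_mult f (D c)) u = (\<lambda>h. shsum (\<lambda>s t. f s * res ?X t h) u)" for u
    by (simp add: fun_eq_iff res_def cochain_mult_shsum)
  have fv: "(\<lambda>h. f s * res ?X t h) \<in> vector_fields E" for s t
    using A.ders_mul[of "f s" 0 _ 0] vf[of t] by simp
  have "contract (0, \<lambda>h. f s * res ?X t h) G = A.fmul 0 (f s) (contract (0, res ?X t) G)" for s t
    using A.gforms_mul_der[OF g _ vf, of "f s" 0] by simp
  then have c: "contract (0, \<lambda>h. f s * res ?X t h) G = (\<lambda>Vs. f s * contract (0, res ?X t) G Vs)" for s t
    by (simp add: A.fmul_def)
  have "ext (contract (0, res (i + k, \<lambda>c. cochain_mult f (D c)) u) G) Xs w =
      shsum (\<lambda>s t. f s * ext (contract (0, res ?X t) G) Xs w) u" for u w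
    unfolding r contract_shsum[OF g fv, THEN conjunct2] c shsum_hom[of "\<lambda>G. ext G Xs w", OF extend_add] extend_scale
    by (rule refl)
  then have "ext G ((i + k, \<lambda>c. cochain_mult f (D c)) # Xs) ys =
      shsum (\<lambda>u w. shsum (\<lambda>s t. sg ((i + k) * ?s) (f s * ext (contract (0, res ?X t) G) Xs w)) u) ys"
    unfolding extend_restrict_Cons by (simp add: shsum_sg)
  also have "\<dots> = shsum (\<lambda>s u. shsum (\<lambda>t w. sg ((i + k) * ?s) (f s * ext (contract (0, res ?X t) G) Xs w)) u) ys"
    by (rule shsum_coassoc)
  also have "\<dots> = shsum (\<lambda>s u. sg (i * ?s) (f s * ext G (?X # Xs) u)) ys"
    unfolding extend_restrict_Cons by (simp add: shsum_sg shsum_mult_left sg_mult_right sg_sg distrib_right)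
  finally show ?thesis by (simp add: shsum_sg)
qed

lemma pullback_form:
  assumes G: "G \<in> A.iforms m 0"
  shows "pullback E G \<in> C.iforms m 0"
proof -
  note g = A.iforms_gforms[OF G]
  let ?w = "pullback E G"
  have w: "?w Xs = (\<lambda>ys. if ys \<in> SL then ext G Xs ys else 0)" if "Xs \<in> der_lists (ce_alg E)" for Xs
    using that by (simp add: pullback_eq)
  have w0: "?w Xs = 0" if "Xs \<notin> der_lists (ce_alg E)" for Xs
    using that by (simp add: pullback_eq fun_eq_iff)
  have "?w Xs = 0" if "Xs \<notin> der_lists (ce_alg E) \<or> length Xs \<noteq> m" for Xs
    using that w0[of Xs] w[of Xs] ext_length[OF G, of Xs] by (cases "Xs \<in> der_lists (ce_alg E)") (auto simp: fun_eq_iff)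
  moreover have "?w Xs \<in> part (ce_alg E) (0 + tot_deg Xs)" if "Xs \<in> der_lists (ce_alg E)" for Xs
    using ext_cochain[OF G that] w[OF that] by simp
  moreover have "?w (Xs @ [X, Y] @ Ys) = sg ((fst X - 1) * (fst Y - 1)) (?w (Xs @ [Y, X] @ Ys))"
    if l: "Xs @ [X, Y] @ Ys \<in> der_lists (ce_alg E)" for Xs X Y Ys
  proof -
    have l': "Xs @ [Y, X] @ Ys \<in> der_lists (ce_alg E)" using l by simp
    show ?thesis unfolding w[OF l] w[OF l'] ext_swap[OF g l] by (simp add: fun_eq_iff sg_apply)
  qed
  moreover have "?w ((k, \<lambda>c. D c + D' c) # Xs) = ?w ((k, D) # Xs) + ?w ((k, D') # Xs)"
    if D: "D \<in> ders (ce_alg E) k" "D' \<in> ders (ce_alg E) k" and Xs: "Xs \<in> der_lists (ce_alg E)" for k D D' Xs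
  proof -
    have l: "(k, \<lambda>c. D c + D' c) # Xs \<in> der_lists (ce_alg E)" "(k, D) # Xs \<in> der_lists (ce_alg E)" "(k, D') # Xs \<in> der_lists (ce_alg E)"
      using D Xs C.ders_add[OF D] by simp_all
    have vf: "res (k, D) u \<in> vector_fields E" "res (k, D') u \<in> vector_fields E" for u using res_vf D by simp_all
    have "res (k, \<lambda>c. D c + D' c) u = (\<lambda>f. res (k, D) u f + res (k, D') u f)" for u
      by (simp add: fun_eq_iff res_def)
    then have "ext G ((k, \<lambda>c. D c + D' c) # Xs) ys = ext G ((k, D) # Xs) ys + ext G ((k, D') # Xs) ys" for ys
      unfolding extend_restrict_Cons by (simp add: A.gforms_add_der[OF g vf] extend_add sg_add shsum_add)
    then show ?thesis unfolding w[OF l(1)] w[OF l(2)] w[OF l(3)] by (simp add: fun_eq_iff)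
  qed
  moreover have "?w ((i + k, \<lambda>c. gmul (ce_alg E) f (D c)) # Xs) = sg (i * shifted_deg Xs) (gmul (ce_alg E) f (?w ((k, D) # Xs)))"
    if f: "f \<in> part (ce_alg E) i" and D: "D \<in> ders (ce_alg E) k" and Xs: "Xs \<in> der_lists (ce_alg E)" for i k f D Xs
  proof -
    have l: "(i + k, \<lambda>c. gmul (ce_alg E) f (D c)) # Xs \<in> der_lists (ce_alg E)" "(k, D) # Xs \<in> der_lists (ce_alg E)"
      using D Xs C.ders_mul[OF f D] by simp_all
    have f': "f \<in> cochains E i" using f by simp
    show ?thesis
    proof
      fix ys
      show "?w ((i + k, \<lambda>c. gmul (ce_alg E) f (D c)) # Xs) ys = sg (i * shifted_deg Xs) (gmul (ce_alg E) f (?w ((k, D) # Xs))) ys"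
      proof (cases "ys \<in> SL")
        case True
        have "shsum (\<lambda>s w. f s * ext G ((k, D) # Xs) w) ys = shsum (\<lambda>s u. f s * ?w ((k, D) # Xs) u) ys"
        proof (rule shsum_cong)
          fix s u assume "set s \<union> set u = set ys"
          then have "u \<in> SL" using True SL_split by blast
          then show "f s * ext G ((k, D) # Xs) u = f s * ?w ((k, D) # Xs) u" unfolding w[OF l(2)] by simp
        qed
        then show ?thesis unfolding w[OF l(1)] using ext_mul[OF g f' D True, of Xs] True
          by (simp add: sg_apply cochain_mult_shsum)
      next
        case False
        have "?w ((k, D) # Xs) \<in> CE" using cochain_CE[OF ext_cochain[OF G l(2)]] w[OF l(2)] by simp
        then have "gmul (ce_alg E) f (?w ((k, D) # Xs)) ys = 0"
          by (intro CE_out[OF C.AP_mul] False) (use cochain_CE[OF f'] in simp_all)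
        then show ?thesis unfolding w[OF l(1)] using False by (simp add: sg_apply)
      qed
    qed
  qed
  ultimately show ?thesis unfolding C.iforms_def by blast
qed

subsection \<open>Restriction of forms to the base\<close>

text \<open>Derivations of \<O>(U) of nonzero degree are 0, so a form on U is determined by its
  values on vector fields with tag 0.\<close>

lemma base_form_vanishes:
  assumes "G \<in> A.iforms m 0" and "\<And>vs. set vs \<subseteq> vector_fields E \<Longrightarrow> length vs = m \<Longrightarrow> G (map (\<lambda>v. (0, v)) vs) = 0"
  shows "G = 0"
  using assms
proof (induction m arbitrary: G)
  case 0
  have "G [] = 0" using "0.prems"(2)[of "[]"] by simp
  then have "G Xs = 0" for Xs using "0.prems"(1) by (cases "Xs = []") (auto simp: A.iforms_0)
  then show ?case by (simp add: fun_eq_iff)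
next
  case (Suc m)
  note G = Suc.prems(1)
  show ?case
  proof (rule A.sform_ext)
    fix V :: "'a der" assume V: "A.is_der V"
    obtain k v where Vk: "V = (k, v)" by (cases V)
    have v: "v \<in> ders (base_alg E) k" using V Vk by simp
    have "contract V G = 0"
    proof (cases "k = 0")
      case True
      have i: "contract (0, v) G \<in> A.iforms m 0" using A.iforms_contract[OF G, of "(0, v)"] v True by simp
      have "contract (0, v) G = 0"
      proof (rule Suc.IH[OF i])
        fix vs assume "set vs \<subseteq> vector_fields E" "length vs = m"
        then show "contract (0, v) G (map (\<lambda>v. (0, v)) vs) = 0"
          using Suc.prems(2)[of "v # vs"] v True by (simp add: contract_def)
      qed
      then show ?thesis using Vk True by simp
    next
      case False
      have "v = (\<lambda>c. 0)" using A.der_part[OF v, of _ 0] False by (auto simp: fun_eq_iff)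
      then show ?thesis unfolding Vk using A.gforms_zero_der[OF A.iforms_gforms[OF G]] by simp
    qed
    then show "contract V G = contract V 0" by (simp only: contract_zero)
  qed (use A.iforms_sforms[OF G] A.sforms_zero A.iforms_Nil[OF G] in \<open>simp_all del: zero_fun_apply\<close>, simp)
qed

abbreviation (input) "pr X \<equiv> (0 :: int, res X [])"

lemma ext_degree_zero:
  "(\<And>X. X \<in> set Xs \<Longrightarrow> fst X = 0) \<Longrightarrow> ext G Xs [] = G (map (\<lambda>X. pr X) Xs)"
proof (induction Xs arbitrary: G)
  case (Cons X Xs)
  then show ?case unfolding extend_restrict_Cons by (simp add: contract_def)
qed simp

lemma res_nab: "v \<in> vector_fields E \<Longrightarrow> res (k, nab v) [] = v"
  by (simp add: fun_eq_iff res_def nab_const)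

lemma der_lists_nab: "set vs \<subseteq> vector_fields E \<Longrightarrow> map (\<lambda>v. (0, nab v)) vs \<in> der_lists (ce_alg E)"
  by (induction vs) (simp_all add: nab_der)

text \<open>Lifts restrict to the given vector fields, so evaluation on lifts undoes the pullback.
  Injectivity of the pullback rests on this.\<close>

lemma pullback_nab:
  assumes vs: "set vs \<subseteq> vector_fields E"
  shows "pullback E G (map (\<lambda>v. (0, nab v)) vs) [] = G (map (\<lambda>v. (0, v)) vs)"
proof -
  have "pullback E G (map (\<lambda>v. (0, nab v)) vs) [] = ext G (map (\<lambda>v. (0, nab v)) vs) []"
    unfolding pullback_eq using der_lists_nab[OF vs] by simp
  also have "\<dots> = G (map (\<lambda>X. pr X) (map (\<lambda>v. (0, nab v)) vs))"
    by (rule ext_degree_zero) auto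
  also have "map (\<lambda>X. pr X) (map (\<lambda>v. (0, nab v)) vs) = map (\<lambda>v. (0 :: int, v)) vs"
    using vs by (induction vs) (simp_all add: res_nab)
  finally show ?thesis .
qed

lemma pullback_diff: "pullback E (G - G') = pullback E G - pullback E G'"
  by (simp add: pullback_eq fun_eq_iff extend_diff)

lemma pullback_add: "pullback E (G + G') = pullback E G + pullback E G'"
  by (simp add: pullback_eq fun_eq_iff extend_add)

lemma pullback_zero: "pullback E 0 = 0"
  by (simp add: pullback_eq fun_eq_iff extend_zero)

lemma pullback_scale: "pullback E (form_scale (base_alg E) r G) = form_scale (ce_alg E) r (pullback E G)"
  by (simp add: pullback_eq fun_eq_iff form_scale_def extend_scale)

lemma pullback_inj: "inj_on (pullback E) (A.iforms m 0)"
proof (rule inj_onI)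
  fix G G' assume G: "G \<in> A.iforms m 0" "G' \<in> A.iforms m 0" and e: "pullback E G = pullback E G'"
  have "G - G' = 0"
  proof (rule base_form_vanishes[OF A.iforms_diff[OF G]])
    fix vs assume "set vs \<subseteq> vector_fields E" "length vs = m"
    then have "pullback E (G - G') (map (\<lambda>v. (0, nab v)) vs) [] = (G - G') (map (\<lambda>v. (0, v)) vs)"
      using pullback_nab by blast
    then show "(G - G') (map (\<lambda>v. (0, v)) vs) = 0"
      unfolding pullback_diff e by simp
  qed
  then show "G = G'" by (metis eq_iff_diff_eq_0)
qed

lemma ders_base_nonzero: "k \<noteq> 0 \<Longrightarrow> v \<in> ders (base_alg E) k \<Longrightarrow> v = (\<lambda>c. 0)"
  using A.der_part[of v k _ 0] by (auto simp: fun_eq_iff)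

lemma nab_der_base: "v \<in> ders (base_alg E) k \<Longrightarrow> nab v \<in> ders (ce_alg E) k"
proof (cases "k = 0")
  case False
  assume "v \<in> ders (base_alg E) k"
  then have v: "v = (\<lambda>c. 0)" by (rule ders_base_nonzero[OF False])
  have "nab v = (\<lambda>c. 0)" unfolding v by (rule HOL.ext) (rule nab_zero)
  then show ?thesis using C.ders_zero[of k] by simp
qed (simp add: nab_der)

text \<open>The candidate G is the value of \<omega> on lifts; its pullback agrees with \<omega> by
  \<open>form_vanishes\<close>, as the difference has internal degree 0. Tags other than 0 are
  carried along, but the derivations bearing them lift to 0.\<close>

lemma base_form_exists:
  assumes \<omega>: "\<omega> \<in> C.iforms m 0"
  shows "\<exists>G\<in>A.iforms m 0. pullback E G = \<omega>"
proof -
  let ?n = "\<lambda>V. (fst V, nab (snd V))"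
  define G :: "'a form" where "G Vs = (if Vs \<in> der_lists (base_alg E) then \<omega> (map ?n Vs) [] else 0)" for Vs
  note g = C.iforms_gforms[OF \<omega>]
  have dl: "map ?n Vs \<in> der_lists (ce_alg E)" if "Vs \<in> der_lists (base_alg E)" for Vs
    using that by (induction Vs) (auto simp: A.is_der_def nab_der_base)
  have td: "tot_deg (map ?n Vs) = tot_deg Vs" for Vs :: "'a der list" by (induction Vs) simp_all
  have sd: "shifted_deg (map ?n Vs) = shifted_deg Vs" for Vs :: "'a der list" by (induction Vs) simp_all
  have "G Vs = 0" if "Vs \<notin> der_lists (base_alg E) \<or> length Vs \<noteq> m" for Vs
    using that C.iforms_out[OF \<omega>, of "map ?n Vs"] by (auto simp: G_def)
  moreover have "G Vs \<in> part (base_alg E) (0 + tot_deg Vs)" for Vs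
  proof (cases "tot_deg Vs = 0")
    case False
    have "\<omega> (map ?n Vs) \<in> cochains E (tot_deg Vs)" using C.iforms_part[OF \<omega>, of "map ?n Vs"] td by simp
    then have "\<omega> (map ?n Vs) [] = 0" using cochain_out[of _ "tot_deg Vs" "[]"] False by simp
    then show ?thesis by (simp add: G_def)
  qed simp
  moreover have "G (Xs @ [X, Y] @ Ys) = sg ((fst X - 1) * (fst Y - 1)) (G (Xs @ [Y, X] @ Ys))"
    if l: "Xs @ [X, Y] @ Ys \<in> der_lists (base_alg E)" for Xs X Y Ys
  proof -
    have l': "Xs @ [Y, X] @ Ys \<in> der_lists (base_alg E)" using l by simp
    have "map ?n Xs @ [?n X, ?n Y] @ map ?n Ys \<in> der_lists (ce_alg E)" using dl[OF l] by simp
    from C.iforms_swap_at[OF \<omega> this]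
    have "\<omega> (map ?n (Xs @ [X, Y] @ Ys)) = sg ((fst X - 1) * (fst Y - 1)) (\<omega> (map ?n (Xs @ [Y, X] @ Ys)))"
      by (simp only: map_append list.map fst_conv)
    then show ?thesis unfolding G_def if_P[OF l] if_P[OF l'] by (simp only: sg_apply)
  qed
  moreover have "G ((k, \<lambda>c. D c + D' c) # Xs) = G ((k, D) # Xs) + G ((k, D') # Xs)"
    if D: "D \<in> ders (base_alg E) k" "D' \<in> ders (base_alg E) k" and Xs: "Xs \<in> der_lists (base_alg E)" for k D D' Xs
  proof -
    have "nab (\<lambda>c. D c + D' c) = (\<lambda>c. nab D c + nab D' c)" by (simp add: fun_eq_iff nab_add)
    then show ?thesis
      using fun_cong[OF C.gforms_add_der[OF g nab_der_base[OF D(1)] nab_der_base[OF D(2)]], of "map ?n Xs"] D Xs A.ders_add[OF D]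
      by (simp add: G_def contract_def)
  qed
  moreover have "G ((i + k, \<lambda>c. gmul (base_alg E) f (D c)) # Xs) = sg (i * shifted_deg Xs) (gmul (base_alg E) f (G ((k, D) # Xs)))"
    if f: "f \<in> part (base_alg E) i" and D: "D \<in> ders (base_alg E) k" and Xs: "Xs \<in> der_lists (base_alg E)" for i k f D Xs
  proof (cases "i = 0")
    case True
    have a: "nab (\<lambda>c. f * D c) = (\<lambda>c. gmul (ce_alg E) (const_cochain f) (nab D c))" by (simp add: fun_eq_iff nab_mult)
    have "contract (0 + k, \<lambda>c. gmul (ce_alg E) (const_cochain f) (nab D c)) \<omega> = C.fmul 0 (const_cochain f) (contract (k, nab D) \<omega>)"
      by (rule C.gforms_mul_der[OF g _ nab_der_base[OF D]]) (use const_cochain in simp)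
    from fun_cong[OF this, of "map ?n Xs"]
    have "\<omega> ((k, nab (\<lambda>c. f * D c)) # map ?n Xs) = cochain_mult (const_cochain f) (\<omega> ((k, nab D) # map ?n Xs))"
      unfolding a by (simp add: contract_def C.fmul_def)
    moreover have "(\<lambda>c. f * D c) \<in> ders (base_alg E) k" using A.ders_mul[of f 0 D k] D by simp
    ultimately show ?thesis using D Xs True by (simp add: G_def const_mult)
  next
    case False
    then have f0: "f = 0" using f by simp
    have "nab (\<lambda>c. 0) = (\<lambda>c. 0)" by (simp add: fun_eq_iff nab_zero)
    then have "\<omega> ((i + k, nab (\<lambda>c. 0)) # map ?n Xs) = 0"
      using fun_cong[OF C.gforms_zero_der[OF g, of "i + k"], of "map ?n Xs"] by (simp add: contract_def)
    then show ?thesis using f0 by (simp add: G_def)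
  qed
  ultimately have G: "G \<in> A.iforms m 0" unfolding A.iforms_def by blast
  have "pullback E G - \<omega> = 0"
  proof (rule form_vanishes[OF C.iforms_diff[OF pullback_form[OF G] \<omega>]])
    fix vs assume vs: "set vs \<subseteq> vector_fields E" "length vs = m"
    have "map (\<lambda>v. (0, v)) vs \<in> der_lists (base_alg E)" using vs(1) by (induction vs) simp_all
    then have "G (map (\<lambda>v. (0, v)) vs) = \<omega> (map (\<lambda>v. (0, nab v)) vs) []"
      by (simp add: G_def comp_def)
    then show "(pullback E G - \<omega>) (map (\<lambda>v. (0, nab v)) vs) [] = 0"
      using pullback_nab[OF vs(1), of G] by simp
  qed simp
  then have "pullback E G = \<omega>" by (metis eq_iff_diff_eq_0)
  then show ?thesis using G by blast
qed

subsection \<open>The de Rham differential commutes with the pullback\<close>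

text \<open>Lifts are not closed under brackets when the connection has curvature. The comparison
  therefore runs over all derivations of degree 0, which preserve \<O>(U) and project to vector
  fields compatibly with brackets.\<close>

definition related :: "('a, 'l) cochain form \<Rightarrow> 'a form \<Rightarrow> bool" where
  "related \<omega> G \<longleftrightarrow> (\<forall>Xs. (\<forall>X\<in>set Xs. C.is_der X \<and> fst X = 0) \<longrightarrow>
     \<omega> Xs \<in> cochains E 0 \<and> \<omega> Xs [] = G (map (\<lambda>X. pr X) Xs))"

lemma relatedD: "related \<omega> G \<Longrightarrow> (\<And>X. X \<in> set Xs \<Longrightarrow> C.is_der X \<and> fst X = 0) \<Longrightarrow>
    \<omega> Xs \<in> cochains E 0 \<and> \<omega> Xs [] = G (map (\<lambda>X. pr X) Xs)"
  unfolding related_def by blast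

lemma related_contract: "related \<omega> G \<Longrightarrow> C.is_der X \<Longrightarrow> fst X = 0 \<Longrightarrow> related (contract X \<omega>) (contract (pr X) G)"
  unfolding related_def contract_def by (auto dest!: spec[of _ "X # _"])

lemma der0_eval:
  assumes "C.is_der X" "fst X = 0" "c \<in> cochains E 0"
  shows "snd X c \<in> cochains E 0" "snd X c [] = res X [] (c [])"
proof -
  show "snd X c \<in> cochains E 0" using C.der_part[OF C.is_der_snd[OF assms(1)], of c 0] assms by simp
  show "snd X c [] = res X [] (c [])"
    unfolding res_def cochain_0[OF assms(3), symmetric] by (rule refl)
qed

lemma pr_bracket:
  assumes X: "C.is_der X" "fst X = 0" and Y: "C.is_der Y" "fst Y = 0"
  shows "pr (der_bracket X Y) = der_bracket (pr X) (pr Y)"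
proof -
  have "snd X (snd Y (const_cochain f)) [] = res X [] (res Y [] f)" if "C.is_der X" "fst X = 0" "C.is_der Y" "fst Y = 0" for X Y f
    using der0_eval[OF that(3,4) const_cochain, of f] der0_eval(2)[OF that(1,2), of "snd Y (const_cochain f)"] by simp
  then show ?thesis using X Y by (simp add: der_bracket_def fun_eq_iff res_def[of "(_, _)"])
qed

lemma related_lie_at:
  assumes X: "C.is_der X" "fst X = 0"
  shows "related \<omega> G \<Longrightarrow> (\<And>Y. Y \<in> set Ys \<Longrightarrow> C.is_der Y \<and> fst Y = 0) \<Longrightarrow>
    lie_at X \<omega> Ys \<in> cochains E 0 \<and> lie_at X \<omega> Ys [] = lie_at (pr X) G (map (\<lambda>X. pr X) Ys)"
proof (induction Ys arbitrary: \<omega> G)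
  case Nil
  then show ?case using relatedD[OF Nil.prems(1), of "[]"] der0_eval[OF X, of "\<omega> []"] by simp
next
  case (Cons Y Ys)
  have Y: "C.is_der Y" "fst Y = 0" using Cons.prems(2) by simp_all
  have 1: "lie_at X (contract Y \<omega>) Ys \<in> cochains E 0 \<and>
      lie_at X (contract Y \<omega>) Ys [] = lie_at (pr X) (contract (pr Y) G) (map (\<lambda>X. pr X) Ys)"
    by (rule Cons.IH[OF related_contract[OF Cons.prems(1) Y]]) (use Cons.prems(2) in simp)
  have 2: "\<omega> (der_bracket X Y # Ys) \<in> cochains E 0 \<and> \<omega> (der_bracket X Y # Ys) [] = G (map (\<lambda>X. pr X) (der_bracket X Y # Ys))"
  proof (rule relatedD[OF Cons.prems(1)])
    fix Z assume "Z \<in> set (der_bracket X Y # Ys)"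
    then consider "Z = der_bracket X Y" | "Z \<in> set Ys" by auto
    then show "C.is_der Z \<and> fst Z = 0"
      by cases (use C.is_der_bracket[OF X(1) Y(1)] X(2) Y(2) Cons.prems(2) in simp_all)
  qed
  show ?case
    using 1 2 X Y C.part_diff[of "lie_at X (contract Y \<omega>) Ys" 0 "\<omega> (der_bracket X Y # Ys)"] pr_bracket[OF X Y]
    by (simp add: fun_diff_def)
qed

lemma related_de_rham_at:
  "related \<omega> G \<Longrightarrow> (\<And>Y. Y \<in> set Ys \<Longrightarrow> C.is_der Y \<and> fst Y = 0) \<Longrightarrow>
    de_rham_at \<omega> Ys \<in> cochains E 0 \<and> de_rham_at \<omega> Ys [] = de_rham_at G (map (\<lambda>X. pr X) Ys)"
proof (induction Ys arbitrary: \<omega> G)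
  case Nil
  have "(0 :: ('a, 'l) cochain) \<in> cochains E 0" using C.part_zero[of 0] by (simp del: zero_fun_apply)
  then show ?case by (simp add: zero_fun_def)
next
  case (Cons Y Ys)
  have Y: "C.is_der Y" "fst Y = 0" using Cons.prems(2) by simp_all
  have 1: "de_rham_at (contract Y \<omega>) Ys \<in> cochains E 0 \<and>
      de_rham_at (contract Y \<omega>) Ys [] = de_rham_at (contract (pr Y) G) (map (\<lambda>X. pr X) Ys)"
    by (rule Cons.IH[OF related_contract[OF Cons.prems(1) Y]]) (use Cons.prems(2) in simp)
  have 2: "lie_at Y \<omega> Ys \<in> cochains E 0 \<and> lie_at Y \<omega> Ys [] = lie_at (pr Y) G (map (\<lambda>X. pr X) Ys)"
    by (rule related_lie_at[OF Y Cons.prems(1)]) (use Cons.prems(2) in simp)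
  show ?case
    using 1 2 Y C.part_diff[of "lie_at Y \<omega> Ys" 0 "de_rham_at (contract Y \<omega>) Ys"]
    by (simp add: fun_diff_def)
qed

text \<open>By \<open>form_vanishes\<close> it suffices to compare values on lifts, where
  \<open>related\<close> carries the recursion for d along on both sides.\<close>

lemma pullback_d:
  assumes G: "G \<in> A.iforms m 0"
  shows "pullback E (d_base E G) = d_ce E (pullback E G)"
proof -
  have "related (pullback E G) G"
    unfolding related_def
  proof (intro allI impI)
    fix Xs :: "('a, 'l) cochain der list" assume Xs: "\<forall>X\<in>set Xs. C.is_der X \<and> fst X = 0"
    then have "tot_deg Xs = 0" "Xs \<in> der_lists (ce_alg E)" by (induction Xs) simp_all
    then show "pullback E G Xs \<in> cochains E 0 \<and> pullback E G Xs [] = G (map (\<lambda>X. pr X) Xs)"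
      using C.iforms_part[OF pullback_form[OF G], of Xs] Xs ext_degree_zero[of Xs G] by (simp add: pullback_eq)
  qed
  note rel = related_de_rham_at[OF this]
  have dG: "d_base E G \<in> A.iforms (Suc m) 0" unfolding d_base_def by (rule A.d_form[OF G])
  have dw: "d_ce E (pullback E G) \<in> C.iforms (Suc m) 0" unfolding d_ce_def by (rule C.d_form[OF pullback_form[OF G]])
  have "pullback E (d_base E G) - d_ce E (pullback E G) = 0"
  proof (rule form_vanishes[OF C.iforms_diff[OF pullback_form[OF dG] dw]])
    fix vs assume vs: "set vs \<subseteq> vector_fields E"
    have dl: "map (\<lambda>v. (0, v)) vs \<in> der_lists (base_alg E)" using vs by (induction vs) simp_all
    have p: "map (\<lambda>X. pr X) (map (\<lambda>v. (0, nab v)) vs) = map (\<lambda>v. (0 :: int, v)) vs"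
      using vs by (induction vs) (simp_all add: res_nab)
    have "pullback E (d_base E G) (map (\<lambda>v. (0, nab v)) vs) [] = de_rham_at G (map (\<lambda>v. (0, v)) vs)"
      unfolding pullback_nab[OF vs] using dl by (simp add: d_base_def de_rham_def)
    moreover have "d_ce E (pullback E G) (map (\<lambda>v. (0, nab v)) vs) [] = de_rham_at G (map (\<lambda>v. (0, v)) vs)"
    proof -
      have "C.is_der X \<and> fst X = 0" if "X \<in> set (map (\<lambda>v. (0, nab v)) vs)" for X
        using that vs nab_der by auto
      from rel[OF this, of "map (\<lambda>v. (0, nab v)) vs", THEN conjunct2]
      show ?thesis unfolding p d_ce_def de_rham_def using der_lists_nab[OF vs] by simp
    qed
    ultimately show "(pullback E (d_base E G) - d_ce E (pullback E G)) (map (\<lambda>v. (0, nab v)) vs) [] = 0" by simp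
  qed simp
  then show ?thesis by (metis eq_iff_diff_eq_0)
qed

subsection \<open>Contraction with exterior powers of the anchor\<close>

definition base_list :: "nat \<Rightarrow> (nat \<times> 'l) list \<Rightarrow> bool" where
  "base_list n u \<longleftrightarrow> length u = n \<and> (\<forall>y\<in>set u. fst y = 0)"

definition anc_form :: "'a form \<Rightarrow> (nat \<times> 'l) list \<Rightarrow> 'a form" where
  "anc_form G u = (\<lambda>Vs. G (map (\<lambda>y. (0, anchor E (snd y))) u @ Vs))"

lemma anc_form_Cons: "anc_form G (y # u) = anc_form (contract (0, anchor E (snd y)) G) u"
  by (simp add: anc_form_def contract_def)

lemma anc_form_snoc: "contract (0, anchor E (snd y)) (anc_form G u) = anc_form G (u @ [y])"
  by (simp add: anc_form_def contract_def)

lemma anc_form_gforms: "G \<in> A.gforms \<Longrightarrow> u \<in> SL \<Longrightarrow> \<forall>y\<in>set u. fst y = 0 \<Longrightarrow> anc_form G u \<in> A.gforms"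
proof (induction u arbitrary: G)
  case (Cons y u)
  have "contract (0, anchor E (snd y)) G \<in> A.gforms"
    using Cons.prems A.gforms_contract[of G "(0, anchor E (snd y))"] anchor_vf[of "snd y"] by simp
  then show ?case unfolding anc_form_Cons using Cons by simp
qed (simp add: anc_form_def)

lemma anchor_contraction_shsum:
  assumes Xs: "Xs \<in> der_lists (ce_alg E)" and ys: "ys \<in> SL"
  shows "anchor_contraction E n G Xs ys =
    shsum (\<lambda>u w. if base_list n u then sg (int n * shifted_deg Xs) (ext (anc_form G u) Xs w) else 0) ys"
proof -
  let ?P = "\<lambda>S. card S = n \<and> (\<forall>j\<in>S. fst (ys ! j) = 0)"
  let ?t = "\<lambda>S. sg (int (koszul (sec_degs ys) S) + int n * shifted_deg Xs) (ext (anc_form G (nths ys S)) Xs (nths ys (- S)))"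
  have b: "base_list n (nths ys S) \<longleftrightarrow> ?P S" if "S \<in> Pow {..<length ys}" for S
  proof -
    have "(\<forall>y\<in>set (nths ys S). fst y = 0) \<longleftrightarrow> (\<forall>y\<in>(\<lambda>j. ys ! j) ` S. fst y = 0)"
      using that by (intro ball_cong refl) (auto simp: set_nths)
    then show ?thesis using that card_nths[of S ys] unfolding base_list_def ball_simps by simp
  qed
  have "anchor_contraction E n G Xs ys = (\<Sum>S | S \<subseteq> {..<length ys} \<and> ?P S. ?t S)"
    using assms by (simp add: anchor_contraction_def anc_form_def)
  also have "{S. S \<subseteq> {..<length ys} \<and> ?P S} = {S \<in> Pow {..<length ys}. base_list n (nths ys S)}"
    using b by auto
  also have "(\<Sum>S\<in>{S \<in> Pow {..<length ys}. base_list n (nths ys S)}. ?t S) =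
      (\<Sum>S\<in>Pow {..<length ys}. if base_list n (nths ys S) then ?t S else 0)"
    by (rule sum.inter_filter) simp
  also have "\<dots> = (\<Sum>S\<in>Pow {..<length ys}. sg (int (koszul (sec_degs ys) S))
      (if base_list n (nths ys S) then sg (int n * shifted_deg Xs) (ext (anc_form G (nths ys S)) Xs (nths ys (- S))) else 0))"
    by (rule sum.cong) (simp_all add: sg_sg)
  finally show ?thesis
    using sum_unshuffles[of ys "\<lambda>u w. if base_list n u then sg (int n * shifted_deg Xs) (ext (anc_form G u) Xs w) else 0"]
    by (rule trans)
qed

lemma anchor_contraction_out: "Xs \<notin> der_lists (ce_alg E) \<or> ys \<notin> SL \<Longrightarrow> anchor_contraction E n G Xs ys = 0"
  by (auto simp: anchor_contraction_def)

lemma is_der_euler [simp]: "C.is_der (0, euler E)"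
  by (simp add: euler_der)

lemma is_der_Q [simp]: "C.is_der (1, ce_diff E)"
  by (simp add: Q_der)

lemma res_euler: "res (0, euler E) u = (\<lambda>f. 0)"
proof
  fix f
  have "euler E (const_cochain f) u = of_int (dg u) * const_cochain f u"
    by (rule euler_apply[OF cochain_CE[OF const_cochain]])
  then show "res (0, euler E) u f = 0" by (simp add: res_def const_cochain_def)
qed

lemma res_Q: "u \<in> SL \<Longrightarrow> res (1, ce_diff E) u = sym_anc u"
  using coder_op_const[OF coder_Q, of u] by (simp add: fun_eq_iff res_def ce_diff_coder)

text \<open>An anchor contraction sees a derivation only through its action on \<O>(U), and the
  Euler derivation kills functions.\<close>

lemma contract_euler_anchor:
  assumes g: "G \<in> A.gforms"
  shows "contract (0, euler E) (anchor_contraction E n G) = 0"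
proof (intro HOL.ext)
  fix Xs ys
  show "contract (0, euler E) (anchor_contraction E n G) Xs ys = 0 Xs ys"
  proof (cases "Xs \<in> der_lists (ce_alg E) \<and> ys \<in> SL")
    case True
    then have Xs: "(0, euler E) # Xs \<in> der_lists (ce_alg E)" and ys: "ys \<in> SL" by (simp_all add: euler_der)
    have "shsum (\<lambda>u w. if base_list n u then sg (int n * shifted_deg ((0, euler E) # Xs)) (ext (anc_form G u) ((0, euler E) # Xs) w) else 0) ys
        = shsum (\<lambda>u w. 0) ys"
    proof (rule shsum_cong)
      fix u w assume "set u \<union> set w = set ys"
      then have u: "u \<in> SL" using ys SL_split by blast
      have "ext (anc_form G u) ((0, euler E) # Xs) w = 0" if "base_list n u"
      proof -
        have "contract (0, res (0, euler E) s) (anc_form G u) = 0" for s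
          unfolding res_euler by (rule A.gforms_zero_der, rule anc_form_gforms[OF g u]) (use that in \<open>simp add: base_list_def\<close>)
        then show ?thesis unfolding extend_restrict_Cons by (simp only: extend_zero sg_zero shsum_zero)
      qed
      then show "(if base_list n u then sg (int n * shifted_deg ((0, euler E) # Xs)) (ext (anc_form G u) ((0, euler E) # Xs) w) else 0) = 0"
        by simp
    qed
    then show ?thesis using anchor_contraction_shsum[OF Xs ys, of n G] by (simp add: contract_def)
  next
    case False
    then show ?thesis using anchor_contraction_out[of "(0, euler E) # Xs" ys] by (auto simp: contract_def)
  qed
qed

lemma anc_form_swap:
  assumes G: "G \<in> A.iforms m 0" and l: "us @ [y, z] @ vs \<in> SL" "\<forall>y\<in>set (us @ [y, z] @ vs). fst y = 0"
  shows "anc_form G (us @ [y, z] @ vs) = - anc_form G (us @ [z, y] @ vs)"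
proof
  fix Vs
  let ?a = "\<lambda>y. (0 :: int, anchor E (snd y))"
  have d: "map ?a u \<in> der_lists (base_alg E)" if "u \<in> SL" "\<forall>y\<in>set u. fst y = 0" for u
    using that by (induction u) (auto simp: anchor_vf)
  show "anc_form G (us @ [y, z] @ vs) Vs = (- anc_form G (us @ [z, y] @ vs)) Vs"
  proof (cases "Vs \<in> der_lists (base_alg E)")
    case True
    have "map ?a us @ [?a y, ?a z] @ (map ?a vs @ Vs) \<in> der_lists (base_alg E)"
      using d[OF l] True by simp
    from A.iforms_swap_at[OF G this] show ?thesis by (simp add: anc_form_def sg_def)
  next
    case False
    then have "anc_form G us' Vs = 0" for us' using A.iforms_out[OF G] by (simp add: anc_form_def)
    then show ?thesis by simp
  qed
qed

text \<open>Contraction with Q adds one anchored entry, by \<open>anc_form_snoc\<close> at the end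
  of the list. A set of n + 1 entries arises once for each choice of the added one, and
  \<open>shsum_single\<close> with weight 1 counts these choices.\<close>

lemma contract_Q_anchor:
  assumes G: "G \<in> A.iforms m 0"
  shows "contract (1, ce_diff E) (anchor_contraction E n G) Xs ys = of_nat (n + 1) * anchor_contraction E (n + 1) G Xs ys"
proof (cases "Xs \<in> der_lists (ce_alg E) \<and> ys \<in> SL")
  case False
  then show ?thesis using anchor_contraction_out[of Xs ys] anchor_contraction_out[of "(1, ce_diff E) # Xs" ys] by (auto simp: contract_def)
next
  case True
  then have Xs: "Xs \<in> der_lists (ce_alg E)" "(1, ce_diff E) # Xs \<in> der_lists (ce_alg E)" and ys: "ys \<in> SL" by (simp_all add: Q_der)
  note g = A.iforms_gforms[OF G]
  let ?s = "shifted_deg Xs" and ?Q = "(1, ce_diff E)"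
  let ?\<Phi> = "\<lambda>t w. if base_list (n + 1) w then sg (int (n + 1) * ?s) (ext (anc_form G w) Xs t) else 0"
  have sym: "gsym (?\<Phi> t)" for t
    unfolding gsym_def
  proof (intro allI impI)
    fix us y z vs assume l: "us @ [y, z] @ vs \<in> SL"
    have b: "base_list (n + 1) (us @ [y, z] @ vs) \<longleftrightarrow> base_list (n + 1) (us @ [z, y] @ vs)"
      by (auto simp: base_list_def)
    show "?\<Phi> t (us @ [y, z] @ vs) = sg (dy y * dy z) (?\<Phi> t (us @ [z, y] @ vs))"
    proof (cases "base_list (n + 1) (us @ [y, z] @ vs)")
      case True
      then have d: "\<forall>y\<in>set (us @ [y, z] @ vs). fst y = 0" by (simp add: base_list_def)
      then have "dy y = 1" "dy z = 1" by simp_all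
      then show ?thesis using True b
        unfolding anc_form_swap[OF G l d] extend_minus by (simp add: sg_def)
    qed (simp only: b if_False sg_zero)
  qed
  have res: "contract (0, res ?Q s) (anc_form G u) = (if base_list 1 s then anc_form G (u @ s) else 0)"
    if "base_list n u" "u \<in> SL" "s \<in> SL" for u s
  proof (cases "base_list 1 s")
    case True
    then obtain y where y: "s = [y]" "fst y = 0" by (cases s) (auto simp: base_list_def)
    have "sym_anc s = anchor E (snd y)" by (simp add: y fun_eq_iff anc_def)
    then show ?thesis using True y(1) anc_form_snoc res_Q[OF that(3)] by simp
  next
    case False
    have "sym_anc s = (\<lambda>f. 0)"
    proof (cases "length s = 1")
      case True
      then obtain y where "s = [y]" by (cases s) auto
      then show ?thesis using False by (auto simp: base_list_def anc_def)
    qed (simp add: fun_eq_iff sym_anc_long)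
    moreover have "anc_form G u \<in> A.gforms" using anc_form_gforms[OF g that(2)] that(1) by (simp add: base_list_def)
    ultimately show ?thesis using A.gforms_zero_der[of "anc_form G u" 0] False res_Q[OF that(3)] by simp
  qed
  have "contract ?Q (anchor_contraction E n G) Xs ys = shsum (\<lambda>u w. shsum (\<lambda>s t. if length s = 1 then ?\<Phi> t (u @ s) else 0) w) ys"
    unfolding contract_apply anchor_contraction_shsum[OF Xs(2) ys]
  proof (rule shsum_cong)
    fix u w assume "set u \<union> set w = set ys"
    then have u: "u \<in> SL" and w: "w \<in> SL" using ys SL_split by blast+
    show "(if base_list n u then sg (int n * shifted_deg (?Q # Xs)) (ext (anc_form G u) (?Q # Xs) w) else 0) =
        shsum (\<lambda>s t. if length s = 1 then ?\<Phi> t (u @ s) else 0) w"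
    proof (cases "base_list n u")
      case True
      have "sg (int n * shifted_deg (?Q # Xs)) (ext (anc_form G u) (?Q # Xs) w) =
         shsum (\<lambda>s t. sg (int n * ?s) (sg ?s (ext (contract (0, res ?Q s) (anc_form G u)) Xs t))) w"
        unfolding extend_restrict_Cons shsum_sg by simp
      also have "\<dots> = shsum (\<lambda>s t. if length s = 1 then ?\<Phi> t (u @ s) else 0) w"
      proof (rule shsum_cong)
        fix s t assume "set s \<union> set t = set w"
        then have s: "s \<in> SL" using w SL_split by blast
        have b: "base_list 1 s \<longleftrightarrow> length s = 1 \<and> base_list (n + 1) (u @ s)"
          using True by (auto simp: base_list_def)
        show "sg (int n * ?s) (sg ?s (ext (contract (0, res ?Q s) (anc_form G u)) Xs t)) = (if length s = 1 then ?\<Phi> t (u @ s) else 0)"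
          unfolding res[OF True u s] b by (auto simp: sg_sg extend_zero distrib_right add.commute)
      qed
      finally show ?thesis using True by simp
    next
      case False
      then have "shsum (\<lambda>s t. if length s = 1 then ?\<Phi> t (u @ s) else 0) w = shsum (\<lambda>s t. 0) w"
      proof (intro shsum_cong)
        fix s t
        have "base_list (n + 1) (u @ s) \<Longrightarrow> length s = 1 \<Longrightarrow> base_list n u" by (simp add: base_list_def)
        then show "(if length s = 1 then ?\<Phi> t (u @ s) else 0) = 0" using False by auto
      qed
      then show ?thesis using False by simp
    qed
  qed
  \<comment> \<open>Regrouping joins the n old entries and the new one into a single block
    w.\<close>
  also have "\<dots> = shsum (\<lambda>w t. shsum (\<lambda>u s. if length s = 1 then ?\<Phi> t (u @ s) else 0) w) ys"
    by (rule shsum_coassoc[symmetric])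
  also have "\<dots> = shsum (\<lambda>w t. of_nat (n + 1) * ?\<Phi> t w) ys"
  proof (rule shsum_cong)
    fix w t assume "set w \<union> set t = set ys"
    then have w: "w \<in> SL" using ys SL_split by blast
    have "shsum (\<lambda>u s. if length s = 1 then ?\<Phi> t (u @ s) else 0) w = shsum (\<lambda>s u. if length s = 1 then 1 * ?\<Phi> t (s @ u) else 0) w"
      unfolding shsum_cocomm[of "\<lambda>u s. if length s = 1 then ?\<Phi> t (u @ s) else 0"]
    proof (rule shsum_cong)
      fix s u assume su: "set s \<union> set u = set w"
      show "sg (dg s * dg u) (if length s = 1 then ?\<Phi> t (u @ s) else 0) = (if length s = 1 then 1 * ?\<Phi> t (s @ u) else 0)"
      proof (cases "length s = 1")
        case True
        then obtain y where y: "s = [y]" by (cases s) auto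
        have "u @ y # [] \<in> SL" using su w SL_split[of s u w] y by simp
        from gsym_front[OF sym[of t] this]
        have "?\<Phi> t (u @ [y]) = sg (dy y * dg u) (?\<Phi> t (y # u))" by (simp only: append_Nil2)
        then have "sg (dg [y] * dg u) (?\<Phi> t (u @ [y])) = ?\<Phi> t ([y] @ u)"
          by (simp only: sg_sg dg_simps add_0_right sg_double append.simps)
        then show ?thesis unfolding y if_P[OF True[unfolded y]] mult_1 .
      qed simp
    qed
    also have "\<dots> = (\<Sum>y\<leftarrow>w. 1) * ?\<Phi> t w" by (rule shsum_single[OF sym w])
    also have "\<dots> = of_nat (n + 1) * ?\<Phi> t w"
    proof (cases "base_list (n + 1) w")
      case True
      then have "(\<Sum>y\<leftarrow>w. 1 :: 'a) = of_nat (n + 1)" by (simp add: base_list_def sum_list_triv)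
      then show ?thesis by (simp only:)
    qed (simp only: if_False mult_zero_right)
    finally show "shsum (\<lambda>u s. if length s = 1 then ?\<Phi> t (u @ s) else 0) w = of_nat (n + 1) * ?\<Phi> t w" .
  qed
  also have "\<dots> = of_nat (n + 1) * anchor_contraction E (n + 1) G Xs ys"
    unfolding anchor_contraction_shsum[OF Xs(1) ys] by (rule shsum_mult_left)
  finally show ?thesis .
qed

abbreviation (input) "fscale r \<omega> \<equiv> form_scale (ce_alg E) r \<omega>"

lemma fscale_fscale: "fscale r (fscale s \<omega>) = fscale (r * s) \<omega>"
  by (simp add: form_scale_def fun_eq_iff base_mult mult.assoc)

lemma fscale_one [simp]: "fscale 1 \<omega> = \<omega>"
  by (simp add: form_scale_def)

lemma fscale_zero [simp]: "fscale r 0 = 0"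
  by (simp add: form_scale_def fun_eq_iff)

lemma fscale_add: "fscale r (\<omega> + \<omega>') = fscale r \<omega> + fscale r \<omega>'"
  by (simp add: form_scale_def fun_eq_iff distrib_left)

lemma fscale_minus: "fscale r (- \<omega>) = - fscale r \<omega>"
  by (simp add: form_scale_def fun_eq_iff)

lemma fscale_add_left: "fscale (r + s) \<omega> = fscale r \<omega> + fscale s \<omega>"
  by (simp add: form_scale_def fun_eq_iff base_add distrib_right)

lemma fscale_sum: "fscale r (\<Sum>j\<in>J. f j) = (\<Sum>j\<in>J. fscale r (f j))"
  by (induction J rule: infinite_finite_induct) (simp_all add: fscale_add del: plus_fun_apply zero_fun_apply)

lemma contract_fscale: "contract X (fscale r \<omega>) = fscale r (contract X \<omega>)"
  by (simp add: contract_def form_scale_def)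

lemma anchor_contraction_Suc:
  assumes "G \<in> A.iforms m 0"
  shows "anchor_contraction E (Suc n) G = fscale (1 / of_nat (Suc n)) (contract (1, ce_diff E) (anchor_contraction E n G))"
proof (intro HOL.ext)
  fix Xs ys
  have "base E (1 / of_int (int (Suc n))) * of_int (int (Suc n)) = 1" by (rule base_inverse) simp
  then have "base E (1 / of_nat (Suc n)) * of_nat (Suc n) = 1" by simp
  then show "anchor_contraction E (Suc n) G Xs ys =
      fscale (1 / of_nat (Suc n)) (contract (1, ce_diff E) (anchor_contraction E n G)) Xs ys"
    using contract_Q_anchor[OF assms, of n Xs ys] by (simp add: form_scale_def mult.assoc[symmetric] del: of_nat_Suc)
qed

lemma anchor_contraction_zero: "anchor_contraction E 0 G = pullback E G"
  by (simp add: pullback_def)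

text \<open>Each term is, up to a factor, the contraction of the previous one with Q, so symmetry
  and multilinearity are inherited from the pullback instead of being checked. Past n = m a form of
  degree 0 is contracted, and the terms are 0.\<close>

lemma anchor_contraction_form:
  assumes G: "G \<in> A.iforms m 0"
  shows "(n \<le> m \<longrightarrow> anchor_contraction E n G \<in> C.iforms (m - n) (int n)) \<and> (m < n \<longrightarrow> anchor_contraction E n G = 0)"
proof (induction n)
  case 0
  then show ?case using pullback_form[OF G] by (simp add: anchor_contraction_zero)
next
  case (Suc n)
  note s = anchor_contraction_Suc[OF G, of n]
  consider "Suc n \<le> m" | "n = m" | "m < n" by linarith
  then show ?case
  proof cases
    case 1
    have "anchor_contraction E n G \<in> C.iforms (Suc (m - Suc n)) (int n)"
      using Suc 1 by (simp add: Suc_diff_Suc)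
    from C.iforms_contract[OF this is_der_Q]
    have "contract (1, ce_diff E) (anchor_contraction E n G) \<in> C.iforms (m - Suc n) (int (Suc n))" by (simp add: add.commute)
    then have "anchor_contraction E (Suc n) G \<in> C.iforms (m - Suc n) (int (Suc n))" unfolding s by (rule C.iforms_scale)
    then show ?thesis using 1 by simp
  next
    case 2
    then have "contract (1, ce_diff E) (anchor_contraction E n G) = 0" using Suc C.iforms_0_contract[of _ "int n"] by simp
    then have "anchor_contraction E (Suc n) G = 0" unfolding s by (simp only: fscale_zero)
    then show ?thesis using 2 by simp
  next
    case 3
    then have "anchor_contraction E n G = 0" using Suc by blast
    then have "anchor_contraction E (Suc n) G = 0" unfolding s by (simp only: fscale_zero contract_zero)
    then show ?thesis using 3 by simp
  qed
qed

lemma anchor_contraction_add: "anchor_contraction E n (G + G') = anchor_contraction E n G + anchor_contraction E n G'"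
proof (intro HOL.ext)
  fix Xs ys
  have "anc_form (G + G') u = anc_form G u + anc_form G' u" for u by (simp add: anc_form_def fun_eq_iff)
  then show "anchor_contraction E n (G + G') Xs ys = (anchor_contraction E n G + anchor_contraction E n G') Xs ys"
    by (cases "Xs \<in> der_lists (ce_alg E) \<and> ys \<in> SL")
      (auto simp: anchor_contraction_shsum anchor_contraction_out extend_add sg_add shsum_add[symmetric] intro!: shsum_cong)
qed

lemma anchor_contraction_scale: "anchor_contraction E n (form_scale (base_alg E) r G) = fscale r (anchor_contraction E n G)"
proof (intro HOL.ext)
  fix Xs ys
  have "anc_form (form_scale (base_alg E) r G) u = (\<lambda>Vs. base E r * anc_form G u Vs)" for u
    by (simp add: anc_form_def form_scale_def fun_eq_iff)
  then show "anchor_contraction E n (form_scale (base_alg E) r G) Xs ys = fscale r (anchor_contraction E n G) Xs ys"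
    by (cases "Xs \<in> der_lists (ce_alg E) \<and> ys \<in> SL")
      (auto simp: anchor_contraction_shsum anchor_contraction_out extend_scale form_scale_def sg_mult_right
        shsum_mult_left[symmetric] intro!: shsum_cong)
qed

lemma anchor_contraction_of_zero: "anchor_contraction E n 0 = 0"
proof -
  have "anchor_contraction E n 0 + anchor_contraction E n 0 = anchor_contraction E n 0 + 0"
    using anchor_contraction_add[of n 0 0] by simp
  then show ?thesis by (rule add_left_imp_eq)
qed

subsection \<open>The homotopy\<close>

lemma fmul_const: "C.fmul 0 (const_cochain (of_int q)) \<omega> = fscale (of_int q) \<omega>"
  by (simp add: C.fmul_def form_scale_def fun_eq_iff const_mult base_of_int)

lemma der_ext:
  assumes D: "D \<in> ders (ce_alg E) k" "D' \<in> ders (ce_alg E) k" and e: "\<And>i c. c \<in> cochains E i \<Longrightarrow> D c = D' c"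
  shows "D = D'"
proof
  fix c
  show "D c = D' c"
  proof (cases "c \<in> CE")
    case True
    then show ?thesis
    proof (induction rule: C.AP_induct)
      case (part i x)
      then show ?case using e by simp
    next
      case (add x y)
      then show "D (x + y) = D' (x + y)" using C.der_add[OF D(1), of x y] C.der_add[OF D(2), of x y] by simp
    qed
  qed (simp add: C.der_out[OF D(1)] C.der_out[OF D(2)])
qed

lemma euler_bracket_left:
  assumes Y: "C.is_der Y"
  shows "der_bracket (0, euler E) Y = (0 + fst Y, \<lambda>c. cochain_mult (const_cochain (of_int (fst Y))) (snd Y c))"
proof -
  note D = C.is_der_snd[OF Y]
  have b: "snd (der_bracket (0, euler E) Y) \<in> ders (ce_alg E) (0 + fst Y)"
    using C.is_der_snd[OF C.is_der_bracket[OF is_der_euler Y]] by simp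
  have m: "(\<lambda>c. cochain_mult (const_cochain (of_int (fst Y))) (snd Y c)) \<in> ders (ce_alg E) (0 + fst Y)"
    using C.ders_mul[of "const_cochain (of_int (fst Y))" 0, OF _ D] const_cochain by simp
  have "snd (der_bracket (0, euler E) Y) = (\<lambda>c. cochain_mult (const_cochain (of_int (fst Y))) (snd Y c))"
  proof (rule der_ext[OF b m])
    fix i c assume c: "c \<in> cochains E i"
    have Yc: "snd Y c \<in> cochains E (i + fst Y)" using C.der_part[OF D, of c i] c by simp
    have "snd Y (euler E c) = gscale (ce_alg E) (of_int i) (snd Y c)"
      unfolding euler_cochain[OF c] by (rule C.der_scale[OF D cochain_CE[OF c]])
    then show "snd (der_bracket (0, euler E) Y) c = cochain_mult (const_cochain (of_int (fst Y))) (snd Y c)"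
      using euler_cochain[OF Yc]
      by (simp add: der_bracket_def fun_eq_iff const_mult base_add base_of_int distrib_right)
  qed
  then show ?thesis by (simp add: prod_eq_iff)
qed

text \<open>Contraction with X shifts the internal degree by |X|, and [\<xi>, X] = |X| X takes the
  same amount away, so the eigenvalue q survives the induction.\<close>

lemma lie_euler:
  "\<omega> \<in> C.iforms p q \<Longrightarrow> lie (ce_alg E) (0, euler E) \<omega> = fscale (of_int q) \<omega>"
proof (induction p arbitrary: \<omega> q)
  case (0 \<omega> q)
  note w = "0.prems"
  note s = C.iforms_sforms[OF w]
  show ?case
  proof (rule C.sform_ext)
    show "lie (ce_alg E) (0, euler E) \<omega> [] = fscale (of_int q) \<omega> []"
      using euler_cochain[of "\<omega> []" q] C.iforms_part[OF w, of "[]"] by (simp add: form_scale_def)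
    fix X :: "('a, 'l) cochain der" assume X: "C.is_der X"
    have "contract Y \<omega> = 0" for Y by (rule C.iforms_0_contract[OF w])
    then show "contract X (lie (ce_alg E) (0, euler E) \<omega>) = contract X (fscale (of_int q) \<omega>)"
      unfolding C.contract_lie[OF is_der_euler X s] contract_fscale
      by (simp only: C.lie_zero[OF is_der_euler] fscale_zero diff_self sg_zero)
  qed (use s C.sforms_lie[OF is_der_euler] C.sforms_scale in simp_all)
next
  case (Suc p \<omega> q)
  note w = Suc.prems
  note s = C.iforms_sforms[OF w]
  show ?case
  proof (rule C.sform_ext)
    show "lie (ce_alg E) (0, euler E) \<omega> [] = fscale (of_int q) \<omega> []"
      unfolding C.lie_Nil form_scale_def C.iforms_Nil[OF w] snd_conv C.der_zero[OF euler_der] by (simp add: fun_eq_iff)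
    fix X :: "('a, 'l) cochain der" assume X: "C.is_der X"
    have 1: "contract (der_bracket (0, euler E) X) \<omega> = fscale (of_int (fst X)) (contract X \<omega>)"
      unfolding euler_bracket_left[OF X]
      using C.gforms_mul_der[OF C.iforms_gforms[OF w] _ C.is_der_snd[OF X], of "const_cochain (of_int (fst X))" 0] const_cochain
      by (simp add: fmul_const)
    have 2: "lie (ce_alg E) (0, euler E) (contract X \<omega>) = fscale (of_int (q + fst X)) (contract X \<omega>)"
      by (rule Suc.IH[OF C.iforms_contract[OF w X]])
    show "contract X (lie (ce_alg E) (0, euler E) \<omega>) = contract X (fscale (of_int q) \<omega>)"
      unfolding C.contract_lie[OF is_der_euler X s] contract_fscale 1 2 of_int_add fscale_add_left
      by (simp only: fst_conv mult_zero_left sg_0 add_diff_cancel_right')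
  qed (use s C.sforms_lie[OF is_der_euler] C.sforms_scale in simp_all)
qed

lemma bracket_Q_euler: "der_bracket (1, ce_diff E) (0, euler E) = (1, \<lambda>c. - ce_diff E c)"
proof -
  have b: "snd (der_bracket (1, ce_diff E) (0, euler E)) \<in> ders (ce_alg E) 1"
    using C.is_der_snd[OF C.is_der_bracket[OF is_der_Q is_der_euler]] by simp
  have "snd (der_bracket (1, ce_diff E) (0, euler E)) = (\<lambda>c. - ce_diff E c)"
  proof (rule der_ext[OF b C.ders_minus[OF Q_der]])
    fix i c assume c: "c \<in> cochains E i"
    have Qc: "ce_diff E c \<in> cochains E (i + 1)" using C.der_part[OF Q_der, of c i] c by simp
    have "ce_diff E (euler E c) = gscale (ce_alg E) (of_int i) (ce_diff E c)"
      unfolding euler_cochain[OF c] by (rule C.der_scale[OF Q_der cochain_CE[OF c]])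
    then show "snd (der_bracket (1, ce_diff E) (0, euler E)) c = - ce_diff E c"
      using euler_cochain[OF Qc]
      by (simp add: der_bracket_def fun_eq_iff base_add base_of_int distrib_right)
  qed
  then show ?thesis by (simp add: prod_eq_iff)
qed

text \<open>As Q raises the degree by 1, [Q, \<xi>] = - Q; moving the contraction with \<xi> past
  L_Q therefore leaves a contraction with Q.\<close>

lemma contract_euler_delta:
  assumes w: "\<omega> \<in> C.gforms"
  shows "contract (0, euler E) (delta E \<omega>) = - delta E (contract (0, euler E) \<omega>) - contract (1, ce_diff E) \<omega>"
  unfolding delta_def C.contract_lie[OF is_der_Q is_der_euler C.gforms_sforms[OF w]] bracket_Q_euler
    C.gforms_minus_der[OF w Q_der]
  by (simp add: sg_def)

text \<open>The contraction is odd for the total degree, so it anticommutes with itself, and 2 is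
  invertible in \<O>(U).\<close>

lemma contract_euler_euler:
  assumes w: "\<omega> \<in> C.gforms"
  shows "contract (0, euler E) (contract (0, euler E) \<omega>) = 0"
proof (intro HOL.ext)
  fix Xs ys
  let ?x = "contract (0, euler E) (contract (0, euler E) \<omega>)"
  have "sg ((fst (0 :: int, euler E) - 1) * (fst (0 :: int, euler E) - 1)) \<eta> = - \<eta>" for \<eta> :: "('a, 'l) cochain form"
    by (simp add: sg_def)
  then have "?x = - ?x" by (rule trans[OF C.gforms_swap[OF w is_der_euler is_der_euler]])
  from fun_cong[OF fun_cong[OF this, of Xs], of ys, unfolded uminus_apply]
  have "?x Xs ys = 0" by (rule double_zero)
  then show "?x Xs ys = 0 Xs ys" by simp
qed

text \<open>\<open>hpty\<close> reads the internal degree off each single value. On a homogeneous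
  form the values of all other degrees are 0, and one scalar remains.\<close>

lemma hpty_pos:
  assumes w: "\<omega> \<in> C.iforms r q" and q: "q > 0"
  shows "hpty E \<omega> = fscale (1 / of_int q) (contract (0, euler E) \<omega>)"
proof (intro HOL.ext)
  fix Xs ys
  have "contract (0, euler E) \<omega> Xs \<in> cochains E (q + tot_deg Xs)"
    using C.iforms_part[OF w, of "(0, euler E) # Xs"] by (simp add: contract_def)
  from cochain_out[OF this, of ys]
  show "hpty E \<omega> Xs ys = fscale (1 / of_int q) (contract (0, euler E) \<omega>) Xs ys"
    using q by (cases "dg ys = q + tot_deg Xs") (auto simp: hpty_def Let_def dg_sec_degs form_scale_def)
qed

lemma hpty_nonpos:
  assumes w: "\<omega> \<in> C.iforms r q" and q: "q \<le> 0"
  shows "hpty E \<omega> = 0"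
proof (intro HOL.ext)
  fix Xs ys
  have "contract (0, euler E) \<omega> Xs \<in> cochains E (q + tot_deg Xs)"
    using C.iforms_part[OF w, of "(0, euler E) # Xs"] by (simp add: contract_def)
  from cochain_out[OF this, of ys]
  show "hpty E \<omega> Xs ys = 0 Xs ys"
    using q by (cases "dg ys = q + tot_deg Xs") (auto simp: hpty_def Let_def dg_sec_degs)
qed

lemma hpty_add: "hpty E (\<omega> + \<omega>') = hpty E \<omega> + hpty E \<omega>'"
  by (simp add: fun_eq_iff hpty_def Let_def contract_def distrib_left)

lemma hpty_scale: "hpty E (fscale r \<omega>) = fscale r (hpty E \<omega>)"
  by (simp add: fun_eq_iff hpty_def Let_def contract_def form_scale_def mult.left_commute)

lemma hpty_zero: "hpty E 0 = 0"
  by (simp add: fun_eq_iff hpty_def Let_def contract_def)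

lemma hpty_minus: "hpty E (- \<omega>) = - hpty E \<omega>"
  by (simp add: fun_eq_iff hpty_def Let_def contract_def)

lemma hpty_sum: "hpty E (\<Sum>j\<in>J. f j) = (\<Sum>j\<in>J. hpty E (f j))"
  by (induction J rule: infinite_finite_induct) (simp_all only: sum.infinite sum.empty sum.insert hpty_zero hpty_add not_False_eq_True)

lemma hpty_form_0: "\<omega> \<in> C.iforms 0 q \<Longrightarrow> hpty E \<omega> = 0"
  by (cases "q > 0") (simp_all only: hpty_pos C.iforms_0_contract fscale_zero not_less hpty_nonpos)

lemma hpty_form: "\<omega> \<in> C.iforms (Suc r) q \<Longrightarrow> hpty E \<omega> \<in> C.iforms r q"
proof (cases "q > 0")
  case True
  assume w: "\<omega> \<in> C.iforms (Suc r) q"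
  show ?thesis unfolding hpty_pos[OF w True]
    using C.iforms_contract[OF w is_der_euler] by (simp add: C.iforms_scale)
next
  case False
  assume w: "\<omega> \<in> C.iforms (Suc r) q"
  then have "hpty E \<omega> = 0" using hpty_nonpos False by simp
  then show ?thesis using C.iforms_zero by (simp only:)
qed

lemma hpty_hpty: "\<omega> \<in> C.iforms r q \<Longrightarrow> hpty E (hpty E \<omega>) = 0"
proof -
  assume w: "\<omega> \<in> C.iforms r q"
  show ?thesis
  proof (cases "q > 0 \<and> r > 0")
    case True
    then obtain r' where r: "r = Suc r'" by (cases r) auto
    have h: "hpty E \<omega> \<in> C.iforms r' q" using hpty_form w r by simp
    have "contract (0, euler E) (hpty E \<omega>) = 0"
      using hpty_pos[OF w] True contract_euler_euler[OF C.iforms_gforms[OF w]] by (simp only: contract_fscale fscale_zero)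
    then show ?thesis using hpty_pos[OF h] True by (simp only: fscale_zero)
  next
    case False
    then have "hpty E \<omega> = 0" using hpty_form_0[of \<omega> q] hpty_nonpos[OF w] w by (cases r) auto
    then show ?thesis by (simp only: hpty_zero)
  qed
qed

lemma fscale_cancel: "q > 0 \<Longrightarrow> fscale (1 / of_int q) (fscale (of_int q) \<omega>) = \<omega>"
  by (simp only: fscale_fscale) simp

text \<open>Since d preserves the internal degree, the same scalar 1/q normalizes both terms of
  Cartan's formula for L_\<xi>.\<close>

lemma hpty_homotopy:
  assumes w: "\<omega> \<in> C.iforms r q" and q: "q > 0"
  shows "d_ce E (hpty E \<omega>) + hpty E (d_ce E \<omega>) = \<omega>"
proof -
  have dw: "d_ce E \<omega> \<in> C.iforms (Suc r) q" unfolding d_ce_def by (rule C.d_form[OF w])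
  have s: "contract (0, euler E) \<omega> \<in> C.sforms" by (rule C.sforms_contract[OF C.iforms_sforms[OF w]])
  have "contract (0, euler E) (d_ce E \<omega>) = fscale (of_int q) \<omega> - d_ce E (contract (0, euler E) \<omega>)"
    unfolding d_ce_def C.contract_d[OF is_der_euler] lie_euler[OF w] by simp
  moreover have "d_ce E (hpty E \<omega>) = fscale (1 / of_int q) (d_ce E (contract (0, euler E) \<omega>))"
    unfolding d_ce_def hpty_pos[OF w q] by (rule C.d_scale[OF s])
  ultimately have "d_ce E (hpty E \<omega>) + hpty E (d_ce E \<omega>) =
      fscale (1 / of_int q) (d_ce E (contract (0, euler E) \<omega>) + (fscale (of_int q) \<omega> - d_ce E (contract (0, euler E) \<omega>)))"
    by (simp only: hpty_pos[OF dw q] fscale_add)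
  then show ?thesis by (simp only: add_diff_cancel_left' add_diff_eq fscale_cancel[OF q])
qed

lemma hpty_anchor:
  assumes "G \<in> A.iforms m 0"
  shows "hpty E (anchor_contraction E n G) = 0"
proof (cases "n \<le> m")
  case True
  then have f: "anchor_contraction E n G \<in> C.iforms (m - n) (int n)" using anchor_contraction_form[OF assms] by blast
  show ?thesis
  proof (cases "n = 0")
    case True
    then show ?thesis using hpty_nonpos[OF f] by simp
  next
    case False
    then show ?thesis using hpty_pos[OF f] contract_euler_anchor[OF A.iforms_gforms[OF assms]]
      by (simp only: fscale_zero of_nat_0_less_iff neq0_conv)
  qed
next
  case False
  then have "anchor_contraction E n G = 0" using anchor_contraction_form[OF assms] by simp
  then show ?thesis by (simp only: hpty_zero)
qed

lemma is_der_zero_lie: "delta E 0 = 0"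
  unfolding delta_def by (rule C.lie_zero[OF is_der_Q])

text \<open>As \<iota>_\<xi> kills the anchor contraction, only - \<iota>_Q survives. The argument
  of h has internal degree n + 1, and the resulting scalar 1/(n + 1) cancels the factor in
  \<open>contract_Q_anchor\<close>.\<close>

lemma hpty_delta_anchor:
  assumes G: "G \<in> A.iforms m 0"
  shows "hpty E (delta E (anchor_contraction E n G)) = - anchor_contraction E (Suc n) G"
proof (cases "n \<le> m")
  case True
  let ?a = "anchor_contraction E n G"
  have f: "?a \<in> C.iforms (m - n) (int n)" using anchor_contraction_form[OF G] True by blast
  have df: "delta E ?a \<in> C.iforms (m - n) (int n + 1)"
    unfolding delta_def using C.lie_form[OF is_der_Q f] by simp
  have q: "int n + 1 > 0" by simp
  have "hpty E (delta E ?a) = fscale (1 / of_int (int n + 1)) (contract (0, euler E) (delta E ?a))"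
    by (rule hpty_pos[OF df q])
  also have "contract (0, euler E) (delta E ?a) = - contract (1, ce_diff E) ?a"
    unfolding contract_euler_delta[OF C.iforms_gforms[OF f]] contract_euler_anchor[OF A.iforms_gforms[OF G]] is_der_zero_lie
    by simp
  also have "fscale (1 / of_int (int n + 1)) (- contract (1, ce_diff E) ?a) = - anchor_contraction E (Suc n) G"
    unfolding anchor_contraction_Suc[OF G] fscale_minus by (simp add: add.commute)
  finally show ?thesis .
next
  case False
  then have "anchor_contraction E n G = 0" "anchor_contraction E (Suc n) G = 0"
    using anchor_contraction_form[OF G, of n] anchor_contraction_form[OF G, of "Suc n"] by simp_all
  then show ?thesis by (simp only: is_der_zero_lie hpty_zero minus_zero)
qed

end

declare plus_fun_apply [simp del] zero_fun_apply [simp del] minus_apply [simp del] uminus_apply [simp del]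

section \<open>Components of fixed form degree\<close>

lemma form_part_add: "form_part r (\<omega> + \<omega>') = form_part r \<omega> + form_part r (\<omega>' :: 'c::ab_group_add form)"
  and form_part_zero [simp]: "form_part r (0 :: 'c::ab_group_add form) = 0"
  and form_part_minus: "form_part r (- \<omega>) = - form_part r (\<omega> :: 'c::ab_group_add form)"
  and form_part_diff: "form_part r (\<omega> - \<omega>') = form_part r \<omega> - form_part r (\<omega>' :: 'c::ab_group_add form)"
  by (auto simp: form_part_def fun_eq_iff form_apply)

lemma form_part_sum: "form_part r (\<Sum>j\<in>J. f j) = (\<Sum>j\<in>J. form_part r (f j :: 'c::ab_group_add form))"
  by (induction J rule: infinite_finite_induct) (simp_all add: form_part_add)

context linfty_alg
begin

subsection \<open>The total complex\<close>

abbreviation "TF \<equiv> total_forms E"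

lemma TF_iff: "\<omega> \<in> TF p m \<longleftrightarrow> (\<forall>r. form_part r \<omega> \<in> (if p \<le> r \<and> r \<le> m then C.iforms r (int (m - r)) else {0}))"
  by (simp add: total_forms_def C.forms_eq_iforms)

lemma TF_part: "\<omega> \<in> TF p m \<Longrightarrow> r \<le> m \<Longrightarrow> form_part r \<omega> \<in> C.iforms r (int (m - r))"
  using C.iforms_zero unfolding TF_iff by (metis singletonD)

lemma TF_part_zero: "\<omega> \<in> TF p m \<Longrightarrow> \<not> (p \<le> r \<and> r \<le> m) \<Longrightarrow> form_part r \<omega> = 0"
  unfolding TF_iff by (metis singletonD)

lemma form_part_iforms: "\<omega> \<in> C.iforms s q \<Longrightarrow> form_part r \<omega> = (if r = s then \<omega> else 0)"
  by (auto simp: form_part_def fun_eq_iff form_apply C.iforms_out)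

lemma iforms_TF: "\<omega> \<in> C.iforms r (int (m - r)) \<Longrightarrow> p \<le> r \<Longrightarrow> r \<le> m \<Longrightarrow> \<omega> \<in> TF p m"
  unfolding TF_iff by (simp add: form_part_iforms)

lemma TF_zero [simp]: "0 \<in> TF p m"
  by (simp add: TF_iff)

lemma TF_add: "\<omega> \<in> TF p m \<Longrightarrow> \<omega>' \<in> TF p m \<Longrightarrow> \<omega> + \<omega>' \<in> TF p m"
  unfolding TF_iff form_part_add
proof (intro allI)
  fix r assume "\<forall>r. form_part r \<omega> \<in> (if p \<le> r \<and> r \<le> m then C.iforms r (int (m - r)) else {0})"
    "\<forall>r. form_part r \<omega>' \<in> (if p \<le> r \<and> r \<le> m then C.iforms r (int (m - r)) else {0})"
  from this[THEN spec, of r] show "form_part r \<omega> + form_part r \<omega>' \<in> (if p \<le> r \<and> r \<le> m then C.iforms r (int (m - r)) else {0})"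
    by (cases "p \<le> r \<and> r \<le> m") (simp_all add: C.iforms_add)
qed

lemma TF_minus: "\<omega> \<in> TF p m \<Longrightarrow> - \<omega> \<in> TF p m"
  unfolding TF_iff form_part_minus by (auto split: if_splits intro: C.iforms_minus)

lemma TF_diff: "\<omega> \<in> TF p m \<Longrightarrow> \<omega>' \<in> TF p m \<Longrightarrow> \<omega> - \<omega>' \<in> TF p m"
  using TF_add[of \<omega> p m "- \<omega>'"] TF_minus by simp

lemma TF_sum: "(\<And>j. j \<in> J \<Longrightarrow> f j \<in> TF p m) \<Longrightarrow> (\<Sum>j\<in>J. f j) \<in> TF p m"
  by (induction J rule: infinite_finite_induct) (auto intro: TF_add)

lemma fscale_diff: "fscale r (\<omega> - \<omega>') = fscale r \<omega> - fscale r \<omega>'"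
  using fscale_add[of r \<omega> "- \<omega>'"] by (simp add: fscale_minus)

lemma form_part_scale: "form_part r (fscale s \<omega>) = fscale s (form_part r \<omega>)"
  by (auto simp: form_part_def form_scale_def fun_eq_iff form_apply)

lemma TF_scale: "\<omega> \<in> TF p m \<Longrightarrow> fscale s \<omega> \<in> TF p m"
  unfolding TF_iff form_part_scale by (auto split: if_splits intro: C.iforms_scale)

text \<open>The homotopy h leaves the complex truncated at p, so the series are computed with p = 0
  and cut off afterwards.\<close>

lemma TF_0: "\<omega> \<in> TF p m \<Longrightarrow> \<omega> \<in> TF 0 m"
  unfolding TF_iff[of \<omega> 0]
proof (intro allI)
  fix r assume "\<omega> \<in> TF p m"
  then show "form_part r \<omega> \<in> (if 0 \<le> r \<and> r \<le> m then C.iforms r (int (m - r)) else {0})"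
    using TF_part[of \<omega> p m r] TF_part_zero[of \<omega> p m r] by (cases "r \<le> m") simp_all
qed

lemma TF_decompose: assumes "\<omega> \<in> TF p m" shows "\<omega> = (\<Sum>r\<le>m. form_part r \<omega>)"
proof
  fix Xs
  have "(\<Sum>r\<le>m. form_part r \<omega>) Xs = (\<Sum>r\<le>m. if length Xs = r then \<omega> Xs else 0)"
    unfolding sum_fun_apply by (simp add: form_part_def)
  also have "\<dots> = \<omega> Xs"
    using fun_cong[OF TF_part_zero[OF assms, of "length Xs"], of Xs] by (auto simp: form_part_def form_apply)
  finally show "\<omega> Xs = (\<Sum>r\<le>m. form_part r \<omega>) Xs" by simp
qed

lemma TF_eq_0: "\<omega> \<in> TF p m \<Longrightarrow> (\<And>r. r \<le> m \<Longrightarrow> form_part r \<omega> = 0) \<Longrightarrow> \<omega> = 0"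
  using TF_decompose[of \<omega> p m] by simp

lemma TF_small: "\<omega> \<in> TF p m \<Longrightarrow> m < p \<Longrightarrow> \<omega> = 0"
  by (rule TF_eq_0) (auto intro: TF_part_zero)

text \<open>Reduces identities between additive operators to single components, for which the
  homogeneous calculus is available.\<close>

lemma TF_induct [consumes 1, case_names hom add]:
  assumes "\<omega> \<in> TF 0 m" and hom: "\<And>r \<omega>. r \<le> m \<Longrightarrow> \<omega> \<in> C.iforms r (int (m - r)) \<Longrightarrow> P \<omega>"
    and add: "\<And>\<omega> \<omega>'. \<omega> \<in> TF 0 m \<Longrightarrow> \<omega>' \<in> TF 0 m \<Longrightarrow> P \<omega> \<Longrightarrow> P \<omega>' \<Longrightarrow> P (\<omega> + \<omega>')"
  shows "P \<omega>"
proof -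
  have t: "form_part r \<omega> \<in> TF 0 m" if "r \<le> m" for r
    using iforms_TF[OF TF_part[OF assms(1) that] _ that] by simp
  have "finite J \<Longrightarrow> J \<subseteq> {..m} \<Longrightarrow> P (\<Sum>r\<in>J. form_part r \<omega>)" for J
  proof (induction J rule: finite_induct)
    case empty
    then show ?case using hom[of 0 0] by simp
  next
    case (insert r J)
    have "P (form_part r \<omega>)" using hom[of r "form_part r \<omega>"] TF_part[OF assms(1)] insert.prems by simp
    moreover have "(\<Sum>r\<in>J. form_part r \<omega>) \<in> TF 0 m" using insert.prems by (intro TF_sum t) auto
    ultimately show ?case using insert add[of "form_part r \<omega>" "\<Sum>r\<in>J. form_part r \<omega>"] t[of r] by simp
  qed
  from this[of "{..m}"] show ?thesis using TF_decompose[OF assms(1)] by simp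
qed

lemma TF_sforms: "\<omega> \<in> TF p m \<Longrightarrow> \<omega> \<in> C.sforms"
proof -
  assume "\<omega> \<in> TF p m"
  from TF_0[OF this] show ?thesis
    by (induction rule: TF_induct) (auto intro: C.iforms_sforms C.sforms_add)
qed

subsection \<open>The operators on the total complex\<close>

lemma delta_add: "\<omega> \<in> C.sforms \<Longrightarrow> \<omega>' \<in> C.sforms \<Longrightarrow> delta E (\<omega> + \<omega>') = delta E \<omega> + delta E \<omega>'"
  unfolding delta_def by (rule C.lie_add[OF is_der_Q])

lemma delta_zero [simp]: "delta E 0 = 0"
  by (rule is_der_zero_lie)

lemma delta_minus: "\<omega> \<in> C.sforms \<Longrightarrow> delta E (- \<omega>) = - delta E \<omega>"
  unfolding delta_def by (rule C.lie_minus[OF is_der_Q])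

lemma delta_diff: "\<omega> \<in> C.sforms \<Longrightarrow> \<omega>' \<in> C.sforms \<Longrightarrow> delta E (\<omega> - \<omega>') = delta E \<omega> - delta E \<omega>'"
  unfolding delta_def by (rule C.lie_diff[OF is_der_Q])

lemma delta_scale: "\<omega> \<in> C.sforms \<Longrightarrow> delta E (fscale r \<omega>) = fscale r (delta E \<omega>)"
  unfolding delta_def by (rule C.lie_scale[OF is_der_Q])

lemma delta_sum: "(\<And>j. j \<in> J \<Longrightarrow> f j \<in> C.sforms) \<Longrightarrow> delta E (\<Sum>j\<in>J. f j) = (\<Sum>j\<in>J. delta E (f j))"
  by (induction J rule: infinite_finite_induct) (auto simp: delta_add C.sforms_sum)

lemma dce_add: "\<omega> \<in> C.sforms \<Longrightarrow> \<omega>' \<in> C.sforms \<Longrightarrow> d_ce E (\<omega> + \<omega>') = d_ce E \<omega> + d_ce E \<omega>'"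
  unfolding d_ce_def by (rule C.d_add)

lemma dce_zero [simp]: "d_ce E 0 = 0"
  unfolding d_ce_def by (rule C.d_zero)

lemma dce_minus: "\<omega> \<in> C.sforms \<Longrightarrow> d_ce E (- \<omega>) = - d_ce E \<omega>"
  unfolding d_ce_def by (rule C.d_minus)

lemma dce_diff: "\<omega> \<in> C.sforms \<Longrightarrow> \<omega>' \<in> C.sforms \<Longrightarrow> d_ce E (\<omega> - \<omega>') = d_ce E \<omega> - d_ce E \<omega>'"
  unfolding d_ce_def by (rule C.d_diff)

lemma dce_scale: "\<omega> \<in> C.sforms \<Longrightarrow> d_ce E (fscale r \<omega>) = fscale r (d_ce E \<omega>)"
  unfolding d_ce_def by (rule C.d_scale)

lemma dce_sum: "(\<And>j. j \<in> J \<Longrightarrow> f j \<in> C.sforms) \<Longrightarrow> d_ce E (\<Sum>j\<in>J. f j) = (\<Sum>j\<in>J. d_ce E (f j))"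
  by (induction J rule: infinite_finite_induct) (auto simp: dce_add C.sforms_sum)

lemma delta_form: "\<omega> \<in> C.iforms r q \<Longrightarrow> delta E \<omega> \<in> C.iforms r (q + 1)"
  unfolding delta_def using C.lie_form[OF is_der_Q] by simp

lemma dce_form: "\<omega> \<in> C.iforms r q \<Longrightarrow> d_ce E \<omega> \<in> C.iforms (Suc r) q"
  unfolding d_ce_def by (rule C.d_form)

lemma delta_sforms: "\<omega> \<in> C.sforms \<Longrightarrow> delta E \<omega> \<in> C.sforms"
  unfolding delta_def by (rule C.sforms_lie[OF is_der_Q])

lemma dce_sforms: "\<omega> \<in> C.sforms \<Longrightarrow> d_ce E \<omega> \<in> C.sforms"
  unfolding d_ce_def by (rule C.sforms_d)

lemma form_part_delta: "\<omega> \<in> TF 0 m \<Longrightarrow> form_part r (delta E \<omega>) = delta E (form_part r \<omega>)"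
proof (induction rule: TF_induct)
  case (hom s \<omega>)
  show ?case using form_part_iforms[OF hom(2)] form_part_iforms[OF delta_form[OF hom(2)]] by simp
next
  case (add \<omega> \<omega>')
  have "form_part r \<omega> \<in> C.sforms" "form_part r \<omega>' \<in> C.sforms" for r
    using TF_part[OF add(1), of r] TF_part[OF add(2), of r] TF_part_zero[OF add(1), of r] TF_part_zero[OF add(2), of r]
    by (cases "r \<le> m"; auto intro: C.iforms_sforms)+
  then show ?case using add TF_sforms by (simp add: delta_add form_part_add)
qed

lemma form_part_sforms: "\<omega> \<in> TF p m \<Longrightarrow> form_part r \<omega> \<in> C.sforms"
  using TF_part[of \<omega> p m r] TF_part_zero[of \<omega> p m r] by (cases "r \<le> m") (auto intro: C.iforms_sforms)

lemma form_part_dce: "\<omega> \<in> TF 0 m \<Longrightarrow> form_part r (d_ce E \<omega>) = (case r of 0 \<Rightarrow> 0 | Suc r' \<Rightarrow> d_ce E (form_part r' \<omega>))"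
proof (induction rule: TF_induct)
  case (hom s \<omega>)
  show ?case using form_part_iforms[OF hom(2)] form_part_iforms[OF dce_form[OF hom(2)]] by (cases r) simp_all
next
  case (add \<omega> \<omega>')
  then show ?case using TF_sforms form_part_sforms by (cases r) (simp_all add: dce_add form_part_add)
qed

lemma form_part_hpty: "form_part r (hpty E \<omega>) = hpty E (form_part (Suc r) \<omega>)"
  by (auto simp: form_part_def hpty_def contract_def Let_def fun_eq_iff form_apply)

lemma delta_TF: assumes "\<omega> \<in> TF p m" shows "delta E \<omega> \<in> TF p (Suc m)"
  unfolding TF_iff
proof
  fix r
  show "form_part r (delta E \<omega>) \<in> (if p \<le> r \<and> r \<le> Suc m then C.iforms r (int (Suc m - r)) else {0})"
  proof (cases "p \<le> r \<and> r \<le> m")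
    case True
    then show ?thesis unfolding form_part_delta[OF TF_0[OF assms]]
      using delta_form[OF TF_part[OF assms, of r]] by (simp add: Suc_diff_le add.commute)
  next
    case False
    then show ?thesis unfolding form_part_delta[OF TF_0[OF assms]] TF_part_zero[OF assms False] by simp
  qed
qed

lemma dce_TF: assumes "\<omega> \<in> TF p m" shows "d_ce E \<omega> \<in> TF p (Suc m)"
  unfolding TF_iff
proof
  fix r
  show "form_part r (d_ce E \<omega>) \<in> (if p \<le> r \<and> r \<le> Suc m then C.iforms r (int (Suc m - r)) else {0})"
  proof (cases r)
    case (Suc r')
    show ?thesis
    proof (cases "p \<le> r' \<and> r' \<le> m")
      case True
      then show ?thesis unfolding form_part_dce[OF TF_0[OF assms]]
        using dce_form[OF TF_part[OF assms, of r']] Suc by simp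
    next
      case False
      then show ?thesis unfolding form_part_dce[OF TF_0[OF assms]] using TF_part_zero[OF assms False] Suc by simp
    qed
  qed (simp add: form_part_dce[OF TF_0[OF assms]])
qed

lemma hpty_TF: assumes "\<omega> \<in> TF 0 (Suc m)" shows "hpty E \<omega> \<in> TF 0 m"
  unfolding TF_iff
proof
  fix r
  show "form_part r (hpty E \<omega>) \<in> (if 0 \<le> r \<and> r \<le> m then C.iforms r (int (m - r)) else {0})"
    unfolding form_part_hpty using hpty_form[of "form_part (Suc r) \<omega>" r] TF_part[OF assms, of "Suc r"]
      TF_part_zero[OF assms, of "Suc r"] hpty_zero by (cases "r \<le> m") simp_all
qed

lemma hpty_TF_0: assumes "\<omega> \<in> TF 0 0" shows "hpty E \<omega> = 0"
proof -
  have "form_part 0 \<omega> \<in> C.iforms 0 0" using TF_part[OF assms, of 0] by simp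
  moreover have "\<omega> = form_part 0 \<omega>" using TF_decompose[OF assms] by simp
  ultimately have "\<omega> \<in> C.iforms 0 0" by simp
  then show ?thesis by (rule hpty_form_0)
qed

lemma total_diff_TF: "\<omega> \<in> TF p m \<Longrightarrow> total_diff E k \<omega> \<in> TF p (Suc m)"
  unfolding total_diff_def by (intro TF_add delta_TF dce_TF)

lemma delta_delta_iforms: "\<omega> \<in> C.iforms r q \<Longrightarrow> delta E (delta E \<omega>) = 0"
  unfolding delta_def by (rule C.lie_square_zero[OF C.iforms_gforms Q_der Q_Q])

lemma delta_dce_iforms: "\<omega> \<in> C.iforms r q \<Longrightarrow> delta E (d_ce E \<omega>) = - d_ce E (delta E \<omega>)"
  unfolding delta_def d_ce_def using C.lie_d[OF C.iforms_gforms is_der_Q] by (simp add: sg_def)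

lemma dce_dce_iforms: "\<omega> \<in> C.iforms r q \<Longrightarrow> d_ce E (d_ce E \<omega>) = 0"
  unfolding d_ce_def by (rule C.d_d[OF C.iforms_gforms])

lemma delta_delta: "\<omega> \<in> TF 0 m \<Longrightarrow> delta E (delta E \<omega>) = 0"
  by (induction rule: TF_induct) (auto simp: delta_delta_iforms delta_add delta_sforms TF_sforms)

lemma dce_dce: "\<omega> \<in> TF 0 m \<Longrightarrow> d_ce E (d_ce E \<omega>) = 0"
  by (induction rule: TF_induct) (auto simp: dce_dce_iforms dce_add dce_sforms TF_sforms)

lemma delta_dce: "\<omega> \<in> TF 0 m \<Longrightarrow> delta E (d_ce E \<omega>) = - d_ce E (delta E \<omega>)"
  by (induction rule: TF_induct) (auto simp: delta_dce_iforms dce_add delta_add dce_sforms delta_sforms TF_sforms)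

text \<open>In total degree m the component of form degree m has internal degree 0; h vanishes on it
  and on its differential, which accounts for the defect.\<close>

lemma homotopy_TF: "\<omega> \<in> TF 0 m \<Longrightarrow> d_ce E (hpty E \<omega>) + hpty E (d_ce E \<omega>) = \<omega> - form_part m \<omega>"
proof (induction rule: TF_induct)
  case (hom r \<omega>)
  show ?case
  proof (cases "r = m")
    case True
    then have w: "\<omega> \<in> C.iforms m 0" using hom by simp
    have "hpty E \<omega> = 0" "hpty E (d_ce E \<omega>) = 0"
      using hpty_nonpos[OF w] hpty_nonpos[OF dce_form[OF w]] by simp_all
    then show ?thesis using form_part_iforms[OF w, of m] by simp
  next
    case False
    then show ?thesis using hpty_homotopy[OF hom(2)] form_part_iforms[OF hom(2), of m] hom(1) by simp
  qed
next
  case (add \<omega> \<omega>')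
  have h: "hpty E \<eta> \<in> C.sforms" if "\<eta> \<in> TF 0 m" for \<eta>
  proof (cases m)
    case 0
    then show ?thesis using hpty_TF_0[of \<eta>] that by simp
  next
    case (Suc k)
    then show ?thesis using hpty_TF[of \<eta> k] that TF_sforms by simp
  qed
  have "d_ce E (hpty E (\<omega> + \<omega>')) + hpty E (d_ce E (\<omega> + \<omega>')) =
      (d_ce E (hpty E \<omega>) + hpty E (d_ce E \<omega>)) + (d_ce E (hpty E \<omega>') + hpty E (d_ce E \<omega>'))"
    unfolding hpty_add dce_add[OF h[OF add(1)] h[OF add(2)]] dce_add[OF TF_sforms[OF add(1)] TF_sforms[OF add(2)]]
    by (simp only: add_ac)
  also have "\<dots> = (\<omega> - form_part m \<omega>) + (\<omega>' - form_part m \<omega>')"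
    unfolding add(3,4) by (rule refl)
  also have "\<dots> = (\<omega> + \<omega>') - form_part m (\<omega> + \<omega>')"
    by (simp only: form_part_add add_diff_add)
  finally show ?case .
qed

subsection \<open>The perturbation series\<close>

text \<open>Preserves the total degree and lowers the form degree by 1. In total degree m its powers
  therefore vanish beyond the m-th, and the series may stop there.\<close>

definition pert :: "('a, 'l) ce_form \<Rightarrow> ('a, 'l) ce_form" where
  "pert \<theta> = - delta E (hpty E \<theta>)"

lemma hpty_TF_any: "\<omega> \<in> TF 0 m \<Longrightarrow> hpty E \<omega> \<in> TF 0 (m - 1) \<and> (m = 0 \<longrightarrow> hpty E \<omega> = 0)"
  using hpty_TF[of \<omega> "m - 1"] hpty_TF_0[of \<omega>] by (cases m) auto

lemma pert_TF: "\<omega> \<in> TF 0 m \<Longrightarrow> pert \<omega> \<in> TF 0 m"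
  unfolding pert_def using delta_TF[of "hpty E \<omega>" 0 "m - 1"] hpty_TF_any[of \<omega> m] by (cases m) (auto intro: TF_minus)

lemma pert_add: "\<omega> \<in> TF 0 m \<Longrightarrow> \<omega>' \<in> TF 0 m \<Longrightarrow> pert (\<omega> + \<omega>') = pert \<omega> + pert \<omega>'"
  unfolding pert_def hpty_add
  using delta_add[OF TF_sforms[OF conjunct1[OF hpty_TF_any]] TF_sforms[OF conjunct1[OF hpty_TF_any]]] by simp

lemma pert_zero [simp]: "pert 0 = 0"
  by (simp add: pert_def hpty_zero)

lemma pert_minus: "\<omega> \<in> TF 0 m \<Longrightarrow> pert (- \<omega>) = - pert \<omega>"
  using pert_add[of \<omega> m "- \<omega>"] TF_minus[of \<omega> 0 m] by (simp add: eq_neg_iff_add_eq_0 add.commute)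

lemma pert_diff: "\<omega> \<in> TF 0 m \<Longrightarrow> \<omega>' \<in> TF 0 m \<Longrightarrow> pert (\<omega> - \<omega>') = pert \<omega> - pert \<omega>'"
  using pert_add[of \<omega> m "- \<omega>'"] TF_minus[of \<omega>' 0 m] pert_minus[of \<omega>' m] by simp

lemma pert_scale: "\<omega> \<in> TF 0 m \<Longrightarrow> pert (fscale r \<omega>) = fscale r (pert \<omega>)"
  unfolding pert_def hpty_scale by (simp add: delta_scale[OF TF_sforms[OF conjunct1[OF hpty_TF_any]]] fscale_minus)

lemma pert_sum: "(\<And>j. j \<in> J \<Longrightarrow> f j \<in> TF 0 m) \<Longrightarrow> pert (\<Sum>j\<in>J. f j) = (\<Sum>j\<in>J. pert (f j))"
  by (induction J rule: infinite_finite_induct) (simp_all add: pert_add[of _ m] TF_sum)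

lemma pert_pow_TF: "\<omega> \<in> TF 0 m \<Longrightarrow> (pert ^^ n) \<omega> \<in> TF 0 m"
  by (induction n) (auto intro: pert_TF)

lemma pert_pow_add: "\<omega> \<in> TF 0 m \<Longrightarrow> \<omega>' \<in> TF 0 m \<Longrightarrow> (pert ^^ n) (\<omega> + \<omega>') = (pert ^^ n) \<omega> + (pert ^^ n) \<omega>'"
  by (induction n) (simp_all add: pert_add[OF pert_pow_TF pert_pow_TF])

lemma pert_pow_scale: "\<omega> \<in> TF 0 m \<Longrightarrow> (pert ^^ n) (fscale r \<omega>) = fscale r ((pert ^^ n) \<omega>)"
  by (induction n) (simp_all add: pert_scale[OF pert_pow_TF])

lemma pert_pow_zero [simp]: "(pert ^^ n) 0 = 0"
  by (induction n) auto

lemma form_part_pert: "\<omega> \<in> TF 0 m \<Longrightarrow> form_part r (pert \<omega>) = pert (form_part (Suc r) \<omega>)"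
  unfolding pert_def form_part_minus using form_part_delta[of "hpty E \<omega>" "m - 1"] hpty_TF_any[of \<omega> m]
  by (simp add: form_part_hpty)

lemma form_part_pert_pow: "\<omega> \<in> TF 0 m \<Longrightarrow> form_part r ((pert ^^ n) \<omega>) = (pert ^^ n) (form_part (r + n) \<omega>)"
proof (induction n arbitrary: r)
  case (Suc n)
  then show ?case using form_part_pert[OF pert_pow_TF[OF Suc.prems], of r n] by simp
qed simp

lemma pert_nilpotent: assumes "\<omega> \<in> TF 0 m" "m < n" shows "(pert ^^ n) \<omega> = 0"
proof (rule TF_eq_0[OF pert_pow_TF[OF assms(1)]])
  fix r
  show "form_part r ((pert ^^ n) \<omega>) = 0"
    unfolding form_part_pert_pow[OF assms(1)] using TF_part_zero[OF assms(1), of "r + n"] assms(2) by simp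
qed

text \<open>For k equal to the total degree of the argument, \<open>pser k\<close> inverts 1 +
  \<delta> h, by \<open>pser_fix\<close>.\<close>

definition pser :: "nat \<Rightarrow> ('a, 'l) ce_form \<Rightarrow> ('a, 'l) ce_form" where
  "pser m \<omega> = (\<Sum>n\<le>m. (pert ^^ n) \<omega>)"

lemma pser_TF: "\<omega> \<in> TF 0 m \<Longrightarrow> pser k \<omega> \<in> TF 0 m"
  unfolding pser_def by (intro TF_sum pert_pow_TF)

lemma pser_add: "\<omega> \<in> TF 0 m \<Longrightarrow> \<omega>' \<in> TF 0 m \<Longrightarrow> pser k (\<omega> + \<omega>') = pser k \<omega> + pser k \<omega>'"
  unfolding pser_def by (simp add: pert_pow_add sum.distrib)

lemma pser_scale: "\<omega> \<in> TF 0 m \<Longrightarrow> pser k (fscale r \<omega>) = fscale r (pser k \<omega>)"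
  unfolding pser_def by (simp add: pert_pow_scale fscale_sum)

lemma pser_fix: assumes "\<omega> \<in> TF 0 m" shows "pser m \<omega> = \<omega> + pert (pser m \<omega>)"
proof -
  have "pert (pser m \<omega>) = (\<Sum>n\<le>m. (pert ^^ Suc n) \<omega>)"
    unfolding pser_def by (subst pert_sum[where m = m]) (simp_all add: pert_pow_TF assms)
  moreover have "(\<Sum>n\<le>Suc m. (pert ^^ n) \<omega>) = \<omega> + (\<Sum>n\<le>m. (pert ^^ Suc n) \<omega>)"
    by (subst sum.atMost_Suc_shift) simp
  moreover have "(pert ^^ Suc m) \<omega> = 0" by (rule pert_nilpotent[OF assms]) simp
  then have "(\<Sum>n\<le>Suc m. (pert ^^ n) \<omega>) = pser m \<omega>"
    unfolding pser_def sum.atMost_Suc by simp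
  ultimately show ?thesis by simp
qed

text \<open>The difference of two solutions is fixed by a nilpotent operator. A value of the series
  can thus be found by exhibiting a solution, without handling powers.\<close>

lemma pser_unique:
  assumes w: "\<omega> \<in> TF 0 m" and t: "\<theta> \<in> TF 0 m" and e: "\<theta> = \<omega> + pert \<theta>"
  shows "\<theta> = pser m \<omega>"
proof -
  let ?\<eta> = "\<theta> - pser m \<omega>"
  have h: "?\<eta> \<in> TF 0 m" by (rule TF_diff[OF t pser_TF[OF w]])
  have "?\<eta> = (\<omega> + pert \<theta>) - (\<omega> + pert (pser m \<omega>))"
    by (rule arg_cong2[of _ _ _ _ "(-)"], rule e, rule pser_fix[OF w])
  also have "\<dots> = pert ?\<eta>"
    unfolding pert_diff[OF t pser_TF[OF w]] by (rule add_diff_cancel_left)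
  finally have f: "?\<eta> = pert ?\<eta>" .
  have "(pert ^^ n) ?\<eta> = ?\<eta>" for n
  proof (induction n)
    case (Suc n)
    have "(pert ^^ Suc n) ?\<eta> = pert ((pert ^^ n) ?\<eta>)" by simp
    also have "\<dots> = ?\<eta>" unfolding Suc by (rule f[symmetric])
    finally show ?case .
  qed simp
  from this[of "Suc m"] have "?\<eta> = 0" using pert_nilpotent[OF h, of "Suc m"] by simp
  then show ?thesis by (rule eq_iff_diff_eq_0[THEN iffD2])
qed

lemma anchor_iforms: "G \<in> A.iforms m 0 \<Longrightarrow> n \<le> m \<Longrightarrow> anchor_contraction E n G \<in> C.iforms (m - n) (int n)"
  using anchor_contraction_form by blast

lemma anchor_large: "G \<in> A.iforms m 0 \<Longrightarrow> m < n \<Longrightarrow> anchor_contraction E n G = 0"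
  using anchor_contraction_form by blast

lemma anchor_TF: "G \<in> A.iforms m 0 \<Longrightarrow> p \<le> m \<Longrightarrow> n \<le> m - p \<Longrightarrow> anchor_contraction E n G \<in> TF p m"
  by (rule iforms_TF[of _ "m - n"]) (use anchor_iforms[of G m n] in simp_all)

lemma anchor_TF_0: "G \<in> A.iforms m 0 \<Longrightarrow> anchor_contraction E n G \<in> TF 0 m"
  using anchor_TF[of G m 0 n] anchor_large[of G m n] by (cases "n \<le> m") simp_all

lemma pert_delta_anchor:
  assumes G: "G \<in> A.iforms m 0"
  shows "pert (delta E (anchor_contraction E n G)) = delta E (anchor_contraction E (Suc n) G)"
  unfolding pert_def hpty_delta_anchor[OF G] delta_minus[OF TF_sforms[OF anchor_TF_0[OF G]]] by simp

text \<open>The candidate d ?\<theta>, with ?\<theta> the series of \<omega>, solves the fixed point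
  equation up to a defect: the homotopy formula fails on the component \<alpha>_0 of internal degree
  0, which leaves \<delta> \<alpha>_0. Applying - \<delta> h to it repeatedly yields the other
  \<delta> \<alpha>_n.\<close>

lemma pser_diff_TF:
  assumes w: "\<omega> \<in> TF 0 m" and G: "G \<in> A.iforms m 0" and p: "form_part m \<omega> = pullback E G"
  shows "pser (Suc m) (total_diff E k \<omega>) = d_ce E (pser m \<omega>) + (\<Sum>n\<le>Suc m. delta E (anchor_contraction E n G))"
proof (rule pser_unique[symmetric])
  let ?\<theta> = "pser m \<omega>" and ?a = "\<lambda>n. anchor_contraction E n G"
  let ?\<zeta> = "\<Sum>n\<le>Suc m. delta E (?a n)"
  have t: "?\<theta> \<in> TF 0 m" by (rule pser_TF[OF w])
  have da: "delta E (?a n) \<in> TF 0 (Suc m)" for n by (rule delta_TF[OF anchor_TF_0[OF G]])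
  have dt: "d_ce E ?\<theta> \<in> TF 0 (Suc m)" by (rule dce_TF[OF t])
  have z: "?\<zeta> \<in> TF 0 (Suc m)" by (rule TF_sum) (rule da)
  show "total_diff E k \<omega> \<in> TF 0 (Suc m)" by (rule total_diff_TF[OF w])
  show "d_ce E ?\<theta> + ?\<zeta> \<in> TF 0 (Suc m)" by (rule TF_add[OF dt z])
  \<comment> \<open>The operator - \<delta> h shifts \<delta> \<alpha>_n to \<delta> \<alpha>_(n+1);
    the term shifted out at the end is 0, its index exceeding the degree m of G.\<close>
  have pz: "delta E (?a 0) + pert ?\<zeta> = ?\<zeta>"
  proof -
    have "pert ?\<zeta> = (\<Sum>n\<le>Suc m. delta E (?a (Suc n)))"
      by (subst pert_sum[where m = "Suc m"]) (simp_all only: da pert_delta_anchor[OF G])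
    moreover have "(\<Sum>n\<le>Suc (Suc m). delta E (?a n)) = delta E (?a 0) + (\<Sum>n\<le>Suc m. delta E (?a (Suc n)))"
      by (rule sum.atMost_Suc_shift)
    moreover have "delta E (?a (Suc (Suc m))) = 0" using anchor_large[OF G, of "Suc (Suc m)"] by simp
    ultimately show ?thesis by (simp only: sum.atMost_Suc add_0_right)
  qed
  have hs: "hpty E ?\<theta> \<in> TF 0 (m - 1)" using hpty_TF_any[OF t] by blast
  note s = TF_sforms[OF t] TF_sforms[OF hs]
  have pp: "form_part m ?\<theta> = ?a 0"
  proof -
    have "form_part m (pert ?\<theta>) = pert (form_part (Suc m) ?\<theta>)" by (rule form_part_pert[OF t])
    also have "\<dots> = 0" using TF_part_zero[OF t, of "Suc m"] by simp
    finally have "form_part m (pert ?\<theta>) = 0" .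
    moreover have "form_part m ?\<theta> = form_part m \<omega> + form_part m (pert ?\<theta>)"
      unfolding form_part_add[symmetric] by (rule arg_cong[OF pser_fix[OF w]])
    ultimately show ?thesis using p by (simp add: anchor_contraction_zero)
  qed
  \<comment> \<open>Solving for \<omega> lets both sides of the fixed point equation be expressed
    through the series alone.\<close>
  have wt: "\<omega> = ?\<theta> - pert ?\<theta>" unfolding eq_diff_eq by (rule pser_fix[OF w, symmetric])
  have "total_diff E k \<omega> = delta E ?\<theta> + d_ce E ?\<theta> - delta E (pert ?\<theta>) - d_ce E (pert ?\<theta>)"
    unfolding total_diff_def
    by (subst (1 2) wt) (simp add: delta_diff dce_diff s TF_sforms[OF pert_TF[OF t]])
  also have "delta E (pert ?\<theta>) = 0"
    unfolding pert_def using delta_delta[OF hs] delta_minus[OF delta_sforms[OF s(2)]] by simp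
  also have "d_ce E (pert ?\<theta>) = delta E (d_ce E (hpty E ?\<theta>))"
    unfolding pert_def dce_minus[OF delta_sforms[OF s(2)]] delta_dce[OF hs] by (rule refl)
  finally have D: "total_diff E k \<omega> = delta E ?\<theta> + d_ce E ?\<theta> - delta E (d_ce E (hpty E ?\<theta>))" by simp
  have "pert (d_ce E ?\<theta>) = - delta E (hpty E (d_ce E ?\<theta>))" by (simp add: pert_def)
  also have "hpty E (d_ce E ?\<theta>) = ?\<theta> - ?a 0 - d_ce E (hpty E ?\<theta>)"
    using homotopy_TF[OF t] unfolding pp by (metis add_diff_cancel_left')
  also have "delta E (?\<theta> - ?a 0 - d_ce E (hpty E ?\<theta>)) = delta E ?\<theta> - delta E (?a 0) - delta E (d_ce E (hpty E ?\<theta>))"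
    using s dce_sforms[OF s(2)] TF_sforms[OF anchor_TF_0[OF G, of 0]] by (simp add: delta_diff)
  finally have pd: "total_diff E k \<omega> + pert (d_ce E ?\<theta>) = d_ce E ?\<theta> + delta E (?a 0)"
    unfolding D by simp
  show "d_ce E ?\<theta> + ?\<zeta> = total_diff E k \<omega> + pert (d_ce E ?\<theta> + ?\<zeta>)"
    unfolding pert_add[OF dt z] add.assoc[symmetric] pd unfolding add.assoc pz by (rule refl)
qed

subsection \<open>The projection to the base\<close>

lemma base_forms_iforms: "base_forms E m = A.iforms m 0"
  using A.forms_eq_iforms[of m 0] by simp

lemma projection_eqI: "G \<in> A.iforms m 0 \<Longrightarrow> form_part m \<omega> = pullback E G \<Longrightarrow> projection E m \<omega> = G"
  unfolding projection_def base_forms_iforms by (simp add: the_inv_into_f_f[OF pullback_inj])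

lemma projection_spec:
  assumes "\<omega> \<in> TF 0 m"
  shows "projection E m \<omega> \<in> A.iforms m 0" "pullback E (projection E m \<omega>) = form_part m \<omega>"
proof -
  have "form_part m \<omega> \<in> C.iforms m 0" using TF_part[OF assms, of m] by simp
  then obtain G where G: "G \<in> A.iforms m 0" "pullback E G = form_part m \<omega>" using base_form_exists by blast
  then have "projection E m \<omega> = G" by (intro projection_eqI) simp_all
  then show "projection E m \<omega> \<in> A.iforms m 0" "pullback E (projection E m \<omega>) = form_part m \<omega>" using G by simp_all
qed

lemma projection_add: "\<omega> \<in> TF 0 m \<Longrightarrow> \<omega>' \<in> TF 0 m \<Longrightarrow> projection E m (\<omega> + \<omega>') = projection E m \<omega> + projection E m \<omega>'"
  by (rule projection_eqI) (simp_all add: A.iforms_add projection_spec pullback_add form_part_add)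

lemma projection_scale: "\<omega> \<in> TF 0 m \<Longrightarrow> projection E m (fscale r \<omega>) = form_scale (base_alg E) r (projection E m \<omega>)"
  by (rule projection_eqI) (simp_all add: A.iforms_scale projection_spec pullback_scale form_part_scale)

lemma projection_zero: "projection E m 0 = 0"
  by (rule projection_eqI) (simp_all add: pullback_zero)

lemma projection_total_diff:
  assumes "\<omega> \<in> TF 0 m" shows "projection E (Suc m) (total_diff E k \<omega>) = d_base E (projection E m \<omega>)"
proof (rule projection_eqI)
  show "d_base E (projection E m \<omega>) \<in> A.iforms (Suc m) 0"
    unfolding d_base_def by (rule A.d_form[OF projection_spec(1)[OF assms]])
  have "form_part (Suc m) (total_diff E k \<omega>) = delta E (form_part (Suc m) \<omega>) + d_ce E (form_part m \<omega>)"
    unfolding total_diff_def form_part_add by (simp add: form_part_delta[OF assms] form_part_dce[OF assms])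
  also have "\<dots> = d_ce E (form_part m \<omega>)" using TF_part_zero[OF assms, of "Suc m"] by simp
  finally show "form_part (Suc m) (total_diff E k \<omega>) = pullback E (d_base E (projection E m \<omega>))"
    unfolding pullback_d[OF projection_spec(1)[OF assms]] projection_spec(2)[OF assms] .
qed

subsection \<open>Potentials and the normalized complex\<close>

lemma potentials_iforms: "potentials E p q = hpty E ` C.iforms p (int q)"
  unfolding potentials_def C.forms_eq_iforms ..

text \<open>The degenerate cases are isolated: forms of degree 0 have no contraction, and h is 0 in
  internal degree 0. Otherwise a potential is a form of degree p - 1 and positive internal
  degree.\<close>

lemma pot_cases:
  assumes "P \<in> potentials E p q"
  shows "P = 0 \<or> (\<exists>p'. p = Suc p' \<and> 0 < q \<and> P \<in> C.iforms p' (int q))" "hpty E P = 0"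
proof -
  obtain \<omega> where w: "\<omega> \<in> C.iforms p (int q)" "P = hpty E \<omega>" using assms unfolding potentials_iforms by blast
  show "P = 0 \<or> (\<exists>p'. p = Suc p' \<and> 0 < q \<and> P \<in> C.iforms p' (int q))"
  proof (cases p)
    case 0
    then show ?thesis using w hpty_form_0 by auto
  next
    case (Suc p')
    then show ?thesis using w hpty_form[of \<omega> p' "int q"] hpty_nonpos[OF w(1)] by (cases "q = 0") auto
  qed
  show "hpty E P = 0" using hpty_hpty[OF w(1)] w(2) by simp
qed

lemma pot_sforms: "P \<in> potentials E p q \<Longrightarrow> P \<in> C.sforms"
  using pot_cases(1)[of P p q] by (auto intro: C.iforms_sforms)

lemma pot_dce: "P \<in> potentials E p q \<Longrightarrow> d_ce E P \<in> C.iforms p (int q)"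
  using pot_cases(1)[of P p q] by (auto intro: dce_form)

text \<open>As h vanishes on its own image, only h d is left of the homotopy formula. So d embeds
  the potentials into the p-forms.\<close>

lemma pot_homotopy: assumes "P \<in> potentials E p q" shows "hpty E (d_ce E P) = P"
  using pot_cases(1)[OF assms]
proof
  assume "\<exists>p'. p = Suc p' \<and> 0 < q \<and> P \<in> C.iforms p' (int q)"
  then obtain p' where "0 < q" "P \<in> C.iforms p' (int q)" by blast
  then show ?thesis using hpty_homotopy[of P p' "int q"] pot_cases(2)[OF assms] by simp
qed (simp add: hpty_zero)

lemma pot_zero [simp]: "0 \<in> potentials E p q"
  unfolding potentials_iforms by (rule image_eqI[of _ _ 0]) (simp_all add: hpty_zero)

lemma pot_add: assumes "P \<in> potentials E p q" "P' \<in> potentials E p q" shows "P + P' \<in> potentials E p q"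
proof -
  obtain \<omega> \<omega>' where "P = hpty E \<omega>" "P' = hpty E \<omega>'" "\<omega> \<in> C.iforms p (int q)" "\<omega>' \<in> C.iforms p (int q)"
    using assms unfolding potentials_iforms by blast
  then show ?thesis unfolding potentials_iforms
    by (intro image_eqI[of _ _ "\<omega> + \<omega>'"]) (simp_all add: hpty_add C.iforms_add)
qed

lemma pot_scale: assumes "P \<in> potentials E p q" shows "fscale r P \<in> potentials E p q"
proof -
  obtain \<omega> where "P = hpty E \<omega>" "\<omega> \<in> C.iforms p (int q)"
    using assms unfolding potentials_iforms by blast
  then show ?thesis unfolding potentials_iforms
    by (intro image_eqI[of _ _ "fscale r \<omega>"]) (simp_all add: hpty_scale C.iforms_scale)
qed

lemma normalized_le: "p \<le> m \<Longrightarrow> z \<in> normalized E p m \<longleftrightarrow> fst z \<in> potentials E p (m - p) \<and> snd z \<in> A.iforms m 0"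
  by (cases z) (simp add: normalized_def base_total_def base_forms_iforms)

lemma normalized_gt: "m < p \<Longrightarrow> z \<in> normalized E p m \<longleftrightarrow> z = 0"
  by (cases z) (auto simp: normalized_def base_total_def zero_prod_def)

lemma normalized_zero [simp]: "0 \<in> normalized E p m"
  by (cases "p \<le> m") (simp_all add: normalized_le normalized_gt)

lemma normalized_add: "z \<in> normalized E p m \<Longrightarrow> z' \<in> normalized E p m \<Longrightarrow> z + z' \<in> normalized E p m"
  by (cases "p \<le> m") (simp_all add: normalized_le normalized_gt pot_add A.iforms_add)

lemma base_scale_zero: "form_scale (base_alg E) r 0 = 0"
  by (simp add: form_scale_def fun_eq_iff form_apply)

lemma normalized_scale_zero: "normalized_scale E r 0 = 0"
  by (simp add: normalized_scale_def zero_prod_def base_scale_zero)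

lemma normalized_scale_mem: "z \<in> normalized E p m \<Longrightarrow> normalized_scale E r z \<in> normalized E p m"
  by (cases "p \<le> m") (simp_all add: normalized_le normalized_gt normalized_scale_zero, simp add: normalized_scale_def pot_scale A.iforms_scale)

lemma normalized_sforms: "z \<in> normalized E p m \<Longrightarrow> fst z \<in> C.sforms \<and> snd z \<in> A.iforms m 0"
  using pot_sforms by (cases "p \<le> m") (auto simp: normalized_le normalized_gt)

lemma delta_pot_mem: assumes "P \<in> potentials E p q" shows "delta_pot E P \<in> potentials E p (Suc q)"
proof -
  have "delta E (d_ce E P) \<in> C.iforms p (int (Suc q))" using delta_form[OF pot_dce[OF assms]] by (simp add: add.commute)
  then show ?thesis unfolding delta_pot_def potentials_iforms by blast
qed

lemma delta_pot_zero: "delta_pot E 0 = 0"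
  by (simp add: delta_pot_def hpty_zero)

text \<open>The twist is \<alpha>_n for n = m - p + 1, hence - h \<delta> \<alpha>_(m-p), which lies
  in the image of h.\<close>

lemma twist_mem: assumes G: "G \<in> A.iforms m 0" and p: "p \<le> m" shows "twist E p m G \<in> potentials E p (Suc (m - p))"
proof -
  have e: "m + 1 - p = Suc (m - p)" using p by simp
  have "delta E (anchor_contraction E (m - p) G) \<in> C.iforms p (int (Suc (m - p)))"
    using delta_form[OF anchor_iforms[OF G, of "m - p"]] p by (simp add: add.commute)
  then have "- delta E (anchor_contraction E (m - p) G) \<in> C.iforms p (int (Suc (m - p)))" by (rule C.iforms_minus)
  moreover have "twist E p m G = hpty E (- delta E (anchor_contraction E (m - p) G))"
    unfolding twist_def e hpty_minus hpty_delta_anchor[OF G] by simp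
  ultimately show ?thesis unfolding potentials_iforms by blast
qed

lemma twist_zero: "twist E p m 0 = 0"
  by (simp add: twist_def anchor_contraction_of_zero)

lemma d_base_zero: "d_base E 0 = 0"
  by (simp add: d_base_def A.d_zero)

lemma delta_tw_zero: "delta_tw E p m 0 = 0"
  by (simp add: delta_tw_def delta_pot_zero twist_zero d_base_zero zero_prod_def)

lemma delta_tw_mem: assumes "z \<in> normalized E p m" shows "delta_tw E p m z \<in> normalized E p (Suc m)"
proof (cases "p \<le> m")
  case True
  then have z: "fst z \<in> potentials E p (m - p)" "snd z \<in> A.iforms m 0" using assms by (simp_all add: normalized_le)
  have "d_base E (snd z) \<in> A.iforms (Suc m) 0" unfolding d_base_def by (rule A.d_form[OF z(2)])
  moreover have "delta_pot E (fst z) + twist E p m (snd z) \<in> potentials E p (Suc (m - p))"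
    by (rule pot_add[OF delta_pot_mem[OF z(1)] twist_mem[OF z(2) True]])
  ultimately show ?thesis using True by (simp add: normalized_le delta_tw_def Suc_diff_le)
next
  case False
  then show ?thesis using assms by (simp add: normalized_gt delta_tw_zero)
qed

lemma delta_pot_add: "P \<in> C.sforms \<Longrightarrow> P' \<in> C.sforms \<Longrightarrow> delta_pot E (P + P') = delta_pot E P + delta_pot E P'"
  by (simp add: delta_pot_def dce_add delta_add dce_sforms hpty_add)

lemma delta_pot_scale: "P \<in> C.sforms \<Longrightarrow> delta_pot E (fscale r P) = fscale r (delta_pot E P)"
  by (simp add: delta_pot_def dce_scale delta_scale dce_sforms hpty_scale)

lemma delta_tw_add:
  assumes "z \<in> normalized E p m" "z' \<in> normalized E p m"
  shows "delta_tw E p m (z + z') = delta_tw E p m z + delta_tw E p m z'"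
  using normalized_sforms[OF assms(1)] normalized_sforms[OF assms(2)]
    A.d_add[OF A.iforms_sforms[OF conjunct2[OF normalized_sforms[OF assms(1)]]] A.iforms_sforms[OF conjunct2[OF normalized_sforms[OF assms(2)]]]]
  by (simp add: delta_tw_def delta_pot_add twist_def anchor_contraction_add d_base_def plus_prod_def add_ac)

lemma delta_tw_scale:
  assumes "z \<in> normalized E p m"
  shows "delta_tw E p m (normalized_scale E r z) = normalized_scale E r (delta_tw E p m z)"
  using normalized_sforms[OF assms] A.d_scale[OF A.iforms_sforms[OF conjunct2[OF normalized_sforms[OF assms]]]]
  by (simp add: delta_tw_def normalized_scale_def delta_pot_scale twist_def anchor_contraction_scale d_base_def fscale_add)

subsection \<open>The inclusion of the normalized complex\<close>

lemma from_mem: assumes "z \<in> normalized E p m" shows "from_normalized E p m z \<in> TF p m"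
proof (cases "p \<le> m")
  case True
  then have z: "fst z \<in> potentials E p (m - p)" "snd z \<in> A.iforms m 0" using assms by (simp_all add: normalized_le)
  have "d_ce E (fst z) \<in> TF p m" using iforms_TF[OF pot_dce[OF z(1)]] True by simp
  moreover have "anchor_contraction E n (snd z) \<in> TF p m" if "n \<le> m - p" for n
    by (rule anchor_TF[OF z(2)]) (use that True in simp_all)
  ultimately show ?thesis unfolding from_normalized_def by (intro TF_add TF_minus TF_sum) auto
next
  case False
  then have "z = 0" using assms by (simp add: normalized_gt)
  then show ?thesis by (simp add: from_normalized_def anchor_contraction_of_zero)
qed

lemma from_zero: "from_normalized E p m 0 = 0"
  by (simp add: from_normalized_def anchor_contraction_of_zero)

lemma from_add:
  assumes "z \<in> normalized E p m" "z' \<in> normalized E p m"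
  shows "from_normalized E p m (z + z') = from_normalized E p m z + from_normalized E p m z'"
  using normalized_sforms[OF assms(1)] normalized_sforms[OF assms(2)]
  by (simp add: from_normalized_def dce_add anchor_contraction_add sum.distrib)

lemma from_scale:
  assumes "z \<in> normalized E p m"
  shows "from_normalized E p m (normalized_scale E r z) = fscale r (from_normalized E p m z)"
  using normalized_sforms[OF assms]
  by (simp add: from_normalized_def normalized_scale_def dce_scale anchor_contraction_scale fscale_diff fscale_sum)

text \<open>The recursion \<alpha>_(n+1) = - h \<delta> \<alpha>_n replaces a computation with
  anchors and brackets. The previous case and \<delta>^2 = 0 give \<delta> \<alpha>_n(dG) = \<delta>
  d \<alpha>_n(G); so \<alpha>_(n+1)(dG) = h d \<delta> \<alpha>_n(G), which the homotopy formula
  splits into the two terms.\<close>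

lemma anchor_d_base:
  assumes G: "G \<in> A.iforms m 0"
  shows "anchor_contraction E (Suc n) (d_base E G) = d_ce E (anchor_contraction E (Suc n) G) + delta E (anchor_contraction E n G)"
proof (induction n)
  note dG = A.d_form[OF G, folded d_base_def]
  have step: "hpty E (d_ce E (delta E (anchor_contraction E n G))) = delta E (anchor_contraction E n G) + d_ce E (anchor_contraction E (Suc n) G)" for n
  proof (cases "n \<le> m")
    case True
    let ?a = "anchor_contraction E n G"
    have f: "delta E ?a \<in> C.iforms (m - n) (int n + 1)" by (rule delta_form[OF anchor_iforms[OF G True]])
    have "d_ce E (hpty E (delta E ?a)) = - d_ce E (anchor_contraction E (Suc n) G)"
      unfolding hpty_delta_anchor[OF G] by (rule dce_minus[OF TF_sforms[OF anchor_TF_0[OF G]]])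
    then show ?thesis using hpty_homotopy[OF f] by (simp add: algebra_simps)
  next
    case False
    then show ?thesis using anchor_large[OF G, of n] anchor_large[OF G, of "Suc n"] by (simp add: hpty_zero)
  qed
  have suc: "anchor_contraction E (Suc n) (d_base E G) = hpty E (d_ce E (delta E (anchor_contraction E n G)))"
    if "delta E (anchor_contraction E n (d_base E G)) = delta E (d_ce E (anchor_contraction E n G))" for n
  proof -
    have "anchor_contraction E (Suc n) (d_base E G) = - hpty E (delta E (anchor_contraction E n (d_base E G)))"
      using hpty_delta_anchor[OF dG, of n] by simp
    then show ?thesis unfolding that delta_dce[OF anchor_TF_0[OF G]] hpty_minus by simp
  qed
  case 0
  have "anchor_contraction E 0 (d_base E G) = d_ce E (anchor_contraction E 0 G)"
    unfolding anchor_contraction_zero by (rule pullback_d[OF G])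
  then show ?case using suc[of 0] step[of 0] by (simp add: add.commute)
  case (Suc n)
  have t: "anchor_contraction E n G \<in> TF 0 m" "anchor_contraction E (Suc n) G \<in> TF 0 m" by (rule anchor_TF_0[OF G])+
  have "delta E (anchor_contraction E (Suc n) (d_base E G)) = delta E (d_ce E (anchor_contraction E (Suc n) G))"
    unfolding Suc.IH delta_add[OF dce_sforms[OF TF_sforms[OF t(2)]] delta_sforms[OF TF_sforms[OF t(1)]]] delta_delta[OF t(1)] by simp
  then show ?case using suc[of "Suc n"] step[of "Suc n"] by (simp add: add.commute)
qed

text \<open>Two mechanisms: applying d to the differential of a potential P gives \<delta> d P,
  because d \<delta> d P = 0 in the homotopy formula; and the surplus term d \<alpha>_(m-p+1) in the
  sum for dG is removed by - d of the twist.\<close>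

lemma from_chain:
  assumes z: "z \<in> normalized E p m"
  shows "from_normalized E p (Suc m) (delta_tw E p m z) = total_diff E k (from_normalized E p m z)"
proof (cases "p \<le> m")
  case False
  then have "z = 0" using z by (simp add: normalized_gt)
  then show ?thesis by (simp only: delta_tw_zero from_zero total_diff_def delta_zero dce_zero add_0_right)
next
  case True
  obtain P G where PG: "z = (P, G)" by (cases z)
  then have P: "P \<in> potentials E p (m - p)" and G: "G \<in> A.iforms m 0" using z True by (simp_all add: normalized_le)
  let ?a = "\<lambda>n. anchor_contraction E n G" and ?N = "m - p"
  have N: "Suc m - p = Suc ?N" "m + 1 - p = Suc ?N" using True by simp_all
  note sP = pot_sforms[OF P]
  have sa: "?a n \<in> C.sforms" for n by (rule TF_sforms[OF anchor_TF_0[OF G]])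
  have dP: "d_ce E P \<in> C.iforms p (int ?N)" by (rule pot_dce[OF P])
  have ddP: "d_ce E (d_ce E P) = 0"
    using pot_cases(1)[OF P] dce_dce_iforms by auto
  have e1: "d_ce E (delta_pot E P) = delta E (d_ce E P)"
  proof -
    have f: "delta E (d_ce E P) \<in> C.iforms p (int ?N + 1)" by (rule delta_form[OF dP])
    have "d_ce E (delta E (d_ce E P)) = 0"
      using delta_dce_iforms[OF dP] ddP by simp
    then show ?thesis using hpty_homotopy[OF f] by (simp add: delta_pot_def hpty_zero)
  qed
  have sdp: "delta_pot E P \<in> C.sforms" by (rule pot_sforms[OF delta_pot_mem[OF P]])
  have "from_normalized E p (Suc m) (delta_tw E p m z) =
      - d_ce E (delta_pot E P + ?a (Suc ?N)) + (\<Sum>n\<le>Suc ?N. anchor_contraction E n (d_base E G))"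
    by (simp only: PG from_normalized_def delta_tw_def twist_def fst_conv snd_conv N)
  also have "(\<Sum>n\<le>Suc ?N. anchor_contraction E n (d_base E G)) =
      anchor_contraction E 0 (d_base E G) + (\<Sum>n\<le>?N. anchor_contraction E (Suc n) (d_base E G))"
    by (rule sum.atMost_Suc_shift)
  also have "\<dots> = d_ce E (?a 0) + (\<Sum>n\<le>?N. d_ce E (?a (Suc n)) + delta E (?a n))"
    by (simp only: anchor_d_base[OF G] anchor_contraction_zero pullback_d[OF G])
  also have "\<dots> = (d_ce E (?a 0) + (\<Sum>n\<le>?N. d_ce E (?a (Suc n)))) + (\<Sum>n\<le>?N. delta E (?a n))"
    by (simp only: sum.distrib add.assoc)
  also have "d_ce E (?a 0) + (\<Sum>n\<le>?N. d_ce E (?a (Suc n))) = (\<Sum>n\<le>?N. d_ce E (?a n)) + d_ce E (?a (Suc ?N))"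
    using sum.atMost_Suc_shift[of "\<lambda>n. d_ce E (?a n)" ?N] by (simp only: sum.atMost_Suc)
  also have "d_ce E (delta_pot E P + ?a (Suc ?N)) = delta E (d_ce E P) + d_ce E (?a (Suc ?N))"
    by (simp only: dce_add[OF sdp sa] e1)
  finally have L: "from_normalized E p (Suc m) (delta_tw E p m z) =
      - delta E (d_ce E P) + (\<Sum>n\<le>?N. d_ce E (?a n)) + (\<Sum>n\<le>?N. delta E (?a n))"
    by simp
  have ss: "(\<Sum>n\<le>?N. ?a n) \<in> C.sforms" by (rule C.sforms_sum) (rule sa)
  have mm: "- d_ce E P \<in> C.sforms" using dce_sforms[OF sP] by simp
  have "total_diff E k (from_normalized E p m z) =
      delta E (- d_ce E P) + delta E (\<Sum>n\<le>?N. ?a n) + (d_ce E (- d_ce E P) + d_ce E (\<Sum>n\<le>?N. ?a n))"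
    by (simp only: PG from_normalized_def total_diff_def fst_conv snd_conv delta_add[OF mm ss] dce_add[OF mm ss])
  also have "\<dots> = - delta E (d_ce E P) + (\<Sum>n\<le>?N. delta E (?a n)) + (\<Sum>n\<le>?N. d_ce E (?a n))"
    using dce_sforms[OF sP] by (simp add: delta_minus dce_minus ddP delta_sum dce_sum sa)
  finally show ?thesis unfolding L by (simp only: add_ac)
qed

text \<open>Among the \<alpha>_n only \<alpha>_0 has internal degree 0. The summand d P could
  interfere only for p = m, and then P = 0.\<close>

lemma projection_from:
  assumes z: "z \<in> normalized E p m"
  shows "projection E m (from_normalized E p m z) = snd z"
proof (cases "p \<le> m")
  case False
  then have "z = 0" using z by (simp add: normalized_gt)
  then show ?thesis by (simp add: from_zero projection_zero)
next
  case True
  then have P: "fst z \<in> potentials E p (m - p)" and G: "snd z \<in> A.iforms m 0" using z by (simp_all add: normalized_le)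
  have 1: "form_part m (d_ce E (fst z)) = 0"
  proof (cases "p = m")
    case True
    then have "fst z = 0" using pot_cases(1)[OF P] by auto
    then show ?thesis by simp
  next
    case False
    then show ?thesis using form_part_iforms[OF pot_dce[OF P], of m] by simp
  qed
  have "form_part m (anchor_contraction E n (snd z)) = (if n = 0 then pullback E (snd z) else 0)" if "n \<le> m - p" for n
    using form_part_iforms[OF anchor_iforms[OF G, of n], of m] that True by (auto simp: anchor_contraction_zero)
  then have "form_part m (\<Sum>n\<le>m - p. anchor_contraction E n (snd z)) = (\<Sum>n\<le>m - p. if n = 0 then pullback E (snd z) else 0)"
    unfolding form_part_sum by (intro sum.cong) simp_all
  then have "form_part m (from_normalized E p m z) = pullback E (snd z)"
    unfolding from_normalized_def form_part_add form_part_minus 1 by simp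
  then show ?thesis by (rule projection_eqI[OF G])
qed

subsection \<open>The retraction onto the normalized complex\<close>

lemma to_eq: "to_normalized E p m \<omega> = (- hpty E (form_part p (pser m \<omega>)), projection E m \<omega>)"
  by (simp only: to_normalized_def pser_def pert_def[abs_def])

lemma to_mem: assumes "\<omega> \<in> TF p m" shows "to_normalized E p m \<omega> \<in> normalized E p m"
proof (cases "p \<le> m")
  case True
  have "form_part p (pser m \<omega>) \<in> C.iforms p (int (m - p))"
    by (rule TF_part[OF pser_TF[OF TF_0[OF assms]] True])
  then have "- form_part p (pser m \<omega>) \<in> C.iforms p (int (m - p))" by (rule C.iforms_minus)
  then have "- hpty E (form_part p (pser m \<omega>)) \<in> potentials E p (m - p)"
    unfolding potentials_iforms hpty_minus[symmetric] by blast
  then show ?thesis using True projection_spec(1)[OF TF_0[OF assms]] by (simp add: normalized_le to_eq)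
next
  case False
  then have "\<omega> = 0" using TF_small[OF assms] by simp
  then have "to_normalized E p m \<omega> = 0"
    by (simp add: to_eq pser_def hpty_zero projection_zero zero_prod_def)
  then show ?thesis by simp
qed

lemma to_add:
  assumes "\<omega> \<in> TF p m" "\<omega>' \<in> TF p m"
  shows "to_normalized E p m (\<omega> + \<omega>') = to_normalized E p m \<omega> + to_normalized E p m \<omega>'"
  using pser_add[OF TF_0[OF assms(1)] TF_0[OF assms(2)], of m] projection_add[OF TF_0[OF assms(1)] TF_0[OF assms(2)]]
  by (simp add: to_eq form_part_add hpty_add)

lemma to_scale:
  assumes "\<omega> \<in> TF p m"
  shows "to_normalized E p m (fscale r \<omega>) = normalized_scale E r (to_normalized E p m \<omega>)"
  using pser_scale[OF TF_0[OF assms], of m r] projection_scale[OF TF_0[OF assms], of r]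
  by (simp add: to_eq form_part_scale hpty_scale normalized_scale_def fscale_minus)

text \<open>As h kills all \<alpha>_n and h d P = P, applying h gives - P. So the first correction
  in the series is \<delta> P, of form degree p - 1, and later ones lie lower still: in form degree
  p the series reduces to its first term.\<close>

lemma to_from:
  assumes z: "z \<in> normalized E p m"
  shows "to_normalized E p m (from_normalized E p m z) = z"
proof (cases "p \<le> m")
  case False
  then have "z = 0" using z by (simp add: normalized_gt)
  then show ?thesis by (simp add: from_zero to_eq pser_def hpty_zero projection_zero flip: zero_prod_def)
next
  case True
  then have P: "fst z \<in> potentials E p (m - p)" and G: "snd z \<in> A.iforms m 0" using z by (simp_all add: normalized_le)
  let ?x = "from_normalized E p m z" and ?a = "\<lambda>n. anchor_contraction E n (snd z)"
  have x: "?x \<in> TF 0 m" by (rule TF_0[OF from_mem[OF z]])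
  have "hpty E ?x = - hpty E (d_ce E (fst z)) + (\<Sum>n\<le>m - p. hpty E (?a n))"
    by (simp only: from_normalized_def hpty_add hpty_minus hpty_sum)
  then have hx: "hpty E ?x = - fst z" by (simp add: pot_homotopy[OF P] hpty_anchor[OF G])
  have px: "pert ?x = delta E (fst z)" unfolding pert_def hx delta_minus[OF pot_sforms[OF P]] by simp
  have "form_part p ((pert ^^ Suc n) ?x) = 0" for n
  proof -
    have "form_part (p + n) (pert ?x) = 0"
      using pot_cases(1)[OF P]
    proof
      assume "\<exists>p'. p = Suc p' \<and> 0 < m - p \<and> fst z \<in> C.iforms p' (int (m - p))"
      then obtain p' where p': "p = Suc p'" "fst z \<in> C.iforms p' (int (m - p))" by blast
      show ?thesis unfolding px using form_part_iforms[OF delta_form[OF p'(2)], of "p + n"] p'(1) by simp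
    qed (simp add: px)
    moreover have "(pert ^^ Suc n) ?x = (pert ^^ n) (pert ?x)" by (simp only: funpow_Suc_right o_apply)
    ultimately show ?thesis using form_part_pert_pow[OF pert_TF[OF x], of p n] by simp
  qed
  then have "form_part p (pser m ?x) = form_part p ?x"
    unfolding pser_def form_part_sum by (cases m) (simp_all add: sum.atMost_Suc_shift del: funpow.simps(2) sum.atMost_Suc)
  moreover have "hpty E (form_part p ?x) = - fst z"
  proof -
    have a: "hpty E (form_part p (?a n)) = 0" if "n \<le> m - p" for n
      using form_part_iforms[OF anchor_iforms[OF G, of n], of p] that hpty_anchor[OF G] by (simp add: hpty_zero)
    have "hpty E (form_part p ?x) = - hpty E (form_part p (d_ce E (fst z))) + (\<Sum>n\<le>m - p. hpty E (form_part p (?a n)))"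
      by (simp only: from_normalized_def form_part_add form_part_minus form_part_sum hpty_add hpty_minus hpty_sum)
    then show ?thesis using a form_part_iforms[OF pot_dce[OF P], of p] by (simp add: pot_homotopy[OF P])
  qed
  ultimately show ?thesis using projection_from[OF z] by (simp add: to_eq prod_eq_iff)
qed

text \<open>This is - h in form degree p, applied to \<open>pser_diff_TF\<close>: the term with d
  yields the differential of potentials, and the sum of the \<delta> \<alpha>_n yields the
  twist.\<close>

lemma to_chain:
  assumes w: "\<omega> \<in> TF p m"
  shows "to_normalized E p (Suc m) (total_diff E k \<omega>) = delta_tw E p m (to_normalized E p m \<omega>)"
proof (cases "p \<le> m")
  case False
  then have "\<omega> = 0" using TF_small[OF w] by simp
  then show ?thesis by (simp add: to_eq pser_def hpty_zero projection_zero total_diff_def delta_tw_def delta_pot_zero twist_zero d_base_zero zero_prod_def)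
next
  case True
  note w0 = TF_0[OF w]
  let ?\<theta> = "pser m \<omega>"
  define G where "G = projection E m \<omega>"
  have G: "G \<in> A.iforms m 0" and pG: "pullback E G = form_part m \<omega>" using projection_spec[OF w0] by (simp_all add: G_def)
  let ?a = "\<lambda>n. anchor_contraction E n G"
  have t: "?\<theta> \<in> TF 0 m" by (rule pser_TF[OF w0])
  have "form_part p (pser (Suc m) (total_diff E k \<omega>)) = form_part p (d_ce E ?\<theta>) + (\<Sum>n\<le>Suc m. form_part p (delta E (?a n)))"
    unfolding pser_diff_TF[OF w0 G pG[symmetric]] form_part_add form_part_sum by (rule refl)
  then have "hpty E (form_part p (pser (Suc m) (total_diff E k \<omega>))) =
      hpty E (form_part p (d_ce E ?\<theta>)) + (\<Sum>n\<le>Suc m. hpty E (form_part p (delta E (?a n))))"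
    by (simp only: hpty_add hpty_sum)
  moreover have "(\<Sum>n\<le>Suc m. hpty E (form_part p (delta E (?a n)))) = - twist E p m G"
  proof -
    \<comment> \<open>The form \<delta> \<alpha>_n has form degree m - n, so only n = m - p
      contributes in form degree p.\<close>
    have "hpty E (form_part p (delta E (?a n))) = (if n = m - p then - twist E p m G else 0)" if "n \<le> Suc m" for n
    proof (cases "n \<le> m")
      case n: True
      show ?thesis
        using form_part_iforms[OF delta_form[OF anchor_iforms[OF G n]], of p] True n hpty_delta_anchor[OF G, of n]
        by (auto simp: hpty_zero twist_def Suc_diff_le)
    next
      case False
      then show ?thesis using anchor_large[OF G, of n] by (simp add: hpty_zero)
    qed
    then have "(\<Sum>n\<le>Suc m. hpty E (form_part p (delta E (?a n)))) = (\<Sum>n\<le>Suc m. if n = m - p then - twist E p m G else 0)"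
      by (intro sum.cong) simp_all
    then show ?thesis by (simp del: sum.atMost_Suc)
  qed
  moreover have "- hpty E (form_part p (d_ce E ?\<theta>)) = delta_pot E (- hpty E (form_part p ?\<theta>))"
  proof (cases p)
    case 0
    have "form_part 0 ?\<theta> \<in> C.iforms 0 (int m)" using TF_part[OF t, of 0] by simp
    then have "hpty E (form_part 0 ?\<theta>) = 0" by (rule hpty_form_0)
    then show ?thesis unfolding 0 form_part_dce[OF t] by (simp add: hpty_zero delta_pot_zero)
  next
    case (Suc p')
    let ?h = "hpty E (form_part p ?\<theta>)"
    have tp: "form_part p ?\<theta> \<in> C.iforms (Suc p') (int (m - p))" using TF_part[OF t True] Suc by simp
    have h: "?h \<in> C.iforms p' (int (m - p))" by (rule hpty_form[OF tp])
    \<comment> \<open>As \<omega> has no component below p, the component of the series in degree p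
      - 1 is entirely the correction produced from degree p.\<close>
    have "form_part p' ?\<theta> = form_part p' \<omega> + form_part p' (pert ?\<theta>)"
      unfolding form_part_add[symmetric] by (rule arg_cong[OF pser_fix[OF w0]])
    moreover have "form_part p' \<omega> = 0" using TF_part_zero[OF w, of p'] Suc by simp
    moreover have "form_part p' (pert ?\<theta>) = - delta E ?h" using form_part_pert[OF t, of p'] Suc by (simp add: pert_def)
    ultimately have f: "form_part p' ?\<theta> = - delta E ?h" by simp
    have "form_part p (d_ce E ?\<theta>) = d_ce E (- delta E ?h)" unfolding form_part_dce[OF t] Suc using f Suc by simp
    also have "\<dots> = delta E (d_ce E ?h)"
      unfolding dce_minus[OF C.iforms_sforms[OF delta_form[OF h]]] delta_dce_iforms[OF h] by simp
    finally show ?thesis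
      unfolding delta_pot_def dce_minus[OF C.iforms_sforms[OF h]] delta_minus[OF dce_sforms[OF C.iforms_sforms[OF h]]] hpty_minus
      by simp
  qed
  ultimately have "- hpty E (form_part p (pser (Suc m) (total_diff E k \<omega>))) = delta_pot E (- hpty E (form_part p ?\<theta>)) + twist E p m G"
    by simp
  then show ?thesis
    using projection_total_diff[OF w0, of k] by (simp add: to_eq delta_tw_def G_def)
qed

subsection \<open>The homotopy on the total complex\<close>

text \<open>Brings forms of the untruncated complex back to form degree at least p. It commutes with
  \<delta>, but with d only up to a boundary term.\<close>

definition trunc :: "nat \<Rightarrow> ('a, 'l) ce_form \<Rightarrow> ('a, 'l) ce_form" where
  "trunc p \<omega> = (\<lambda>Xs. if p \<le> length Xs then \<omega> Xs else 0)"

lemma trunc_add: "trunc p (\<omega> + \<omega>') = trunc p \<omega> + trunc p \<omega>'"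
  and trunc_minus: "trunc p (- \<omega>) = - trunc p \<omega>"
  and trunc_diff: "trunc p (\<omega> - \<omega>') = trunc p \<omega> - trunc p \<omega>'"
  and trunc_zero [simp]: "trunc p 0 = 0"
  and trunc_scale: "trunc p (fscale r \<omega>) = fscale r (trunc p \<omega>)"
  by (auto simp: trunc_def fun_eq_iff form_apply form_scale_def)

lemma trunc_sum: "trunc p (\<Sum>j\<in>J. f j) = (\<Sum>j\<in>J. trunc p (f j))"
  by (induction J rule: infinite_finite_induct) (simp_all add: trunc_add)

lemma form_part_trunc: "form_part r (trunc p \<omega>) = (if p \<le> r then form_part r \<omega> else 0)"
  by (auto simp: trunc_def form_part_def fun_eq_iff form_apply)

lemma trunc_TF: "\<omega> \<in> TF 0 m \<Longrightarrow> trunc p \<omega> \<in> TF p m"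
  unfolding TF_iff[of "trunc p \<omega>"] form_part_trunc
proof (intro allI)
  fix r assume w: "\<omega> \<in> TF 0 m"
  show "(if p \<le> r then form_part r \<omega> else 0) \<in> (if p \<le> r \<and> r \<le> m then C.iforms r (int (m - r)) else {0})"
    using TF_part[OF w, of r] TF_part_zero[OF w, of r] by (cases "r \<le> m") simp_all
qed

lemma TF_ext: "\<omega> \<in> TF 0 m \<Longrightarrow> \<omega>' \<in> TF 0 m \<Longrightarrow> (\<And>r. form_part r \<omega> = form_part r \<omega>') \<Longrightarrow> \<omega> = \<omega>'"
  by (rule trans[OF TF_decompose trans[OF sum.cong[OF refl] TF_decompose[symmetric]]])

lemma trunc_id: "\<omega> \<in> TF p m \<Longrightarrow> trunc p \<omega> = \<omega>"
proof (rule TF_ext)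
  assume w: "\<omega> \<in> TF p m"
  show "\<omega> \<in> TF 0 m" by (rule TF_0[OF w])
  then show "trunc p \<omega> \<in> TF 0 m" by (rule TF_0[OF trunc_TF])
  show "form_part r (trunc p \<omega>) = form_part r \<omega>" for r
    using TF_part_zero[OF w, of r] by (simp add: form_part_trunc)
qed

lemma trunc_iforms: "\<omega> \<in> C.iforms r q \<Longrightarrow> trunc p \<omega> = (if p \<le> r then \<omega> else 0)"
  by (auto simp: trunc_def fun_eq_iff form_apply C.iforms_out)

lemma trunc_delta: assumes "\<omega> \<in> TF 0 m" shows "delta E (trunc p \<omega>) = trunc p (delta E \<omega>)"
proof (rule TF_ext)
  have t: "trunc p \<omega> \<in> TF 0 m" by (rule TF_0[OF trunc_TF[OF assms]])
  show "delta E (trunc p \<omega>) \<in> TF 0 (Suc m)" by (rule delta_TF[OF t])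
  show "trunc p (delta E \<omega>) \<in> TF 0 (Suc m)" by (rule TF_0[OF trunc_TF[OF delta_TF[OF assms]]])
  fix r
  show "form_part r (delta E (trunc p \<omega>)) = form_part r (trunc p (delta E \<omega>))"
    by (simp add: form_part_delta[OF t] form_part_delta[OF assms] form_part_trunc)
qed

text \<open>The boundary term is d of the discarded component of degree p - 1, which d carries into
  the retained degree p.\<close>

lemma trunc_dce:
  assumes "\<omega> \<in> TF 0 m"
  shows "d_ce E (trunc p \<omega>) = trunc p (d_ce E \<omega>) - (case p of 0 \<Rightarrow> 0 | Suc p' \<Rightarrow> d_ce E (form_part p' \<omega>))"
proof (rule TF_ext)
  have t: "trunc p \<omega> \<in> TF 0 m" by (rule TF_0[OF trunc_TF[OF assms]])
  show "d_ce E (trunc p \<omega>) \<in> TF 0 (Suc m)" by (rule dce_TF[OF t])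
  have fp: "d_ce E (form_part p' \<omega>) \<in> TF 0 (Suc m)" for p'
  proof (cases "p' \<le> m")
    case True
    then show ?thesis using dce_TF[OF iforms_TF[OF TF_part[OF assms True], of 0]] by simp
  qed (simp add: TF_part_zero[OF assms])
  show "trunc p (d_ce E \<omega>) - (case p of 0 \<Rightarrow> 0 | Suc p' \<Rightarrow> d_ce E (form_part p' \<omega>)) \<in> TF 0 (Suc m)"
    using fp TF_0[OF trunc_TF[OF dce_TF[OF assms], of p]] by (cases p) (auto intro: TF_diff)
  have fpp: "form_part r (d_ce E (form_part p' \<omega>)) = (if r = Suc p' then d_ce E (form_part p' \<omega>) else 0)" for p' r
  proof (cases "p' \<le> m")
    case True
    then show ?thesis using form_part_iforms[OF dce_form[OF TF_part[OF assms True]], of r] by simp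
  qed (simp add: TF_part_zero[OF assms])
  fix r
  show "form_part r (d_ce E (trunc p \<omega>)) = form_part r (trunc p (d_ce E \<omega>) - (case p of 0 \<Rightarrow> 0 | Suc p' \<Rightarrow> d_ce E (form_part p' \<omega>)))"
    unfolding form_part_diff form_part_dce[OF t] form_part_trunc form_part_dce[OF assms]
    by (cases r; cases p) (auto simp: form_part_trunc fpp)
qed

text \<open>The homotopy is the truncation of - h (1 + \<delta> h)^(-1). Truncating before applying
  d misses d h of the component of the series in degree p; this is the summand - d P of the
  composite, as P is - h of that component. The \<alpha>_n with n > 0 come from the series of the
  differential of \<omega>.\<close>

lemma trunc_homotopy:
  assumes w: "\<omega> \<in> TF p m"
  shows "from_normalized E p m (to_normalized E p m \<omega>) - \<omega> =
    total_diff E k (- trunc p (hpty E (pser m \<omega>))) + (- trunc p (hpty E (pser (Suc m) (total_diff E k \<omega>))))"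
proof (cases "p \<le> m")
  case False
  then have "\<omega> = 0" using TF_small[OF w] by simp
  then show ?thesis
    using from_zero[of p m]
    by (simp add: to_eq pser_def hpty_zero projection_zero total_diff_def flip: zero_prod_def)
next
  case True
  note w0 = TF_0[OF w]
  let ?\<theta> = "pser m \<omega>"
  define G where "G = projection E m \<omega>"
  have G: "G \<in> A.iforms m 0" and pG: "pullback E G = form_part m \<omega>" using projection_spec[OF w0] by (simp_all add: G_def)
  let ?a = "\<lambda>n. anchor_contraction E n G"
  have t: "?\<theta> \<in> TF 0 m" by (rule pser_TF[OF w0])
  have ht: "hpty E ?\<theta> \<in> TF 0 (m - 1)" using hpty_TF_any[OF t] by blast
  note sh = TF_sforms[OF TF_0[OF trunc_TF[OF ht, of p]]]
  have pp: "form_part m ?\<theta> = ?a 0"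
  proof -
    have "form_part m (pert ?\<theta>) = pert (form_part (Suc m) ?\<theta>)" by (rule form_part_pert[OF t])
    also have "\<dots> = 0" using TF_part_zero[OF t, of "Suc m"] by simp
    finally have "form_part m (pert ?\<theta>) = 0" .
    moreover have "form_part m ?\<theta> = form_part m \<omega> + form_part m (pert ?\<theta>)"
      unfolding form_part_add[symmetric] by (rule arg_cong[OF pser_fix[OF w0]])
    ultimately show ?thesis using pG by (simp add: anchor_contraction_zero)
  qed
  have "hpty E (pser (Suc m) (total_diff E k \<omega>)) = hpty E (d_ce E ?\<theta>) - (\<Sum>n\<le>Suc m. ?a (Suc n))"
    unfolding pser_diff_TF[OF w0 G pG[symmetric]] hpty_add hpty_sum hpty_delta_anchor[OF G] sum_negf by simp
  then have 1: "trunc p (hpty E (pser (Suc m) (total_diff E k \<omega>))) = trunc p (hpty E (d_ce E ?\<theta>)) - (\<Sum>n\<le>Suc m. trunc p (?a (Suc n)))"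
    by (simp only: trunc_diff trunc_sum)
  have 2: "total_diff E k (- trunc p (hpty E ?\<theta>)) = - delta E (trunc p (hpty E ?\<theta>)) - d_ce E (trunc p (hpty E ?\<theta>))"
    unfolding total_diff_def delta_minus[OF sh] dce_minus[OF sh] by simp
  have 3: "- delta E (trunc p (hpty E ?\<theta>)) = trunc p ?\<theta> - \<omega>"
  proof -
    have "- delta E (trunc p (hpty E ?\<theta>)) = trunc p (pert ?\<theta>)"
      unfolding trunc_delta[OF ht] pert_def trunc_minus by (rule refl)
    also have "pert ?\<theta> = ?\<theta> - \<omega>" using pser_fix[OF w0] by (simp only: add_diff_cancel_left' diff_eq_eq eq_diff_eq add.commute)
    finally show ?thesis by (simp only: trunc_diff trunc_id[OF w])
  qed
  have 4: "d_ce E (trunc p (hpty E ?\<theta>)) = trunc p (d_ce E (hpty E ?\<theta>)) - d_ce E (hpty E (form_part p ?\<theta>))"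
  proof (cases p)
    case 0
    have "form_part 0 ?\<theta> \<in> C.iforms 0 (int m)" using TF_part[OF t, of 0] by simp
    then have "hpty E (form_part 0 ?\<theta>) = 0" by (rule hpty_form_0)
    then show ?thesis unfolding trunc_dce[OF ht] using 0 by simp
  next
    case (Suc p')
    then show ?thesis unfolding trunc_dce[OF ht] by (simp add: form_part_hpty)
  qed
  have 5: "trunc p (d_ce E (hpty E ?\<theta>)) + trunc p (hpty E (d_ce E ?\<theta>)) = trunc p ?\<theta> - ?a 0"
    unfolding trunc_add[symmetric] homotopy_TF[OF t] pp trunc_diff
    using trunc_iforms[OF anchor_iforms[OF G, of 0], of p] True by simp
  \<comment> \<open>Truncation at p keeps exactly the \<alpha>_n with n \<le> m - p, the range of
    summation in \<open>from_normalized\<close>.\<close>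
  have 6: "(\<Sum>n\<le>m - p. ?a n) = ?a 0 + (\<Sum>n\<le>Suc m. trunc p (?a (Suc n)))"
  proof -
    have tr: "trunc p (?a n) = (if n \<le> m - p then ?a n else 0)" for n
    proof (cases "n \<le> m")
      case n: True
      then show ?thesis using trunc_iforms[OF anchor_iforms[OF G n], of p] True by auto
    qed (simp add: anchor_large[OF G])
    have "?a 0 + (\<Sum>n\<le>Suc m. trunc p (?a (Suc n))) = (\<Sum>n\<le>Suc (Suc m). trunc p (?a n))"
      using sum.atMost_Suc_shift[of "\<lambda>n. trunc p (?a n)" "Suc m"] tr[of 0] by simp
    also have "\<dots> = (\<Sum>n\<in>{n \<in> {..Suc (Suc m)}. n \<le> m - p}. ?a n)"
      unfolding tr by (rule sum.inter_filter[symmetric]) simp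
    also have "{n \<in> {..Suc (Suc m)}. n \<le> m - p} = {..m - p}" by auto
    finally show ?thesis by simp
  qed
  have sp: "hpty E (form_part p ?\<theta>) \<in> C.sforms"
    using pot_sforms[of _ p "m - p"] TF_part[OF t True] unfolding potentials_iforms by blast
  have "from_normalized E p m (to_normalized E p m \<omega>) = d_ce E (hpty E (form_part p ?\<theta>)) + (\<Sum>n\<le>m - p. ?a n)"
    unfolding to_eq from_normalized_def fst_conv snd_conv dce_minus[OF sp] G_def by simp
  then have L: "from_normalized E p m (to_normalized E p m \<omega>) = d_ce E (hpty E (form_part p ?\<theta>)) + ?a 0 + (\<Sum>n\<le>Suc m. trunc p (?a (Suc n)))"
    unfolding 6 by (simp only: add.assoc)
  have h5: "?a 0 = trunc p ?\<theta> - trunc p (d_ce E (hpty E ?\<theta>)) - trunc p (hpty E (d_ce E ?\<theta>))"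
    using 5 by (simp add: algebra_simps)
  show ?thesis
    unfolding L 1 2 3 4 h5 by (simp add: algebra_simps del: sum.atMost_Suc)
qed

subsection \<open>The homotopy equivalence\<close>

lemma total_diff_add: "\<omega> \<in> C.sforms \<Longrightarrow> \<omega>' \<in> C.sforms \<Longrightarrow> total_diff E k (\<omega> + \<omega>') = total_diff E k \<omega> + total_diff E k \<omega>'"
  by (simp add: total_diff_def delta_add dce_add)

lemma total_diff_scale: "\<omega> \<in> C.sforms \<Longrightarrow> total_diff E k (fscale r \<omega>) = fscale r (total_diff E k \<omega>)"
  by (simp add: total_diff_def delta_scale dce_scale fscale_add)

lemma total_diff_square: assumes "\<omega> \<in> TF 0 m" shows "total_diff E k (total_diff E k' \<omega>) = 0"
proof -
  have s: "delta E \<omega> \<in> C.sforms" "d_ce E \<omega> \<in> C.sforms" using TF_sforms[OF assms] delta_sforms dce_sforms by auto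
  show ?thesis
    using delta_delta[OF assms] dce_dce[OF assms] delta_dce[OF assms]
    by (simp add: total_diff_def delta_add[OF s] dce_add[OF s])
qed

lemma total_complex: "cochain_complex (total_scale E) (TF p) (total_diff E)"
  unfolding cochain_complex_def linear_between_def total_scale_def
  by (auto intro: TF_add TF_scale total_diff_TF total_diff_square[OF TF_0] total_diff_add[OF TF_sforms TF_sforms] total_diff_scale[OF TF_sforms])

lemma delta_tw_square: assumes z: "z \<in> normalized E p m" shows "delta_tw E p (Suc m) (delta_tw E p m z) = 0"
proof -
  let ?y = "delta_tw E p (Suc m) (delta_tw E p m z)"
  have 1: "delta_tw E p m z \<in> normalized E p (Suc m)" by (rule delta_tw_mem[OF z])
  have "from_normalized E p (Suc (Suc m)) ?y = total_diff E 0 (total_diff E 0 (from_normalized E p m z))"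
    unfolding from_chain[OF 1, of 0] from_chain[OF z, of 0] by (rule refl)
  also have "\<dots> = 0" by (rule total_diff_square[OF TF_0[OF from_mem[OF z]]])
  finally have f: "from_normalized E p (Suc (Suc m)) ?y = 0" .
  have "?y = to_normalized E p (Suc (Suc m)) (from_normalized E p (Suc (Suc m)) ?y)"
    by (rule to_from[OF delta_tw_mem[OF 1], symmetric])
  also have "\<dots> = to_normalized E p (Suc (Suc m)) (from_normalized E p (Suc (Suc m)) 0)"
    unfolding f from_zero ..
  also have "\<dots> = 0" by (rule to_from) simp
  finally show ?thesis .
qed

lemma normalized_complex: "cochain_complex (normalized_scale E) (normalized E p) (delta_tw E p)"
  unfolding cochain_complex_def linear_between_def
  by (auto intro: normalized_add normalized_scale_mem delta_tw_mem delta_tw_add delta_tw_scale delta_tw_square)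

lemma to_chain_map: "chain_map (total_scale E) (TF p) (total_diff E) (normalized_scale E) (normalized E p) (delta_tw E p) (to_normalized E p)"
  unfolding chain_map_def linear_between_def total_scale_def
  by (auto intro: to_mem to_add to_scale to_chain)

lemma from_chain_map: "chain_map (normalized_scale E) (normalized E p) (delta_tw E p) (total_scale E) (TF p) (total_diff E) (from_normalized E p)"
  unfolding chain_map_def linear_between_def total_scale_def
  by (auto intro: from_mem from_add from_scale from_chain)

lemma homotopic_total: "homotopic_to_id (total_scale E) (TF p) (total_diff E) (\<lambda>m x. from_normalized E p m (to_normalized E p m x))"
  unfolding homotopic_to_id_def
proof (intro exI conjI allI ballI)
  let ?H = "\<lambda>m \<omega>. - trunc p (hpty E (pser (Suc m) \<omega>))"
  fix m
  show "linear_between (total_scale E) (total_scale E) (TF p (Suc m)) (TF p m) (?H m)"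
    unfolding linear_between_def total_scale_def
  proof (intro conjI ballI allI)
    fix x assume x: "x \<in> TF p (Suc m)"
    show "?H m x \<in> TF p m"
      by (intro TF_minus trunc_TF hpty_TF pser_TF TF_0[OF x])
    fix r show "?H m (fscale r x) = fscale r (?H m x)"
      by (simp only: pser_scale[OF TF_0[OF x]] hpty_scale trunc_scale fscale_minus)
    fix y assume y: "y \<in> TF p (Suc m)"
    show "?H m (x + y) = ?H m x + ?H m y"
      by (simp only: pser_add[OF TF_0[OF x] TF_0[OF y]] hpty_add trunc_add minus_add_distrib)
  qed
  fix \<omega> assume w: "\<omega> \<in> TF p m"
  show "from_normalized E p m (to_normalized E p m \<omega>) - \<omega> =
      (case m of 0 \<Rightarrow> 0 | Suc k \<Rightarrow> total_diff E k (?H k \<omega>)) + ?H m (total_diff E m \<omega>)"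
  proof (cases m)
    \<comment> \<open>In total degree 0 no homotopy arrives from below; the corresponding term of
      \<open>trunc_homotopy\<close> vanishes because h is 0 on forms of degree 0.\<close>
    case 0
    have "pser 0 \<omega> \<in> TF 0 0" using pser_TF[OF TF_0[OF w]] 0 by simp
    then have "hpty E (pser 0 \<omega>) = 0" by (rule hpty_TF_0)
    then show ?thesis using trunc_homotopy[OF w, of m] 0 by (simp add: total_diff_def)
  next
    case (Suc k)
    have "total_diff E k' \<omega>' = total_diff E k'' \<omega>'" for k' k'' \<omega>' by (simp add: total_diff_def)
    then show ?thesis using trunc_homotopy[OF w, of m] Suc by simp
  qed
qed

lemma homotopic_normalized: "homotopic_to_id (normalized_scale E) (normalized E p) (delta_tw E p) (\<lambda>m x. to_normalized E p m (from_normalized E p m x))"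
  unfolding homotopic_to_id_def
proof (intro exI[of _ "\<lambda>m z. 0"] conjI allI ballI)
  fix m
  show "linear_between (normalized_scale E) (normalized_scale E) (normalized E p (Suc m)) (normalized E p m) (\<lambda>z. 0)"
    unfolding linear_between_def by (simp add: normalized_scale_zero)
  fix z assume "z \<in> normalized E p m"
  then show "to_normalized E p m (from_normalized E p m z) - z = (case m of 0 \<Rightarrow> 0 | Suc k \<Rightarrow> delta_tw E p k 0) + 0"
    by (simp add: to_from delta_tw_zero split: nat.split)
qed

end

theorem theorem3p11:
  fixes E :: "('k::field_char_0, 'a::comm_ring_1, 'l::ab_group_add) linfty" and p :: nat
  assumes "affine_manifold TYPE('m) (base E)"
    and "linfty_algebroid E"
  shows "cochain_complex (normalized_scale E) (normalized E p) (delta_tw E p) \<and>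
    homotopy_equivalence (total_scale E) (total_forms E p) (total_diff E)
      (normalized_scale E) (normalized E p) (delta_tw E p)
      (to_normalized E p) (from_normalized E p) \<and>
    (\<forall>m. \<forall>\<omega>\<in>total_forms E p m. snd (to_normalized E p m \<omega>) = projection E m \<omega>) \<and>
    (\<forall>m. \<forall>z\<in>normalized E p m. projection E m (from_normalized E p m z) = snd z)"
proof -
  interpret linfty_alg E by standard (rule assms(2))
  show ?thesis
    unfolding homotopy_equivalence_def
    by (intro conjI allI ballI normalized_complex total_complex to_chain_map from_chain_map
        homotopic_total homotopic_normalized projection_from) (simp add: to_normalized_def)
qed

end
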